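(* Let $N\ge 2$ be an integer, $0\le b<2<p<q<2^*_b$, $\delta=\frac{2-b}{q-2}$ and $a=2-\delta(p-2)=b+\delta(q-p)$. Let $(\eta,r)$ be a subscaled pair and suppose that $\lambda\in\mathbb{R}$ is not an eigenvalue of $-\Delta u+\frac{|u|^{q-2}u}{|x|^b}=\lambda\frac{|u|^{p-2}u}{|x|^a}$ in $\mathbb{R}^N$. Then the problem $$-\Delta u+\frac{|u|^{q-2}u}{|x|^b}=\lambda\frac{|u|^{p-2}u}{|x|^a}+\frac{|u|^{r-2}u}{|x|^\eta}\quad\text{in }\mathbb{R}^N$$ has a sequence of solutions $(u_k)$ at negative levels such that $\Phi(u_k)\nearrow0$.
   Context: For $0\le\eta<N$: $2^*_\eta=+\infty$ if $N=2$ and $2^*_\eta=\frac{2(N-\eta)}{N-2}$ if $N\ge3$. For $r\ge1$, $L^r_\eta(\mathbb{R}^N)=L^r(\mathbb{R}^N;|x|^{-\eta}dx)$. The space $E^q_b=\{u\in L^q_b(\mathbb{R}^N):\nabla u\in (L^2(\mathbb{R}^N))^N\}$ (weak gradient) carries the norm $\|u\|=\big[\int_{\mathbb{R}^N}|\nabla u|^2dx+\big(\int_{\mathbb{R}^N}\frac{|u|^q}{|x|^b}dx\big)^{2/q}\big]^{1/2}$. Solution: for a Carathéodory $f$, a (weak) solution of $-\Delta u+|x|^{-b}|u|^{q-2}u=f(x,u)$ is $u\in E^q_b$ with $f(\cdot,u)\in L^1_{loc}(\mathbb{R}^N)$ and $\int\nabla u\cdot\nabla v\,dx+\int\frac{|u|^{q-2}uv}{|x|^b}dx=\int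 f(x,u)v\,dx$ for all $v\in C_c^\infty(\mathbb{R}^N)$. The energy functional is $\Phi(u)=\frac12\int|\nabla u|^2dx+\frac1q\int\frac{|u|^q}{|x|^b}dx-\int F(x,u)dx$, with $F(x,s)=\int_0^sf(x,t)dt$. "At negative levels" means $\Phi(u_k)<0$; $\nearrow$ means nondecreasing with the indicated limit. Eigenvalue: $\lambda\in\mathbb{R}$ is an eigenvalue of $-\Delta u+|x|^{-b}|u|^{q-2}u=\lambda|x|^{-a}|u|^{p-2}u$ if this equation has a nontrivial solution $u\in E^q_b$. Exponents: $2^*_{b,q,\eta}=\frac{q(N-\eta)}{N-b}$ if $N\ge2$ and $b\le\eta$; $2^*_{b,q,\eta}=\frac{\eta q(N-2)+2N(b-\eta)}{b(N-2)}$ if $N\ge3$ and $0\le\eta<b$. Set $\ell(\eta,r)=r\delta+\eta-N$ and $\ell=\ell(b,q)=\ell(a,p)$. Admissible pairs: $(\eta,r)$ is admissible if $0\le\eta<\frac{N+2}{2}$ (and $b\le\eta<2$ if $N=2$), $r>1$ and $r\in(2^*_{b,q,\eta},2^*_\eta)$; in addition, $r=2^*_{b,q,\eta}$ is allowed when $\eta\le b$, and $r=2^*_\eta$ is allowed when $\eta\le2$ and $N\ge3$. An admissible pair is subscaled if $\ell(\eta,r)<\ell$, scaled if $\ell(\eta,r)=\ell$, superscaled if $\ell(\eta,r)>\ell$. *)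

theory Defs
  imports "HOL-Analysis.Analysis"
begin

text \<open>
  The space \<open>\<real>\<^sup>N\<close> is \<open>real ^ 'n\<close> with \<open>N = CARD('n)\<close>. Elements of Lebesgue and Sobolev spaces are
  represented by Lebesgue measurable functions, not by classes modulo null sets; consequently
  ``nontrivial'' below means ``not almost everywhere zero''. A weight with exponent \<open>- s\<close> is written
  \<open>norm x powr (- s)\<close>; its value at the origin (a null set) is \<open>0\<close>, also for \<open>s = 0\<close>.
\<close>

subsection \<open>Test functions and weak gradients\<close>

definition partial_deriv :: "'n::finite \<Rightarrow> (real ^ 'n \<Rightarrow> real) \<Rightarrow> real ^ 'n \<Rightarrow> real" where
  "partial_deriv i v x = frechet_derivative v (at x) (axis i 1)"

definition grad :: "(real ^ 'n::finite \<Rightarrow> real) \<Rightarrow> real ^ 'n \<Rightarrow> real ^ 'n" where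
  "grad v x = (\<chi> i. partial_deriv i v x)"

primrec C_class :: "nat \<Rightarrow> (real ^ 'n::finite \<Rightarrow> real) \<Rightarrow> bool" where
  "C_class 0 v \<longleftrightarrow> continuous_on UNIV v"
| "C_class (Suc k) v \<longleftrightarrow> v differentiable_on UNIV \<and> (\<forall>i. C_class k (partial_deriv i v))"

definition test_functions :: "(real ^ 'n::finite \<Rightarrow> real) set" where
  "test_functions = {v. (\<forall>k. C_class k v) \<and> compact (closure {x. v x \<noteq> 0})}"

definition locally_integrable ::
    "(real ^ 'n::finite \<Rightarrow> 'b::{banach, second_countable_topology}) \<Rightarrow> bool" where
  "locally_integrable g \<longleftrightarrow> (\<forall>K. compact K \<longrightarrow> set_integrable lebesgue K g)"

definition is_weak_gradient :: "(real ^ 'n::finite \<Rightarrow> real) \<Rightarrow> (real ^ 'n \<Rightarrow> real ^ 'n) \<Rightarrow> bool" where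
  "is_weak_gradient u G \<longleftrightarrow> locally_integrable u \<and> locally_integrable G \<and>
     (\<forall>v\<in>test_functions. \<forall>i.
        (LINT x|lebesgue. u x * partial_deriv i v x) = - (LINT x|lebesgue. G x $ i * v x))"

text \<open>The weak gradient is unique up to a null set, so the choice of a representative is immaterial
  in the integrals below.\<close>

definition weak_grad :: "(real ^ 'n::finite \<Rightarrow> real) \<Rightarrow> real ^ 'n \<Rightarrow> real ^ 'n" where
  "weak_grad u = (SOME G. is_weak_gradient u G)"

definition weighted_Lebesgue_space :: "real \<Rightarrow> real \<Rightarrow> (real ^ 'n::finite \<Rightarrow> real) set" where
  "weighted_Lebesgue_space r \<eta> =
     {u \<in> borel_measurable lebesgue. integrable lebesgue (\<lambda>x. \<bar>u x\<bar> powr r * norm x powr (- \<eta>))}"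

definition E_space :: "real \<Rightarrow> real \<Rightarrow> (real ^ 'n::finite \<Rightarrow> real) set" where
  "E_space b q =
     {u \<in> weighted_Lebesgue_space q b.
        (\<exists>G. is_weak_gradient u G) \<and> integrable lebesgue (\<lambda>x. (norm (weak_grad u x))\<^sup>2)}"

subsection \<open>Weak solutions, eigenvalues, energy\<close>

text \<open>\<open>spow r s\<close> is \<open>|s|\<^sup>r\<^sup>-\<^sup>2 s\<close>; it is \<open>0\<close> at \<open>s = 0\<close> for every \<open>r\<close>, which for \<open>r > 1\<close>
  is the continuous extension.\<close>

definition spow :: "real \<Rightarrow> real \<Rightarrow> real" where
  "spow r s = \<bar>s\<bar> powr (r - 2) * s"

text \<open>The notions below are meant for Caratheodory functions \<open>f\<close>, such as
  \<open>power_nonlinearity \<eta> r\<close> for \<open>r > 1\<close> and linear combinations of these.\<close>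

definition weak_solution ::
    "real \<Rightarrow> real \<Rightarrow> (real ^ 'n::finite \<Rightarrow> real \<Rightarrow> real) \<Rightarrow> (real ^ 'n \<Rightarrow> real) \<Rightarrow> bool" where
  "weak_solution b q f u \<longleftrightarrow>
     u \<in> E_space b q \<and> locally_integrable (\<lambda>x. f x (u x)) \<and>
     (\<forall>v\<in>test_functions.
        (LINT x|lebesgue. weak_grad u x \<bullet> grad v x)
        + (LINT x|lebesgue. norm x powr (- b) * spow q (u x) * v x)
        = (LINT x|lebesgue. f x (u x) * v x))"

definition primitive :: "(real ^ 'n::finite \<Rightarrow> real \<Rightarrow> real) \<Rightarrow> real ^ 'n \<Rightarrow> real \<Rightarrow> real" where
  "primitive f x s = (LBINT t=ereal 0..ereal s. f x t)"

definition energy ::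
    "real \<Rightarrow> real \<Rightarrow> (real ^ 'n::finite \<Rightarrow> real \<Rightarrow> real) \<Rightarrow> (real ^ 'n \<Rightarrow> real) \<Rightarrow> real" where
  "energy b q f u =
     1 / 2 * (LINT x|lebesgue. (norm (weak_grad u x))\<^sup>2)
     + 1 / q * (LINT x|lebesgue. \<bar>u x\<bar> powr q * norm x powr (- b))
     - (LINT x|lebesgue. primitive f x (u x))"

definition power_nonlinearity :: "real \<Rightarrow> real \<Rightarrow> real ^ 'n::finite \<Rightarrow> real \<Rightarrow> real" where
  "power_nonlinearity \<eta> r x s = norm x powr (- \<eta>) * spow r s"

definition is_eigenvalue ::
    "'n::finite itself \<Rightarrow> real \<Rightarrow> real \<Rightarrow> real \<Rightarrow> real \<Rightarrow> real \<Rightarrow> bool" where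
  "is_eigenvalue _ b q a p lam \<longleftrightarrow>
     (\<exists>u :: real ^ 'n \<Rightarrow> real.
        weak_solution b q (\<lambda>x s. lam * power_nonlinearity a p x s) u \<and>
        \<not> (AE x in lebesgue. u x = 0))"

subsection \<open>Exponents and admissible pairs\<close>

definition critical_exponent :: "nat \<Rightarrow> real \<Rightarrow> ereal" where
  "critical_exponent N \<eta> = (if N = 2 then \<infinity> else ereal (2 * (real N - \<eta>) / (real N - 2)))"

text \<open>The second branch is meant for \<open>N \<ge> 3\<close> only; admissible pairs have \<open>b \<le> \<eta>\<close> if \<open>N = 2\<close>.\<close>

definition lower_exponent :: "nat \<Rightarrow> real \<Rightarrow> real \<Rightarrow> real \<Rightarrow> real" where
  "lower_exponent N b q \<eta> =
     (if b \<le> \<eta> then q * (real N - \<eta>) / (real N - b)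
      else (\<eta> * q * (real N - 2) + 2 * real N * (b - \<eta>)) / (b * (real N - 2)))"

definition scaling_level :: "nat \<Rightarrow> real \<Rightarrow> real \<Rightarrow> real \<Rightarrow> real" where
  "scaling_level N \<delta> \<eta> r = r * \<delta> + \<eta> - real N"

definition admissible :: "nat \<Rightarrow> real \<Rightarrow> real \<Rightarrow> real \<Rightarrow> real \<Rightarrow> bool" where
  "admissible N b q \<eta> r \<longleftrightarrow>
     0 \<le> \<eta> \<and> \<eta> < (real N + 2) / 2 \<and> (N = 2 \<longrightarrow> b \<le> \<eta> \<and> \<eta> < 2) \<and> 1 < r \<and>
     (lower_exponent N b q \<eta> < r \<and> ereal r < critical_exponent N \<eta>
      \<or> r = lower_exponent N b q \<eta> \<and> \<eta> \<le> b
      \<or> ereal r = critical_exponent N \<eta> \<and> \<eta> \<le> 2 \<and> 3 \<le> N)"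

definition subscaled :: "nat \<Rightarrow> real \<Rightarrow> real \<Rightarrow> real \<Rightarrow> real \<Rightarrow> real \<Rightarrow> bool" where
  "subscaled N b q \<delta> \<eta> r \<longleftrightarrow>
     admissible N b q \<eta> r \<and> scaling_level N \<delta> \<eta> r < scaling_level N \<delta> b q"

lemma scaling_exponent_eq:
  fixes b p q \<delta> :: real
  assumes "2 < q" "\<delta> = (2 - b) / (q - 2)"
  shows "2 - \<delta> * (p - 2) = b + \<delta> * (q - p)"
proof -
  have "\<delta> * (q - 2) = 2 - b"
    using assms by simp
  then show ?thesis
    by (simp add: algebra_simps)
qed

lemma scaling_level_eq:
  assumes "2 < q" "\<delta> = (2 - b) / (q - 2)" "a = 2 - \<delta> * (p - 2)"
  shows "scaling_level N \<delta> b q = scaling_level N \<delta> a p"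
  using assms(3) scaling_exponent_eq[OF assms(1,2), of p]
  by (simp add: scaling_level_def algebra_simps)

end

theory Submission
 imports Defs "HOL-Library.Z2"
begin

text \<open>
 The equation is the Euler equation of \<open>\<Phi>(u) = En u - (\<lambda>/p) Ja u - (1/r) Gr u\<close>, where \<open>En\<close> collects the gradient
 term and the \<open>q\<close>-term, \<open>Ja\<close> is the eigenvalue term and \<open>Gr\<close> the subscaled term. The dilations \<open>t\<^sup>\<delta> u(t x)\<close>
 multiply \<open>En\<close> and \<open>Ja\<close> by \<open>t\<^sup>\<ell>\<close>, but \<open>Gr\<close> only by \<open>t\<^sup>\<ell>\<^sup>'\<close> with \<open>0 < \<ell>' < \<ell>\<close>. So at small energy \<open>Gr\<close> dominates, which
 creates negative levels, while at large energy \<open>\<Phi>\<close> behaves like the functional of the eigenvalue problem.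

 The critical levels are \<open>c\<^sub>k = inf max \<Phi>(g(y))\<close>, the infimum over the odd maps \<open>g\<close> from the boundary of a
 \<open>(k+1)\<close>-dimensional cross-polytope into finite-dimensional spaces of test functions. Three facts carry the proof.

 First, \<open>c\<^sub>k < 0\<close> (\<open>negative_odd_map\<close>): combine bumps with disjoint supports and dilate with small \<open>t\<close>.

 Second, \<open>c\<^sub>k\<close> tends to \<open>0\<close> (\<open>index_lemma\<close>, \<open>levels_vanish\<close>): rescale an odd map to constant energy. By the Borsuk--Ulam
 theorem \<open>k\<close> given averages over balls vanish at one of its points. By compactness of the embeddings, a function of
 bounded energy with many vanishing averages has small \<open>Ja\<close> and \<open>Gr\<close>, so \<open>\<Phi>\<close> is almost nonnegative there.

 Third, \<open>c\<^sub>k\<close> is the energy of a solution if it is finite. Otherwise approximate critical points at this level are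
 excluded: a bounded sequence of them would converge strongly, because the principal part is strongly monotone and
 the other terms are compact (\<open>PS_Cauchy\<close>, \<open>PS_limit\<close>); an unbounded one, dilated to energy \<open>1\<close>, would converge to an
 eigenfunction, because the dilation sends the coefficient of \<open>Gr\<close> to zero (\<open>PS_unbounded\<close>). Hence there are descent
 directions of uniform quality (\<open>pseudo_gradient\<close>), and one step along an odd field made of them pushes the maximum of
 a nearly optimal map below \<open>c\<^sub>k\<close> (\<open>deformation\<close>).

 All estimates are made for test functions with classical gradients; a Sobolev function appears only as the limit of
 a sequence of them. The embeddings are needed only for \<open>good_pair\<close> exponents, where every inequality is strict;
 \<open>scaled_problemI\<close> shows that subscaled pairs are of this kind.
\<close>

notation LIMSEQ (infix "---->" 60)

section \<open>The Borsuk--Ulam theorem\<close>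

text \<open>
 Mod 2 cochains are functions on lists of points (ordered simplices). The empty list is the only
 simplex of dimension \<open>-1\<close>, so the coboundary is the augmented one.
\<close>

(* bit serves as the field with two elements, hence sums and products are not to become bit operations *)
declare add_bit_eq_xor [simp del] mult_bit_eq_and [simp del] bit_not_zero_iff [simp del] bit_not_one_iff [simp del]

lemma bit_double [simp]: "x + x = (0::bit)" "x + (x + y) = (y::bit)"
 by (cases x; cases y; simp)+

primrec cobd :: "('a list => bit) => 'a list => bit" where
 "cobd F [] = 0"
| "cobd F (v # \<tau>) = F \<tau> + cobd (%\<rho>. F (v # \<rho>)) \<tau>"

lemma cobd_add: "cobd (%\<sigma>. F \<sigma> + H \<sigma>) \<sigma> = cobd F \<sigma> + cobd H \<sigma>"
 by (induction \<sigma> arbitrary: F H) (simp_all add: algebra_simps)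

lemma cobd_zero: "cobd (%\<sigma>. 0) \<sigma> = 0"
 by (induction \<sigma>) simp_all

lemma cobd_scale: "cobd (%\<sigma>. c * F \<sigma>) \<sigma> = c * cobd F \<sigma>"
 by (induction \<sigma> arbitrary: F) (simp_all add: algebra_simps)

lemma cobd_cong:
 assumes "!!\<rho>. Suc (length \<rho>) = length \<sigma> ==> set \<rho> \<subseteq> set \<sigma> ==> F \<rho> = H \<rho>"
 shows "cobd F \<sigma> = cobd H \<sigma>"
 using assms
proof (induction \<sigma> arbitrary: F H)
 case (Cons v \<tau>)
 have "F \<tau> = H \<tau>"
  by (rule Cons.prems) auto
 moreover have "cobd (%\<rho>. F (v # \<rho>)) \<tau> = cobd (%\<rho>. H (v # \<rho>)) \<tau>"
  by (rule Cons.IH, rule Cons.prems) auto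
 ultimately show ?case by simp
qed simp

lemma cobd_map: "cobd F (map g \<sigma>) = cobd (%\<rho>. F (map g \<rho>)) \<sigma>"
 by (induction \<sigma> arbitrary: F) simp_all

lemma cobd_cobd: "cobd (cobd F) \<sigma> = 0"
 by (induction \<sigma> arbitrary: F) (simp_all add: cobd_add algebra_simps)

text \<open>
 Pull-back of a cochain along barycentric subdivision: the subdivision of a simplex is the cone from
 its barycentre over the subdivided boundary. The number is the length of the lists.
\<close>

primrec sd :: "('a list => 'a) => nat => ('a list => bit) => 'a list => bit" where
 "sd b 0 F \<sigma> = F \<sigma>"
| "sd b (Suc n) F \<sigma> = cobd (%\<rho>. sd b n (%\<tau>. F (b \<sigma> # \<tau>)) \<rho>) \<sigma>"

lemma sd_add: "sd b n (%\<sigma>. F \<sigma> + H \<sigma>) \<sigma> = sd b n F \<sigma> + sd b n H \<sigma>"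
 by (induction n arbitrary: F H \<sigma>) (simp_all add: cobd_add)

lemma sd_add_fun: "sd b n (%\<sigma>. F \<sigma> + H \<sigma>) = (%\<sigma>. sd b n F \<sigma> + sd b n H \<sigma>)"
 by (rule ext) (rule sd_add)

lemma sd_zero: "sd b n (%\<sigma>. 0) \<sigma> = 0"
 by (induction n arbitrary: \<sigma>) (simp_all add: cobd_zero)

lemma sd_map:
 assumes "!!\<sigma>. b (map g \<sigma>) = g (b \<sigma>)"
 shows "sd b n F (map g \<sigma>) = sd b n (%\<tau>. F (map g \<tau>)) \<sigma>"
 by (induction n arbitrary: F \<sigma>) (simp_all add: cobd_map assms)

definition avg_closed :: "('a list => 'a) => 'a set => bool" where
 "avg_closed b S \<longleftrightarrow> (ALL \<rho>. \<rho> ~= [] --> set \<rho> \<subseteq> S --> b \<rho> \<in> S)"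

text \<open>
 The subdivided cochain only sees the pieces of the simplex; these stay in each set that is closed
 under barycentres, and they are smaller by a factor that depends on the dimension only.
\<close>

lemma sd_cong_pieces:
 fixes d :: "'a => 'a => real"
 assumes d0: "!!x. d x x = 0" and dsym: "!!x y. d x y = d y x"
  and ball: "!!x r. avg_closed b {y. d x y <= r}"
  and bary: "!!\<sigma> D v. length \<sigma> <= Suc m ==> ALL x:set \<sigma>. ALL y:set \<sigma>. d x y <= D ==>
   v \<in> set \<sigma> ==> d (b \<sigma>) v <= \<theta> * D"
  and th: "0 <= \<theta>"
 assumes len: "length \<sigma> = n" "n <= Suc m" and D0: "0 <= D"
  and D: "ALL x:set \<sigma>. ALL y:set \<sigma>. d x y <= D"
  and eq: "!!\<tau>. length \<tau> = n ==> (!!S. avg_closed b S ==> set \<sigma> \<subseteq> S ==> set \<tau> \<subseteq> S) ==>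
    ALL x:set \<tau>. ALL y:set \<tau>. d x y <= \<theta> * D ==> F \<tau> = H \<tau>"
 shows "sd b n F \<sigma> = sd b n H \<sigma>"
 using len D eq
proof (induction n arbitrary: F H \<sigma>)
 case 0
 show ?case using 0 by simp
next
 case (Suc n)
 have "sd b n (%\<tau>. F (b \<sigma> # \<tau>)) \<rho> = sd b n (%\<tau>. H (b \<sigma> # \<tau>)) \<rho>"
  if \<rho>: "Suc (length \<rho>) = length \<sigma>" "set \<rho> \<subseteq> set \<sigma>" for \<rho>
 proof (rule Suc.IH)
  show "length \<rho> = n" "n <= Suc m" using \<rho> Suc.prems by auto
  show "ALL x:set \<rho>. ALL y:set \<rho>. d x y <= D" using \<rho> Suc.prems(3) by blast
  fix \<tau> assume \<tau>: "length \<tau> = n" "!!S. avg_closed b S ==> set \<rho> \<subseteq> S ==> set \<tau> \<subseteq> S"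
   "ALL x:set \<tau>. ALL y:set \<tau>. d x y <= \<theta> * D"
  have ne: "\<sigma> ~= []" using Suc.prems by auto
  have "set \<rho> \<subseteq> {y. d (b \<sigma>) y <= \<theta> * D}"
   using bary[OF _ Suc.prems(3)] \<rho> Suc.prems(1,2) by auto
  from \<tau>(2)[OF ball this] have c: "ALL y:set \<tau>. d (b \<sigma>) y <= \<theta> * D" by auto
  show "F (b \<sigma> # \<tau>) = H (b \<sigma> # \<tau>)"
  proof (rule Suc.prems(4))
   show "length (b \<sigma> # \<tau>) = Suc n" using \<tau> by simp
   show "set (b \<sigma> # \<tau>) \<subseteq> S" if "avg_closed b S" "set \<sigma> \<subseteq> S" for S
    using that \<tau>(2)[of S] \<rho> ne unfolding avg_closed_def by auto
   show "ALL x:set (b \<sigma> # \<tau>). ALL y:set (b \<sigma> # \<tau>). d x y <= \<theta> * D"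
    using c \<tau>(3) d0 dsym th D0 by auto
  qed
 qed
 then show ?case by (auto intro!: cobd_cong)
qed

lemma sd_cong_length:
 assumes "length \<sigma> = n" and "!!\<tau>. length \<tau> = n ==> F \<tau> = H \<tau>"
 shows "sd b n F \<sigma> = sd b n H \<sigma>"
 using assms
proof (induction n arbitrary: F H \<sigma>)
 case (Suc n)
 then show ?case by (auto intro!: cobd_cong Suc.IH)
qed simp

text \<open>
 The boundary of the cone over \<open>\<tau>\<close> is \<open>\<tau>\<close> plus the cone over the boundary of \<open>\<tau>\<close>, and the second part drops out by
 induction because boundaries have no boundary. The empty simplex makes this correct in dimension \<open>0\<close>, too.
\<close>

lemma sd_cobd:
 "length \<sigma> = Suc n ==> sd b (Suc n) (cobd F) \<sigma> = cobd (sd b n F) \<sigma>"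
proof (induction n arbitrary: F \<sigma>)
 case 0
 then obtain v where "\<sigma> = [v]" by (cases \<sigma>) auto
 then show ?case by simp
next
 case (Suc n)
 let ?F = "%\<rho>. F (b \<sigma> # \<rho>)"
 have "cobd (sd b (Suc n) (cobd ?F)) \<sigma> = cobd (cobd (sd b n ?F)) \<sigma>"
  by (rule cobd_cong, rule Suc.IH) (use Suc.prems in auto)
 also have "... = 0" by (rule cobd_cobd)
 finally have "cobd (sd b (Suc n) (cobd ?F)) \<sigma> = 0" .
 then show ?case
  by (subst sd.simps) (simp add: sd_add_fun cobd_add del: sd.simps)
qed

lemma sd_iter_cobd:
 "length \<sigma> = Suc n ==> (sd b (Suc n) ^^ N) (cobd F) \<sigma> = cobd ((sd b n ^^ N) F) \<sigma>"
proof (induction N arbitrary: \<sigma>)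
 case (Suc N)
 have "(sd b (Suc n) ^^ Suc N) (cobd F) \<sigma> = sd b (Suc n) ((sd b (Suc n) ^^ N) (cobd F)) \<sigma>"
  by (simp del: sd.simps)
 also have "... = sd b (Suc n) (cobd ((sd b n ^^ N) F)) \<sigma>"
  by (rule sd_cong_length[OF Suc.prems]) (rule Suc.IH)
 also have "... = cobd (sd b n ((sd b n ^^ N) F)) \<sigma>"
  by (rule sd_cobd[OF Suc.prems])
 finally show ?case by (simp del: sd.simps)
qed simp

lemma sd_iter_add:
 "(sd b n ^^ N) (%\<sigma>. F \<sigma> + H \<sigma>) \<sigma> = (sd b n ^^ N) F \<sigma> + (sd b n ^^ N) H \<sigma>"
proof (induction N arbitrary: \<sigma>)
 case (Suc N)
 have "(sd b n ^^ N) (%\<sigma>. F \<sigma> + H \<sigma>) = (%\<sigma>. (sd b n ^^ N) F \<sigma> + (sd b n ^^ N) H \<sigma>)"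
  using Suc by blast
 then show ?case by (simp add: sd_add)
qed simp

lemma sd_iter_zero: "(sd b n ^^ N) (%\<sigma>. 0) \<sigma> = 0"
proof (induction N arbitrary: \<sigma>)
 case (Suc N)
 then have "(sd b n ^^ N) (%\<sigma>. 0) = (%\<sigma>. 0)" by blast
 then show ?case by (simp add: sd_zero)
qed simp

lemma sd_iter_map:
 assumes "!!\<sigma>. b (map g \<sigma>) = g (b \<sigma>)"
 shows "(sd b n ^^ N) F (map g \<sigma>) = (sd b n ^^ N) (%\<tau>. F (map g \<tau>)) \<sigma>"
proof (induction N arbitrary: F \<sigma>)
 case (Suc N)
 have "(%\<tau>. (sd b n ^^ N) F (map g \<tau>)) = (sd b n ^^ N) (%\<tau>. F (map g \<tau>))"
  using Suc by blast
 then show ?case by (simp add: sd_map[where b=b and g=g, OF assms])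
qed simp

lemma sd_iter_cong_pieces:
 fixes d :: "'a => 'a => real"
 assumes d0: "!!x. d x x = 0" and dsym: "!!x y. d x y = d y x"
  and ball: "!!x r. avg_closed b {y. d x y <= r}"
  and bary: "!!\<sigma> D v. length \<sigma> <= Suc m ==> ALL x:set \<sigma>. ALL y:set \<sigma>. d x y <= D ==>
   v \<in> set \<sigma> ==> d (b \<sigma>) v <= \<theta> * D"
  and th: "0 <= \<theta>"
 assumes len: "length \<sigma> = n" "n <= Suc m" and D0: "0 <= D"
  and D: "ALL x:set \<sigma>. ALL y:set \<sigma>. d x y <= D"
  and S: "avg_closed b S" "set \<sigma> \<subseteq> S"
  and eq: "!!\<tau>. length \<tau> = n ==> set \<tau> \<subseteq> S ==>
    ALL x:set \<tau>. ALL y:set \<tau>. d x y <= \<theta> ^ N * D ==> F \<tau> = H \<tau>"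
 shows "(sd b n ^^ N) F \<sigma> = (sd b n ^^ N) H \<sigma>"
 using len D S D0 eq
proof (induction N arbitrary: \<sigma> D)
 case (Suc N)
 have "sd b n ((sd b n ^^ N) F) \<sigma> = sd b n ((sd b n ^^ N) H) \<sigma>"
 proof (rule sd_cong_pieces[where d=d and m=m and \<theta>=\<theta> and D=D, OF d0 dsym ball bary th])
  fix \<tau> assume \<tau>: "length \<tau> = n" "!!S. avg_closed b S ==> set \<sigma> \<subseteq> S ==> set \<tau> \<subseteq> S"
   "ALL x:set \<tau>. ALL y:set \<tau>. d x y <= \<theta> * D"
  show "(sd b n ^^ N) F \<tau> = (sd b n ^^ N) H \<tau>"
  proof (rule Suc.IH[where D="\<theta> * D"])
   show "F \<tau> = H \<tau>" if "length \<tau> = n" "set \<tau> \<subseteq> S"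
    "ALL x:set \<tau>. ALL y:set \<tau>. d x y <= \<theta> ^ N * (\<theta> * D)" for \<tau>
    using that Suc.prems(7) by (simp add: mult_ac)
  qed (use \<tau> Suc.prems th in auto)
 qed (use Suc.prems in auto)
 then show ?case by simp
qed auto

text \<open>
 The sum of a cochain over the simplices \<open>[\<plusminus>e\<^bsub>k-1\<^esub>, ..., \<plusminus>e\<^sub>0]\<close>, that is, over the boundary of the
 cross-polytope.
\<close>

definition pneg :: "(nat => real) => nat => real" where "pneg x = (%i. - x i)"
definition unit_pt :: "nat => nat => real" where "unit_pt k = (%i. if i = k then 1 else 0)"

lemma pneg_pneg [simp]: "pneg (pneg x) = x" by (simp add: pneg_def)

primrec csum :: "nat => ((nat => real) list => bit) => bit" where
 "csum 0 F = F []"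
| "csum (Suc k) F = csum k (%\<sigma>. F (unit_pt k # \<sigma>)) + csum k (%\<sigma>. F (pneg (unit_pt k) # \<sigma>))"

lemma csum_add: "csum k (%\<sigma>. F \<sigma> + H \<sigma>) = csum k F + csum k H"
 by (induction k arbitrary: F H) (simp_all add: algebra_simps)

lemma csum_zero: "csum k (%\<sigma>. 0) = 0"
 by (induction k) simp_all

text \<open>
 Each face that omits a vertex \<open>\<plusminus>e\<^sub>i\<close> occurs twice, once for each sign.
\<close>

lemma csum_cobd: "csum k (cobd F) = 0"
 by (induction k arbitrary: F) (simp_all add: csum_add algebra_simps)

lemma csum_neg: "csum k (%\<sigma>. F (map pneg \<sigma>)) = csum k F"
proof (induction k arbitrary: F)
 case (Suc k)
 show ?case
  using Suc[of "%\<sigma>. F (pneg (unit_pt k) # \<sigma>)"] Suc[of "%\<sigma>. F (unit_pt k # \<sigma>)"]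
  by (simp add: algebra_simps)
qed simp

text \<open>
 The signs \<open>\<epsilon>\<close> single out one face of the cross-polytope, so it suffices to compare cochains face by face.
\<close>

lemma csum_cong:
 assumes "!!\<sigma> \<epsilon>. length \<sigma> = k ==> (!!i. \<epsilon> i = 1 | \<epsilon> i = (-1::real)) ==>
  (!!v. v \<in> set \<sigma> ==> EX i<k. v = (%j. if j = i then \<epsilon> i else 0)) ==> F \<sigma> = H \<sigma>"
 shows "csum k F = csum k H"
 using assms
proof (induction k arbitrary: F H)
 case 0
 show ?case by (simp, rule 0[where \<epsilon>="%_. 1"]) auto
next
 case (Suc k)
 have "csum k (%\<sigma>. F (w # \<sigma>)) = csum k (%\<sigma>. H (w # \<sigma>))"
  if w: "w = (%j. if j = k then s else 0)" and s: "s = 1 | s = -1" for w s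
 proof (rule Suc.IH)
  fix \<sigma> and \<epsilon> :: "nat => real" assume *: "length \<sigma> = k" "!!i. \<epsilon> i = 1 | \<epsilon> i = -1"
   "!!v. v \<in> set \<sigma> ==> EX i<k. v = (%j. if j = i then \<epsilon> i else 0)"
  show "F (w # \<sigma>) = H (w # \<sigma>)"
  proof (rule Suc.prems[where \<epsilon>="\<epsilon>(k := s)"])
   show "length (w # \<sigma>) = Suc k" using * by simp
   show "(\<epsilon>(k := s)) i = 1 | (\<epsilon>(k := s)) i = - 1" for i using *(2) s by auto
   show "EX i<Suc k. v = (%j. if j = i then (\<epsilon>(k := s)) i else 0)" if "v \<in> set (w # \<sigma>)" for v
   proof (cases "v = w")
    case True
    then show ?thesis using w by (intro exI[of _ k]) auto
   next
    case False
    then have "v \<in> set \<sigma>" using that by simp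
    from *(3)[OF this] obtain i where "i < k" "v = (%j. if j = i then \<epsilon> i else 0)" by blast
    then show ?thesis by (intro exI[of _ i]) auto
   qed
  qed
 qed
 moreover have "unit_pt k = (%j. if j = k then 1 else 0)" "pneg (unit_pt k) = (%j. if j = k then -1 else 0)"
  by (auto simp: unit_pt_def pneg_def)
 ultimately show ?case by (metis csum.simps(2))
qed

text \<open>
 The coboundary of a \<open>0\<close>-cochain that changes under the antipodal map represents the generator of
 \<open>H\<^sup>1\<close> of projective space; \<open>cup k\<close> is the cup product of \<open>k\<close> such representatives.
\<close>

primrec cup :: "(nat => 'a => bit) => nat => 'a list => bit" where
 "cup a 0 \<sigma> = 1"
| "cup a (Suc k) \<sigma> = (case \<sigma> of [] => 0 | v # \<tau> =>
  (case \<tau> of [] => 0 | w # _ => (a k v + a k w) * cup a k \<tau>))"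

definition cup' :: "(nat => 'a => bit) => nat => 'a list => bit" where
 "cup' a k \<sigma> = a k (hd \<sigma>) * cup a k \<sigma>"

text \<open>
 The Leibniz rule for cup products of coboundaries, with the primitive of one factor in front in the second case.
\<close>

lemma cobd_cup_cup':
 "(length \<sigma> = k + 2 --> cobd (cup a k) \<sigma> = 0) & (length \<sigma> = k + 2 --> cobd (cup' a k) \<sigma> = cup a (Suc k) \<sigma>)"
proof (induction k arbitrary: \<sigma>)
 have step: "cobd (cup' a k) \<sigma> = cup a (Suc k) \<sigma>"
  if *: "cobd (cup a k) \<sigma> = 0" "length \<sigma> = k + 2" for k \<sigma>
 proof -
  obtain v w \<tau> where \<sigma>: "\<sigma> = v # w # \<tau>"
   using *(2) by (metis Suc_length_conv add_2_eq_Suc')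
  have "cup a k (w # \<tau>) = cobd (%\<rho>. cup a k (v # \<rho>)) (w # \<tau>)"
   using *(1) unfolding \<sigma>
   by (cases "cup a k (w # \<tau>)"; cases "cobd (%\<rho>. cup a k (v # \<rho>)) (w # \<tau>)")
    (simp_all del: cobd.simps add: cobd.simps(2)[of _ v])
  then show ?thesis
   unfolding \<sigma> cup'_def
   by (simp add: cobd_scale algebra_simps del: cobd.simps add: cobd.simps(2)[of _ v])
 qed
 {
  case 0
  have "cobd (cup a 0) \<sigma> = 0" if l: "length \<sigma> = 0 + 2"
  proof -
   obtain v w where "\<sigma> = [v, w]"
    using l by (cases \<sigma>; cases "tl \<sigma>") auto
   then show ?thesis by simp
  qed
  with step[of 0 \<sigma>] show ?case by blast
 next
  case (Suc k)
  have "cobd (cup a (Suc k)) \<sigma> = 0" if "length \<sigma> = Suc k + 2"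
  proof -
   have "cobd (cup a (Suc k)) \<sigma> = cobd (cobd (cup' a k)) \<sigma>"
    using Suc that by (intro cobd_cong) auto
   then show ?thesis by (simp add: cobd_cobd)
  qed
  with step[of "Suc k" \<sigma>] show ?case by blast
 }
qed

lemma cup_neg:
 assumes "!!k v. v \<in> X ==> a k (g v) = a k v + 1"
 shows "set \<sigma> \<subseteq> X ==> cup a k (map g \<sigma>) = cup a k \<sigma>"
proof (induction k arbitrary: \<sigma>)
 case (Suc k)
 show ?case
 proof (cases \<sigma>)
  case (Cons v \<tau>)
  then show ?thesis
  proof (cases \<tau>)
   case (Cons w \<tau>')
   with Suc \<open>\<sigma> = v # \<tau>\<close> show ?thesis
    using assms[of v k] assms[of w k] Suc.IH[of \<tau>] by (simp add: algebra_simps)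
  qed simp
 qed simp
qed simp

text \<open>
 On a simplex that is small enough to miss a sign change of some \<open>F\<^sub>j\<close> the product vanishes.
\<close>

lemma cup_nonzero:
 "cup a k \<sigma> ~= 0 ==> j < k ==> EX v:set \<sigma>. EX w:set \<sigma>. a j v ~= a j w"
proof (induction k arbitrary: \<sigma>)
 case (Suc k)
 then obtain v w \<tau> where \<sigma>: "\<sigma> = v # w # \<tau>" by (auto split: list.splits)
 have *: "a k v + a k w ~= 0" "cup a k (w # \<tau>) ~= 0"
  using Suc.prems(1) unfolding \<sigma> by auto
 have vw: "a k v ~= a k w"
 proof
  assume "a k v = a k w"
  then have "a k v + a k w = 0" by (simp only: bit_double)
  with *(1) show False by blast
 qed
 have in\<sigma>: "v \<in> set \<sigma>" "w \<in> set \<sigma>" "set (w # \<tau>) \<subseteq> set \<sigma>" unfolding \<sigma> by auto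
 show ?case
 proof (cases "j = k")
  case True
  then show ?thesis using vw in\<sigma> by blast
 next
  case False
  then have "j < k" using Suc.prems(2) by simp
  from Suc.IH[OF *(2) this] show ?thesis using in\<sigma>(3) by blast
 qed
qed simp

definition cross_sphere :: "nat => (nat => real) set" where
 "cross_sphere m = {x. (\<Sum>i\<le>m. abs (x i)) = 1 & (ALL i>m. x i = 0)}"

lemma pneg_cross_sphere [simp]: "pneg x \<in> cross_sphere m \<longleftrightarrow> x \<in> cross_sphere m"
 by (simp add: cross_sphere_def pneg_def)

lemma compact_cross_sphere: "compact (cross_sphere m)"
proof -
 have "compact (PiE UNIV (%i::nat. {-1..1::real}))"
  using compactin_PiE[of "%_::nat. euclideanreal" UNIV "%i::nat. {-1..1::real}"]
  by (simp add: euclidean_product_topology)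
 moreover have "closed (cross_sphere m)"
 proof -
  have "cross_sphere m = {x. (\<Sum>i\<le>m. abs (x i)) = 1} \<inter> (\<Inter>i\<in>{m<..}. {x. x i = 0})"
   by (auto simp: cross_sphere_def)
  moreover have "closed ..."
   by (intro closed_Int closed_INT ballI closed_Collect_eq continuous_intros continuous_on_product_coordinates)
  ultimately show ?thesis by simp
 qed
 moreover have "cross_sphere m \<subseteq> PiE UNIV (%i::nat. {-1..1::real})"
 proof
  fix x assume x: "x \<in> cross_sphere m"
  have "abs (x i) <= 1" for i
  proof (cases "i <= m")
   case True
   then have "abs (x i) <= (\<Sum>i\<le>m. abs (x i))" by (intro member_le_sum) auto
   then show ?thesis using x by (simp add: cross_sphere_def)
  qed (use x in \<open>simp add: cross_sphere_def\<close>)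
  then show "x \<in> PiE UNIV (%i::nat. {-1..1::real})"
   by (auto simp: abs_le_iff minus_le_iff)
 qed
 ultimately show ?thesis
  by (metis compact_Int_closed inf.absorb_iff2)
qed

text \<open>
 Applied with a vertex \<open>y\<close> of the simplex: that vertex contributes \<open>0\<close> to the mean, which gives the contraction factor
 \<open>m/(m+1)\<close> of barycentric subdivision.
\<close>

lemma bary_bound:
 fixes \<sigma> :: "(nat => real) list" and m :: nat
 defines "d \<equiv> %x y. \<Sum>i\<le>m. \<bar>x i - y i :: real\<bar>"
 assumes "\<sigma> ~= []"
 shows "d (%i. (\<Sum>v\<leftarrow>\<sigma>. v i) / length \<sigma>) y <= (\<Sum>v\<leftarrow>\<sigma>. d v y) / length \<sigma>"
proof -
 have *: "\<bar>(\<Sum>v\<leftarrow>\<sigma>. v i) / length \<sigma> - y i\<bar> <= (\<Sum>v\<leftarrow>\<sigma>. \<bar>v i - y i\<bar>) / length \<sigma>" for i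
 proof -
  have "(\<Sum>v\<leftarrow>\<sigma>. v i) / length \<sigma> - y i = (\<Sum>v\<leftarrow>\<sigma>. v i - y i) / length \<sigma>"
   using \<open>\<sigma> ~= []\<close> by (simp add: sum_list_subtractf sum_list_triv field_simps)
  moreover have "\<bar>\<Sum>v\<leftarrow>\<sigma>. v i - y i\<bar> <= (\<Sum>v\<leftarrow>\<sigma>. \<bar>v i - y i\<bar>)"
   by (rule order_trans[OF sum_list_abs]) (simp add: comp_def)
  ultimately show ?thesis by (simp add: divide_right_mono)
 qed
 have "(\<Sum>i\<le>m. (\<Sum>v\<leftarrow>\<sigma>. \<bar>v i - y i\<bar>)) = (\<Sum>v\<leftarrow>\<sigma>. d v y)"
  unfolding d_def by (induction \<sigma>) (simp_all add: sum.distrib)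
 then show ?thesis
  unfolding d_def
  by (intro order_trans[OF sum_mono[OF *]]) (simp add: d_def flip: sum_divide_distrib)
qed

text \<open>
 If \<open>F\<close> had no zero, let \<open>a\<^sub>j\<close> be the sign of \<open>F\<^sub>j\<close>. On a fine subdivision no simplex
 sees sign changes of all \<open>F\<^sub>j\<close>, so the cup product of the \<open>m\<close> cochains \<open>d a\<^sub>j\<close> vanishes there.
 But the relation \<open>d (a\<^sub>k \<union> d a\<^bsub>k-1\<^esub> \<union> ...) = d a\<^sub>k \<union> ...\<close> propagates the value \<open>1\<close> from
 dimension \<open>0\<close> to dimension \<open>m\<close> through the hemispheres.
\<close>

theorem Borsuk_Ulam_cross_sphere:
 fixes F :: "nat => (nat => real) => real"
 assumes cont: "!!j. j < m ==> continuous_on (cross_sphere m) (F j)"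
  and odd: "!!j x. j < m ==> x \<in> cross_sphere m ==> F j (pneg x) = - F j x"
 shows "EX x:cross_sphere m. ALL j<m. F j x = 0"
proof (rule ccontr)
 assume nz: "~ ?thesis"
 let ?X = "cross_sphere m"
 define d where "d = (%x y. \<Sum>i\<le>m. \<bar>x i - y i :: real\<bar>)"
 define b where "b = (%(\<sigma>::(nat=>real) list) i. (\<Sum>v\<leftarrow>\<sigma>. v i) / length \<sigma>)"
 define \<theta> where "\<theta> = real m / (real m + 1)"
 have th: "0 <= \<theta>" "\<theta> < 1" by (auto simp: \<theta>_def)
 have unit_X: "unit_pt 0 \<in> ?X"
  by (auto simp: cross_sphere_def unit_pt_def if_distrib cong: if_cong)
 \<comment> \<open>a positive lower bound for the sum of the absolute values, by compactness\<close>
 have "continuous_on ?X (%x. \<Sum>j<m. abs (F j x))"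
  using cont by (intro continuous_intros) auto
 then obtain x0 where x0: "x0 \<in> ?X" "!!x. x \<in> ?X ==> (\<Sum>j<m. abs (F j x0)) <= (\<Sum>j<m. abs (F j x))"
  using continuous_attains_inf[OF compact_cross_sphere, of m] unit_X by blast
 define \<mu> where "\<mu> = (\<Sum>j<m. abs (F j x0))"
 have "\<mu> > 0"
 proof -
  obtain j where "j < m" "F j x0 ~= 0" using nz x0(1) by blast
  then show ?thesis unfolding \<mu>_def by (intro sum_pos2[of _ j]) auto
 qed
 have m0: "m > 0" using \<open>\<mu> > 0\<close> by (cases m) (auto simp: \<mu>_def)
 have "EX \<delta>>0. ALL x:?X. ALL y:?X. d x y <= \<delta> --> (ALL j<m. \<bar>F j x - F j y\<bar> < \<mu> / m)"
 proof -
  have "EX \<delta>>0. ALL x:?X. ALL y:?X. dist x y < \<delta> --> \<bar>F j x - F j y\<bar> < \<mu> / m" if "j < m" for j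
  proof -
   have "uniformly_continuous_on ?X (F j)"
    using compact_uniformly_continuous[OF cont[OF that] compact_cross_sphere] .
   moreover have "\<mu> / m > 0" using \<open>\<mu> > 0\<close> m0 by simp
   ultimately obtain \<delta> where "\<delta> > 0" "ALL x:?X. ALL y:?X. dist y x < \<delta> --> dist (F j y) (F j x) < \<mu> / m"
    unfolding uniformly_continuous_on_def by blast
   then show ?thesis
    by (intro exI[of _ \<delta>]) (simp add: dist_real_def dist_commute abs_minus_commute)
  qed
  then have "ALL j:{..<m}. EX \<delta>. \<delta> > 0 & (ALL x:?X. ALL y:?X. dist x y < \<delta> --> \<bar>F j x - F j y\<bar> < \<mu> / m)"
   by blast
  from bchoice[OF this] obtain \<delta> where "ALL j:{..<m}. \<delta> j > 0 & (ALL x:?X. ALL y:?X. dist x y < \<delta> j --> \<bar>F j x - F j y\<bar> < \<mu> / m)"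
   by blast
  then have \<delta>: "!!j. j < m ==> \<delta> j > 0"
   "!!j x y. j < m ==> x \<in> ?X ==> y \<in> ?X ==> dist x y < \<delta> j ==> \<bar>F j x - F j y\<bar> < \<mu> / m"
   by auto
  define \<delta>0 where "\<delta>0 = Min (\<delta> ` {..<m})"
  have \<delta>0: "\<delta>0 > 0" "!!j. j < m ==> \<delta>0 <= \<delta> j"
   using \<delta>(1) m0 unfolding \<delta>0_def by (subst Min_gr_iff) (auto simp: lessThan_empty_iff intro!: Min_le)
  obtain K where K: "(1/2)^K < \<delta>0 / 2"
   using real_arch_pow_inv[of "\<delta>0/2" "1/2"] \<delta>0(1) by auto
  show ?thesis
  proof (intro exI[of _ "\<delta>0/5"] conjI ballI impI allI)
   fix x y j assume *: "x \<in> ?X" "y \<in> ?X" "d x y <= \<delta>0/5" "j < m"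
   have co: "dist (x i) (y i) <= \<delta>0/5" for i
   proof (cases "i <= m")
    case True
    then have "\<bar>x i - y i\<bar> <= d x y" unfolding d_def by (intro member_le_sum) auto
    then show ?thesis using * by (simp add: dist_real_def)
   next
    case False
    then show ?thesis using * \<delta>0(1) by (simp add: cross_sphere_def)
   qed
   have "dist x y <= 2 * Max {dist (x (from_nat n)) (y (from_nat n))|n. n <= K} + (1/2)^K"
    by (rule dist_fun_le_dist_first_terms)
   moreover have "Max {dist (x (from_nat n)) (y (from_nat n))|n. n <= K} <= \<delta>0/5"
    using co by (subst Max_le_iff) auto
   ultimately have "dist x y < \<delta>0" using K \<delta>0(1) by linarith
   then show "\<bar>F j x - F j y\<bar> < \<mu> / m" using \<delta>(2)[OF *(4,1,2)] \<delta>0(2)[OF *(4)] by linarith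
  qed (use \<delta>0 in auto)
 qed
 then obtain \<delta> where \<delta>: "\<delta> > 0" "!!x y j. x \<in> ?X ==> y \<in> ?X ==> d x y <= \<delta> ==> j < m ==>
   \<bar>F j x - F j y\<bar> < \<mu> / m" by blast
 have "EX N. \<theta> ^ N < \<delta> / 2"
  using real_arch_pow_inv[of "\<delta>/2" \<theta>] \<delta>(1) th by simp
 then obtain N where "\<theta> ^ N < \<delta> / 2" by blast
 then have N: "\<theta> ^ N * 2 <= \<delta>" by simp
 \<comment> \<open>signs; ties are broken by the sign of the first nonzero coordinate\<close>
 define lead where "lead = (%x::nat=>real. x (LEAST i. x i ~= 0))"
 have lead: "lead (pneg x) = - lead x" for x by (simp add: lead_def pneg_def)
 have lead_nz: "lead x ~= 0" if "x \<in> ?X" for x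
 proof -
  have "EX i. x i ~= 0"
  proof (rule ccontr)
   assume "~ (EX i. x i ~= 0)"
   then have "(\<Sum>i\<le>m. abs (x i)) = 0" by simp
   then show False using that by (simp add: cross_sphere_def)
  qed
  then show ?thesis unfolding lead_def by (rule LeastI_ex)
 qed
 define a where "a = (%j x. of_bool (if j < m & F j x ~= 0 then F j x > 0 else lead x > 0) :: bit)"
 have a_neg: "a j (pneg x) = a j x + 1" if "x \<in> ?X" for j x
  using odd[of j x] that lead[of x] lead_nz[OF that] by (auto simp: a_def)
 have bneg: "b (map pneg \<sigma>) = pneg (b \<sigma>)" for \<sigma>
 proof -
  have "(\<Sum>v\<leftarrow>map pneg \<sigma>. v i) = - (\<Sum>v\<leftarrow>\<sigma>. v i)" for i
   by (induction \<sigma>) (auto simp: pneg_def)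
  then show ?thesis by (auto simp: b_def pneg_def fun_eq_iff)
 qed
 have ball: "avg_closed b {y. d x y <= r}" for x r
  unfolding avg_closed_def
 proof (intro allI impI)
  fix \<rho> :: "(nat=>real) list" assume \<rho>: "\<rho> ~= []" "set \<rho> \<subseteq> {y. d x y <= r}"
  have "d (b \<rho>) x <= (\<Sum>v\<leftarrow>\<rho>. d v x) / length \<rho>"
   unfolding d_def b_def by (rule bary_bound) (use \<rho> in auto)
  also have "(\<Sum>v\<leftarrow>\<rho>. d v x) <= (\<Sum>v\<leftarrow>\<rho>. r)"
   using \<rho> by (intro sum_list_mono) (auto simp: d_def abs_minus_commute)
  also have "(\<Sum>v\<leftarrow>\<rho>. r) / length \<rho> = r" using \<rho>(1) by (simp add: sum_list_triv)
  finally have "d (b \<rho>) x <= r" by (simp add: divide_right_mono)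
  then show "b \<rho> \<in> {y. d x y <= r}" by (simp add: d_def abs_minus_commute)
 qed
 have bary: "d (b \<sigma>) v <= \<theta> * D"
  if bb: "length \<sigma> <= Suc m" "ALL x:set \<sigma>. ALL y:set \<sigma>. d x y <= D" "v \<in> set \<sigma>" for \<sigma> v D
 proof -
  obtain \<alpha> \<beta> where \<sigma>: "\<sigma> = \<alpha> @ v # \<beta>" using split_list[OF bb(3)] by blast
  have D: "D >= 0" using that by (force simp: d_def)
  have "(\<Sum>w\<leftarrow>\<sigma>. d w v) = (\<Sum>w\<leftarrow>\<alpha> @ \<beta>. d w v)" by (simp add: \<sigma> d_def)
  also have "... <= (\<Sum>w\<leftarrow>\<alpha> @ \<beta>. D)" using that(2) by (intro sum_list_mono) (auto simp: \<sigma>)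
  also have "... = (real (length \<sigma>) - 1) * D" by (simp add: \<sigma> sum_list_triv algebra_simps)
  finally have s: "(\<Sum>w\<leftarrow>\<sigma>. d w v) <= (real (length \<sigma>) - 1) * D" .
  have ne: "\<sigma> ~= []" "length \<sigma> >= 1" by (auto simp: \<sigma>)
  have "d (b \<sigma>) v <= (\<Sum>w\<leftarrow>\<sigma>. d w v) / length \<sigma>"
   unfolding d_def b_def by (rule bary_bound) (use ne in auto)
  also have "... <= (real (length \<sigma>) - 1) / length \<sigma> * D"
   using s ne by (simp add: divide_right_mono)
  also have "... <= \<theta> * D"
   using ne that(1) D unfolding \<theta>_def by (intro mult_right_mono) (auto simp: field_simps)
  finally show ?thesis .
 qed
 define face where "face = (%\<epsilon>::nat=>real. {x. (\<Sum>i\<le>m. \<epsilon> i * x i) = 1 & (ALL i<=m. 0 <= \<epsilon> i * x i) & (ALL i>m. x i = 0)})"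
 have face_X: "face \<epsilon> \<subseteq> ?X" if "!!i. \<epsilon> i = 1 | \<epsilon> i = -1" for \<epsilon>
 proof
  fix x assume x: "x \<in> face \<epsilon>"
  have "(\<Sum>i\<le>m. abs (x i)) = (\<Sum>i\<le>m. \<epsilon> i * x i)"
  proof (rule sum.cong)
   fix i assume "i \<in> {..m}"
   then have "0 <= \<epsilon> i * x i" using x by (auto simp: face_def)
   then show "abs (x i) = \<epsilon> i * x i" using that[of i] by auto
  qed simp
  then show "x \<in> ?X" using x by (simp add: face_def cross_sphere_def)
 qed
 have face_avg: "avg_closed b (face \<epsilon>)" for \<epsilon>
  unfolding avg_closed_def
 proof (intro allI impI)
  fix \<rho> :: "(nat=>real) list" assume \<rho>: "\<rho> ~= []" "set \<rho> \<subseteq> face \<epsilon>"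
  have "(\<Sum>i\<le>m. \<epsilon> i * (\<Sum>v\<leftarrow>\<rho>. v i)) = (\<Sum>v\<leftarrow>\<rho>. \<Sum>i\<le>m. \<epsilon> i * v i)"
   by (induction \<rho>) (simp_all add: algebra_simps sum.distrib)
  also have "... = (\<Sum>v\<leftarrow>\<rho>. 1)"
   using \<rho>(2) by (intro arg_cong[of _ _ sum_list] map_cong) (auto simp: face_def)
  finally have 1: "(\<Sum>i\<le>m. \<epsilon> i * (\<Sum>v\<leftarrow>\<rho>. v i)) = length \<rho>" by (simp add: sum_list_triv)
  have 2: "0 <= \<epsilon> i * (\<Sum>v\<leftarrow>\<rho>. v i)" if "i <= m" for i
  proof -
   have "\<epsilon> i * (\<Sum>v\<leftarrow>\<rho>. v i) = (\<Sum>v\<leftarrow>\<rho>. \<epsilon> i * v i)" by (simp add: sum_list_const_mult)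
   moreover have "... >= 0" using \<rho>(2) that by (intro sum_list_nonneg) (auto simp: face_def)
   ultimately show ?thesis by simp
  qed
  have 3: "(\<Sum>v\<leftarrow>\<rho>. v i) = 0" if "i > m" for i
   using \<rho>(2) that by (induction \<rho>) (auto simp: face_def)
  show "b \<rho> \<in> face \<epsilon>"
   using 1 2 3 \<rho>(1) unfolding face_def b_def
   by (auto simp flip: sum_divide_distrib)
 qed
 have d2: "d x y <= 2" if "x \<in> ?X" "y \<in> ?X" for x y
 proof -
  have "d x y <= (\<Sum>i\<le>m. abs (x i) + abs (y i))" unfolding d_def by (intro sum_mono) auto
  then show ?thesis using that by (simp add: sum.distrib cross_sphere_def)
 qed
 \<comment> \<open>sums over the subdivided cross-polytope only depend on small simplices in its faces\<close>
 have cong: "(sd b k ^^ N) G \<sigma> = (sd b k ^^ N) H \<sigma>"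
  if "k <= Suc m" "length \<sigma> = k" and e: "!!i. \<epsilon> i = 1 | \<epsilon> i = (-1::real)"
   and v: "!!v. v \<in> set \<sigma> ==> EX i<k. v = (%j. if j = i then \<epsilon> i else 0)"
   and eq: "!!\<tau>. length \<tau> = k ==> set \<tau> \<subseteq> ?X ==> ALL x:set \<tau>. ALL y:set \<tau>. d x y <= \<delta> ==> G \<tau> = H \<tau>"
  for k G H \<sigma> \<epsilon>
 proof (rule sd_iter_cong_pieces[where d=d and m=m and \<theta>=\<theta> and D=2 and S="face \<epsilon>"])
  show fs: "set \<sigma> \<subseteq> face \<epsilon>"
  proof
   fix x assume "x \<in> set \<sigma>"
   then obtain i where i: "i < k" "x = (%j. if j = i then \<epsilon> i else 0)" using v by blast
   have "(\<Sum>j\<le>m. \<epsilon> j * x j) = (\<Sum>j\<le>m. if j = i then \<epsilon> i * \<epsilon> i else 0)"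
    unfolding i by (intro sum.cong) auto
   also have "... = 1" using i(1) that(1) e[of i] by auto
   finally show "x \<in> face \<epsilon>" using i that(1) e[of i] by (auto simp: face_def)
  qed
  show "ALL x:set \<sigma>. ALL y:set \<sigma>. d x y <= 2" using fs face_X[of \<epsilon>, OF e] d2 by blast
  show "G \<tau> = H \<tau>" if "length \<tau> = k" "set \<tau> \<subseteq> face \<epsilon>" "ALL x:set \<tau>. ALL y:set \<tau>. d x y <= \<theta> ^ N * 2" for \<tau>
   using that eq[of \<tau>] N face_X[of \<epsilon>, OF e] by force
 qed (use that th ball bary face_avg in \<open>auto simp: d_def abs_minus_commute\<close>)
 define A where "A = (%k. csum (Suc k) ((sd b (Suc k) ^^ N) (cup' a k)))"
 have step: "A (Suc k) = A k" if "Suc k <= m" for k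
 proof -
  let ?G = "(sd b (Suc k) ^^ N) (cup' a k)"
  let ?P = "(sd b (Suc (Suc k)) ^^ N) (cup' a (Suc k))"
  let ?e = "unit_pt (Suc k)"
  have "A k = csum (Suc k) (%\<sigma>. cobd ?G (?e # \<sigma>))"
   by (simp add: csum_add csum_cobd A_def del: csum.simps funpow.simps sd.simps)
  also have "... = csum (Suc k) (%\<sigma>. ?P (?e # \<sigma>) + ?P (map pneg (?e # \<sigma>)))"
  proof (rule csum_cong)
   fix \<sigma> and \<epsilon> :: "nat => real" assume *: "length \<sigma> = Suc k" "!!i. \<epsilon> i = 1 | \<epsilon> i = -1"
    "!!v. v \<in> set \<sigma> ==> EX i<Suc k. v = (%j. if j = i then \<epsilon> i else 0)"
   let ?s = "?e # \<sigma>"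
   have "cobd ?G ?s = (sd b (Suc (Suc k)) ^^ N) (cobd (cup' a k)) ?s"
    using * by (subst sd_iter_cobd) auto
   also have "... = (sd b (Suc (Suc k)) ^^ N) (%\<tau>. cup' a (Suc k) \<tau> + cup' a (Suc k) (map pneg \<tau>)) ?s"
   proof (rule cong[where \<epsilon>="\<epsilon>(Suc k := 1)"])
    show "EX i<Suc (Suc k). v = (%j. if j = i then (\<epsilon>(Suc k := 1)) i else 0)" if v: "v \<in> set ?s" for v
    proof (cases "v = ?e")
     case True
     then show ?thesis by (intro exI[of _ "Suc k"]) (auto simp: unit_pt_def)
    next
     case False
     then have "v \<in> set \<sigma>" using v by simp
     from *(3)[OF this] obtain i where "i < Suc k" "v = (%j. if j = i then \<epsilon> i else 0)" by blast
     then show ?thesis by (intro exI[of _ i]) auto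
    qed
    fix \<tau> assume \<tau>: "length \<tau> = Suc (Suc k)" "set \<tau> \<subseteq> ?X"
    have "cobd (cup' a k) \<tau> = cup a (Suc k) \<tau>"
     using cobd_cup_cup'[of \<tau> k a] \<tau>(1) by (simp del: cup.simps)
    moreover have "a (Suc k) (hd (map pneg \<tau>)) = a (Suc k) (hd \<tau>) + 1"
     using a_neg[of "hd \<tau>" "Suc k"] \<tau> by (cases \<tau>) auto
    moreover have "cup a (Suc k) (map pneg \<tau>) = cup a (Suc k) \<tau>"
     by (rule cup_neg[where X="?X"]) (use a_neg \<tau>(2) in auto)
    ultimately show "cobd (cup' a k) \<tau> = cup' a (Suc k) \<tau> + cup' a (Suc k) (map pneg \<tau>)"
     by (simp add: cup'_def algebra_simps del: cup.simps)
   qed (use * that in auto)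
   also have "... = ?P ?s + ?P (map pneg ?s)"
    by (subst sd_iter_add, subst sd_iter_map[where b=b and g=pneg, OF bneg], rule refl)
   finally show "cobd ?G ?s = ?P ?s + ?P (map pneg ?s)" .
  qed
  also have "... = csum (Suc k) (%\<sigma>. ?P (?e # \<sigma>)) + csum (Suc k) (%\<sigma>. ?P (pneg ?e # \<sigma>))"
   using csum_neg[of "Suc k" "%\<sigma>. ?P (pneg ?e # \<sigma>)"]
   by (simp add: csum_add del: csum.simps funpow.simps sd.simps)
  also have "... = A (Suc k)" unfolding A_def by (subst (3) csum.simps) (rule refl)
  finally show ?thesis ..
 qed
 have "A 0 = 1"
 proof -
  have b1: "b [v] = v" for v by (simp add: b_def)
  have "(sd b (Suc 0) ^^ N) G [v] = G [v]" for G v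
   by (induction N) (simp_all add: b1)
  then have "A 0 = a 0 (unit_pt 0) + a 0 (pneg (unit_pt 0))"
   by (simp add: A_def cup'_def)
  also have "... = 1" using a_neg[OF unit_X, of 0] by simp
  finally show ?thesis .
 qed
 have "A k = 1" if "k <= m" for k
  using that by (induction k) (use \<open>A 0 = 1\<close> step in auto)
 then have "A m = 1" by simp
 moreover have "A m = csum (Suc m) (%\<sigma>. 0)"
  unfolding A_def
 proof (rule csum_cong)
  fix \<sigma> and \<epsilon> :: "nat => real" assume *: "length \<sigma> = Suc m" "!!i. \<epsilon> i = 1 | \<epsilon> i = -1"
   "!!v. v \<in> set \<sigma> ==> EX i<Suc m. v = (%j. if j = i then \<epsilon> i else 0)"
  have "(sd b (Suc m) ^^ N) (cup' a m) \<sigma> = (sd b (Suc m) ^^ N) (%\<sigma>. 0) \<sigma>"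
  proof (rule cong[where \<epsilon>=\<epsilon>])
   fix \<tau> assume \<tau>: "length \<tau> = Suc m" "set \<tau> \<subseteq> ?X" "ALL x:set \<tau>. ALL y:set \<tau>. d x y <= \<delta>"
   have "cup a m \<tau> = 0"
   proof (rule ccontr)
    assume nz: "cup a m \<tau> ~= 0"
    obtain u where u: "u \<in> set \<tau>" using \<tau>(1) by (cases \<tau>) auto
    have "abs (F j u) < \<mu> / m" if j: "j < m" for j
    proof -
     obtain v w where vw: "v \<in> set \<tau>" "w \<in> set \<tau>" "a j v ~= a j w"
      using cup_nonzero[OF nz j] by blast
     have "\<bar>F j u - F j v\<bar> < \<mu> / m" "\<bar>F j u - F j w\<bar> < \<mu> / m"
      using \<delta>(2) \<tau>(2,3) u vw j by blast+
     moreover have "F j v <= 0 & 0 <= F j w | F j w <= 0 & 0 <= F j v"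
      using vw(3) j by (auto simp: a_def split: if_splits)
     ultimately show ?thesis by linarith
    qed
    then have "(\<Sum>j<m. abs (F j u)) < (\<Sum>j<m. \<mu> / m)"
     using m0 by (intro sum_strict_mono) auto
    moreover have "(\<Sum>j<m. \<mu> / m) = \<mu>" using m0 by simp
    ultimately show False using x0(2)[of u] u \<tau>(2) unfolding \<mu>_def by force
   qed
   then show "cup' a m \<tau> = 0" by (simp add: cup'_def)
  qed (use * in auto)
  then show "(sd b (Suc m) ^^ N) (cup' a m) \<sigma> = 0" by (simp only: sd_iter_zero)
 qed
 ultimately show False by (simp add: csum_zero del: csum.simps)
qed

section \<open>Powers and Lebesgue integrals of powers\<close>

lemma spow_zero [simp]: "spow r 0 = 0"
 by (simp add: spow_def)

lemma abs_spow: "abs (spow r s) = abs s powr (r - 1)"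
proof (cases "s = 0")
 case False
 then have "abs s powr (r - 2) * abs s = abs s powr (r - 2) * abs s powr 1" by simp
 also have "... = abs s powr (r - 1)" by (subst powr_add[symmetric]) simp
 finally show ?thesis by (simp add: spow_def abs_mult)
qed simp

lemma spow_mult_self: "spow r s * s = abs s powr r"
proof (cases "s = 0")
 case False
 have "spow r s * s = abs s powr (r - 2) * (abs s * abs s)" by (simp add: spow_def)
 also have "... = abs s powr (r - 2) * abs s powr 2" using False by (simp add: power2_eq_square)
 also have "... = abs s powr r" by (subst powr_add[symmetric]) simp
 finally show ?thesis .
qed simp

lemma spow_minus [simp]: "spow r (- s) = - spow r s"
 by (simp add: spow_def)

lemma spow_two [simp]: "spow 2 s = s"
 by (simp add: spow_def)

lemma spow_scale: "spow r (c * s) = spow r c * spow r s"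
 by (simp add: spow_def abs_mult powr_mult)

lemma spow_pos: "c > 0 ==> spow r c = c powr (r - 1)"
 using abs_spow[of r c] by (simp add: spow_def)

lemma powr_Young: "1 < r ==> \<bar>spow r b * c\<bar> <= (1 - 1 / r) * abs b powr r + abs c powr r / r"
 for r :: real
proof -
 assume r: "1 < r"
 have "abs b powr (r - 1) * abs c <= (abs b powr (r - 1)) powr (r / (r - 1)) / (r / (r - 1)) + abs c powr r / r"
  using r by (intro Youngs_inequality) (auto simp: field_simps)
 also have "(abs b powr (r - 1)) powr (r / (r - 1)) / (r / (r - 1)) = (1 - 1 / r) * abs b powr r"
 proof -
  have "(r - 1) * (r / (r - 1)) = r" using r by simp
  then show ?thesis using r by (simp add: powr_powr divide_simps)
 qed
 finally show ?thesis by (simp add: abs_mult abs_spow)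
qed

text \<open>Convexity of \<open>|\<cdot>|\<^sup>r\<close>, in the form of the tangent inequality.\<close>

lemma powr_tangent:
 assumes "1 < r"
 shows "abs b powr r + r * (spow r b * (a - b)) <= abs a powr r"
proof -
 have "spow r b * a <= (1 - 1 / r) * abs b powr r + abs a powr r / r"
  using powr_Young[OF assms, of b a] by linarith
 then have "r * (spow r b * a) <= r * ((1 - 1 / r) * abs b powr r + abs a powr r / r)"
  using assms by (intro mult_left_mono) auto
 also have "... = (r - 1) * abs b powr r + abs a powr r"
  using assms by (simp add: field_simps)
 finally have "r * (spow r b * a) <= (r - 1) * abs b powr r + abs a powr r" .
 moreover have "r * (spow r b * (a - b)) = r * (spow r b * a) - r * (spow r b * b)"
  by (simp add: algebra_simps)
 ultimately show ?thesis by (simp add: spow_mult_self left_diff_distrib)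
qed

text \<open>
 The weights may sum to less than \<open>1\<close> since the missing weight can be put on the value \<open>0\<close>.
\<close>

lemma powr_abs_convex:
 fixes c x :: "'i => real"
 assumes "1 < r" "finite A" "!!i. i \<in> A ==> 0 <= c i" "sum c A <= 1"
 shows "\<bar>\<Sum>i\<in>A. c i * x i\<bar> powr r <= (\<Sum>i\<in>A. c i * abs (x i) powr r)"
proof -
 let ?b = "\<Sum>i\<in>A. c i * x i"
 have lin: "(\<Sum>i\<in>A. c i * (B + r * (S * (x i - b)))) = sum c A * B + r * S * (\<Sum>i\<in>A. c i * x i) - sum c A * (r * (S * b))"
  for B S b :: real
  by (induction A rule: infinite_finite_induct) (simp_all add: algebra_simps)
 have "(\<Sum>i\<in>A. c i * (\<bar>?b\<bar> powr r + r * (spow r ?b * (x i - ?b)))) <= (\<Sum>i\<in>A. c i * abs (x i) powr r)"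
  using assms by (intro sum_mono mult_left_mono powr_tangent) auto
 also have "(\<Sum>i\<in>A. c i * (\<bar>?b\<bar> powr r + r * (spow r ?b * (x i - ?b))))
  = sum c A * (\<bar>?b\<bar> powr r) + r * spow r ?b * ?b - sum c A * (r * (spow r ?b * ?b))"
  unfolding lin by simp
 also have "... = (r - sum c A * (r - 1)) * \<bar>?b\<bar> powr r"
  by (simp only: mult.assoc spow_mult_self) (simp add: algebra_simps)
 finally have "(r - sum c A * (r - 1)) * \<bar>?b\<bar> powr r <= (\<Sum>i\<in>A. c i * abs (x i) powr r)" .
 moreover have "1 <= r - sum c A * (r - 1)"
 proof -
  have "sum c A * (r - 1) <= 1 * (r - 1)" using assms by (intro mult_right_mono) auto
  from diff_left_mono[OF this, of r] show ?thesis by simp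
 qed
 then have "1 * \<bar>?b\<bar> powr r <= (r - sum c A * (r - 1)) * \<bar>?b\<bar> powr r"
  by (rule mult_right_mono) simp
 ultimately show ?thesis by simp
qed

lemma powr_add_le:
 fixes a b r :: real
 assumes "1 < r"
 shows "\<bar>a + b\<bar> powr r <= 2 powr r * (abs a powr r + abs b powr r)"
proof -
 have "\<bar>a + b\<bar> <= 2 * max \<bar>a\<bar> \<bar>b\<bar>" by auto
 then have "\<bar>a + b\<bar> powr r <= (2 * max \<bar>a\<bar> \<bar>b\<bar>) powr r"
  using assms by (intro powr_mono2) auto
 also have "... = 2 powr r * (max \<bar>a\<bar> \<bar>b\<bar>) powr r" by (simp add: powr_mult)
 also have "(max \<bar>a\<bar> \<bar>b\<bar>) powr r <= abs a powr r + abs b powr r" by (simp add: max_def)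
 finally show ?thesis by simp
qed

lemma powr_diff_le:
 fixes a b r :: real
 assumes "1 < r"
 shows "\<bar>a - b\<bar> powr r <= 2 powr r * (abs a powr r + abs b powr r)"
 using powr_add_le[OF assms, of a "- b"] by simp

lemma powr_abs_DERIV:
 assumes "1 < r"
 shows "((%s. abs s powr r / r) has_real_derivative spow r s) (at s)"
proof -
 consider "s > 0" | "s < 0" | "s = 0" by linarith
 then show ?thesis
 proof cases
  case 1
  have "((%s. s powr r / r) has_real_derivative spow r s) (at s)"
   using 1 assms by (auto intro!: derivative_eq_intros simp: spow_pos)
  then show ?thesis
   by (rule has_field_derivative_transform_within_open[of _ _ _ "{0<..}"]) (use 1 in auto)
 next
  case 2
  have "((%s. (- s) powr r / r) has_real_derivative - spow r (- s)) (at s)"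
   using 2 assms by (auto intro!: derivative_eq_intros simp: spow_pos simp del: spow_minus)
  then have "((%s. (- s) powr r / r) has_real_derivative spow r s) (at s)" by simp
  then show ?thesis
   by (rule has_field_derivative_transform_within_open[of _ _ _ "{..<0}"]) (use 2 in auto)
 next
  case 3
  have "((%h. abs h powr r / r / h) \<longlongrightarrow> 0) (at 0)"
  proof (rule Lim_null_comparison)
   show "\<forall>\<^sub>F h in at 0. norm (abs h powr r / r / h) <= abs h powr (r - 1)"
   proof (rule eventually_at_filter[THEN iffD2], rule always_eventually, intro allI impI)
    fix h :: real assume h: "h ~= 0"
    have "norm (abs h powr r / r / h) = abs h powr (r - 1) / r"
     using h assms by (simp add: powr_diff abs_mult mult.commute)
    also have "... <= abs h powr (r - 1)" using assms by (simp add: divide_le_eq mult_le_cancel_left1)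
    finally show "norm (abs h powr r / r / h) <= abs h powr (r - 1)" .
   qed
   have "((%h::real. abs h powr (r - 1)) \<longlongrightarrow> \<bar>0\<bar> powr (r - 1)) (at 0)"
    using assms by (intro tendsto_intros) auto
   then show "((%h::real. abs h powr (r - 1)) \<longlongrightarrow> 0) (at 0)" by simp
  qed
  then show ?thesis using 3 assms by (simp add: DERIV_def)
 qed
qed

lemma continuous_on_spow: "1 < r ==> continuous_on A (spow r)"
proof -
 assume r: "1 < r"
 have "isCont (spow r) s" for s
 proof (cases "s = 0")
  case True
  have "(spow r \<longlongrightarrow> 0) (at 0)"
  proof (rule Lim_null_comparison)
   show "\<forall>\<^sub>F h in at 0. norm (spow r h) <= abs h powr (r - 1)"
    by (simp add: abs_spow)
   have "((%h::real. abs h powr (r - 1)) \<longlongrightarrow> \<bar>0\<bar> powr (r - 1)) (at 0)"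
    using r by (intro tendsto_intros) auto
   then show "((%h::real. abs h powr (r - 1)) \<longlongrightarrow> 0) (at 0)" by simp
  qed
  then show ?thesis using True by (simp add: isCont_def)
 next
  case False
  then show ?thesis unfolding spow_def by (intro continuous_intros) auto
 qed
 then show ?thesis by (simp add: continuous_at_imp_continuous_on)
qed

lemma borel_measurable_spow [measurable]: "spow r \<in> borel_measurable borel"
 unfolding spow_def by measurable

lemma powr_Young_eps:
 assumes "1 < r" "0 < e"
 shows "\<bar>spow r b * c\<bar> <= e * abs b powr r + e powr (1 - r) * abs c powr r"
proof (cases "abs c <= e * abs b")
 case True
 have "\<bar>spow r b * c\<bar> <= abs (spow r b) * (e * abs b)"
  using True by (auto simp: abs_mult intro!: mult_left_mono)
 also have "... = e * \<bar>spow r b * b\<bar>" by (simp add: abs_mult)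
 finally show ?thesis by (simp add: spow_mult_self add_increasing2)
next
 case False
 then have "abs b <= abs c / e" using assms by (simp add: field_simps)
 then have "abs b powr (r - 1) <= (abs c / e) powr (r - 1)"
  using assms by (intro powr_mono2) auto
 then have "\<bar>spow r b * c\<bar> <= (abs c / e) powr (r - 1) * abs c"
  by (simp add: abs_mult abs_spow mult_right_mono)
 also have "... = e powr (1 - r) * abs c powr r"
 proof (cases "c = 0")
  case False
  then show ?thesis using assms
   by (simp add: powr_divide powr_diff field_simps)
 qed simp
 finally show ?thesis using assms by (simp add: add_increasing)
qed

text \<open>
 The modulus of continuity of \<open>spow r\<close> enters all limit arguments in this form; since both sides are
 homogeneous of degree \<open>r\<close>, uniform continuity on a bounded set is enough.
\<close>

lemma spow_modulus:
 assumes r: "1 < r" and e: "0 < e"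
 obtains C where "C > 0"
  "!!a b c. \<bar>(spow r a - spow r b) * c\<bar> <= e * (abs a powr r + abs b powr r + abs c powr r) + C * \<bar>a - b\<bar> powr r"
proof -
 have "uniformly_continuous_on {-1..1} (spow r)"
  by (intro compact_uniformly_continuous continuous_on_spow r) simp
 then obtain d where d: "d > 0" "!!a b. a \<in> {-1..1} ==> b \<in> {-1..1} ==> \<bar>a - b\<bar> < d ==> \<bar>spow r a - spow r b\<bar> < e"
  using e unfolding uniformly_continuous_on_def dist_real_def by meson
 define C where "C = 2 / d powr r"
 have C: "C > 0" using d by (simp add: C_def)
 let ?L = "%a b c. \<bar>(spow r a - spow r b) * c\<bar>"
 let ?R = "%a b c. e * (abs a powr r + abs b powr r + abs c powr r) + C * \<bar>a - b\<bar> powr r"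
 have unit: "?L a b c <= ?R a b c" if "abs a <= 1" "abs b <= 1" "abs c <= 1" "abs a = 1 | abs b = 1 | abs c = 1" for a b c
 proof -
  have L: "?L a b c <= \<bar>spow r a - spow r b\<bar>"
   using that(3) by (simp add: abs_mult mult_left_le)
  show ?thesis
  proof (cases "\<bar>a - b\<bar> < d")
   case True
   have "?L a b c <= e"
    using L d(2)[of a b] True that(1,2) by (auto simp: abs_le_iff)
   moreover have "1 <= abs a powr r + abs b powr r + abs c powr r"
    using that(4) by (auto simp: add_increasing add_increasing2)
   then have "e * 1 <= e * (abs a powr r + abs b powr r + abs c powr r)"
    using e by (intro mult_left_mono) auto
   moreover have "0 <= C * \<bar>a - b\<bar> powr r" using C by simp
   ultimately show ?thesis by linarith
  next
   case False
   have "abs (spow r a) <= 1" "abs (spow r b) <= 1"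
    using that r by (auto simp: abs_spow intro!: powr_le1)
   then have "?L a b c <= 2" using L by linarith
   also have "2 = C * d powr r" using d by (simp add: C_def)
   also have "... <= C * \<bar>a - b\<bar> powr r"
    using False C r d by (intro mult_left_mono powr_mono2) auto
   finally show ?thesis using e by (simp add: add_increasing)
  qed
 qed
 have "?L a b c <= ?R a b c" for a b c
 proof (cases "a = 0 & b = 0 & c = 0")
  case False
  define M where "M = max \<bar>a\<bar> (max \<bar>b\<bar> \<bar>c\<bar>)"
  have M: "M > 0" "abs a <= M" "abs b <= M" "abs c <= M" "M = abs a | M = abs b | M = abs c"
   using False by (auto simp: M_def max_def)
  have sc: "spow r (M * t) = M powr (r - 1) * spow r t" for t
   using M by (simp add: spow_scale spow_pos)
  have MM: "M powr (r - 1) * M = M powr r" using M by (simp add: powr_diff)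
  have pw: "\<bar>M * t\<bar> powr r = M powr r * abs t powr r" for t
   using M by (simp add: abs_mult powr_mult)
  have L: "?L (M * x) (M * y) (M * z) = M powr r * ?L x y z" for x y z
  proof -
   have "(spow r (M * x) - spow r (M * y)) * (M * z) = (M powr (r - 1) * M) * ((spow r x - spow r y) * z)"
    by (simp add: sc algebra_simps)
   then show ?thesis by (simp only: MM abs_mult) simp
  qed
  have R: "?R (M * x) (M * y) (M * z) = M powr r * ?R x y z" for x y z
   by (simp only: pw right_diff_distrib[symmetric]) (simp add: algebra_simps)
  have u: "?L (a / M) (b / M) (c / M) <= ?R (a / M) (b / M) (c / M)"
   by (rule unit) (use M in auto)
  have "?L (M * (a / M)) (M * (b / M)) (M * (c / M)) <= ?R (M * (a / M)) (M * (b / M)) (M * (c / M))"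
   unfolding L R by (rule mult_left_mono[OF u]) simp
  moreover have "M * (a / M) = a" "M * (b / M) = b" "M * (c / M) = c" using M by auto
  ultimately show ?thesis by simp
 qed simp
 then show ?thesis using C that by blast
qed

lemma powr_modulus:
 fixes r e :: real
 assumes r: "1 < r" and e: "0 < e"
 obtains C :: real where "C > 0"
  "!!a b. \<bar>\<bar>a\<bar> powr r - abs b powr r\<bar> <= e * (abs a powr r + abs b powr r) + C * \<bar>a - b\<bar> powr r"
proof -
 have e3: "e / 3 > 0" using e by simp
 obtain C where C: "C > 0"
  "!!a b c. \<bar>(spow r a - spow r b) * c\<bar> <= (e/3) * (abs a powr r + abs b powr r + abs c powr r) + C * \<bar>a - b\<bar> powr r"
  using spow_modulus[OF r e3] by blast
 define K where "K = (e/3) powr (1 - r)"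
 have K: "K >= 0" by (simp add: K_def)
 show ?thesis
 proof (rule that[of "C + K"])
  fix a b
  have "abs a powr r - abs b powr r = (spow r a - spow r b) * a + spow r b * (a - b)"
   by (simp add: spow_mult_self[symmetric] algebra_simps)
  then have "\<bar>\<bar>a\<bar> powr r - abs b powr r\<bar> <= \<bar>(spow r a - spow r b) * a\<bar> + \<bar>spow r b * (a - b)\<bar>" by simp
  also have "... <= (e/3) * (abs a powr r + abs b powr r + abs a powr r) + C * \<bar>a - b\<bar> powr r
   + ((e/3) * abs b powr r + K * \<bar>a - b\<bar> powr r)"
   unfolding K_def by (intro add_mono C powr_Young_eps r e3)
  also have "... = e * (abs a powr r + abs b powr r) - (e/3) * (abs a powr r) - (e/3) * abs b powr r + (C + K) * \<bar>a - b\<bar> powr r"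
   by (simp add: algebra_simps)
  also have "... <= e * (abs a powr r + abs b powr r) + (C + K) * \<bar>a - b\<bar> powr r"
  proof -
   have "0 <= (e/3) * (abs a powr r)" "0 <= (e/3) * (abs b powr r)" using e by auto
   then show ?thesis by linarith
  qed
  finally show "\<bar>\<bar>a\<bar> powr r - abs b powr r\<bar> <= e * (abs a powr r + abs b powr r) + (C + K) * \<bar>a - b\<bar> powr r" .
 qed (use C K in linarith)
qed

text \<open>
 The step \<open>s0\<close> is independent of \<open>a\<close> and \<open>b\<close>. After integration this becomes a step length that is common to all
 functions.
\<close>

lemma powr_Taylor:
 fixes r e :: real
 assumes r: "1 < r" and e: "0 < e"
 obtains s0 where "0 < s0" "s0 <= 1"
  "!!a b s. 0 <= s ==> s <= s0 ==>
   \<bar>\<bar>a - s * b\<bar> powr r - abs a powr r + r * s * (spow r a * b)\<bar> <= s * (e * (abs a powr r + abs b powr r))"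
proof -
 define K where "K = 2 + 2 powr r"
 have K: "K > 0" unfolding K_def by (rule add_pos_nonneg) auto
 define e' where "e' = e / (2 * r * K)"
 have e': "e' > 0" using e r K by (simp add: e'_def)
 obtain C where C: "C > 0"
  "!!a b c. \<bar>(spow r a - spow r b) * c\<bar> <= e' * (abs a powr r + abs b powr r + abs c powr r) + C * \<bar>a - b\<bar> powr r"
  using spow_modulus[OF r e'] by blast
 define s0 where "s0 = min 1 ((e / (2 * r * C)) powr (1 / r))"
 have s0: "0 < s0" "s0 <= 1" using e r C by (auto simp: s0_def)
 have Cs: "C * s powr r <= e / (2 * r)" if "0 <= s" "s <= s0" for s
 proof -
  have "s powr r <= ((e / (2 * r * C)) powr (1 / r)) powr r"
   using that r by (intro powr_mono2) (auto simp: s0_def)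
  also have "... = e / (2 * r * C)" using r e C by (simp add: powr_powr)
  finally show ?thesis using C r by (simp add: field_simps)
 qed
 show ?thesis
 proof (rule that[OF s0])
  fix a b s :: real assume s: "0 <= s" "s <= s0"
  let ?T = "\<bar>a - s * b\<bar> powr r - abs a powr r + r * s * (spow r a * b)"
  let ?E = "abs a powr r + abs b powr r"
  have "0 <= ?T" using powr_tangent[OF r, of a "a - s * b"] by (simp add: algebra_simps)
  have sb: "\<bar>s * b\<bar> powr r = s powr r * abs b powr r" using s by (simp add: abs_mult powr_mult)
  have s1: "s powr r <= 1" using s s0 r by (intro powr_le1) auto
  have m: "\<bar>a - s * b\<bar> powr r <= 2 powr r * ?E"
  proof -
   have "\<bar>a - s * b\<bar> powr r <= 2 powr r * (abs a powr r + \<bar>s * b\<bar> powr r)" by (rule powr_diff_le[OF r])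
   also have "... <= 2 powr r * ?E"
    using s1 by (intro mult_left_mono add_left_mono) (auto simp: sb mult_right_le_one_le mult_left_le_one_le)
   finally show ?thesis .
  qed
  have "?T <= r * s * ((spow r a - spow r (a - s * b)) * b)"
   using powr_tangent[OF r, of "a - s * b" a] by (simp add: algebra_simps)
  also have "... <= r * s * \<bar>(spow r a - spow r (a - s * b)) * b\<bar>"
   using r s by (intro mult_left_mono) auto
  also have "... <= r * s * (e' * (abs a powr r + \<bar>a - s * b\<bar> powr r + abs b powr r) + C * \<bar>a - (a - s * b)\<bar> powr r)"
   using r s by (intro mult_left_mono C) auto
  also have "... <= r * s * (e' * (K * ?E) + e / (2 * r) * ?E)"
  proof (intro mult_left_mono add_mono)
   show "abs a powr r + \<bar>a - s * b\<bar> powr r + abs b powr r <= K * ?E"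
   proof -
    have "0 <= abs a powr r" "0 <= abs b powr r" by auto
    then show ?thesis using m unfolding K_def distrib_right distrib_left by linarith
   qed
   have "C * \<bar>a - (a - s * b)\<bar> powr r = C * s powr r * abs b powr r" by (simp add: sb)
   also have "... <= e / (2 * r) * abs b powr r" by (intro mult_right_mono Cs s) auto
   also have "... <= e / (2 * r) * ?E" using e r by (intro mult_left_mono) auto
   finally show "C * \<bar>a - (a - s * b)\<bar> powr r <= e / (2 * r) * ?E" .
  qed (use r s e' in auto)
  also have "... = s * (e * ?E)"
   using r K by (simp add: e'_def field_simps)
  finally show "\<bar>?T\<bar> <= s * (e * ?E)" using \<open>0 <= ?T\<close> by simp
 qed
qed

text \<open>
 Quantitative monotonicity for \<open>q \<ge> 2\<close>; it turns convergence of the equations into strong convergence.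
\<close>

lemma spow_monotone:
 assumes "2 <= q"
 shows "\<bar>a - b\<bar> powr q <= 2 powr (q - 1) * ((spow q a - spow q b) * (a - b))"
proof -
 have super: "x powr (q - 1) + y powr (q - 1) <= (x + y) powr (q - 1)" if "0 <= x" "0 <= y" for x y :: real
 proof (cases "x = 0 | y = 0")
  case False
  have e: "z powr (q - 1) = z * z powr (q - 2)" if "z > 0" for z :: real
   using that powr_add[of z 1 "q - 2"] by simp
  have "x * x powr (q - 2) + y * y powr (q - 2) <= x * (x + y) powr (q - 2) + y * (x + y) powr (q - 2)"
   using that assms by (intro add_mono mult_left_mono powr_mono2) auto
  then show ?thesis using False that by (simp add: e algebra_simps)
 qed auto
 have main: "(a - b) powr (q - 1) <= 2 powr (q - 1) * (spow q a - spow q b)" if "b <= a" for a b :: real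
 proof -
  have sp: "spow q z = z powr (q - 1)" if "0 <= z" for z
   using that spow_pos[of z q] by (cases "z = 0") auto
  have one: "x <= 2 powr (q - 1) * x" if "0 <= x" for x :: real
   using that assms mult_right_mono[of 1 "2 powr (q - 1)" x] by (simp add: ge_one_powr_ge_zero)
  consider "0 <= b" | "a <= 0" | "b < 0" "0 < a" by linarith
  then show ?thesis
  proof cases
   case 1
   have "(a - b) powr (q - 1) <= a powr (q - 1) - b powr (q - 1)"
    using super[of "a - b" b] 1 that by simp
   moreover have "... <= 2 powr (q - 1) * (a powr (q - 1) - b powr (q - 1))"
    using 1 that assms by (intro one) (simp add: powr_mono2)
   ultimately show ?thesis using 1 that by (simp add: sp)
  next
   case 2
   have "(a - b) powr (q - 1) <= (- b) powr (q - 1) - (- a) powr (q - 1)"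
    using super[of "a - b" "- a"] 2 that by simp
   moreover have "... <= 2 powr (q - 1) * ((- b) powr (q - 1) - (- a) powr (q - 1))"
    using 2 that assms by (intro one) (simp add: powr_mono2)
   moreover have "spow q a = - ((- a) powr (q - 1))" "spow q b = - ((- b) powr (q - 1))"
    using sp[of "- a"] sp[of "- b"] 2 that by simp_all
   ultimately show ?thesis by simp
  next
   case 3
   have "(a - b) powr (q - 1) <= (2 * max a (- b)) powr (q - 1)"
    using 3 assms by (intro powr_mono2) auto
   also have "... = 2 powr (q - 1) * max a (- b) powr (q - 1)" using 3 by (simp add: powr_mult)
   also have "... <= 2 powr (q - 1) * (a powr (q - 1) + (- b) powr (q - 1))"
    by (intro mult_left_mono) (auto simp: max_def)
   also have "a powr (q - 1) + (- b) powr (q - 1) = spow q a - spow q b"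
    using sp[of a] sp[of "- b"] 3 by simp
   finally show ?thesis .
  qed
 qed
 have main2: "(a - b) powr q <= 2 powr (q - 1) * ((spow q a - spow q b) * (a - b))" if "b <= a" for a b :: real
 proof (cases "a = b")
  case False
  have "(a - b) powr q = (a - b) powr (q - 1) * (a - b)"
   using False that powr_add[of "a - b" "q - 1" 1] by simp
  also have "... <= 2 powr (q - 1) * (spow q a - spow q b) * (a - b)"
   using main[OF that] that by (intro mult_right_mono) auto
  finally show ?thesis by (simp add: mult_ac)
 qed simp
 show ?thesis
 proof (cases "b <= a")
  case True
  then show ?thesis using main2[of b a] by simp
 next
  case False
  then show ?thesis using main2[of a b] by (simp add: algebra_simps)
 qed
qed

subsection \<open>Integrals\<close>

definition Lspace :: "'a measure => real => ('a => real) set" where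
 "Lspace M r = {u \<in> borel_measurable M. integrable M (%x. abs (u x) powr r)}"

definition pint :: "'a measure => real => ('a => real) => real" where
 "pint M r u = (LINT x|M. abs (u x) powr r)"

text \<open>
 The functional \<open>sint M r u\<close> is the derivative of \<open>pint M r / r\<close> at \<open>u\<close>.
\<close>

definition sint :: "'a measure => real => ('a => real) => ('a => real) => real" where
 "sint M r u v = (LINT x|M. spow r (u x) * v x)"

lemma pint_nonneg [simp]: "0 <= pint M r u"
 by (simp add: pint_def)

lemma LspaceD:
 assumes "u \<in> Lspace M r"
 shows "u \<in> borel_measurable M" "integrable M (%x. abs (u x) powr r)"
 using assms by (auto simp: Lspace_def)

lemma Lspace_bound:
 assumes "u \<in> borel_measurable M" "integrable M g" "!!x. abs (u x) powr r <= g x"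
 shows "u \<in> Lspace M r"
proof -
 have [measurable]: "u \<in> borel_measurable M" by fact
 have "integrable M (%x. abs (u x) powr r)"
  by (rule Bochner_Integration.integrable_bound[OF assms(2)])
   (use assms(3) in \<open>auto intro: order_trans[OF _ abs_ge_self]\<close>)
 then show ?thesis using assms by (simp add: Lspace_def)
qed

lemma Lspace_add:
 assumes "1 < r" "u \<in> Lspace M r" "v \<in> Lspace M r"
 shows "(%x. u x + v x) \<in> Lspace M r"
 by (rule Lspace_bound[where g="%x. 2 powr r * (abs (u x) powr r + abs (v x) powr r)"])
  (use assms LspaceD[OF assms(2)] LspaceD[OF assms(3)] powr_add_le[OF assms(1)] in auto)

lemma Lspace_cmult:
 assumes "u \<in> Lspace M r"
 shows "(%x. c * u x) \<in> Lspace M r"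
 by (rule Lspace_bound[where g="%x. abs c powr r * abs (u x) powr r"])
  (use LspaceD[OF assms] in \<open>auto simp: abs_mult powr_mult\<close>)

lemma Lspace_diff:
 assumes "1 < r" "u \<in> Lspace M r" "v \<in> Lspace M r"
 shows "(%x. u x - v x) \<in> Lspace M r"
 using Lspace_add[OF assms(1,2) Lspace_cmult[OF assms(3), of "-1"]] by simp

lemma Lspace_zero [simp]: "(%x. 0) \<in> Lspace M r"
 by (simp add: Lspace_def)

lemma Lspace_sum:
 assumes "1 < r" "!!i. i \<in> A ==> u i \<in> Lspace M r"
 shows "(%x. \<Sum>i\<in>A. u i x) \<in> Lspace M r"
 using assms by (induction A rule: infinite_finite_induct) (auto intro: Lspace_add)

lemma pint_cmult: "pint M r (%x. c * u x) = abs c powr r * pint M r u"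
 by (simp add: pint_def abs_mult powr_mult)

lemma integrable_spow_mult:
 assumes r: "1 < r" and u: "u \<in> Lspace M r" and v: "v \<in> Lspace M r"
 shows "integrable M (%x. spow r (u x) * v x)"
proof (rule Bochner_Integration.integrable_bound)
 have [measurable]: "u \<in> borel_measurable M" "v \<in> borel_measurable M"
  using u v by (auto dest: LspaceD)
 show "integrable M (%x. 1 * abs (u x) powr r + 1 powr (1 - r) * abs (v x) powr r)"
  using u v by (auto dest: LspaceD)
 show "(%x. spow r (u x) * v x) \<in> borel_measurable M" by measurable
 show "AE x in M. norm (spow r (u x) * v x) <= norm (1 * abs (u x) powr r + 1 powr (1 - r) * abs (v x) powr r)"
  using powr_Young_eps[OF r, of 1] by (auto intro!: AE_I2 order_trans[OF _ abs_ge_self])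
qed

lemma sint_Young:
 assumes r: "1 < r" and u: "u \<in> Lspace M r" and v: "v \<in> Lspace M r" and e: "0 < e"
 shows "abs (sint M r u v) <= e * pint M r u + e powr (1 - r) * pint M r v"
proof -
 have "abs (sint M r u v) <= (LINT x|M. \<bar>spow r (u x) * v x\<bar>)"
  unfolding sint_def by (rule integral_abs_bound)
 also have "... <= (LINT x|M. e * abs (u x) powr r + e powr (1 - r) * abs (v x) powr r)"
  using integrable_spow_mult[OF r u v] LspaceD[OF u] LspaceD[OF v] powr_Young_eps[OF r e]
  by (intro integral_mono) auto
 also have "... = e * pint M r u + e powr (1 - r) * pint M r v"
  using LspaceD[OF u] LspaceD[OF v] by (simp add: pint_def)
 finally show ?thesis .
qed

lemma sint_modulus:
 assumes r: "1 < r" and e: "0 < e"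
 shows "EX C>0. ALL u:Lspace M r. ALL v:Lspace M r. ALL w:Lspace M r.
   \<bar>sint M r u w - sint M r v w\<bar> <= e * (pint M r u + pint M r v + pint M r w) + C * pint M r (%x. u x - v x)"
proof -
 obtain C where C: "C > 0"
  "!!a b c. \<bar>(spow r a - spow r b) * c\<bar> <= e * (abs a powr r + abs b powr r + abs c powr r) + C * \<bar>a - b\<bar> powr r"
  using spow_modulus[OF r e] by blast
 show ?thesis
 proof (intro exI[of _ C] conjI ballI)
  fix u v w assume uvw: "u \<in> Lspace M r" "v \<in> Lspace M r" "w \<in> Lspace M r"
  have i: "integrable M (%x. spow r (u x) * w x)" "integrable M (%x. spow r (v x) * w x)"
   using uvw r by (auto intro: integrable_spow_mult)
  have j: "integrable M (%x. abs (u x) powr r)" "integrable M (%x. abs (v x) powr r)"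
   "integrable M (%x. abs (w x) powr r)" "integrable M (%x. \<bar>u x - v x\<bar> powr r)"
   using uvw Lspace_diff[OF r uvw(1,2)] by (auto dest: LspaceD)
  have eq: "sint M r u w - sint M r v w = (LINT x|M. (spow r (u x) - spow r (v x)) * w x)"
   using i by (simp add: sint_def left_diff_distrib)
  have "\<bar>sint M r u w - sint M r v w\<bar> <= (LINT x|M. \<bar>(spow r (u x) - spow r (v x)) * w x\<bar>)"
   unfolding eq by (rule integral_abs_bound)
  also have "... <= (LINT x|M. e * (abs (u x) powr r + abs (v x) powr r + abs (w x) powr r) + C * \<bar>u x - v x\<bar> powr r)"
   using i j C(2) by (intro integral_mono) (auto simp: left_diff_distrib)
  also have "... = e * (pint M r u + pint M r v + pint M r w) + C * pint M r (%x. u x - v x)"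
   using j by (simp add: pint_def)
  finally show "\<bar>sint M r u w - sint M r v w\<bar>
   <= e * (pint M r u + pint M r v + pint M r w) + C * pint M r (%x. u x - v x)" .
 qed (use C in auto)
qed

lemma pint_modulus:
 assumes r: "1 < r" and e: "0 < e"
 shows "EX C>0. ALL u:Lspace M r. ALL v:Lspace M r.
   \<bar>pint M r u - pint M r v\<bar> <= e * (pint M r u + pint M r v) + C * pint M r (%x. u x - v x)"
proof -
 obtain C where C: "C > 0"
  "!!a b. \<bar>\<bar>a\<bar> powr r - abs b powr r\<bar> <= e * (abs a powr r + abs b powr r) + C * \<bar>a - b\<bar> powr r"
  using powr_modulus[OF r e] by blast
 show ?thesis
 proof (intro exI[of _ C] conjI ballI)
  fix u v assume uv: "u \<in> Lspace M r" "v \<in> Lspace M r"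
  have j: "integrable M (%x. abs (u x) powr r)" "integrable M (%x. abs (v x) powr r)"
   "integrable M (%x. \<bar>u x - v x\<bar> powr r)"
   using uv Lspace_diff[OF r uv] by (auto dest: LspaceD)
  have eq: "pint M r u - pint M r v = (LINT x|M. abs (u x) powr r - abs (v x) powr r)"
   using j by (simp add: pint_def)
  have "\<bar>pint M r u - pint M r v\<bar> <= (LINT x|M. \<bar>\<bar>u x\<bar> powr r - abs (v x) powr r\<bar>)"
   unfolding eq by (rule integral_abs_bound)
  also have "... <= (LINT x|M. e * (abs (u x) powr r + abs (v x) powr r) + C * \<bar>u x - v x\<bar> powr r)"
   using j C(2) by (intro integral_mono) auto
  also have "... = e * (pint M r u + pint M r v) + C * pint M r (%x. u x - v x)"
   using j by (simp add: pint_def)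
  finally show "\<bar>pint M r u - pint M r v\<bar> <= e * (pint M r u + pint M r v) + C * pint M r (%x. u x - v x)" .
 qed (use C in auto)
qed

lemma pint_Taylor:
 assumes r: "1 < r" and e: "0 < e"
 shows "EX s0>0. ALL u:Lspace M r. ALL w:Lspace M r. ALL s. 0 <= s --> s <= s0 -->
   \<bar>pint M r (%x. u x - s * w x) - pint M r u + r * s * sint M r u w\<bar> <= s * (e * (pint M r u + pint M r w))"
proof -
 obtain s0 where s0: "0 < s0" "s0 <= 1"
  "!!a b s. 0 <= s ==> s <= s0 ==>
   \<bar>\<bar>a - s * b\<bar> powr r - abs a powr r + r * s * (spow r a * b)\<bar> <= s * (e * (abs a powr r + abs b powr r))"
  using powr_Taylor[OF r e] by blast
 show ?thesis
 proof (intro exI[of _ s0] conjI ballI allI impI)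
  fix u w s assume uw: "u \<in> Lspace M r" "w \<in> Lspace M r" and s: "0 <= s" "s <= s0"
  have j: "integrable M (%x. abs (u x) powr r)" "integrable M (%x. abs (w x) powr r)"
   "integrable M (%x. \<bar>u x - s * w x\<bar> powr r)" "integrable M (%x. spow r (u x) * w x)"
   using uw Lspace_diff[OF r uw(1) Lspace_cmult[OF uw(2)], of s] integrable_spow_mult[OF r uw]
   by (auto dest: LspaceD)
  have eq: "pint M r (%x. u x - s * w x) - pint M r u + r * s * sint M r u w
   = (LINT x|M. \<bar>u x - s * w x\<bar> powr r - abs (u x) powr r + r * s * (spow r (u x) * w x))"
   using j by (simp add: pint_def sint_def)
  have "\<bar>pint M r (%x. u x - s * w x) - pint M r u + r * s * sint M r u w\<bar> <= (LINT x|M. \<bar>\<bar>u x - s * w x\<bar> powr r - abs (u x) powr r + r * s * (spow r (u x) * w x)\<bar>)"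
   unfolding eq by (rule integral_abs_bound)
  also have "... <= (LINT x|M. s * (e * (abs (u x) powr r + abs (w x) powr r)))"
  proof (rule integral_mono)
   show "integrable M (%x. \<bar>\<bar>u x - s * w x\<bar> powr r - abs (u x) powr r + r * s * (spow r (u x) * w x)\<bar>)"
    by (intro integrable_abs Bochner_Integration.integrable_add Bochner_Integration.integrable_diff
      integrable_mult_right j)
   show "integrable M (%x. s * (e * (abs (u x) powr r + abs (w x) powr r)))"
    by (intro integrable_mult_right Bochner_Integration.integrable_add j)
  qed (rule s0(3)[OF s])
  also have "... = s * (e * (pint M r u + pint M r w))"
   using j by (simp add: pint_def)
  finally show "\<bar>pint M r (%x. u x - s * w x) - pint M r u + r * s * sint M r u w\<bar>
   <= s * (e * (pint M r u + pint M r w))" .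
 qed (use s0 in auto)
qed

lemma sint_uminus_left: "sint M r (%x. - u x) v = - sint M r u v"
 by (simp add: sint_def)

lemma sint_self: "sint M r u u = pint M r u"
 by (simp add: sint_def pint_def spow_mult_self)

lemma pint_monotone:
 assumes q: "2 <= q" and u: "u \<in> Lspace M q" and v: "v \<in> Lspace M q"
 shows "pint M q (%x. u x - v x)
  <= 2 powr (q - 1) * (sint M q u (%x. u x - v x) - sint M q v (%x. u x - v x))"
proof -
 have q1: "1 < q" using q by simp
 note d = Lspace_diff[OF q1 u v]
 have i: "integrable M (%x. spow q (u x) * (u x - v x))" "integrable M (%x. spow q (v x) * (u x - v x))"
  using integrable_spow_mult[OF q1 u d] integrable_spow_mult[OF q1 v d] by auto
 have "pint M q (%x. u x - v x) <= (LINT x|M. 2 powr (q - 1) * ((spow q (u x) - spow q (v x)) * (u x - v x)))"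
  unfolding pint_def using i LspaceD[OF d] spow_monotone[OF q]
  by (intro integral_mono) (auto simp: left_diff_distrib)
 then show ?thesis using i by (simp add: sint_def left_diff_distrib)
qed

lemma pint_convex:
 fixes c :: "'i => real"
 assumes r: "1 < r" and A: "finite A" "!!i. i \<in> A ==> 0 <= c i" "sum c A <= 1"
  and u: "!!i. i \<in> A ==> u i \<in> Lspace M r"
 shows "pint M r (%x. \<Sum>i\<in>A. c i * u i x) <= (\<Sum>i\<in>A. c i * pint M r (u i))"
proof -
 have "pint M r (%x. \<Sum>i\<in>A. c i * u i x) <= (LINT x|M. (\<Sum>i\<in>A. c i * abs (u i x) powr r))"
  unfolding pint_def
  using LspaceD[OF u] LspaceD(2)[OF Lspace_sum[OF r, of A "%i x. c i * u i x" M]] Lspace_cmult[OF u]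
   powr_abs_convex[OF r A]
  by (intro integral_mono) auto
 also have "... = (\<Sum>i\<in>A. c i * pint M r (u i))"
  using LspaceD[OF u] by (simp add: pint_def)
 finally show ?thesis .
qed

text \<open>Completeness: an \<open>L\<^sup>r\<close>-Cauchy sequence that converges almost everywhere converges in \<open>L\<^sup>r\<close>.\<close>

lemma pint_Cauchy_limit:
 assumes r: "1 < r" and u: "!!n. u n \<in> Lspace M r" and [measurable]: "w \<in> borel_measurable M"
  and ae: "AE x in M. (%n. u n x) ----> w x"
  and cau: "!!e. 0 < e ==> EX N. ALL m>=N. ALL n>=N. pint M r (%x. u m x - u n x) < e"
 shows "w \<in> Lspace M r" "(%n. pint M r (%x. u n x - w x)) ----> 0"
proof -
 have [measurable]: "u n \<in> borel_measurable M" for n using u by (auto dest: LspaceD)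
 have key: "(\<integral>\<^sup>+x. ennreal (\<bar>u m x - w x\<bar> powr r) \<partial>M) <= ennreal e"
  if N: "ALL m>=N. ALL n>=N. pint M r (%x. u m x - u n x) < e" and m: "m >= N" for e N m
 proof -
  have "(\<integral>\<^sup>+x. ennreal (\<bar>u m x - w x\<bar> powr r) \<partial>M)
   = (\<integral>\<^sup>+x. liminf (%n. ennreal (\<bar>u m x - u n x\<bar> powr r)) \<partial>M)"
  proof (rule nn_integral_cong_AE)
   show "AE x in M. ennreal (\<bar>u m x - w x\<bar> powr r) = liminf (%n. ennreal (\<bar>u m x - u n x\<bar> powr r))"
    using ae
   proof eventually_elim
    case (elim x)
    have "(%n. ennreal (\<bar>u m x - u n x\<bar> powr r)) ----> ennreal (\<bar>u m x - w x\<bar> powr r)"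
     using elim r by (intro tendsto_intros) auto
    then show ?case using lim_imp_Liminf[OF sequentially_bot] by metis
   qed
  qed
  also have "... <= liminf (%n. \<integral>\<^sup>+x. ennreal (\<bar>u m x - u n x\<bar> powr r) \<partial>M)"
   by (rule nn_integral_liminf) measurable
  also have "... <= ennreal e"
  proof (rule Liminf_le)
   show "\<forall>\<^sub>F n in sequentially. (\<integral>\<^sup>+x. ennreal (\<bar>u m x - u n x\<bar> powr r) \<partial>M) <= ennreal e"
    unfolding eventually_sequentially
   proof (intro exI[of _ N] allI impI)
    fix n assume n: "N <= n"
    have "(\<integral>\<^sup>+x. ennreal (\<bar>u m x - u n x\<bar> powr r) \<partial>M) = ennreal (pint M r (%x. u m x - u n x))"
     unfolding pint_def using LspaceD[OF Lspace_diff[OF r u u]]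
     by (intro nn_integral_eq_integral) auto
    then show "(\<integral>\<^sup>+x. ennreal (\<bar>u m x - u n x\<bar> powr r) \<partial>M) <= ennreal e"
     using N m n by (simp add: ennreal_leI less_imp_le)
   qed
  qed simp
  finally show ?thesis .
 qed
 have dif: "(%x. u m x - w x) \<in> Lspace M r & pint M r (%x. u m x - w x) <= e"
  if "ALL m>=N. ALL n>=N. pint M r (%x. u m x - u n x) < e" "m >= N" for e N m
 proof -
  note k = key[OF that]
  have e: "0 <= e" using that by (metis less_imp_le order_refl order_trans pint_nonneg)
  have i: "integrable M (%x. \<bar>u m x - w x\<bar> powr r)"
   using k by (intro integrableI_bounded) (auto intro: le_less_trans)
  have "ennreal (pint M r (%x. u m x - w x)) <= ennreal e"
   using k unfolding pint_def by (subst (asm) nn_integral_eq_integral[OF i]) auto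
  then show ?thesis using i e by (simp add: Lspace_def)
 qed
 obtain N where N: "ALL m>=N. ALL n>=N. pint M r (%x. u m x - u n x) < 1" using cau[of 1] by auto
 from Lspace_diff[OF r u[of N] conjunct1[OF dif[OF N order_refl]]] show "w \<in> Lspace M r" by simp
 show "(%n. pint M r (%x. u n x - w x)) ----> 0"
 proof (rule LIMSEQ_I)
  fix e :: real assume "0 < e"
  then obtain N where N: "ALL m>=N. ALL n>=N. pint M r (%x. u m x - u n x) < e / 2"
   using cau[of "e/2"] by auto
  have "norm (pint M r (%x. u n x - w x) - 0) < e" if "n >= N" for n
   using dif[OF N that] \<open>0 < e\<close> by simp
  then show "EX no. ALL n>=no. norm (pint M r (%x. u n x - w x) - 0) < e" by blast
 qed
qed

text \<open>Convergence in \<open>L\<^sup>r\<close> carries the two integrals along.\<close>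

lemma pint_sint_limit:
 assumes r: "1 < r" and u: "!!n. u n \<in> Lspace M r" and w: "w \<in> Lspace M r"
  and lim: "(%n. pint M r (%x. u n x - w x)) ----> 0"
 shows "(%n. pint M r (u n)) ----> pint M r w"
  and "v \<in> Lspace M r ==> (%n. sint M r (u n) v) ----> sint M r w v"
proof -
 have "Bseq (%n. pint M r (%x. u n x - w x))"
  using lim by (intro convergent_imp_Bseq) (auto simp: convergent_def)
 then obtain K where K: "!!n. pint M r (%x. u n x - w x) <= K" "K > 0"
  unfolding Bseq_def by (auto simp: abs_le_iff)
 define B where "B = 2 powr r * (K + pint M r w)"
 have B: "pint M r (u n) <= B" for n
 proof -
  note d = Lspace_diff[OF r u[of n] w]
  have "pint M r (u n) <= (LINT x|M. 2 powr r * (\<bar>u n x - w x\<bar> powr r + abs (w x) powr r))"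
   unfolding pint_def using LspaceD[OF d] LspaceD[OF w] LspaceD[OF u[of n]]
    powr_add_le[OF r, of "u n x - w x" "w x" for x]
   by (intro integral_mono) auto
  also have "... = 2 powr r * (pint M r (%x. u n x - w x) + pint M r w)"
   using LspaceD[OF d] LspaceD[OF w] by (simp add: pint_def)
  also have "... <= B" unfolding B_def using K(1)[of n] by (intro mult_left_mono) auto
  finally show ?thesis .
 qed
 have B0: "0 <= B" using B[of 0] pint_nonneg order_trans by blast
 show "(%n. pint M r (u n)) ----> pint M r w"
 proof (rule LIMSEQ_I)
  fix e :: real assume e: "0 < e"
  define e' where "e' = e / (2 * (B + pint M r w + 1))"
  have den: "B + pint M r w + 1 > 0" using B0 pint_nonneg[of M r w] by linarith
  have e': "e' > 0" using e den by (simp add: e'_def)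
  obtain C where C: "C > 0" "!!u v. u \<in> Lspace M r ==> v \<in> Lspace M r ==>
   \<bar>pint M r u - pint M r v\<bar> <= e' * (pint M r u + pint M r v) + C * pint M r (%x. u x - v x)"
   using pint_modulus[OF r e', of M] by blast
  obtain N where N: "!!n. n >= N ==> norm (pint M r (%x. u n x - w x) - 0) < e / (2 * C)"
   using LIMSEQ_D[OF lim, of "e / (2*C)"] e C(1) by auto
  have "norm (pint M r (u n) - pint M r w) < e" if "n >= N" for n
  proof -
   have "\<bar>pint M r (u n) - pint M r w\<bar> <= e' * (pint M r (u n) + pint M r w) + C * pint M r (%x. u n x - w x)"
    by (rule C(2)[OF u w])
   also have "e' * (pint M r (u n) + pint M r w) <= e' * (B + pint M r w + 1)"
    using B[of n] e' by (intro mult_left_mono) auto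
   also have "... = e / 2" using den unfolding e'_def by (simp only: times_divide_eq_left times_divide_eq_right nonzero_divide_mult_cancel_right mult_divide_mult_cancel_right)
   also have "C * pint M r (%x. u n x - w x) < e / 2"
    using N[OF that] C(1) by (simp add: field_simps)
   finally show ?thesis by simp
  qed
  then show "EX no. ALL n>=no. norm (pint M r (u n) - pint M r w) < e" by blast
 qed
 show "(%n. sint M r (u n) v) ----> sint M r w v" if v: "v \<in> Lspace M r"
 proof (rule LIMSEQ_I)
  fix e :: real assume e: "0 < e"
  define D where "D = B + pint M r w + pint M r v + 1"
  define e' where "e' = e / (2 * D)"
  have den: "D > 0" using B0 pint_nonneg[of M r w] pint_nonneg[of M r v] unfolding D_def by linarith
  have e': "e' > 0" using e den by (simp add: e'_def)
  obtain C where C: "C > 0" "!!u w v. u \<in> Lspace M r ==> w \<in> Lspace M r ==> v \<in> Lspace M r ==>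
   \<bar>sint M r u v - sint M r w v\<bar> <= e' * (pint M r u + pint M r w + pint M r v) + C * pint M r (%x. u x - w x)"
   using sint_modulus[OF r e', of M] by blast
  obtain N where N: "!!n. n >= N ==> norm (pint M r (%x. u n x - w x) - 0) < e / (2 * C)"
   using LIMSEQ_D[OF lim, of "e / (2*C)"] e C(1) by auto
  have "norm (sint M r (u n) v - sint M r w v) < e" if "n >= N" for n
  proof -
   have "\<bar>sint M r (u n) v - sint M r w v\<bar>
    <= e' * (pint M r (u n) + pint M r w + pint M r v) + C * pint M r (%x. u n x - w x)"
    by (rule C(2)[OF u w v])
   also have "e' * (pint M r (u n) + pint M r w + pint M r v) <= e' * D"
    using B[of n] e' unfolding D_def by (intro mult_left_mono) auto
   also have "... = e / 2" using den unfolding e'_def by (simp only: times_divide_eq_left times_divide_eq_right nonzero_divide_mult_cancel_right mult_divide_mult_cancel_right)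
   also have "C * pint M r (%x. u n x - w x) < e / 2"
    using N[OF that] C(1) by (simp add: field_simps)
   finally show ?thesis by simp
  qed
  then show "EX no. ALL n>=no. norm (sint M r (u n) v - sint M r w v) < e" by blast
 qed
qed

section \<open>Test functions and weak gradients\<close>

lemma frechet_derivative_worksI:
 "f differentiable net ==> (f has_derivative frechet_derivative f net) net"
 by (simp add: frechet_derivative_works)

lemma partial_deriv_eq:
 "(v has_derivative v') (at x) ==> partial_deriv i v x = v' (axis i 1)"
 by (metis partial_deriv_def frechet_derivative_at)

lemma C_class_diff: "C_class (Suc k) v ==> v differentiable at x"
 by (simp add: differentiable_on_def)

lemma partial_deriv_add:
 "u differentiable at x ==> v differentiable at x ==>
  partial_deriv i (%x. u x + v x) x = partial_deriv i u x + partial_deriv i v x"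
 by (subst partial_deriv_eq[OF has_derivative_add[OF frechet_derivative_worksI frechet_derivative_worksI]])
  (auto simp: partial_deriv_def)

lemma partial_deriv_cmult:
 "u differentiable at x ==> partial_deriv i (%x. c * u x) x = c * partial_deriv i u x"
 by (subst partial_deriv_eq[OF has_derivative_mult_right[OF frechet_derivative_worksI]])
  (auto simp: partial_deriv_def)

lemma dilation_derivative:
 assumes "u differentiable at (t *\<^sub>R x)"
 shows "((%x. u (t *\<^sub>R x)) has_derivative (%h. frechet_derivative u (at (t *\<^sub>R x)) (t *\<^sub>R h))) (at x)"
proof -
 have "((%x. t *\<^sub>R x) has_derivative (%h. t *\<^sub>R h)) (at x)"
  by (auto intro!: derivative_eq_intros)
 from diff_chain_at[OF this frechet_derivative_worksI[OF assms]] show ?thesis by (simp add: o_def)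
qed

lemma partial_deriv_dilation:
 assumes "u differentiable at (t *\<^sub>R x)"
 shows "partial_deriv i (%x. u (t *\<^sub>R x)) x = t * partial_deriv i u (t *\<^sub>R x)"
proof -
 have "linear (frechet_derivative u (at (t *\<^sub>R x)))"
  using frechet_derivative_worksI[OF assms] has_derivative_linear by blast
 then show ?thesis
  by (subst partial_deriv_eq[OF dilation_derivative[OF assms]]) (simp add: linear_cmul partial_deriv_def)
qed

lemma C_class_add: "C_class k u ==> C_class k v ==> C_class k (%x. u x + v x)"
proof (induction k arbitrary: u v)
 case 0
 then show ?case by (auto intro: continuous_intros)
next
 case (Suc k)
 have "partial_deriv i (%x. u x + v x) = (%x. partial_deriv i u x + partial_deriv i v x)" for i
  using Suc.prems by (auto intro!: ext partial_deriv_add C_class_diff simp del: C_class.simps)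
 with Suc show ?case by (auto intro: differentiable_on_add)
qed

lemma C_class_cmult: "C_class k u ==> C_class k (%x. c * u x)"
proof (induction k arbitrary: u)
 case 0
 then show ?case by (auto intro: continuous_intros)
next
 case (Suc k)
 have "partial_deriv i (%x. c * u x) = (%x. c * partial_deriv i u x)" for i
  using Suc.prems by (auto intro!: ext partial_deriv_cmult C_class_diff simp del: C_class.simps)
 with Suc show ?case by (auto intro: differentiable_on_mult differentiable_on_const)
qed

lemma C_class_dilation: "C_class k u ==> C_class k (%x. u (t *\<^sub>R x))"
proof (induction k arbitrary: u)
 case 0
 then have "continuous_on UNIV u" by simp
 from continuous_on_compose2[OF this, of UNIV "%x. t *\<^sub>R x"] show ?case
  by (simp add: continuous_intros)
next
 case (Suc k)
 have d: "u differentiable at x" for x using C_class_diff[OF Suc.prems] .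
 have "partial_deriv i (%x. u (t *\<^sub>R x)) = (%x. t * partial_deriv i u (t *\<^sub>R x))" for i
  using d by (intro ext partial_deriv_dilation)
 moreover have "(%x. u (t *\<^sub>R x)) differentiable at x" for x
  using dilation_derivative[OF d] unfolding differentiable_def by blast
 ultimately show ?case using Suc by (auto intro: C_class_cmult simp: differentiable_on_def)
qed

lemma test_functions_iff:
 "v \<in> test_functions \<longleftrightarrow> (ALL k. C_class k v) & bounded {x. v x ~= 0}"
 by (simp add: test_functions_def compact_closure)

lemma tf_add:
 assumes "u \<in> test_functions" "v \<in> test_functions"
 shows "(%x. u x + v x) \<in> test_functions"
proof -
 have "bounded ({x. u x ~= 0} \<union> {x. v x ~= 0})"
  using assms by (simp add: test_functions_iff)
 then have "bounded {x. u x + v x ~= 0}" by (rule bounded_subset) auto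
 then show ?thesis using assms by (simp add: test_functions_iff C_class_add)
qed

lemma tf_cmult: "u \<in> test_functions ==> (%x. c * u x) \<in> test_functions"
 by (auto simp: test_functions_iff intro: C_class_cmult elim: bounded_subset)

lemma tf_diff:
 assumes "u \<in> test_functions" "v \<in> test_functions"
 shows "(%x. u x - v x) \<in> test_functions"
 using tf_add[OF assms(1) tf_cmult[OF assms(2), of "-1"]] by simp

lemma partial_deriv_const: "partial_deriv i (%x. c) = (%x. 0)"
 by (rule ext) (simp add: partial_deriv_eq[OF has_derivative_const])

lemma C_class_const: "C_class k (%x. c)"
proof (induction k arbitrary: c)
 case (Suc k)
 then show ?case by (simp add: differentiable_on_const partial_deriv_const)
qed (simp add: continuous_on_const)

lemma tf_zero: "(%x. 0) \<in> test_functions"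
 by (simp add: test_functions_iff C_class_const)

lemma tf_sum: "(!!i. i \<in> A ==> u i \<in> test_functions) ==> (%x. \<Sum>i\<in>A. u i x) \<in> test_functions"
 by (induction A rule: infinite_finite_induct) (auto intro: tf_add tf_zero)

lemma tf_dilation:
 assumes u: "u \<in> test_functions" and t: "t ~= 0"
 shows "(%x. c * u (t *\<^sub>R x)) \<in> test_functions"
proof -
 have "{x. u (t *\<^sub>R x) ~= 0} \<subseteq> (%x. (1/t) *\<^sub>R x) ` {x. u x ~= 0}"
 proof
  fix x assume "x \<in> {x. u (t *\<^sub>R x) ~= 0}"
  then show "x \<in> (%x. (1/t) *\<^sub>R x) ` {x. u x ~= 0}"
   using t by (intro image_eqI[of _ _ "t *\<^sub>R x"]) auto
 qed
 moreover have "bounded ((%x. (1/t) *\<^sub>R x) ` {x. u x ~= 0})"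
  using u by (intro bounded_scaling) (simp add: test_functions_iff)
 ultimately have "bounded {x. u (t *\<^sub>R x) ~= 0}" by (rule bounded_subset[rotated])
 then have "(%x. u (t *\<^sub>R x)) \<in> test_functions"
  using u C_class_dilation by (auto simp: test_functions_iff)
 then show ?thesis by (rule tf_cmult)
qed

lemma tf_differentiable: "u \<in> test_functions ==> u differentiable at x"
 using C_class_diff[of 0] by (auto simp: test_functions_iff simp del: C_class.simps)

lemma tf_C: "u \<in> test_functions ==> C_class k u"
 by (simp add: test_functions_iff)

lemma tf_partial:
 assumes u: "u \<in> test_functions"
 shows "partial_deriv i u \<in> test_functions"
proof -
 have "C_class k (partial_deriv i u)" for k
  using tf_C[OF u, of "Suc k"] by simp
 moreover have "{x. partial_deriv i u x ~= 0} \<subseteq> closure {x. u x ~= 0}"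
 proof (rule ccontr)
  assume "~ ?thesis"
  then obtain x where x: "partial_deriv i u x ~= 0" "x \<notin> closure {x. u x ~= 0}" by blast
  have "((%x. 0) has_derivative (%h. 0)) (at x)" by simp
  then have "(u has_derivative (%h. 0)) (at x)"
  proof (rule has_derivative_transform_within_open)
   show "open (- closure {x. u x ~= 0})" by auto
   show "x \<in> - closure {x. u x ~= 0}" using x by simp
   show "0 = u y" if "y \<in> - closure {x. u x ~= 0}" for y
    using that closure_subset[of "{x. u x ~= 0}"] by auto
  qed
  then show False using x by (simp add: partial_deriv_eq)
 qed
 then have "bounded {x. partial_deriv i u x ~= 0}"
  using u by (metis bounded_closure bounded_subset test_functions_iff)
 ultimately show ?thesis by (simp add: test_functions_iff)
qed

lemma tf_continuous: "u \<in> test_functions ==> continuous_on A u"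
 using tf_C[of u 0] by (auto intro: continuous_on_subset)

lemma tf_borel [measurable (raw)]: "u \<in> test_functions ==> u \<in> borel_measurable borel"
 by (intro borel_measurable_continuous_onI tf_continuous)

lemma tf_bound:
 assumes u: "u \<in> test_functions"
 obtains R B where "R > 0" "B > 0" "!!x. abs (u x) <= B" "!!x. norm x >= R ==> u x = 0"
proof -
 obtain R where R: "!!x. u x ~= 0 ==> norm x <= R"
  using u by (auto simp: test_functions_iff bounded_iff)
 have "compact (u ` cball 0 (abs R + 1))"
  by (intro compact_continuous_image tf_continuous u) auto
 then obtain B where B: "!!x. x \<in> cball 0 (abs R + 1) ==> abs (u x) <= B"
  using compact_imp_bounded[of "u ` cball 0 (abs R + 1)"] unfolding bounded_iff by fastforce
 show ?thesis
 proof (rule that[of "abs R + 1" "abs B + 1"])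
  fix x
  show "abs (u x) <= abs B + 1"
  proof (cases "u x = 0")
   case False
   then have "abs (u x) <= B" using R[of x] by (intro B) auto
   then show ?thesis by linarith
  qed simp
  show "norm x >= abs R + 1 ==> u x = 0" using R[of x] by force
 qed auto
qed

lemma tf_integrable_lborel:
 assumes u: "u \<in> test_functions"
 shows "integrable lborel u"
proof -
 obtain R B where RB: "R > 0" "B > 0" "!!x. abs (u x) <= B" "!!x. norm x >= R ==> u x = 0"
  using tf_bound[OF u] by blast
 have "integrable lborel (%x. indicator (cball 0 R) x *\<^sub>R u x)"
  by (intro borel_integrable_compact tf_continuous u) auto
 moreover have "(%x. indicator (cball 0 R) x *\<^sub>R u x) = u"
  using RB(4) by (auto simp: indicator_def fun_eq_iff)
 ultimately show ?thesis by simp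
qed

lemma tf_mult_integrable:
 assumes u: "u \<in> test_functions" and v: "v \<in> test_functions"
 shows "integrable lborel (%x. u x * v x)"
proof -
 obtain R B where B: "B > 0" "!!x. abs (u x) <= B" using tf_bound[OF u] by metis
 have [measurable]: "u \<in> borel_measurable borel" "v \<in> borel_measurable borel"
  using u v by (auto intro: tf_borel)
 show ?thesis
 proof (rule Bochner_Integration.integrable_bound)
  show "integrable lborel (%x. B * v x)" by (intro integrable_mult_right tf_integrable_lborel v)
  show "AE x in lborel. norm (u x * v x) <= norm (B * v x)"
   using B by (intro AE_I2) (auto simp: abs_mult intro!: mult_right_mono)
 qed measurable
qed

lemma tf_has_derivative:
 assumes "u \<in> test_functions"
 shows "(u has_derivative (%h. grad u x \<bullet> h)) (at x)"
proof -
 have d: "(u has_derivative frechet_derivative u (at x)) (at x)"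
  using tf_differentiable[OF assms] by (rule frechet_derivative_worksI)
 have lin: "linear (frechet_derivative u (at x))"
  using d has_derivative_linear by blast
 have "frechet_derivative u (at x) h = grad u x \<bullet> h" for h
 proof -
  have "h = (\<Sum>i\<in>UNIV. h $ i *\<^sub>R axis i 1)"
   using basis_expansion[of h] by (simp add: scalar_mult_eq_scaleR)
  then have "frechet_derivative u (at x) h = frechet_derivative u (at x) (\<Sum>i\<in>UNIV. h $ i *\<^sub>R axis i 1)"
   by simp
  also have "... = (\<Sum>i\<in>UNIV. h $ i * partial_deriv i u x)"
   by (simp add: linear_sum[OF lin] linear_cmul[OF lin] partial_deriv_def)
  also have "... = grad u x \<bullet> h" by (simp add: inner_vec_def grad_def mult.commute)
  finally show ?thesis .
 qed
 then have "frechet_derivative u (at x) = (%h. grad u x \<bullet> h)" by blast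
 with d show ?thesis by simp
qed

lemma tf_line_derivative:
 assumes "u \<in> test_functions"
 shows "((%t. u (x + t *\<^sub>R h)) has_real_derivative grad u (x + t *\<^sub>R h) \<bullet> h) (at t within S)"
proof -
 have "((%t. x + t *\<^sub>R h) has_derivative (%s. s *\<^sub>R h)) (at t within S)"
  by (auto intro!: derivative_eq_intros)
 from diff_chain_within[OF this has_derivative_at_withinI[OF tf_has_derivative[OF assms]]]
 show ?thesis
  by (simp add: o_def has_field_derivative_def mult_commute_abs)
qed

lemma grad_continuous: "u \<in> test_functions ==> continuous_on A (grad u)"
 unfolding grad_def by (intro continuous_intros tf_continuous tf_partial)

lemma grad_borel [measurable (raw)]: "u \<in> test_functions ==> grad u \<in> borel_measurable borel"
 by (intro borel_measurable_continuous_onI grad_continuous)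

subsection \<open>Integration by parts\<close>

text \<open>The integral of a directional derivative vanishes, because difference quotients have integral
 zero by translation invariance.\<close>

lemma integral_line_derivative_zero:
 fixes \<phi> g :: "real ^ 'n::finite => real"
 assumes der: "!!x s. ((%s. \<phi> (x + s *\<^sub>R e)) has_real_derivative g (x + s *\<^sub>R e)) (at s)"
  and cont: "continuous_on UNIV \<phi>" "continuous_on UNIV g"
  and supp: "!!x. norm x >= R ==> \<phi> x = 0" "!!x. norm x >= R ==> g x = 0" and e: "norm e <= 1"
 shows "(LINT x|lborel. g x) = 0"
proof -
 have [measurable]: "\<phi> \<in> borel_measurable borel" "g \<in> borel_measurable borel"
  using cont by (auto intro: borel_measurable_continuous_onI)
 have "compact (g ` cball 0 R)" using cont by (intro compact_continuous_image) (auto intro: continuous_on_subset)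
 then obtain B0 where B0: "!!x. x \<in> cball 0 R ==> abs (g x) <= B0"
  using compact_imp_bounded[of "g ` cball 0 R"] unfolding bounded_iff by fastforce
 define B where "B = abs B0"
 have B: "abs (g x) <= B" for x
  using B0[of x] supp(2)[of x] by (cases "norm x <= R") (auto simp: B_def)
 have int: "integrable lborel \<phi>"
 proof -
  have "integrable lborel (%x. indicator (cball 0 R) x *\<^sub>R \<phi> x)"
   by (intro borel_integrable_compact continuous_on_subset[OF cont(1)]) auto
  moreover have "(%x. indicator (cball 0 R) x *\<^sub>R \<phi> x) = \<phi>"
   using supp(1) by (auto simp: indicator_def fun_eq_iff)
  ultimately show ?thesis by simp
 qed
 define t where "t = (%n. 1 / real (Suc n))"
 have t: "0 < t n" "t n <= 1" for n by (auto simp: t_def)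
 define q where "q = (%n x. (\<phi> (x + t n *\<^sub>R e) - \<phi> x) / t n)"
 have q0: "(LINT x|lborel. q n x) = 0" for n
 proof -
  have sh: "integrable lborel (%x. \<phi> (x + t n *\<^sub>R e))" "(LINT x|lborel. \<phi> (x + t n *\<^sub>R e)) = (LINT x|lborel. \<phi> x)"
  proof -
   have d: "lborel = distr lborel borel (%x. t n *\<^sub>R e + x)" by (rule lborel_distr_plus[symmetric])
   show "integrable lborel (%x. \<phi> (x + t n *\<^sub>R e))"
    using int by (subst (asm) d, subst (asm) integrable_distr_eq) (auto simp: add.commute)
   show "(LINT x|lborel. \<phi> (x + t n *\<^sub>R e)) = (LINT x|lborel. \<phi> x)"
    by (subst (2) d, subst integral_distr) (auto simp: add.commute)
  qed
  then show ?thesis using int by (simp add: q_def)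
 qed
 have "(%n. LINT x|lborel. q n x) ----> (LINT x|lborel. g x)"
 proof (rule integral_dominated_convergence[where w="%x. B * indicator (cball 0 (R + 1)) x"])
  show "integrable lborel (%x. B * indicator (cball 0 (R + 1)) x :: real)"
   using emeasure_bounded_finite[OF bounded_cball, of 0 "R + 1"]
   by (intro integrable_mult_right integrable_real_indicator) auto
  show "AE x in lborel. (%n. q n x) ----> g x"
  proof (rule AE_I2)
   fix x
   have "((%s. (\<phi> (x + s *\<^sub>R e) - \<phi> x) / s) \<longlongrightarrow> g x) (at 0)"
    using der[of x 0] by (simp add: DERIV_def)
   moreover have "filterlim t (at 0) sequentially"
    unfolding filterlim_at t_def using LIMSEQ_inverse_real_of_nat by (auto simp: inverse_eq_divide)
   ultimately show "(%n. q n x) ----> g x"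
    unfolding q_def by (rule filterlim_compose)
  qed
  show "AE x in lborel. norm (q n x) <= B * indicator (cball 0 (R + 1)) x" for n
  proof (rule AE_I2)
   fix x
   have e1: "norm (t n *\<^sub>R e) <= 1" using mult_mono[of "t n" 1 "norm e" 1] t[of n] e by simp
   show "norm (q n x) <= B * indicator (cball 0 (R + 1)) x"
   proof (cases "norm x <= R + 1")
    case True
    obtain z where "\<phi> (x + t n *\<^sub>R e) - \<phi> (x + 0 *\<^sub>R e) = (t n - 0) * g (x + z *\<^sub>R e)"
     using MVT2[of 0 "t n" "%s. \<phi> (x + s *\<^sub>R e)" "%s. g (x + s *\<^sub>R e)"] t[of n] der by blast
    then have "q n x = g (x + z *\<^sub>R e)" using t[of n] by (simp add: q_def)
    then show ?thesis using B True by simp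
   next
    case False
    have "norm x - norm (t n *\<^sub>R e) <= norm (x + t n *\<^sub>R e)" by (rule norm_diff_ineq)
    then have "norm (x + t n *\<^sub>R e) >= R" using e1 False by linarith
    then show ?thesis using supp(1) False by (simp add: q_def)
   qed
  qed
 qed (auto simp: q_def)
 then show ?thesis unfolding q0 using LIMSEQ_unique tendsto_const by blast
qed

lemma tf_integral_by_parts:
 fixes u v :: "real ^ 'n::finite => real"
 assumes u: "u \<in> test_functions" and v: "v \<in> test_functions"
 shows "(LINT x|lborel. u x * partial_deriv i v x) = - (LINT x|lborel. partial_deriv i u x * v x)"
proof -
 obtain R B where R: "!!x. norm x >= R ==> u x = 0" "B > 0" "!!x. abs (u x) <= B" using tf_bound[OF u] by metis
 obtain R' B' where R': "!!x. norm x >= R' ==> v x = 0" "B' > 0" "!!x. abs (v x) <= B'" using tf_bound[OF v] by metis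
 let ?g = "%x. u x * partial_deriv i v x + partial_deriv i u x * v x"
 have gd: "grad w x \<bullet> axis i 1 = partial_deriv i w x" for w :: "real ^ 'n => real" and x
  by (simp add: grad_def inner_axis)
 have "(LINT x|lborel. ?g x) = 0"
 proof (rule integral_line_derivative_zero[where e="axis i 1" and \<phi>="%x. u x * v x" and R="max R R'"])
  fix x :: "real ^ 'n" and s :: real
  show "((%s. u (x + s *\<^sub>R axis i 1) * v (x + s *\<^sub>R axis i 1)) has_real_derivative
    u (x + s *\<^sub>R axis i 1) * partial_deriv i v (x + s *\<^sub>R axis i 1) +
    partial_deriv i u (x + s *\<^sub>R axis i 1) * v (x + s *\<^sub>R axis i 1)) (at s)"
   using DERIV_mult[OF tf_line_derivative[OF u, of x "axis i 1" s UNIV] tf_line_derivative[OF v, of x "axis i 1" s UNIV]]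
   by (simp add: gd algebra_simps)
 next
  show "continuous_on UNIV (%x. u x * v x)"
   "continuous_on UNIV (%x. u x * partial_deriv i v x + partial_deriv i u x * v x)"
   by (intro continuous_on_add continuous_on_mult tf_continuous tf_partial u v)+
 qed (use R(1) R'(1) in auto)
 moreover have "integrable lborel (%x. u x * partial_deriv i v x)" "integrable lborel (%x. partial_deriv i u x * v x)"
  by (intro tf_mult_integrable tf_partial u v)+
 ultimately show ?thesis by simp
qed

subsection \<open>Smooth cut-off functions\<close>

definition flat :: "nat => real => real" where
 "flat j s = (if s > 0 then exp (- 1 / s) / s ^ j else 0)"

text \<open>This family contains its derivatives.\<close>

lemma flat_DERIV: "(flat j has_real_derivative flat (j + 2) s - real j * flat (j + 1) s) (at s)"
proof -
 consider "s > 0" | "s < 0" | "s = 0" by linarith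
 then show ?thesis
 proof cases
  case 1
  have "((%s. exp (- 1 / s) * inverse (s ^ j)) has_real_derivative
   exp (- 1 / s) * (1 / s ^ 2) * inverse (s ^ j) + exp (- 1 / s) * - (real j * s ^ (j - 1) * (inverse (s ^ j)) ^ 2)) (at s)"
   using 1 by (auto intro!: derivative_eq_intros simp: power2_eq_square field_simps)
  moreover have "exp (- 1 / s) * (1 / s ^ 2) * inverse (s ^ j) + exp (- 1 / s) * - (real j * s ^ (j - 1) * (inverse (s ^ j)) ^ 2)
   = flat (j + 2) s - real j * flat (j + 1) s"
  proof -
   have e: "real j * s ^ (j - 1) * (inverse (s ^ j)) ^ 2 = real j * inverse (s ^ (j + 1))"
    using 1 by (cases j) (auto simp: field_simps power2_eq_square)
   have "exp (- 1 / s) * (1 / s ^ 2) * inverse (s ^ j) = flat (j + 2) s"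
    using 1 by (simp add: flat_def power_add divide_inverse power2_eq_square)
   moreover have "exp (- 1 / s) * - (real j * inverse (s ^ (j + 1))) = - (real j * flat (j + 1) s)"
    using 1 by (simp add: flat_def divide_inverse)
   ultimately show ?thesis unfolding e by simp
  qed
  ultimately have "((%s. exp (- 1 / s) * inverse (s ^ j)) has_real_derivative
    flat (j + 2) s - real j * flat (j + 1) s) (at s)" by simp
  then show ?thesis
   by (rule has_field_derivative_transform_within_open[of _ _ _ "{0<..}"])
    (use 1 in \<open>auto simp: flat_def field_simps\<close>)
 next
  case 2
  have "((%s. 0) has_real_derivative flat (j + 2) s - real j * flat (j + 1) s) (at s)"
   using 2 by (simp add: flat_def)
  then show ?thesis
   by (rule has_field_derivative_transform_within_open[of _ _ _ "{..<0}"]) (use 2 in \<open>auto simp: flat_def\<close>)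
 next
  case 3
  have "((%h. flat j h / h) \<longlongrightarrow> 0) (at_right 0)"
  proof (rule Lim_transform_eventually)
   show "((%h::real. (inverse h) ^ (j + 1) / exp (inverse h)) \<longlongrightarrow> 0) (at_right 0)"
    by (rule filterlim_compose[OF tendsto_power_div_exp_0 filterlim_inverse_at_top_right])
   show "\<forall>\<^sub>F h::real in at_right 0. (inverse h) ^ (j + 1) / exp (inverse h) = flat j h / h"
    unfolding eventually_at_right_field
    by (rule exI[of _ 1]) (auto simp: flat_def field_simps exp_minus inverse_eq_divide)
  qed
  moreover have "((%h. flat j h / h) \<longlongrightarrow> 0) (at_left 0)"
  proof (rule Lim_transform_eventually)
   show "((%h::real. 0::real) \<longlongrightarrow> 0) (at_left 0)" by simp
   show "\<forall>\<^sub>F h::real in at_left 0. 0 = flat j h / h"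
    unfolding eventually_at_left_field by (rule exI[of _ "-1"]) (auto simp: flat_def)
  qed
  ultimately have "((%h. flat j h / h) \<longlongrightarrow> 0) (at 0)"
   by (simp add: filterlim_split_at)
  then show ?thesis using 3 by (simp add: DERIV_def flat_def)
 qed
qed

text \<open>
 A class of functions that is closed under partial derivatives by construction, which gives smoothness of bumps
 without computing their derivatives.
\<close>

inductive smooth_gen :: "(real ^ 'n::finite => real) => bool" where
 smooth_const: "smooth_gen (%x. c)"
| smooth_coord: "smooth_gen (%x. x $ i)"
| smooth_add: "smooth_gen u ==> smooth_gen v ==> smooth_gen (%x. u x + v x)"
| smooth_mult: "smooth_gen u ==> smooth_gen v ==> smooth_gen (%x. u x * v x)"
| smooth_flat: "smooth_gen u ==> smooth_gen (%x. flat j (u x))"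

lemma smooth_gen_deriv:
 "smooth_gen u ==> (ALL x. u differentiable at x) & (ALL i. smooth_gen (partial_deriv i u))"
proof (induction rule: smooth_gen.induct)
 case (smooth_const c)
 show ?case by (auto intro: smooth_gen.intros simp: partial_deriv_const)
next
 case (smooth_coord k)
 have d: "((%x. x $ k) has_derivative (%h. h $ k)) (at x)" for x :: "real ^ 'a"
  by (rule bounded_linear_imp_has_derivative[OF bounded_linear_vec_nth])
 have "partial_deriv i (%x. x $ k) = (%x. axis i 1 $ k)" for i
  by (rule ext, rule partial_deriv_eq[OF d])
 then show ?case using d by (auto intro: smooth_gen.intros simp: differentiable_def)
next
 case (smooth_add u v)
 have "partial_deriv i (%x. u x + v x) = (%x. partial_deriv i u x + partial_deriv i v x)" for i
  using smooth_add by (auto intro!: ext partial_deriv_add)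
 with smooth_add show ?case by (auto intro: smooth_gen.intros)
next
 case (smooth_mult u v)
 have d: "((%x. u x * v x) has_derivative (%h. u x * frechet_derivative v (at x) h + frechet_derivative u (at x) h * v x)) (at x)" for x
  using smooth_mult by (intro has_derivative_mult frechet_derivative_worksI) auto
 have "partial_deriv i (%x. u x * v x) = (%x. u x * partial_deriv i v x + partial_deriv i u x * v x)" for i
  by (rule ext) (simp add: partial_deriv_eq[OF d] partial_deriv_def)
 moreover have "smooth_gen (%x. u x * partial_deriv i v x + partial_deriv i u x * v x)" for i
  using smooth_mult by (intro smooth_gen.intros(3,4)) auto
 ultimately show ?case using d by (auto simp: differentiable_def)
next
 case (smooth_flat u j)
 have d: "((%x. flat j (u x)) has_derivative
  (%h. (flat (j + 2) (u x) - real j * flat (j + 1) (u x)) * frechet_derivative u (at x) h)) (at x)" for x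
  using smooth_flat has_derivative_compose[OF frechet_derivative_worksI has_field_derivative_imp_has_derivative[OF flat_DERIV], of u x UNIV j]
  by simp
 have "partial_deriv i (%x. flat j (u x)) = (%x. (flat (j + 2) (u x) + (- real j) * flat (j + 1) (u x)) * partial_deriv i u x)" for i
  by (rule ext) (simp add: partial_deriv_eq[OF d] partial_deriv_def)
 moreover have "smooth_gen (%x. (flat (j + 2) (u x) + (- real j) * flat (j + 1) (u x)) * partial_deriv i u x)" for i
  using smooth_flat by (intro smooth_gen.intros(3,4) smooth_gen.intros(5)[of u] smooth_gen.intros(1)) auto
 ultimately show ?case using d by (auto simp: differentiable_def)
qed

lemma smooth_gen_C_class: "smooth_gen u ==> C_class k u"
proof (induction k arbitrary: u)
 case 0
 then have "u differentiable_on UNIV" using smooth_gen_deriv[of u] by (auto simp: differentiable_on_def)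
 then show ?case by (auto intro: differentiable_imp_continuous_on)
next
 case (Suc k)
 then show ?case using smooth_gen_deriv[of u] by (auto simp: differentiable_on_def)
qed

lemma smooth_prod: "(!!i. i \<in> A ==> smooth_gen (u i)) ==> smooth_gen (%x. \<Prod>i\<in>A. u i x)"
 by (induction A rule: infinite_finite_induct) (auto intro: smooth_gen.intros)

text \<open>
 As \<open>n\<close> grows these functions exhaust the indicator of the box, so testing with them recovers integrals over boxes.
\<close>

definition box_bump :: "nat => real ^ 'n::finite => real ^ 'n => real ^ 'n => real" where
 "box_bump n a b x = (\<Prod>i\<in>UNIV. flat 0 (real n * (x $ i - a $ i)) * flat 0 (real n * (b $ i - x $ i)))"

lemma flat_0_bounds: "0 <= flat 0 s" "flat 0 s <= 1" "0 < s ==> 0 < flat 0 s" "s <= 0 ==> flat 0 s = 0"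
 by (auto simp: flat_def)

lemma box_bump_bounds: "0 <= box_bump n a b x" "box_bump n a b x <= 1"
 unfolding box_bump_def
 by (auto intro!: prod_nonneg prod_le_1 mult_nonneg_nonneg mult_le_one simp: flat_0_bounds)

lemma box_bump_zero: "x \<notin> box a b ==> box_bump n a b x = 0"
proof -
 assume "x \<notin> box a b"
 then obtain i where "~ (a $ i < x $ i & x $ i < b $ i)" by (auto simp: mem_box_cart)
 then have "real n * (x $ i - a $ i) <= 0 | real n * (b $ i - x $ i) <= 0"
  by (auto simp: mult_le_0_iff not_less)
 then show ?thesis
  unfolding box_bump_def
  by (intro prod_zero[OF finite] bexI[of _ i]) (auto simp: flat_0_bounds(4))
qed

lemma box_bump_pos: "x \<in> box a b ==> n > 0 ==> box_bump n a b x > 0"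
 unfolding box_bump_def by (intro prod_pos) (auto intro!: mult_pos_pos flat_0_bounds simp: mem_box_cart)

lemma box_bump_tf: "box_bump n a b \<in> test_functions"
proof -
 have "smooth_gen (%x. flat 0 (real n * (x $ i + (- (a $ i)))) * flat 0 (real n * (b $ i + (- 1) * x $ i)))" for i
  by (intro smooth_gen.intros)
 then have "smooth_gen (box_bump n a b)"
  unfolding box_bump_def by (intro smooth_prod) simp
 moreover have "bounded {x. box_bump n a b x ~= 0}"
  by (rule bounded_subset[OF bounded_box[of a b]]) (use box_bump_zero in blast)
 ultimately show ?thesis by (simp add: test_functions_iff smooth_gen_C_class)
qed

lemma flat_0_tendsto: "(%n. flat 0 (real n * s)) ----> (if s > 0 then 1 else 0)"
proof (cases "s > 0")
 case True
 have "(%n. exp (- ((1 / s) * inverse (real (Suc n))))) ----> exp (- ((1 / s) * 0))"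
  by (intro tendsto_intros LIMSEQ_inverse_real_of_nat)
 moreover have "(%n. exp (- ((1 / s) * inverse (real (Suc n))))) = (%n. flat 0 (real (Suc n) * s))"
 proof
  fix n
  have "real (Suc n) * s > 0" using True by simp
  then show "exp (- ((1 / s) * inverse (real (Suc n)))) = flat 0 (real (Suc n) * s)"
   by (simp add: flat_def divide_inverse mult.commute del: of_nat_Suc)
 qed
 ultimately have "(%n. flat 0 (real (Suc n) * s)) ----> 1" by simp
 then show ?thesis using True by (subst (asm) filterlim_sequentially_Suc) simp
next
 case False
 then have "flat 0 (real n * s) = 0" for n by (intro flat_0_bounds) (simp add: mult_nonneg_nonpos)
 then show ?thesis using False by simp
qed

lemma box_bump_tendsto: "(%n. box_bump n a b x) ----> indicator (box a b) x"
proof -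
 have "(%n. box_bump n a b x) ---->
  (\<Prod>i\<in>UNIV. (if x $ i - a $ i > 0 then 1 else 0) * (if b $ i - x $ i > 0 then 1 else 0))"
  unfolding box_bump_def by (intro tendsto_prod tendsto_mult flat_0_tendsto)
 moreover have "(\<Prod>i\<in>UNIV. (if x $ i - a $ i > 0 then 1 else 0) * (if b $ i - x $ i > 0 then 1 else 0)) = (indicator (box a b) x :: real)"
 proof (cases "x \<in> box a b")
  case True
  then show ?thesis by (simp add: mem_box_cart)
 next
  case False
  then obtain i where "~ (a $ i < x $ i & x $ i < b $ i)" by (auto simp: mem_box_cart)
  then show ?thesis using False by (subst prod_zero) (auto intro!: exI[of _ i])
 qed
 ultimately show ?thesis by simp
qed

subsection \<open>Uniqueness of weak gradients\<close>

lemma locally_integrable_measurable: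
 fixes g :: "real ^ 'n::finite => 'b::{banach, second_countable_topology}"
 assumes g: "locally_integrable g"
 shows "g \<in> borel_measurable lebesgue"
proof (rule borel_measurable_LIMSEQ_metric)
 show "(%x. indicator (cball 0 (real n)) x *\<^sub>R g x) \<in> borel_measurable lebesgue" for n
  using g compact_cball[of "0 :: real ^ 'n" "real n"]
  unfolding locally_integrable_def set_integrable_def by (blast intro: borel_measurable_integrable)
 show "(%n. indicator (cball 0 (real n)) x *\<^sub>R g x) ----> g x" for x
 proof (rule tendsto_eventually)
  obtain m where "norm x <= real m" using real_arch_simple by blast
  then show "\<forall>\<^sub>F n in sequentially. indicator (cball 0 (real n)) x *\<^sub>R g x = g x"
   unfolding eventually_sequentially by (intro exI[of _ m]) (auto simp: indicator_def)
 qed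
qed

lemma locally_integrable_mult_tf:
 fixes g :: "real ^ 'n::finite => real"
 assumes g: "locally_integrable g" and v: "v \<in> test_functions"
 shows "integrable lebesgue (%x. g x * v x)"
proof -
 obtain R B where RB: "B > 0" "!!x. abs (v x) <= B" "!!x. norm x >= R ==> v x = 0"
  using tf_bound[OF v] by metis
 have i: "integrable lebesgue (%x. indicator (cball 0 R) x *\<^sub>R g x)"
  using g by (auto simp: locally_integrable_def set_integrable_def)
 have vm: "v \<in> borel_measurable lebesgue"
  using tf_borel[OF v] by (simp add: measurable_completion)
 have eq: "(%x. g x * v x) = (%x. (indicator (cball 0 R) x *\<^sub>R g x) * v x)"
  using RB(3) by (auto simp: indicator_def fun_eq_iff)
 show ?thesis unfolding eq
 proof (rule Bochner_Integration.integrable_bound)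
  show "integrable lebesgue (%x. B * (indicator (cball 0 R) x *\<^sub>R g x))"
   using i by (rule integrable_mult_right)
  show "(%x. (indicator (cball 0 R) x *\<^sub>R g x) * v x) \<in> borel_measurable lebesgue"
   using borel_measurable_integrable[OF i] vm by (rule borel_measurable_times)
  show "AE x in lebesgue. norm ((indicator (cball 0 R) x *\<^sub>R g x) * v x) <= norm (B * (indicator (cball 0 R) x *\<^sub>R g x))"
  proof (rule AE_I2)
   fix x
   have "\<bar>indicator (cball 0 R) x *\<^sub>R g x\<bar> * abs (v x) <= \<bar>indicator (cball 0 R) x *\<^sub>R g x\<bar> * B"
    using RB by (intro mult_left_mono) auto
   then show "norm ((indicator (cball 0 R) x *\<^sub>R g x) * v x) <= norm (B * (indicator (cball 0 R) x *\<^sub>R g x))"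
    using RB(1) by (simp add: abs_mult mult_ac)
  qed
 qed
qed

text \<open>
 Testing with \<open>box_bump\<close> shows that the integral of \<open>H\<close> over each box is zero, and boxes generate the Borel sets.
\<close>

lemma du_Bois_Reymond:
 fixes H :: "real ^ 'n::finite => real"
 assumes H: "locally_integrable H" and 0: "!!v. v \<in> test_functions ==> (LINT x|lebesgue. H x * v x) = 0"
 shows "AE x in lebesgue. H x = 0"
proof -
 have loc: "integrable lebesgue (%x. indicator (cball 0 R) x *\<^sub>R H x)" for R
  using H by (auto simp: locally_integrable_def set_integrable_def)
 have Hm: "H \<in> borel_measurable lebesgue" by (rule locally_integrable_measurable[OF H])
 obtain H' where H'm: "H' \<in> borel_measurable lborel" and H': "AE x in lborel. H x = H' x"
  using completion_ex_borel_measurable_real[OF Hm] by blast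
 have H'l: "AE x in lebesgue. H x = H' x" using H' by (rule AE_completion)
 have [measurable]: "H' \<in> borel_measurable borel" using H'm by simp
 have int: "integrable lborel (%x. indicator (box a b) x * H' x)" for a b
 proof -
  obtain R where R: "box a b \<subseteq> cball 0 R" using bounded_subset_ballD[OF bounded_box[of a b], of 0] ball_subset_cball by blast
  have "integrable lebesgue (%x. indicator (box a b) x * (indicator (cball 0 R) x *\<^sub>R H x))"
   using integrable_mult_indicator[OF _ loc, of "box a b" R] by simp
  moreover have "(%x. indicator (box a b) x * (indicator (cball 0 R) x *\<^sub>R H x)) = (%x. indicator (box a b) x * H x)"
   using R by (auto simp: indicator_def fun_eq_iff)
  ultimately have "integrable lebesgue (%x. indicator (box a b) x * H x)" by simp
  then have "integrable lebesgue (%x. indicator (box a b) x * H' x)"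
   by (rule integrable_cong_AE_imp) (use H'l in \<open>auto intro!: measurable_completion\<close>)
  then show ?thesis by (subst (asm) integrable_completion) auto
 qed
 have z: "(LINT x|lborel. indicator (box a b) x * H' x) = 0" for a b
 proof -
  have "(%n. LINT x|lborel. H' x * box_bump n a b x) ----> (LINT x|lborel. indicator (box a b) x * H' x)"
  proof (rule integral_dominated_convergence[where w="%x. norm (indicator (box a b) x * H' x)"])
   show "integrable lborel (%x. norm (indicator (box a b) x * H' x))" using int by (rule integrable_norm)
   show "AE x in lborel. (%n. H' x * box_bump n a b x) ----> indicator (box a b) x * H' x"
   proof (rule AE_I2)
    fix x show "(%n. H' x * box_bump n a b x) ----> indicator (box a b) x * H' x"
     using tendsto_mult_left[OF box_bump_tendsto[of a b x], of "H' x"] by (simp add: mult.commute)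
   qed
   show "AE x in lborel. norm (H' x * box_bump n a b x) <= norm (indicator (box a b) x * H' x)" for n
   proof (rule AE_I2)
    fix x show "norm (H' x * box_bump n a b x) <= norm (indicator (box a b) x * H' x)"
    proof (cases "x \<in> box a b")
     case True
     then show ?thesis using box_bump_bounds[of n a b x] by (simp add: abs_mult mult_left_le)
    qed (simp add: box_bump_zero)
   qed
   show "(%x. H' x * box_bump n a b x) \<in> borel_measurable lborel" for n
    using tf_borel[OF box_bump_tf[of n a b]] by simp
  qed simp
  moreover have "(LINT x|lborel. H' x * box_bump n a b x) = 0" for n
  proof -
   have m: "(%x. H' x * box_bump n a b x) \<in> borel_measurable lborel"
    using tf_borel[OF box_bump_tf[of n a b]] by simp
   have "(LINT x|lborel. H' x * box_bump n a b x) = (LINT x|lebesgue. H' x * box_bump n a b x)"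
    by (rule integral_completion[symmetric, OF m])
   also have "... = (LINT x|lebesgue. H x * box_bump n a b x)"
   proof (rule integral_cong_AE)
    have "box_bump n a b \<in> borel_measurable lebesgue"
     using tf_borel[OF box_bump_tf[of n a b]] by (simp add: measurable_completion)
    then show "(%x. H x * box_bump n a b x) \<in> borel_measurable lebesgue"
     by (rule borel_measurable_times[OF Hm])
    show "(%x. H' x * box_bump n a b x) \<in> borel_measurable lebesgue"
     using m by (rule measurable_completion)
   qed (use H'l in auto)
   finally show ?thesis using 0[OF box_bump_tf] by simp
  qed
  ultimately show ?thesis by (simp add: LIMSEQ_const_iff)
 qed
 \<comment> \<open>the positive and the negative part have the same integral over all boxes\<close>
 have box: "emeasure (density lborel (%x. ennreal (H' x))) (box a b)
  = emeasure (density lborel (%x. ennreal (- H' x))) (box a b)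
  & emeasure (density lborel (%x. ennreal (H' x))) (box a b) ~= \<infinity>" for a b
 proof -
  let ?h = "%x. indicator (box a b) x * H' x"
  have e: "emeasure (density lborel (%x. ennreal (f x))) (box a b)
    = (\<integral>\<^sup>+x. ennreal (indicator (box a b) x * f x) \<partial>lborel)"
   if "f \<in> borel_measurable borel" for f
   using that by (subst emeasure_density) (auto intro!: nn_integral_cong simp: indicator_def)
  have fin: "(\<integral>\<^sup>+x. ennreal (?h x) \<partial>lborel) < \<infinity>" "(\<integral>\<^sup>+x. ennreal (- ?h x) \<partial>lborel) < \<infinity>"
   using int[of a b] by (auto elim: integrableE)
  have "(LINT x|lborel. ?h x) = enn2real (\<integral>\<^sup>+x. ennreal (?h x) \<partial>lborel) - enn2real (\<integral>\<^sup>+x. ennreal (- ?h x) \<partial>lborel)"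
   by (rule real_lebesgue_integral_def[OF int])
  then have "enn2real (\<integral>\<^sup>+x. ennreal (?h x) \<partial>lborel) = enn2real (\<integral>\<^sup>+x. ennreal (- ?h x) \<partial>lborel)"
   using z[of a b] by linarith
  then have "ennreal (enn2real (\<integral>\<^sup>+x. ennreal (?h x) \<partial>lborel)) = ennreal (enn2real (\<integral>\<^sup>+x. ennreal (- ?h x) \<partial>lborel))"
   by (rule arg_cong)
  moreover have "ennreal (enn2real (\<integral>\<^sup>+x. ennreal (?h x) \<partial>lborel)) = (\<integral>\<^sup>+x. ennreal (?h x) \<partial>lborel)"
   "ennreal (enn2real (\<integral>\<^sup>+x. ennreal (- ?h x) \<partial>lborel)) = (\<integral>\<^sup>+x. ennreal (- ?h x) \<partial>lborel)"
   using fin by (intro ennreal_enn2real, simp)+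
  ultimately have "(\<integral>\<^sup>+x. ennreal (?h x) \<partial>lborel) = (\<integral>\<^sup>+x. ennreal (- ?h x) \<partial>lborel)"
   by (simp only:)
  then show ?thesis using fin(1) e[of H'] e[of "%x. - H' x"] by simp
 qed
 have "density lborel (%x. ennreal (H' x)) = density lborel (%x. ennreal (- H' x))"
 proof (rule measure_eqI_generator_eq[where E="range (%(a, b). box a b)" and \<Omega>=UNIV
    and A="%n. box (- (real n *\<^sub>R One)) (real n *\<^sub>R One)"])
  show "Int_stable (range (%(a, b). box a b :: (real ^ 'n) set))"
   by (auto simp: Int_stable_def box_Int_box)
  show "sets (density lborel (%x. ennreal (H' x))) = sigma_sets UNIV (range (%(a, b). box a b))"
   by (simp add: borel_eq_box)
  show "sets (density lborel (%x. ennreal (- H' x))) = sigma_sets UNIV (range (%(a, b). box a b))"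
   by (simp add: borel_eq_box)
  show "(\<Union>n. box (- (real n *\<^sub>R One)) (real n *\<^sub>R One)) = (UNIV :: (real ^ 'n) set)"
   by (rule UN_box_eq_UNIV)
  show "emeasure (density lborel (%x. ennreal (H' x))) (box (- (real n *\<^sub>R One)) (real n *\<^sub>R One)) ~= \<infinity>" for n
   using box by blast
  show "emeasure (density lborel (%x. ennreal (H' x))) X = emeasure (density lborel (%x. ennreal (- H' x))) X"
   if X: "X \<in> range (%(a, b). box a b)" for X
  proof -
   obtain a b where "X = box a b" using X by auto
   then show ?thesis using box[of a b] by simp
  qed
 qed auto
 then have "AE x in lborel. ennreal (H' x) = ennreal (- H' x)"
  by (intro sigma_finite_measure.density_unique[OF sigma_finite_lborel]) auto
 then have "AE x in lborel. H' x = 0"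
 proof eventually_elim
  case (elim x)
  then show ?case by (cases "H' x >= 0") (auto simp: ennreal_neg)
 qed
 then have "AE x in lebesgue. H' x = 0" by (rule AE_completion)
 with H'l show ?thesis by eventually_elim simp
qed

lemma weak_gradient_unique:
 fixes u :: "real ^ 'n::finite => real"
 assumes G: "is_weak_gradient u G" and G': "is_weak_gradient u G'"
 shows "AE x in lebesgue. G x = G' x"
proof -
 have li: "locally_integrable (%x. G x $ i)" if "is_weak_gradient u G" for G :: "real ^ 'n => real ^ 'n" and i
  unfolding locally_integrable_def set_integrable_def
 proof (intro allI impI)
  fix K :: "(real ^ 'n) set" assume "compact K"
  then have "integrable lebesgue (%x. indicator K x *\<^sub>R G x)"
   using that by (simp add: is_weak_gradient_def locally_integrable_def set_integrable_def)
  from integrable_bounded_linear[OF bounded_linear_vec_nth this, of i]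
  show "integrable lebesgue (%x. indicator K x *\<^sub>R (G x $ i))" by simp
 qed
 have "AE x in lebesgue. G x $ i - G' x $ i = 0" for i
 proof (rule du_Bois_Reymond)
  show "locally_integrable (%x. G x $ i - G' x $ i)"
   unfolding locally_integrable_def
  proof (intro allI impI set_integral_diff(1))
   fix K :: "(real ^ 'n) set" assume K: "compact K"
   show "set_integrable lebesgue K (%x. G x $ i)" "set_integrable lebesgue K (%x. G' x $ i)"
    using li[OF G, of i] li[OF G', of i] K unfolding locally_integrable_def by blast+
  qed
  fix v :: "real ^ 'n => real" assume v: "v \<in> test_functions"
  have "(LINT x|lebesgue. u x * partial_deriv i v x) = - (LINT x|lebesgue. G x $ i * v x)"
   using G v unfolding is_weak_gradient_def by blast
  moreover have "(LINT x|lebesgue. u x * partial_deriv i v x) = - (LINT x|lebesgue. G' x $ i * v x)"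
   using G' v unfolding is_weak_gradient_def by blast
  ultimately have "(LINT x|lebesgue. G x $ i * v x) = (LINT x|lebesgue. G' x $ i * v x)" by linarith
  then show "(LINT x|lebesgue. (G x $ i - G' x $ i) * v x) = 0"
   using locally_integrable_mult_tf[OF li[OF G, of i] v] locally_integrable_mult_tf[OF li[OF G', of i] v]
   by (simp add: left_diff_distrib)
 qed
 then have "AE x in lebesgue. ALL i:UNIV. G x $ i - G' x $ i = 0"
  by (intro AE_finite_allI) auto
 then show ?thesis by eventually_elim (simp add: vec_eq_iff)
qed

lemma weak_grad_AE:
 "is_weak_gradient u G ==> AE x in lebesgue. weak_grad u x = G x"
 unfolding weak_grad_def by (rule weak_gradient_unique[OF someI[of "is_weak_gradient u"]])

section \<open>Averages over balls\<close>

lemma ball_borel [measurable]: "ball (a :: 'a::euclidean_space) r \<in> sets borel"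
 by simp

lemma nn_integral_shift:
 fixes f :: "'a::euclidean_space => ennreal"
 assumes [measurable]: "f \<in> borel_measurable borel"
 shows "(\<integral>\<^sup>+x. f (c + x) \<partial>lborel) = (\<integral>\<^sup>+x. f x \<partial>lborel)"
proof -
 have "(\<integral>\<^sup>+x. f x \<partial>lborel) = (\<integral>\<^sup>+x. f x \<partial>distr lborel borel ((+) c))"
  by (simp add: lborel_distr_plus)
 then show ?thesis by (simp add: nn_integral_distr)
qed

lemma nn_integral_scale:
 fixes f :: "'a::euclidean_space => ennreal"
 assumes [measurable]: "f \<in> borel_measurable borel" and c: "c > 0"
 shows "(\<integral>\<^sup>+x. f (y + c *\<^sub>R x) \<partial>lborel) = ennreal (1 / c ^ DIM('a)) * (\<integral>\<^sup>+x. f x \<partial>lborel)"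
proof -
 have "(\<integral>\<^sup>+x. f x \<partial>lborel) = (\<integral>\<^sup>+x. f x \<partial>density (distr lborel borel (%x. y + c *\<^sub>R x)) (%_. ennreal (abs c ^ DIM('a))))"
  using lborel_affine[of c y] c by simp
 also have "... = (\<integral>\<^sup>+x. ennreal (c ^ DIM('a)) * f (y + c *\<^sub>R x) \<partial>lborel)"
  using c by (simp add: nn_integral_density nn_integral_distr)
 also have "... = ennreal (c ^ DIM('a)) * (\<integral>\<^sup>+x. f (y + c *\<^sub>R x) \<partial>lborel)"
  by (rule nn_integral_cmult) simp
 finally have e: "(\<integral>\<^sup>+x. f x \<partial>lborel) = ennreal (c ^ DIM('a)) * (\<integral>\<^sup>+x. f (y + c *\<^sub>R x) \<partial>lborel)" .
 have "ennreal (1 / c ^ DIM('a)) * ennreal (c ^ DIM('a)) = 1"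
  using c by (subst ennreal_mult[symmetric]) auto
 then show ?thesis by (simp add: e mult.assoc[symmetric])
qed

definition unif :: "'a::euclidean_space set => 'a measure" where
 "unif A = density lborel (%x. ennreal (indicator A x / measure lborel A))"

lemma sets_unif [simp, measurable_cong]: "sets (unif A) = sets borel"
 by (simp add: unif_def)

lemma space_unif [simp]: "space (unif A) = UNIV"
 by (simp add: unif_def)

lemma nn_integral_unif:
 assumes [measurable]: "A \<in> sets borel" "f \<in> borel_measurable borel"
 shows "(\<integral>\<^sup>+x. f x \<partial>unif A) = (\<integral>\<^sup>+x. ennreal (indicator A x / measure lborel A) * f x \<partial>lborel)"
 unfolding unif_def by (subst nn_integral_density) auto

lemma emeasure_unif:
 fixes A :: "'a::euclidean_space set"
 assumes [measurable]: "A \<in> sets borel" and A: "emeasure lborel A ~= \<infinity>" "measure lborel A > 0"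
 shows "emeasure (unif A) UNIV = 1"
proof -
 have "emeasure (unif A) UNIV = (\<integral>\<^sup>+x. ennreal (indicator A x / measure lborel A) \<partial>lborel)"
  unfolding unif_def by (subst emeasure_density) auto
 also have "... = (\<integral>\<^sup>+x. ennreal (1 / measure lborel A) * indicator A x \<partial>lborel)"
  by (intro nn_integral_cong) (auto simp: indicator_def)
 also have "... = ennreal (1 / measure lborel A) * emeasure lborel A"
  by (simp add: nn_integral_cmult_indicator)
 also have "... = ennreal (1 / measure lborel A) * ennreal (measure lborel A)"
  using A(1) by (simp add: emeasure_eq_ennreal_measure)
 also have "... = 1" using A(2) by (subst ennreal_mult[symmetric]) auto
 finally show ?thesis .
qed

lemma square_mean_le:
 assumes M: "emeasure M (space M) = 1" and g: "integrable M (g :: _ => real)"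
 shows "ennreal ((LINT x|M. g x)\<^sup>2) <= (\<integral>\<^sup>+x. ennreal ((g x)\<^sup>2) \<partial>M)"
proof (cases "(\<integral>\<^sup>+x. ennreal ((g x)\<^sup>2) \<partial>M) = \<infinity>")
 case False
 have fin: "finite_measure M" by (rule finite_measureI) (simp add: M)
 have m1: "measure M (space M) = 1" using M by (simp add: measure_def)
 have [measurable]: "g \<in> borel_measurable M" using g by simp
 have i2: "integrable M (%x. (g x)\<^sup>2)"
  using False by (intro integrableI_bounded) (auto simp: top.not_eq_extremum)
 have ic: "integrable M (%x. c)" for c :: real
  using fin by (simp add: finite_measure.integrable_const)
 let ?c = "LINT x|M. g x"
 have "0 <= (LINT x|M. (g x - ?c)\<^sup>2)" by simp
 also have "... = (LINT x|M. (g x)\<^sup>2 - 2 * ?c * g x + ?c\<^sup>2)"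
  by (simp add: power2_diff algebra_simps)
 also have "... = (LINT x|M. (g x)\<^sup>2) - 2 * ?c * ?c + ?c\<^sup>2"
  using i2 g ic m1 by simp
 finally have "?c\<^sup>2 <= (LINT x|M. (g x)\<^sup>2)" by (simp add: power2_eq_square)
 then show ?thesis by (subst nn_integral_eq_integral[OF i2]) (auto intro: ennreal_leI)
qed simp

abbreviation unit_ball :: "'a::euclidean_space set" where "unit_ball \<equiv> ball 0 1"

lemma unit_ball_measure:
 "measure lborel (unit_ball :: 'a::euclidean_space set) > 0"
 "emeasure lborel (unit_ball :: 'a::euclidean_space set) ~= \<infinity>"
 using emeasure_bounded_finite[OF bounded_ball, of "0::'a" 1] content_ball_gt_0_iff[of "0::'a" 1] by auto

lemma emeasure_unif_ball: "emeasure (unif (unit_ball :: 'a::euclidean_space set)) UNIV = 1"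
 by (rule emeasure_unif) (use unit_ball_measure in auto)

lemma nn_integral_unif_ball_density:
 "(\<integral>\<^sup>+z. ennreal (indicator unit_ball (z :: 'a::euclidean_space) / measure lborel (unit_ball :: 'a set)) \<partial>lborel) = 1"
 using nn_integral_unif[of "unit_ball :: 'a set" "%_. 1"] emeasure_unif_ball[where 'a='a] by simp

lemma emeasure_unif_Icc: "emeasure (unif {0..1::real}) UNIV = 1"
 by (rule emeasure_unif) auto

lemma unif_bounded_integrable:
 assumes "emeasure (unif A) UNIV = 1" "f \<in> borel_measurable borel" "!!x. abs (f x) <= (B::real)"
 shows "integrable (unif A) f"
proof -
 interpret finite_measure "unif A" by (rule finite_measureI) (simp add: assms)
 show ?thesis by (rule integrable_const_bound[where B=B]) (use assms in auto)
qed

definition dirichlet :: "(real ^ 'n::finite => real) => real" where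
 "dirichlet u = (LINT x|lborel. (norm (grad u x))\<^sup>2)"

lemma norm_grad: "(norm (grad u x))\<^sup>2 = (\<Sum>i\<in>UNIV. (partial_deriv i u x)\<^sup>2)"
 unfolding power2_norm_eq_inner by (simp add: inner_vec_def grad_def power2_eq_square)

lemma dirichlet_integrable:
 assumes "u \<in> test_functions" shows "integrable lborel (%x. (norm (grad u x))\<^sup>2)"
 unfolding norm_grad using tf_mult_integrable[OF tf_partial[OF assms] tf_partial[OF assms]]
 by (intro Bochner_Integration.integrable_sum) (simp add: power2_eq_square)

lemma dirichlet_nonneg [simp]: "dirichlet u >= 0"
 by (simp add: dirichlet_def)

lemma nn_dirichlet:
 assumes "u \<in> test_functions"
 shows "(\<integral>\<^sup>+x. ennreal ((norm (grad u x))\<^sup>2) \<partial>lborel) = ennreal (dirichlet u)"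
 unfolding dirichlet_def by (rule nn_integral_eq_integral[OF dirichlet_integrable[OF assms]]) simp

text \<open>
 The fundamental theorem of calculus on the segment, followed by the Cauchy--Schwarz inequality.
\<close>

lemma tf_segment:
 fixes u :: "real ^ 'n::finite => real"
 assumes u: "u \<in> test_functions"
 shows "ennreal ((u (x + h) - u x)\<^sup>2) <= (\<integral>\<^sup>+t. ennreal ((norm h)\<^sup>2 * (norm (grad u (x + t *\<^sub>R h)))\<^sup>2) \<partial>unif {0..1})"
proof -
 let ?f = "%t. grad u (x + t *\<^sub>R h) \<bullet> h"
 have cont: "continuous_on UNIV ?f"
  by (intro continuous_intros continuous_on_compose2[OF grad_continuous[OF u, of UNIV]]) auto
 have [measurable]: "?f \<in> borel_measurable borel" by (rule borel_measurable_continuous_onI[OF cont])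
 have d: "DERIV (%t. u (x + t *\<^sub>R h)) t :> ?f t" for t
  by (rule tf_line_derivative[OF u])
 have c: "isCont ?f t" for t using cont by (simp add: continuous_on_eq_continuous_at)
 have "(LINT t|lborel. ?f t * indicator {0..1} t) = u (x + 1 *\<^sub>R h) - u (x + 0 *\<^sub>R h)"
  by (rule integral_FTC_Icc_real) (use d c in auto)
 moreover have "(LINT t|unif {0..1}. ?f t) = (LINT t|lborel. ?f t * indicator {0..1} t)"
  unfolding unif_def by (subst integral_density) (auto simp: mult.commute)
 moreover have "integrable lborel (%t. indicator {0..1} t *\<^sub>R ?f t)"
  by (rule borel_integrable_compact) (auto intro: continuous_on_subset[OF cont])
 then have "integrable (unif {0..1}) ?f"
  unfolding unif_def by (subst integrable_density) auto
 ultimately have "ennreal ((u (x + h) - u x)\<^sup>2) <= (\<integral>\<^sup>+t. ennreal ((?f t)\<^sup>2) \<partial>unif {0..1})"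
  using square_mean_le[of "unif {0..1}" ?f] emeasure_unif_Icc by simp
 also have "... <= (\<integral>\<^sup>+t. ennreal ((norm h)\<^sup>2 * (norm (grad u (x + t *\<^sub>R h)))\<^sup>2) \<partial>unif {0..1})"
 proof (intro nn_integral_mono ennreal_leI)
  fix t
  have "\<bar>?f t\<bar>\<^sup>2 <= (norm (grad u (x + t *\<^sub>R h)) * norm h)\<^sup>2"
   by (intro power_mono Cauchy_Schwarz_ineq2) auto
  then show "(?f t)\<^sup>2 <= (norm h)\<^sup>2 * (norm (grad u (x + t *\<^sub>R h)))\<^sup>2"
   by (simp add: power_mult_distrib mult.commute)
 qed
 finally show ?thesis .
qed

lemma unif_Icc_mean:
 assumes "!!t. 0 <= t ==> t <= 1 ==> f t <= c" and [measurable]: "f \<in> borel_measurable borel"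
 shows "(\<integral>\<^sup>+t. f t \<partial>unif {0..1::real}) <= c"
proof -
 have "(\<integral>\<^sup>+t. f t \<partial>unif {0..1::real}) = (\<integral>\<^sup>+t. ennreal (indicator {0..1} t / measure lborel {0..1::real}) * f t \<partial>lborel)"
  by (rule nn_integral_unif) auto
 also have "... <= (\<integral>\<^sup>+t. c * indicator {0..1::real} t \<partial>lborel)"
  using assms(1) by (intro nn_integral_mono) (auto simp: indicator_def)
 also have "... = c" by (simp add: nn_integral_cmult_indicator)
 finally show ?thesis .
qed

lemma nn_integral_unif_swap:
 fixes f :: "'a::euclidean_space => 'b::euclidean_space => ennreal"
 assumes A[measurable]: "A \<in> sets borel" and emA: "emeasure (unif A) UNIV = 1"
  and M: "sigma_finite_measure M" and [measurable_cong]: "sets M = sets borel"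
  and f[measurable]: "(%(x, t). f x t) \<in> borel_measurable (borel \<Otimes>\<^sub>M borel)"
 shows "(\<integral>\<^sup>+x. (\<integral>\<^sup>+t. f x t \<partial>unif A) \<partial>M) = (\<integral>\<^sup>+t. (\<integral>\<^sup>+x. f x t \<partial>M) \<partial>unif A)"
proof -
 interpret U: finite_measure "unif A" by (rule finite_measureI) (simp add: emA)
 interpret M: sigma_finite_measure M by fact
 interpret pair_sigma_finite M "unif A" by standard
 have "(%(x, t). f x t) \<in> borel_measurable (M \<Otimes>\<^sub>M unif A)" by measurable
 from Fubini'[of "%x t. f x t", OF this] show ?thesis by simp
qed

lemma tf_translation:
 fixes u :: "real ^ 'n::finite => real"
 assumes u: "u \<in> test_functions"
 shows "(\<integral>\<^sup>+x. ennreal ((u (x + h) - u x)\<^sup>2) \<partial>lborel) <= ennreal ((norm h)\<^sup>2 * dirichlet u)"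
proof -
 note [measurable] = grad_borel[OF u] tf_borel[OF u]
 let ?g = "%x t. ennreal ((norm h)\<^sup>2 * (norm (grad u (x + t *\<^sub>R h)))\<^sup>2)"
 have "(\<integral>\<^sup>+x. ennreal ((u (x + h) - u x)\<^sup>2) \<partial>lborel) <= (\<integral>\<^sup>+x. (\<integral>\<^sup>+t. ?g x t \<partial>unif {0..1}) \<partial>lborel)"
  by (intro nn_integral_mono tf_segment u)
 also have "... = (\<integral>\<^sup>+t. (\<integral>\<^sup>+x. ?g x t \<partial>lborel) \<partial>unif {0..1})"
  by (rule nn_integral_unif_swap) (auto simp: emeasure_unif_Icc sigma_finite_lborel)
 also have "... <= ennreal ((norm h)\<^sup>2 * dirichlet u)"
 proof (rule unif_Icc_mean)
  fix t :: real
  have "(\<integral>\<^sup>+x. ?g x t \<partial>lborel) = (\<integral>\<^sup>+x. ennreal ((norm h)\<^sup>2) * ennreal ((norm (grad u (t *\<^sub>R h + x)))\<^sup>2) \<partial>lborel)"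
   by (simp add: ennreal_mult add.commute)
  also have "... = ennreal ((norm h)\<^sup>2) * (\<integral>\<^sup>+x. ennreal ((norm (grad u (t *\<^sub>R h + x)))\<^sup>2) \<partial>lborel)"
   by (rule nn_integral_cmult) simp
  also have "... = ennreal ((norm h)\<^sup>2) * ennreal (dirichlet u)"
   using nn_integral_shift[of "%x. ennreal ((norm (grad u x))\<^sup>2)" "t *\<^sub>R h"] by (simp add: nn_dirichlet[OF u])
  finally show "(\<integral>\<^sup>+x. ?g x t \<partial>lborel) <= ennreal ((norm h)\<^sup>2 * dirichlet u)"
   by (simp add: ennreal_mult)
 qed measurable
 finally show ?thesis .
qed

definition avg :: "real => (real ^ 'n::finite => real) => real ^ 'n => real" where
 "avg h u x = (LINT z|unif unit_ball. u (x + h *\<^sub>R z))"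

lemma avg_integrable:
 fixes u :: "real ^ 'n::finite => real"
 assumes u: "u \<in> test_functions" shows "integrable (unif unit_ball) (%z. u (x + h *\<^sub>R z))"
proof -
 obtain R B where "!!x. abs (u x) <= B" using tf_bound[OF u] by metis
 moreover note [measurable] = tf_borel[OF u]
 ultimately show ?thesis by (intro unif_bounded_integrable[where B=B] emeasure_unif_ball) auto
qed

lemma unif_ball_const: "(LINT z|unif (unit_ball :: 'a::euclidean_space set). c) = (c::real)"
 using emeasure_unif_ball[where 'a='a] by (simp add: measure_def)

lemma unif_ball_integrable_const: "integrable (unif (unit_ball :: 'a::euclidean_space set)) (%z. c::real)"
 by (rule unif_bounded_integrable[where B="abs c"]) (auto simp: emeasure_unif_ball)

lemma avg_diff:
 assumes "u \<in> test_functions" "v \<in> test_functions"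
 shows "avg h (%x. u x - v x) x = avg h u x - avg h v x"
 using avg_integrable[OF assms(1)] avg_integrable[OF assms(2)] by (simp add: avg_def)

lemma avg_cmult: "avg h (%x. c * u x) x = c * avg h u x"
 by (simp add: avg_def)

lemma avg_diff_sq:
 fixes u :: "real ^ 'n::finite => real"
 assumes u: "u \<in> test_functions"
 shows "ennreal ((avg h u x - avg k u y)\<^sup>2) <= (\<integral>\<^sup>+z. ennreal ((u (x + h *\<^sub>R z) - u (y + k *\<^sub>R z))\<^sup>2) \<partial>unif unit_ball)"
 using square_mean_le[of "unif unit_ball" "%z. u (x + h *\<^sub>R z) - u (y + k *\<^sub>R z)"] emeasure_unif_ball
  avg_integrable[OF u, of x h] avg_integrable[OF u, of y k]
 by (simp add: avg_def)

lemma unif_ball_le: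
 fixes f :: "'a::euclidean_space => ennreal"
 assumes [measurable]: "f \<in> borel_measurable borel"
 shows "(\<integral>\<^sup>+z. f z \<partial>unif unit_ball) <= ennreal (1 / measure lborel (unit_ball :: 'a set)) * (\<integral>\<^sup>+z. f z \<partial>lborel)"
proof -
 have "(\<integral>\<^sup>+z. f z \<partial>unif unit_ball) = (\<integral>\<^sup>+z. ennreal (indicator unit_ball z / measure lborel (unit_ball :: 'a set)) * f z \<partial>lborel)"
  by (rule nn_integral_unif) auto
 also have "... <= (\<integral>\<^sup>+z. ennreal (1 / measure lborel (unit_ball :: 'a set)) * f z \<partial>lborel)"
  by (intro nn_integral_mono mult_right_mono) (auto simp: indicator_def)
 also have "... = ennreal (1 / measure lborel (unit_ball :: 'a set)) * (\<integral>\<^sup>+z. f z \<partial>lborel)"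
  by (rule nn_integral_cmult) simp
 finally show ?thesis .
qed

text \<open>
 The difference is a mean of \<open>u - u(\<cdot> + h z)\<close>, to which \<open>tf_translation\<close> applies for each \<open>z\<close> in the unit ball.
\<close>

lemma avg_L2:
 fixes u :: "real ^ 'n::finite => real"
 assumes u: "u \<in> test_functions" and h: "0 <= h"
 shows "(\<integral>\<^sup>+x. ennreal ((u x - avg h u x)\<^sup>2) \<partial>lborel) <= ennreal (h\<^sup>2 * dirichlet u)"
proof -
 note [measurable] = tf_borel[OF u]
 let ?g = "%x z. ennreal ((u (x + h *\<^sub>R z) - u x)\<^sup>2)"
 have pt: "ennreal (indicator unit_ball z / measure lborel (unit_ball :: (real^'n) set)) * (\<integral>\<^sup>+x. ?g x z \<partial>lborel)
   <= ennreal (indicator unit_ball z / measure lborel (unit_ball :: (real^'n) set)) * ennreal (h\<^sup>2 * dirichlet u)" for z :: "real ^ 'n"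
  proof (cases "z \<in> unit_ball")
   case True
   have "(\<integral>\<^sup>+x. ?g x z \<partial>lborel) <= ennreal ((norm (h *\<^sub>R z))\<^sup>2 * dirichlet u)"
    by (rule tf_translation[OF u])
   also have "... <= ennreal (h\<^sup>2 * dirichlet u)"
    using True h by (intro ennreal_leI mult_right_mono power_mono) (auto simp: mult_left_le)
   finally show ?thesis by (rule mult_left_mono) simp
  qed simp
 have "(\<integral>\<^sup>+x. ennreal ((u x - avg h u x)\<^sup>2) \<partial>lborel) <= (\<integral>\<^sup>+x. (\<integral>\<^sup>+z. ?g x z \<partial>unif unit_ball) \<partial>lborel)"
 proof (rule nn_integral_mono)
  fix x
  have "avg 0 u x = u x" by (simp add: avg_def unif_ball_const del: lebesgue_integral_const)
  then have "(u x - avg h u x)\<^sup>2 = (avg h u x - avg 0 u x)\<^sup>2" by (simp add: power2_commute)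
  then show "ennreal ((u x - avg h u x)\<^sup>2) <= (\<integral>\<^sup>+z. ?g x z \<partial>unif unit_ball)"
   using avg_diff_sq[OF u, of h x 0 x] by simp
 qed
 also have "... = (\<integral>\<^sup>+z. (\<integral>\<^sup>+x. ?g x z \<partial>lborel) \<partial>unif unit_ball)"
  by (rule nn_integral_unif_swap) (auto simp: emeasure_unif_ball sigma_finite_lborel)
 also have "... = (\<integral>\<^sup>+z. ennreal (indicator unit_ball z / measure lborel (unit_ball :: (real^'n) set)) * (\<integral>\<^sup>+x. ?g x z \<partial>lborel) \<partial>lborel)"
  by (rule nn_integral_unif) auto
 also have "... <= (\<integral>\<^sup>+z. ennreal (indicator unit_ball (z :: real^'n) / measure lborel (unit_ball :: (real^'n) set)) * ennreal (h\<^sup>2 * dirichlet u) \<partial>lborel)"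
  by (intro nn_integral_mono pt)
 also have "... = 1 * ennreal (h\<^sup>2 * dirichlet u)"
  by (subst nn_integral_multc) (measurable, simp only: nn_integral_unif_ball_density)
 finally show ?thesis by simp
qed

definition ball_const :: "'n::finite itself => real" where
 "ball_const _ = 1 / measure lborel (unit_ball :: (real ^ 'n) set)"

lemma ball_const_pos: "ball_const TYPE('n::finite) > 0"
 by (simp add: ball_const_def unit_ball_measure)

lemma avg_Lipschitz:
 fixes u :: "real ^ 'n::finite => real"
 assumes u: "u \<in> test_functions" and h: "0 < h"
 shows "(avg h u x - avg h u y)\<^sup>2 <= ball_const TYPE('n) * (1 / h ^ CARD('n)) * ((norm (x - y))\<^sup>2 * dirichlet u)"
proof -
 note [measurable] = tf_borel[OF u]
 have "ennreal ((avg h u x - avg h u y)\<^sup>2) <= (\<integral>\<^sup>+z. ennreal ((u (x + h *\<^sub>R z) - u (y + h *\<^sub>R z))\<^sup>2) \<partial>unif unit_ball)"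
  by (rule avg_diff_sq[OF u])
 also have "... <= ennreal (ball_const TYPE('n)) * (\<integral>\<^sup>+z. ennreal ((u (x + h *\<^sub>R z) - u (y + h *\<^sub>R z))\<^sup>2) \<partial>lborel)"
  unfolding ball_const_def by (rule unif_ball_le) simp
 also have "(\<integral>\<^sup>+z. ennreal ((u (x + h *\<^sub>R z) - u (y + h *\<^sub>R z))\<^sup>2) \<partial>lborel)
  = (\<integral>\<^sup>+z. ennreal ((u ((y + h *\<^sub>R z) + (x - y)) - u (y + h *\<^sub>R z))\<^sup>2) \<partial>lborel)"
  by (simp add: algebra_simps)
 also have "... = ennreal (1 / h ^ CARD('n)) * (\<integral>\<^sup>+z. ennreal ((u (z + (x - y)) - u z)\<^sup>2) \<partial>lborel)"
  using nn_integral_scale[of "%z. ennreal ((u (z + (x - y)) - u z)\<^sup>2)" h y] h by simp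
 also have "ennreal (ball_const TYPE('n)) * ... <= ennreal (ball_const TYPE('n)) * (ennreal (1 / h ^ CARD('n)) * ennreal ((norm (x - y))\<^sup>2 * dirichlet u))"
  by (intro mult_left_mono tf_translation u) auto
 also have "... = ennreal (ball_const TYPE('n) * (1 / h ^ CARD('n)) * ((norm (x - y))\<^sup>2 * dirichlet u))"
  using h ball_const_pos[where 'n='n] by (simp add: ennreal_mult[symmetric] mult.assoc)
 finally show ?thesis
  using h less_imp_le[OF ball_const_pos[where 'n='n]] by (subst (asm) ennreal_le_iff) auto
qed

text \<open>
 The change per halving of the radius is of order \<open>h\<^sup>1\<^sup>-\<^sup>N\<^sup>/\<^sup>2\<close>. Summed over dyadic scales, this rate determines the
 critical exponent in the local Sobolev inequality.
\<close>

lemma avg_halving: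
 fixes u :: "real ^ 'n::finite => real"
 assumes u: "u \<in> test_functions" and h: "0 < h"
 shows "(avg (2 * h) u x - avg h u x)\<^sup>2 <= ball_const TYPE('n) * (h\<^sup>2 / h ^ CARD('n) * dirichlet u)"
proof -
 interpret U: finite_measure "unif (unit_ball :: (real^'n) set)" by (rule finite_measureI) (simp add: emeasure_unif_ball)
 note [measurable] = tf_borel[OF u] grad_borel[OF u]
 let ?G = "%(z :: real ^ 'n) (t :: real). ennreal ((norm (h *\<^sub>R z))\<^sup>2 * (norm (grad u (x + ((1 + t) * h) *\<^sub>R z)))\<^sup>2)"
 have "ennreal ((avg (2 * h) u x - avg h u x)\<^sup>2) <= (\<integral>\<^sup>+z. ennreal ((u (x + (2 * h) *\<^sub>R z) - u (x + h *\<^sub>R z))\<^sup>2) \<partial>unif unit_ball)"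
  using avg_diff_sq[OF u, of "2 * h" x h x] .
 also have "... <= (\<integral>\<^sup>+z. (\<integral>\<^sup>+t. ?G z t \<partial>unif {0..1}) \<partial>unif unit_ball)"
 proof (rule nn_integral_mono)
  fix z
  show "ennreal ((u (x + (2 * h) *\<^sub>R z) - u (x + h *\<^sub>R z))\<^sup>2) <= (\<integral>\<^sup>+t. ?G z t \<partial>unif {0..1})"
  proof -
   have e: "x + h *\<^sub>R z + h *\<^sub>R z = x + (2 * h) *\<^sub>R z" by (simp only: mult_2 scaleR_left_distrib add.assoc)
   have e': "x + h *\<^sub>R z + t *\<^sub>R (h *\<^sub>R z) = x + ((1 + t) * h) *\<^sub>R z" for t
    by (simp only: distrib_right scaleR_left_distrib add.assoc mult_1 scaleR_scaleR)
   show ?thesis using tf_segment[OF u, of "x + h *\<^sub>R z" "h *\<^sub>R z"] unfolding e e' .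
  qed
 qed
 also have "... = (\<integral>\<^sup>+t. (\<integral>\<^sup>+z. ?G z t \<partial>unif unit_ball) \<partial>unif {0..1})"
 proof (rule nn_integral_unif_swap)
  show "sigma_finite_measure (unif (unit_ball :: (real^'n) set))" by unfold_locales
 qed (auto simp: emeasure_unif_Icc)
 also have "... <= ennreal (ball_const TYPE('n) * (h\<^sup>2 / h ^ CARD('n) * dirichlet u))"
 proof (rule unif_Icc_mean)
  fix t :: real assume t: "0 <= t" "t <= 1"
  have "(\<integral>\<^sup>+z. ?G z t \<partial>unif unit_ball)
   = (\<integral>\<^sup>+z. ennreal (indicator unit_ball z / measure lborel (unit_ball :: (real^'n) set))
     * ?G z t \<partial>lborel)"
   by (rule nn_integral_unif) auto
  also have "... <= (\<integral>\<^sup>+z. ennreal (ball_const TYPE('n) * h\<^sup>2) * ennreal ((norm (grad u (x + ((1 + t) * h) *\<^sub>R z)))\<^sup>2) \<partial>lborel)"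
  proof (rule nn_integral_mono)
   fix z :: "real ^ 'n"
   show "ennreal (indicator unit_ball z / measure lborel (unit_ball :: (real^'n) set))
     * ?G z t
     <= ennreal (ball_const TYPE('n) * h\<^sup>2) * ennreal ((norm (grad u (x + ((1 + t) * h) *\<^sub>R z)))\<^sup>2)"
   proof (cases "z \<in> unit_ball")
    case True
    have "(norm (h *\<^sub>R z))\<^sup>2 <= h\<^sup>2" using True h by (intro power_mono) (auto simp: mult_left_le)
    then have "ball_const TYPE('n) * ((norm (h *\<^sub>R z))\<^sup>2 * (norm (grad u (x + ((1 + t) * h) *\<^sub>R z)))\<^sup>2)
     <= ball_const TYPE('n) * (h\<^sup>2 * (norm (grad u (x + ((1 + t) * h) *\<^sub>R z)))\<^sup>2)"
     using ball_const_pos[where 'n='n] by (intro mult_left_mono mult_right_mono) auto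
    then show ?thesis using True ball_const_pos[where 'n='n]
     by (simp add: ball_const_def ennreal_mult[symmetric] mult.assoc ennreal_leI)
   qed simp
  qed
  also have "... = ennreal (ball_const TYPE('n) * h\<^sup>2) * (\<integral>\<^sup>+z. ennreal ((norm (grad u (x + ((1 + t) * h) *\<^sub>R z)))\<^sup>2) \<partial>lborel)"
   by (rule nn_integral_cmult) simp
  also have "(\<integral>\<^sup>+z. ennreal ((norm (grad u (x + ((1 + t) * h) *\<^sub>R z)))\<^sup>2) \<partial>lborel)
   = ennreal (1 / ((1 + t) * h) ^ CARD('n)) * ennreal (dirichlet u)"
   using nn_integral_scale[of "%z. ennreal ((norm (grad u z))\<^sup>2)" "(1 + t) * h" x] h t
   by (simp add: nn_dirichlet[OF u])
  also have "... <= ennreal (1 / h ^ CARD('n)) * ennreal (dirichlet u)"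
  proof (intro mult_right_mono ennreal_leI divide_left_mono power_mono)
   show "h <= (1 + t) * h" using h t by (simp add: algebra_simps)
  qed (use h t in auto)
  also have "ennreal (ball_const TYPE('n) * h\<^sup>2) * (ennreal (1 / h ^ CARD('n)) * ennreal (dirichlet u))
   = ennreal (ball_const TYPE('n) * (h\<^sup>2 / h ^ CARD('n) * dirichlet u))"
   using h ball_const_pos[where 'n='n] by (simp add: ennreal_mult[symmetric] mult.assoc)
  finally show "(\<integral>\<^sup>+z. ?G z t \<partial>unif unit_ball)
   <= ennreal (ball_const TYPE('n) * (h\<^sup>2 / h ^ CARD('n) * dirichlet u))"
   by (simp add: mult_left_mono)
 qed measurable
 finally show ?thesis
  using h less_imp_le[OF ball_const_pos[where 'n='n]] by (subst (asm) ennreal_le_iff) auto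
qed

section \<open>Weighted integrals\<close>

lemma ex_dyadic:
 fixes t a g :: real
 assumes "0 < a" "1 < g" "a < t"
 obtains k :: nat where "a * g ^ k < t" "t <= a * g ^ Suc k"
proof -
 obtain n where "t / a < g ^ n" using real_arch_pow[OF assms(2)] by blast
 then have ex: "EX n. t <= a * g ^ n" using assms by (intro exI[of _ n]) (simp add: field_simps)
 define k where "k = (LEAST n. t <= a * g ^ n)"
 have k: "t <= a * g ^ k" unfolding k_def by (rule LeastI_ex[OF ex])
 have "k ~= 0" using k assms by (intro notI) simp
 then obtain j where j: "k = Suc j" by (cases k) auto
 have "~ t <= a * g ^ j" using not_less_Least[of j "%n. t <= a * g ^ n"] j by (simp add: k_def)
 then show ?thesis using k j that[of j] by auto
qed

lemma suminf_term_le: "f k <= (\<Sum>i. f i)" for f :: "nat => ennreal"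
 using sum_le_suminf[OF summableI, of "{k}" f] by simp

lemma emeasure_ball_power:
 "0 <= r ==> emeasure lborel (ball (0 :: 'a::euclidean_space) r) = ennreal (unit_ball_vol (real DIM('a)) * r ^ DIM('a))"
 by (simp add: emeasure_ball)

text \<open>Integrability of radial powers near the origin and near infinity, by dyadic decomposition.\<close>

lemma radial_near:
 assumes m: "0 <= m" "m < real DIM('a)" and R: "0 < R"
 shows "(\<integral>\<^sup>+x. ennreal (norm x powr (- m)) * indicator (ball (0 :: 'a::euclidean_space) R) x \<partial>lborel) < \<infinity>"
proof -
 let ?N = "DIM('a)"
 define f where "f = (%k x. ennreal ((R / 2 ^ Suc k) powr (- m)) * indicator (ball (0 :: 'a) (R / 2 ^ k)) x)"
 have pt: "ennreal (norm x powr (- m)) * indicator (ball 0 R) x <= (\<Sum>k. f k x)" for x :: 'a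
 proof (cases "x \<in> ball 0 R & x ~= 0")
  case True
  then have "norm x < R" "0 < norm x" by auto
  then have T: "1 < 2 * (R / norm x)" using R by (simp add: field_simps)
  have d: "0 < (1::real)" "1 < (2::real)" by auto
  obtain k where k: "1 * 2 ^ k < 2 * (R / norm x)" "2 * (R / norm x) <= 1 * 2 ^ Suc k"
   using ex_dyadic[OF d T] by blast
  obtain k' where k': "norm x < R / 2 ^ k'" "R / 2 ^ Suc k' <= norm x"
  proof (cases "R / norm x <= 2 ^ k & norm x < R / 2 ^ k")
   case True
   then show ?thesis using that[of k] \<open>x \<in> ball 0 R & x ~= 0\<close> R by (simp add: field_simps)
  next
   case False
   have n0: "norm x > 0" using \<open>x \<in> ball 0 R & x ~= 0\<close> by simp
   have "R / norm x <= 2 ^ k" using k(2) by simp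
   with False have "~ norm x < R / 2 ^ k" by blast
   then have a: "R <= norm x * 2 ^ k" by (simp add: field_simps)
   have "k ~= 0" using a \<open>x \<in> ball 0 R & x ~= 0\<close> by (intro notI) simp
   then obtain j where j: "k = Suc j" by (cases k) auto
   have "norm x < R / 2 ^ j" using k(1) n0 by (simp add: j field_simps)
   moreover have "R / 2 ^ Suc j <= norm x" using a by (simp add: j field_simps)
   ultimately show ?thesis by (rule that)
  qed
  have "norm x powr (- m) <= (R / 2 ^ Suc k') powr (- m)"
   using k' R m by (intro powr_mono2') auto
  then have "ennreal (norm x powr (- m)) * indicator (ball 0 R) x <= f k' x"
   using True k' by (simp add: f_def ennreal_leI)
  also have "... <= (\<Sum>k. f k x)" by (rule suminf_term_le)
  finally show ?thesis .
 qed auto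
 have "(\<integral>\<^sup>+x. ennreal (norm x powr (- m)) * indicator (ball (0 :: 'a) R) x \<partial>lborel) <= (\<integral>\<^sup>+x. (\<Sum>k. f k x) \<partial>lborel)"
  by (intro nn_integral_mono pt)
 also have "... = (\<Sum>k. \<integral>\<^sup>+x. f k x \<partial>lborel)"
  by (rule nn_integral_suminf) (simp add: f_def)
 also have "... = (\<Sum>k. ennreal ((R / 2) powr (- m) * (unit_ball_vol (real ?N) * R ^ ?N) * (2 powr (m - ?N)) ^ k))"
 proof (rule arg_cong[where f=suminf], rule ext)
  fix k
  have "(\<integral>\<^sup>+x. f k x \<partial>lborel) = ennreal ((R / 2 ^ Suc k) powr (- m)) * ennreal (unit_ball_vol (real ?N) * (R / 2 ^ k) ^ ?N)"
   unfolding f_def using R by (subst nn_integral_cmult_indicator) (auto simp: emeasure_ball_power)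
  also have "... = ennreal ((R / 2 ^ Suc k) powr (- m) * (unit_ball_vol (real ?N) * (R / 2 ^ k) ^ ?N))"
   using R by (subst ennreal_mult) auto
  also have "(R / 2 ^ Suc k) powr (- m) * (unit_ball_vol (real ?N) * (R / 2 ^ k) ^ ?N)
   = (R / 2) powr (- m) * (unit_ball_vol (real ?N) * R ^ ?N) * (2 powr (m - ?N)) ^ k"
  proof -
   have p: "(2 powr (m - ?N)) ^ k = (2 ^ k) powr m / (2 ^ k) ^ ?N"
   proof -
    have "(2 powr (m - ?N)) ^ k = 2 powr ((m - ?N) * k)" by (simp add: powr_power mult.commute)
    also have "... = (2 powr k) powr (m - ?N)" by (simp add: powr_powr mult.commute)
    also have "... = (2 ^ k) powr (m - ?N)" by (simp add: powr_realpow)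
    also have "... = (2 ^ k) powr m / (2 ^ k) powr ?N" by (simp add: powr_diff)
    also have "(2 ^ k) powr ?N = (2 ^ k) ^ ?N" by (simp add: powr_realpow)
    finally show ?thesis .
   qed
   have "(R / 2 ^ Suc k) powr (- m) = ((R / 2) / 2 ^ k) powr (- m)" by simp
   also have "... = (R / 2) powr (- m) / (2 ^ k) powr (- m)" using R by (simp add: powr_divide powr_mult)
   also have "... = (R / 2) powr (- m) * (2 ^ k) powr m"
    by (simp only: powr_minus[of "2 ^ k" m] divide_inverse inverse_inverse_eq)
   finally show ?thesis by (simp add: p power_divide)
  qed
  finally show "(\<integral>\<^sup>+x. f k x \<partial>lborel) = ennreal ((R / 2) powr (- m) * (unit_ball_vol (real ?N) * R ^ ?N) * (2 powr (m - ?N)) ^ k)" .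
 qed
 also have "... < \<infinity>"
 proof -
  have "summable (%k. (R / 2) powr (- m) * (unit_ball_vol (real ?N) * R ^ ?N) * (2 powr (m - ?N)) ^ k)"
   using m by (intro summable_mult summable_geometric) (simp add: powr_less_one)
  then have "(\<Sum>k. ennreal ((R / 2) powr (- m) * (unit_ball_vol (real ?N) * R ^ ?N) * (2 powr (m - ?N)) ^ k)) ~= top"
   using R by (intro ennreal_suminf_neq_top) auto
  then show ?thesis by (simp add: top.not_eq_extremum)
 qed
 finally show ?thesis .
qed

lemma radial_far:
 assumes m: "real DIM('a) < m"
 shows "(\<integral>\<^sup>+x. ennreal (norm x powr (- m)) * indicator (- ball (0 :: 'a::euclidean_space) 1) x \<partial>lborel) < \<infinity>"
proof -
 let ?N = "DIM('a)"
 define f where "f = (%k x. ennreal ((2 ^ k) powr (- m)) * indicator (ball (0 :: 'a) (2 ^ Suc k)) x)"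
 have pt: "ennreal (norm x powr (- m)) * indicator (- ball 0 1) x <= (\<Sum>k. f k x)" for x :: 'a
 proof (cases "norm x >= 1")
  case True
  obtain k where k: "(1/2) * 2 ^ k < norm x" "norm x <= (1/2) * 2 ^ Suc k"
   using ex_dyadic[of "1/2" 2 "norm x"] True by auto
  obtain k' where k': "2 ^ k' <= norm x" "norm x < 2 ^ Suc k'"
  proof (cases "norm x = 2 ^ k")
   case True
   then show ?thesis using that[of k] by simp
  next
   case False
   then have "norm x < 2 ^ k" using k(2) by simp
   moreover from this True have "k ~= 0" by (intro notI) simp
   then obtain j where "k = Suc j" by (cases k) auto
   ultimately show ?thesis using that[of j] k(1) by simp
  qed
  have "norm x powr (- m) <= (2 ^ k') powr (- m)"
   using k' m by (intro powr_mono2') auto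
  then have "ennreal (norm x powr (- m)) * indicator (- ball 0 1) x <= f k' x"
   using True k' by (simp add: f_def ennreal_leI)
  also have "... <= (\<Sum>k. f k x)" by (rule suminf_term_le)
  finally show ?thesis .
 qed auto
 have "(\<integral>\<^sup>+x. ennreal (norm x powr (- m)) * indicator (- ball (0 :: 'a) 1) x \<partial>lborel) <= (\<integral>\<^sup>+x. (\<Sum>k. f k x) \<partial>lborel)"
  by (intro nn_integral_mono pt)
 also have "... = (\<Sum>k. \<integral>\<^sup>+x. f k x \<partial>lborel)"
  by (rule nn_integral_suminf) (simp add: f_def)
 also have "... = (\<Sum>k. ennreal ((unit_ball_vol (real ?N) * 2 ^ ?N) * (2 powr (?N - m)) ^ k))"
 proof (rule arg_cong[where f=suminf], rule ext)
  fix k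
  have "(\<integral>\<^sup>+x. f k x \<partial>lborel) = ennreal ((2 ^ k) powr (- m)) * ennreal (unit_ball_vol (real ?N) * (2 ^ Suc k) ^ ?N)"
   unfolding f_def by (subst nn_integral_cmult_indicator) (auto simp: emeasure_ball_power)
  also have "... = ennreal ((2 ^ k) powr (- m) * (unit_ball_vol (real ?N) * (2 ^ Suc k) ^ ?N))"
   by (subst ennreal_mult) auto
  also have "(2 ^ k) powr (- m) * (unit_ball_vol (real ?N) * (2 ^ Suc k) ^ ?N)
   = (unit_ball_vol (real ?N) * 2 ^ ?N) * (2 powr (?N - m)) ^ k"
  proof -
   have "(2 powr (?N - m)) ^ k = 2 powr ((?N - m) * k)" by (simp add: powr_power mult.commute)
   also have "... = (2 powr k) powr (?N - m)" by (simp add: powr_powr mult.commute)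
   also have "... = (2 ^ k) powr (?N - m)" by (simp add: powr_realpow)
   also have "... = (2 ^ k) powr ?N * (2 ^ k) powr (- m)" by (simp add: powr_add[symmetric])
   also have "(2 ^ k) powr ?N = (2 ^ k) ^ ?N" by (simp add: powr_realpow)
   finally show ?thesis by (simp add: power_mult_distrib)
  qed
  finally show "(\<integral>\<^sup>+x. f k x \<partial>lborel) = ennreal ((unit_ball_vol (real ?N) * 2 ^ ?N) * (2 powr (?N - m)) ^ k)" .
 qed
 also have "... < \<infinity>"
 proof -
  have "summable (%k. (unit_ball_vol (real ?N) * 2 ^ ?N) * (2 powr (?N - m)) ^ k)"
   using m by (intro summable_mult summable_geometric) (simp add: powr_less_one)
  then have "(\<Sum>k. ennreal ((unit_ball_vol (real ?N) * 2 ^ ?N) * (2 powr (?N - m)) ^ k)) ~= top"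
   by (intro ennreal_suminf_neq_top) auto
  then show ?thesis by (simp add: top.not_eq_extremum)
 qed
 finally show ?thesis .
qed

definition wmeas :: "real => (real ^ 'n::finite) measure" where
 "wmeas \<eta> = density lborel (%x. ennreal (norm x powr (- \<eta>)))"

lemma sets_wmeas [simp, measurable_cong]: "sets (wmeas \<eta>) = sets borel"
 by (simp add: wmeas_def)

lemma space_wmeas [simp]: "space (wmeas \<eta>) = UNIV"
 by (simp add: wmeas_def)

lemma nn_integral_wmeas:
 assumes [measurable]: "f \<in> borel_measurable borel"
 shows "(\<integral>\<^sup>+x. f x \<partial>wmeas \<eta>) = (\<integral>\<^sup>+x. ennreal (norm x powr (- \<eta>)) * f x \<partial>lborel)"
 unfolding wmeas_def by (subst nn_integral_density) auto

lemma tf_Lspace_wmeas: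
 fixes u :: "real ^ 'n::finite => real"
 assumes u: "u \<in> test_functions" and \<eta>: "0 <= \<eta>" "\<eta> < real CARD('n)" and r: "0 < r"
 shows "u \<in> Lspace (wmeas \<eta>) r"
proof -
 obtain R B where RB: "R > 0" "B > 0" "!!x. abs (u x) <= B" "!!x. norm x >= R ==> u x = 0" using tf_bound[OF u] by metis
 note [measurable] = tf_borel[OF u]
 have "(\<integral>\<^sup>+x. ennreal (abs (u x) powr r) \<partial>wmeas \<eta>) = (\<integral>\<^sup>+x. ennreal (norm x powr (- \<eta>)) * ennreal (abs (u x) powr r) \<partial>lborel)"
  by (rule nn_integral_wmeas) simp
 also have "... <= (\<integral>\<^sup>+x. ennreal (B powr r) * (ennreal (norm x powr (- \<eta>)) * indicator (ball (0::real^'n) R) x) \<partial>lborel)"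
 proof (rule nn_integral_mono)
  fix x
  show "ennreal (norm x powr (- \<eta>)) * ennreal (abs (u x) powr r) <= ennreal (B powr r) * (ennreal (norm x powr (- \<eta>)) * indicator (ball 0 R) x)"
  proof (cases "norm x < R")
   case True
   have "abs (u x) powr r <= B powr r" using RB r by (intro powr_mono2) auto
   then have "norm x powr (- \<eta>) * abs (u x) powr r <= B powr r * norm x powr (- \<eta>)"
    by (subst mult.commute) (rule mult_right_mono, auto)
   then show ?thesis using True by (simp add: ennreal_mult[symmetric] ennreal_leI)
  next
   case False
   then show ?thesis using RB(4)[of x] by simp
  qed
 qed
 also have "... = ennreal (B powr r) * (\<integral>\<^sup>+x. ennreal (norm x powr (- \<eta>)) * indicator (ball (0::real^'n) R) x \<partial>lborel)"
  by (rule nn_integral_cmult) simp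
 also have "... < \<infinity>"
  using radial_near[where 'a="real^'n", OF \<eta>(1) _ RB(1)] \<eta>(2) by (simp add: ennreal_mult_less_top)
 finally show ?thesis
  unfolding Lspace_def by (auto intro!: integrableI_bounded)
qed

lemma nn_pint:
 assumes "u \<in> Lspace M r"
 shows "(\<integral>\<^sup>+x. ennreal (abs (u x) powr r) \<partial>M) = ennreal (pint M r u)"
 unfolding pint_def by (rule nn_integral_eq_integral) (use LspaceD[OF assms] in auto)

lemma nn_pint_wmeas:
 fixes u :: "real ^ 'n::finite => real"
 assumes "u \<in> Lspace (wmeas \<eta>) r"
 shows "(\<integral>\<^sup>+x. ennreal (norm x powr (- \<eta>) * abs (u x) powr r) \<partial>lborel) = ennreal (pint (wmeas \<eta>) r u)"
proof -
 have [measurable]: "u \<in> borel_measurable borel"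
  using LspaceD(1)[OF assms] by (simp add: wmeas_def)
 have "(\<integral>\<^sup>+x. ennreal (norm x powr (- \<eta>) * abs (u x) powr r) \<partial>lborel) = (\<integral>\<^sup>+x. ennreal (abs (u x) powr r) \<partial>wmeas \<eta>)"
  by (subst nn_integral_wmeas) (auto simp: ennreal_mult)
 then show ?thesis using nn_pint[OF assms] by simp
qed

section \<open>Local estimates\<close>

lemma AE_nonzero: "AE x in lborel. x ~= (0 :: 'a::euclidean_space)"
 by (rule AE_lborel_singleton)

text \<open>
 Starts the dyadic chain at radius \<open>1\<close>, and provides a bound for dominated convergence at a fixed radius.
\<close>

lemma avg_bound:
 fixes u :: "real ^ 'n::finite => real"
 assumes u: "u \<in> test_functions" and b: "0 <= b" "b < real CARD('n)" and q: "1 < q"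
  and h: "0 < h" "h <= 1" and x: "norm x <= R"
 shows "abs (avg h u x) <= 1 + ball_const TYPE('n) * (1 / h ^ CARD('n)) * ((R + 1) powr b * pint (wmeas b) q u)"
proof -
 note [measurable] = tf_borel[OF u]
 let ?f = "%y. ennreal (abs (u y) powr q) * indicator (ball 0 (R + 1)) y"
 let ?Q = "pint (wmeas b) q u"
 have R: "R >= 0" using x norm_ge_zero order_trans by blast
 have "ennreal (norm (avg h u x)) <= (\<integral>\<^sup>+z. ennreal (norm (u (x + h *\<^sub>R z))) \<partial>unif unit_ball)"
  unfolding avg_def by (rule integral_norm_bound_ennreal[OF avg_integrable[OF u]])
 also have "... = (\<integral>\<^sup>+z. ennreal (indicator unit_ball z / measure lborel (unit_ball :: (real^'n) set)) * ennreal (norm (u (x + h *\<^sub>R z))) \<partial>lborel)"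
  by (rule nn_integral_unif) auto
 also have "... <= (\<integral>\<^sup>+z. ennreal (indicator unit_ball z / measure lborel (unit_ball :: (real^'n) set)) + ennreal (ball_const TYPE('n)) * ?f (x + h *\<^sub>R z) \<partial>lborel)"
 proof (rule nn_integral_mono)
  fix z :: "real ^ 'n"
  show "ennreal (indicator unit_ball z / measure lborel (unit_ball :: (real^'n) set)) * ennreal (norm (u (x + h *\<^sub>R z)))
   <= ennreal (indicator unit_ball z / measure lborel (unit_ball :: (real^'n) set)) + ennreal (ball_const TYPE('n)) * ?f (x + h *\<^sub>R z)"
  proof (cases "z \<in> unit_ball")
   case True
   let ?y = "x + h *\<^sub>R z"
   have "norm ?y <= norm x + norm (h *\<^sub>R z)" by (rule norm_triangle_ineq)
   also have "norm (h *\<^sub>R z) < 1"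
   proof -
    have "norm (h *\<^sub>R z) = h * norm z" using h by simp
    also have "... <= norm z" using h mult_right_mono[of h 1 "norm z"] by simp
    also have "... < 1" using True by simp
    finally show ?thesis .
   qed
   finally have y: "?y \<in> ball 0 (R + 1)" using x by simp
   have "\<bar>u ?y\<bar> <= 1 + \<bar>u ?y\<bar> powr q"
   proof (cases "\<bar>u ?y\<bar> <= 1")
    case False
    then have "\<bar>u ?y\<bar> powr 1 <= \<bar>u ?y\<bar> powr q" using q by (intro powr_mono) auto
    then show ?thesis by simp
   qed (simp add: add_increasing2)
   then have "ball_const TYPE('n) * \<bar>u ?y\<bar> <= ball_const TYPE('n) + ball_const TYPE('n) * \<bar>u ?y\<bar> powr q"
    using mult_left_mono[of "\<bar>u ?y\<bar>" "1 + \<bar>u ?y\<bar> powr q" "ball_const TYPE('n)"] ball_const_pos[where 'n='n]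
    by (simp add: distrib_left)
   then show ?thesis using True y ball_const_pos[where 'n='n]
    by (simp add: ball_const_def ennreal_mult[symmetric] ennreal_plus[symmetric] del: ennreal_plus)
  qed simp
 qed
 also have "... = (\<integral>\<^sup>+z. ennreal (indicator unit_ball (z :: real^'n) / measure lborel (unit_ball :: (real^'n) set)) \<partial>lborel)
   + ennreal (ball_const TYPE('n)) * (\<integral>\<^sup>+z. ?f (x + h *\<^sub>R z) \<partial>lborel)"
  by (subst nn_integral_add) (auto simp: nn_integral_cmult)
 also have "(\<integral>\<^sup>+z. ennreal (indicator unit_ball (z :: real^'n) / measure lborel (unit_ball :: (real^'n) set)) \<partial>lborel) = 1"
  by (rule nn_integral_unif_ball_density)
 also have "(\<integral>\<^sup>+z. ?f (x + h *\<^sub>R z) \<partial>lborel) = ennreal (1 / h ^ CARD('n)) * (\<integral>\<^sup>+y. ?f y \<partial>lborel)"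
  using nn_integral_scale[of ?f h x] h by simp
 also have "(\<integral>\<^sup>+y. ?f y \<partial>lborel) <= (\<integral>\<^sup>+y. ennreal ((R + 1) powr b) * ennreal (norm y powr (- b) * abs (u y) powr q) \<partial>lborel)"
 proof (rule nn_integral_mono_AE)
  show "AE y in lborel. ?f y <= ennreal ((R + 1) powr b) * ennreal (norm y powr (- b) * abs (u y) powr q)"
   using AE_nonzero
  proof eventually_elim
   case (elim y)
   show ?case
   proof (cases "norm y < R + 1")
    case True
    have "norm y powr b <= (R + 1) powr b" using True b R by (intro powr_mono2) auto
    then have "1 <= (R + 1) powr b * norm y powr (- b)"
     using elim by (simp add: powr_minus field_simps)
    then have "1 * abs (u y) powr q <= ((R + 1) powr b * norm y powr (- b)) * abs (u y) powr q"
     by (rule mult_right_mono) simp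
    then show ?thesis using True
     by (simp add: ennreal_mult[symmetric] mult.assoc ennreal_leI)
   qed simp
  qed
 qed
 also have "... = ennreal ((R + 1) powr b) * ennreal ?Q"
  using q by (subst nn_integral_cmult) (auto simp: nn_pint_wmeas[OF tf_Lspace_wmeas[OF u b]])
 finally have "ennreal (norm (avg h u x)) <= 1 + ennreal (ball_const TYPE('n)) * (ennreal (1 / h ^ CARD('n)) * (ennreal ((R + 1) powr b) * ennreal ?Q))"
  by (simp add: add_left_mono mult_left_mono)
 also have "... = ennreal (1 + ball_const TYPE('n) * (1 / h ^ CARD('n)) * ((R + 1) powr b * ?Q))"
  using h ball_const_pos[where 'n='n]
  by (simp add: ennreal_mult[symmetric] mult.assoc ennreal_plus[symmetric] ennreal_1[symmetric] del: ennreal_plus ennreal_1)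
 finally show ?thesis
  using h ball_const_pos[where 'n='n] by (subst (asm) ennreal_le_iff) (auto intro!: add_nonneg_nonneg mult_nonneg_nonneg)
qed

lemma avg_borel:
 fixes u :: "real ^ 'n::finite => real"
 assumes u: "u \<in> test_functions" shows "avg h u \<in> borel_measurable borel"
proof -
 interpret U: finite_measure "unif (unit_ball :: (real^'n) set)" by (rule finite_measureI) (simp add: emeasure_unif_ball)
 note [measurable] = tf_borel[OF u]
 have "(%(x, z). u (x + h *\<^sub>R z)) \<in> borel_measurable (borel \<Otimes>\<^sub>M unif unit_ball)" by measurable
 then have "(%x. LINT z|unif unit_ball. u (x + h *\<^sub>R z)) \<in> borel_measurable borel"
  by (intro U.borel_measurable_lebesgue_integral) simp
 then show ?thesis by (simp add: avg_def[abs_def])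
qed

text \<open>
 The local Sobolev inequality below the critical exponent: the averages at scale \<open>2\<^sup>-\<^sup>k\<close> are bounded
 by \<open>K g\<^sup>k\<close> with \<open>g = 2\<^sup>\<kappa>\<close> for each \<open>\<kappa> > (N - 2)/2\<close>, so where \<open>|u|\<close> is of size \<open>2 K g\<^sup>k\<close> it is
 controlled by its difference from the average, which is of size \<open>2\<^sup>-\<^sup>k\<close> in \<open>L\<^sup>2\<close>.
\<close>

lemma local_Sobolev:
 assumes s: "2 <= s" "(real CARD('n) - 2) * s < 2 * real CARD('n)" and N: "2 <= CARD('n)"
  and b: "0 <= b" "b < real CARD('n)" and q: "1 < q"
 shows "EX C>=0. ALL u:(test_functions :: (real ^ 'n::finite => real) set).
  dirichlet u <= 1 --> pint (wmeas b) q u <= 1 -->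
  (\<integral>\<^sup>+x. ennreal (abs (u x) powr s) * indicator (ball 0 1) x \<partial>lborel) <= ennreal C"
proof -
 let ?N = "real CARD('n)"
 obtain \<kappa> where \<kappa>: "\<kappa> > 0" "(?N - 2) / 2 <= \<kappa>" "\<kappa> * (s - 2) < 2"
 proof (cases "s = 2")
  case True
  then show ?thesis using that[of ?N] N by simp
 next
  case False
  then have s2: "s - 2 > 0" using s by simp
  have "(?N - 2) / 2 < 2 / (s - 2)"
   using s(2) s2 by (simp add: field_simps)
  moreover have "0 < 2 / (s - 2)" using s2 by simp
  ultimately obtain k where "max 0 ((?N - 2) / 2) < k" "k < 2 / (s - 2)"
   using dense[of "max 0 ((?N - 2) / 2)" "2 / (s - 2)"] by auto
  then show ?thesis using that[of k] s2 by (simp add: field_simps)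
 qed
 define g where "g = 2 powr \<kappa>"
 have g: "g > 1" using \<kappa>(1) by (simp add: g_def)
 define C1 where "C1 = sqrt (ball_const TYPE('n))"
 define K where "K = max (1 + ball_const TYPE('n) * 2 powr b) (C1 * g / (g - 1))"
 have K: "K > 0" "K >= 1 + ball_const TYPE('n) * 2 powr b" "C1 * g <= K * (g - 1)"
 proof -
  have "1 + ball_const TYPE('n) * 2 powr b > 0" using ball_const_pos[where 'n='n] by (simp add: add_pos_nonneg)
  then show "K > 0" by (simp add: K_def)
  have "C1 * g / (g - 1) <= K" by (simp add: K_def)
  then show "C1 * g <= K * (g - 1)" using g by (simp add: field_simps)
 qed (simp add: K_def)
 let ?\<rho> = "g powr (s - 2) / 4"
 have \<rho>: "?\<rho> < 1"
 proof -
  have "g powr (s - 2) = 2 powr (\<kappa> * (s - 2))" by (simp add: g_def powr_powr)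
  also have "... < 2 powr 2" using \<kappa>(3) by (intro powr_less_mono) auto
  finally show ?thesis by simp
 qed
 define c where "c = (%k. 4 * (2 * K * g ^ Suc k) powr (s - 2))"
 have c0: "c k >= 0" for k by (simp add: c_def)
 define D where "D = (%k. 4 * (2 * K * g) powr (s - 2) * ?\<rho> ^ k)"
 have cD: "c k * ((1/2) ^ k)\<^sup>2 = D k" for k
 proof -
  have "(2 * K * g ^ Suc k) powr (s - 2) = ((2 * K * g) * g ^ k) powr (s - 2)" by (simp add: mult_ac)
  also have "... = (2 * K * g) powr (s - 2) * (g ^ k) powr (s - 2)"
   using K g by (subst powr_mult) auto
  also have "(g ^ k) powr (s - 2) = (g powr (s - 2)) ^ k"
   using g by (simp add: powr_realpow[symmetric] powr_powr mult.commute)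
  finally have 1: "(2 * K * g ^ Suc k) powr (s - 2) = (2 * K * g) powr (s - 2) * (g powr (s - 2)) ^ k" .
  have "((1/2::real) ^ k)\<^sup>2 = 1 / 4 ^ k" by (simp add: power_divide power_mult_distrib[symmetric] power2_eq_square)
  then show ?thesis by (simp add: c_def D_def 1 power_divide del: power_Suc)
 qed
 have sumD: "summable D" unfolding D_def using \<rho> by (intro summable_mult summable_geometric) simp
 have D0: "D k >= 0" for k by (simp add: D_def)
 define V where "V = measure lborel (ball (0 :: real ^ 'n) 1)"
 have V: "emeasure lborel (ball (0 :: real ^ 'n) 1) = ennreal V" "V >= 0"
  using unit_ball_measure(2)[where 'a="real^'n"] by (auto simp: V_def emeasure_eq_ennreal_measure)
 define C where "C = (2 * K) powr s * V + suminf D"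
 have sD: "suminf D >= 0" using sumD D0 by (rule suminf_nonneg)
 have "(\<integral>\<^sup>+x. ennreal (abs (u x) powr s) * indicator (ball 0 1) x \<partial>lborel) <= ennreal C"
  if u: "u \<in> test_functions" and d: "dirichlet u <= 1" and Q: "pint (wmeas b) q u <= 1" for u :: "real ^ 'n => real"
 proof -
  note [measurable] = tf_borel[OF u] avg_borel[OF u]
  have A: "\<bar>avg ((1/2) ^ k) u x\<bar> <= K * g ^ k" if x: "norm x <= 1" for k x
  proof (induction k)
   case 0
   have "abs (avg 1 u x) <= 1 + ball_const TYPE('n) * (1 / 1 ^ CARD('n)) * ((1 + 1) powr b * pint (wmeas b) q u)"
    by (rule avg_bound[OF u b q]) (use x in auto)
   also have "... <= 1 + ball_const TYPE('n) * (1 / 1 ^ CARD('n)) * ((1 + 1) powr b * 1)"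
    using Q ball_const_pos[where 'n='n] by (intro add_left_mono mult_left_mono) auto
   also have "... <= K" using K(2) by simp
   finally show ?case by simp
  next
   case (Suc k)
   define h where "h = (1/2::real) ^ Suc k"
   have h: "0 < h" "h <= 1"
    using power_le_one[of "1/2::real" "Suc k"] by (simp_all add: h_def del: power_Suc)
   have 2: "2 * h = (1/2) ^ k" by (simp add: h_def)
   have "(avg (2 * h) u x - avg h u x)\<^sup>2 <= ball_const TYPE('n) * (h\<^sup>2 / h ^ CARD('n) * dirichlet u)"
    by (rule avg_halving[OF u h(1)])
   also have "... <= ball_const TYPE('n) * (h\<^sup>2 / h ^ CARD('n) * 1)"
    using d h ball_const_pos[where 'n='n] by (intro mult_left_mono) auto
   also have "h\<^sup>2 / h ^ CARD('n) = h powr (2 - ?N)"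
    using h by (simp add: powr_diff powr_realpow)
   also have "h powr (2 - ?N) <= h powr (- (2 * \<kappa>))"
    using h \<kappa>(2) by (intro powr_mono') auto
   also have "h powr (- (2 * \<kappa>)) = (g ^ Suc k)\<^sup>2"
   proof -
    have "h = 2 powr (- real (Suc k))" by (simp add: h_def powr_minus powr_realpow power_one_over inverse_eq_divide del: power_Suc of_nat_Suc)
    then have "h powr (- (2 * \<kappa>)) = 2 powr (real (Suc k) * (2 * \<kappa>))" by (simp add: powr_powr del: of_nat_Suc)
    also have "... = (2 powr \<kappa>) powr (real (2 * Suc k))" by (simp add: powr_powr mult_ac)
    also have "... = g ^ (2 * Suc k)" using g unfolding g_def[symmetric] by (subst powr_realpow) auto
    finally show ?thesis by (metis power_mult mult.commute)
   qed
   finally have "(avg (2 * h) u x - avg h u x)\<^sup>2 <= (C1 * g ^ Suc k)\<^sup>2"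
    using ball_const_pos[where 'n='n] by (simp add: C1_def power_mult_distrib mult_left_mono)
   then have "\<bar>avg (2 * h) u x - avg h u x\<bar> <= C1 * g ^ Suc k"
    using g ball_const_pos[where 'n='n] by (subst (asm) abs_le_square_iff[symmetric]) (auto simp: C1_def)
   then have "abs (avg h u x) <= K * g ^ k + C1 * g ^ Suc k" using Suc.IH unfolding 2 by linarith
   also have "... = g ^ k * (K + C1 * g)" by (simp add: algebra_simps)
   also have "... <= g ^ k * (K * g)"
    using K(3) g by (intro mult_left_mono) (auto simp: algebra_simps)
   finally show ?case by (simp add: h_def mult_ac)
  qed
  let ?f = "%k x. ennreal (c k * (u x - avg ((1/2) ^ k) u x)\<^sup>2)"
  have pt: "ennreal (abs (u x) powr s) * indicator (ball 0 1) x
    <= ennreal ((2 * K) powr s) * indicator (ball 0 1) x + (\<Sum>k. ?f k x)" for x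
  proof (cases "norm x < 1")
   case True
   show ?thesis
   proof (cases "abs (u x) <= 2 * K")
    case le: True
    have "abs (u x) powr s <= (2 * K) powr s" using le s by (intro powr_mono2) auto
    then show ?thesis using True by (simp add: ennreal_leI add_increasing2)
   next
    case False
    then obtain k where k: "2 * K * g ^ k < abs (u x)" "abs (u x) <= 2 * K * g ^ Suc k"
     using ex_dyadic[of "2 * K" g "abs (u x)"] K g by (auto simp del: power_Suc)
    have "abs (u x) <= 2 * \<bar>u x - avg ((1/2) ^ k) u x\<bar>"
    proof -
     have "\<bar>avg ((1/2) ^ k) u x\<bar> <= K * g ^ k" using A[of x k] True by simp
     moreover have "2 * (K * g ^ k) < abs (u x)" using k(1) by (simp only: mult.assoc)
     moreover have "abs (u x) - \<bar>avg ((1/2) ^ k) u x\<bar> <= \<bar>u x - avg ((1/2) ^ k) u x\<bar>"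
      by (rule abs_triangle_ineq2)
     ultimately show ?thesis by argo
    qed
    then have "\<bar>u x\<bar>\<^sup>2 <= (2 * \<bar>u x - avg ((1/2) ^ k) u x\<bar>)\<^sup>2" by (intro power_mono) auto
    then have sq: "abs (u x) powr 2 <= 4 * (u x - avg ((1/2) ^ k) u x)\<^sup>2"
     by (simp add: power_mult_distrib)
    have "abs (u x) powr s = abs (u x) powr (s - 2) * abs (u x) powr 2"
     by (subst powr_add[symmetric]) simp
    also have "... <= (2 * K * g ^ Suc k) powr (s - 2) * (4 * (u x - avg ((1/2) ^ k) u x)\<^sup>2)"
     using k(2) s K g sq by (intro mult_mono powr_mono2) auto
    also have "... = c k * (u x - avg ((1/2) ^ k) u x)\<^sup>2" by (simp add: c_def)
    finally have "ennreal (abs (u x) powr s) <= ?f k x" by (rule ennreal_leI)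
    also have "... <= (\<Sum>k. ?f k x)" by (rule suminf_term_le)
    finally show ?thesis using True by (simp add: add_increasing)
   qed
  qed simp
  have "(\<integral>\<^sup>+x. ennreal (abs (u x) powr s) * indicator (ball 0 1) x \<partial>lborel)
   <= (\<integral>\<^sup>+x. ennreal ((2 * K) powr s) * indicator (ball 0 1) x + (\<Sum>k. ?f k x) \<partial>lborel)"
   by (intro nn_integral_mono pt)
  also have "... = (\<integral>\<^sup>+x. ennreal ((2 * K) powr s) * indicator (ball (0 :: real^'n) 1) x \<partial>lborel) + (\<integral>\<^sup>+x. (\<Sum>k. ?f k x) \<partial>lborel)"
   by (rule nn_integral_add) auto
  also have "(\<integral>\<^sup>+x. ennreal ((2 * K) powr s) * indicator (ball (0 :: real^'n) 1) x \<partial>lborel) = ennreal ((2 * K) powr s * V)"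
   by (subst nn_integral_cmult_indicator) (auto simp: V ennreal_mult)
  also have "(\<integral>\<^sup>+x. (\<Sum>k. ?f k x) \<partial>lborel) = (\<Sum>k. \<integral>\<^sup>+x. ?f k x \<partial>lborel)"
   by (rule nn_integral_suminf) simp
  also have "... <= (\<Sum>k. ennreal (D k))"
  proof (rule suminf_le)
   fix k
   have "(\<integral>\<^sup>+x. ?f k x \<partial>lborel) = ennreal (c k) * (\<integral>\<^sup>+x. ennreal ((u x - avg ((1/2) ^ k) u x)\<^sup>2) \<partial>lborel)"
    using c0 by (subst nn_integral_cmult[symmetric]) (auto simp: ennreal_mult)
   also have "... <= ennreal (c k) * ennreal (((1/2) ^ k)\<^sup>2 * dirichlet u)"
    by (intro mult_left_mono avg_L2 u) auto
   also have "... <= ennreal (c k) * ennreal (((1/2) ^ k)\<^sup>2)"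
    using d by (intro mult_left_mono ennreal_leI mult_left_le) auto
   also have "... = ennreal (D k)" using c0 by (simp add: cD ennreal_mult[symmetric])
   finally show "(\<integral>\<^sup>+x. ?f k x \<partial>lborel) <= ennreal (D k)" .
  qed auto
  also have "(\<Sum>k. ennreal (D k)) = ennreal (suminf D)"
   by (rule suminf_ennreal2[OF D0 sumD])
  also have "ennreal ((2 * K) powr s * V) + ennreal (suminf D) = ennreal C"
   using V sD by (simp add: C_def)
  finally show ?thesis by (simp add: add_left_mono)
 qed
 moreover have "C >= 0" using V sD by (simp add: C_def)
 ultimately show ?thesis by blast
qed

section \<open>Compact embeddings\<close>

lemma Young_power:
 fixes \<theta> e :: real
 assumes \<theta>: "0 < \<theta>" "\<theta> < 1" and e: "0 < e"
 shows "EX C>=0. ALL A>=0. ALL B>=0. A powr \<theta> * B powr (1 - \<theta>) <= e * A + C * B"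
proof (intro exI[of _ "e powr (- \<theta> / (1 - \<theta>))"] conjI allI impI)
 fix A B :: real assume AB: "A >= 0" "B >= 0"
 show "A powr \<theta> * B powr (1 - \<theta>) <= e * A + e powr (- \<theta> / (1 - \<theta>)) * B"
 proof (cases "A = 0 | B = 0")
  case False
  then have pos: "A > 0" "B > 0" using AB by auto
  show ?thesis
  proof (cases "B <= e powr (1 / (1 - \<theta>)) * A")
   case True
   have "B powr (1 - \<theta>) <= (e powr (1 / (1 - \<theta>)) * A) powr (1 - \<theta>)"
    using True pos \<theta> by (intro powr_mono2) auto
   also have "... = e * A powr (1 - \<theta>)" using e pos \<theta> by (simp add: powr_mult powr_powr)
   finally have "A powr \<theta> * B powr (1 - \<theta>) <= A powr \<theta> * (e * A powr (1 - \<theta>))"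
    by (intro mult_left_mono) auto
   also have "... = e * (A powr \<theta> * A powr (1 - \<theta>))" by simp
   also have "A powr \<theta> * A powr (1 - \<theta>) = A" using pos by (subst powr_add[symmetric]) simp
   finally show ?thesis using pos by (simp add: add_increasing2)
  next
   case False
   define k where "k = e powr (1 / (1 - \<theta>))"
   have k: "k > 0" using e by (simp add: k_def)
   have "A <= B / k" using False k by (simp add: k_def[symmetric] field_simps)
   then have "A powr \<theta> <= (B / k) powr \<theta>" using pos \<theta> by (intro powr_mono2) auto
   also have "... = B powr \<theta> * k powr (- \<theta>)" using pos k by (simp add: powr_divide powr_minus_divide)
   also have "k powr (- \<theta>) = e powr (- \<theta> / (1 - \<theta>))" by (simp add: k_def powr_powr)
   finally have "A powr \<theta> * B powr (1 - \<theta>) <= (B powr \<theta> * e powr (- \<theta> / (1 - \<theta>))) * B powr (1 - \<theta>)"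
    by (intro mult_right_mono) auto
   also have "... = e powr (- \<theta> / (1 - \<theta>)) * (B powr \<theta> * B powr (1 - \<theta>))" by simp
   also have "B powr \<theta> * B powr (1 - \<theta>) = B" using pos by (subst powr_add[symmetric]) simp
   finally show ?thesis using pos e by (simp add: add_increasing)
  qed
 qed (use AB e \<theta> in \<open>auto simp: add_nonneg_nonneg\<close>)
qed simp

text \<open>
 Three forms of Young's inequality. Near the origin the weighted power is absorbed by \<open>|u|\<^sup>s\<close>, which the local Sobolev
 inequality controls; far away it is absorbed by the weighted \<open>q\<close>-power, and in between by \<open>|u|\<close>. The remainders of the
 first two are fixed functions of \<open>y = |x|\<close>.
\<close>

lemma Young_near:
 fixes r s \<eta> e :: real
 assumes "0 < r" "r < s" "0 < e"
 shows "EX C>=0. ALL t>=0. ALL y>0. y powr (- \<eta>) * t powr r <= e * t powr s + C * y powr (- (\<eta> * s / (s - r)))"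
proof -
 have th: "0 < r / s" "r / s < 1" using assms by auto
 obtain C where C: "C >= 0" "!!A B. A >= 0 ==> B >= 0 ==> A powr (r / s) * B powr (1 - r / s) <= e * A + C * B"
  using Young_power[OF th assms(3)] by blast
 show ?thesis
 proof (intro exI[of _ C] conjI allI impI C(1))
  fix t y :: real assume ty: "t >= 0" "y > 0"
  have "(t powr s) powr (r / s) = t powr r" using assms by (simp add: powr_powr)
  moreover have "(y powr (- (\<eta> * s / (s - r)))) powr (1 - r / s) = y powr (- \<eta>)"
  proof -
   have "(- (\<eta> * s / (s - r))) * (1 - r / s) = - \<eta>" using assms by (simp add: divide_simps)
   then show ?thesis by (simp add: powr_powr)
  qed
  ultimately show "y powr (- \<eta>) * t powr r <= e * t powr s + C * y powr (- (\<eta> * s / (s - r)))"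
   using C(2)[of "t powr s" "y powr (- (\<eta> * s / (s - r)))"] by (simp add: mult.commute)
 qed
qed

lemma Young_far:
 fixes r q \<eta> b e :: real
 assumes "0 < r" "r < q" "0 < e"
 shows "EX C>=0. ALL t>=0. ALL y>0. y powr (- \<eta>) * t powr r <= e * (y powr (- b) * t powr q) + C * y powr (- ((\<eta> * q - b * r) / (q - r)))"
proof -
 have th: "0 < r / q" "r / q < 1" using assms by auto
 obtain C where C: "C >= 0" "!!A B. A >= 0 ==> B >= 0 ==> A powr (r / q) * B powr (1 - r / q) <= e * A + C * B"
  using Young_power[OF th assms(3)] by blast
 show ?thesis
 proof (intro exI[of _ C] conjI allI impI C(1))
  fix t y :: real assume ty: "t >= 0" "y > 0"
  let ?m = "(\<eta> * q - b * r) / (q - r)"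
  have "(y powr (- b) * t powr q) powr (r / q) = y powr (- b * (r / q)) * t powr r"
   using assms ty by (simp add: powr_mult powr_powr)
  moreover have "(y powr (- ?m)) powr (1 - r / q) = y powr (- \<eta> + b * (r / q))"
  proof -
   have "- ?m * (1 - r / q) = - \<eta> + b * (r / q)" using assms by (simp add: divide_simps)
   then show ?thesis by (simp add: powr_powr)
  qed
  moreover have "y powr (- b * (r / q)) * y powr (- \<eta> + b * (r / q)) = y powr (- \<eta>)"
   by (subst powr_add[symmetric]) simp
  ultimately have "(y powr (- b) * t powr q) powr (r / q) * (y powr (- ?m)) powr (1 - r / q) = y powr (- \<eta>) * t powr r"
   by (simp add: mult.commute mult.left_commute)
  then show "y powr (- \<eta>) * t powr r <= e * (y powr (- b) * t powr q) + C * y powr (- ?m)"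
   using C(2)[of "y powr (- b) * t powr q" "y powr (- ?m)"] by simp
 qed
qed

lemma Young_mid:
 fixes r q e :: real
 assumes "1 < r" "r < q" "0 < e"
 shows "EX C>=0. ALL t>=0. t powr r <= e * t powr q + C * t"
proof -
 let ?\<theta> = "(r - 1) / (q - 1)"
 have th: "0 < ?\<theta>" "?\<theta> < 1" using assms by auto
 obtain C where C: "C >= 0" "!!A B. A >= 0 ==> B >= 0 ==> A powr ?\<theta> * B powr (1 - ?\<theta>) <= e * A + C * B"
  using Young_power[OF th assms(3)] by blast
 show ?thesis
 proof (intro exI[of _ C] conjI allI impI C(1))
  fix t :: real assume t: "t >= 0"
  have "q * ?\<theta> + (1 - ?\<theta>) = r" using assms by (simp add: divide_simps) (simp add: algebra_simps)
  then have "(t powr q) powr ?\<theta> * t powr (1 - ?\<theta>) = t powr r"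
   by (simp add: powr_powr flip: powr_add)
  then show "t powr r <= e * t powr q + C * t" using C(2)[of "t powr q" t] t by simp
 qed
qed

text \<open>
 The pairs \<open>(\<eta>, r)\<close> for which the weighted integral is subcritical at the origin and is controlled by
 the \<open>q\<close>-integral at infinity by means of Hoelder's inequality, both with room to spare.
\<close>

definition good_pair :: "nat => real => real => real => real => bool" where
 "good_pair N b q \<eta> r \<longleftrightarrow> 0 <= b & b < \<eta> & \<eta> < real N & 1 < r & r < q &
  q * (real N - \<eta>) < r * (real N - b) & r * (real N - 2) < 2 * (real N - \<eta>)"

text \<open>
 For \<open>s\<close> close to the critical exponent the remainder of \<open>Young_near\<close> is integrable at the origin. The remainder
 of \<open>Young_far\<close> is integrable at infinity exactly because \<open>q (N - \<eta>) < r (N - b)\<close>.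
\<close>

lemma good_pair_dominated:
 assumes g: "good_pair CARD('n::finite) b q \<eta> r" and N: "2 <= CARD('n)"
 obtains s W where "2 <= s" "(real CARD('n) - 2) * s < 2 * real CARD('n)"
  "W \<in> borel_measurable (borel :: (real ^ 'n) measure)" "!!x. 0 <= W x"
  "(\<integral>\<^sup>+x. ennreal (W x) \<partial>lborel) < \<infinity>"
  "!!e. 0 < e ==> EX C>=0. ALL x. ALL t>=0. norm x powr (- \<eta>) * t powr r <=
    e * (norm x powr (- b) * t powr q + t powr s * indicator (ball 0 1) x) + C * W x"
proof -
 let ?N = "real CARD('n)"
 note g' = g[unfolded good_pair_def]
 have \<eta>0: "0 <= \<eta>" using g' by linarith
 obtain s where s: "2 <= s" "(?N - 2) * s < 2 * ?N" "r * ?N / (?N - \<eta>) < s"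
 proof (cases "CARD('n) = 2")
  case True
  then show ?thesis using that[of "max 2 (r * ?N / (?N - \<eta>) + 1)"] by auto
 next
  case False
  then have N2: "?N - 2 > 0" using N by auto
  have "r * ?N / (?N - \<eta>) < 2 * ?N / (?N - 2)"
  proof -
   have "(r * (?N - 2)) * ?N < (2 * (?N - \<eta>)) * ?N" using g' by (intro mult_strict_right_mono) auto
   then show ?thesis using N2 g' by (simp add: divide_simps mult_ac)
  qed
  moreover have "2 < 2 * ?N / (?N - 2)" using N2 by (simp add: field_simps)
  ultimately obtain s where "max 2 (r * ?N / (?N - \<eta>)) < s" "s < 2 * ?N / (?N - 2)"
   using dense[of "max 2 (r * ?N / (?N - \<eta>))" "2 * ?N / (?N - 2)"] by auto
  then show ?thesis using that[of s] N2 by (simp add: field_simps)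
 qed
 have rs: "r < s"
 proof -
  have "r * (?N - \<eta>) <= r * ?N" using g' \<eta>0 by (intro mult_left_mono) auto
  then have "r <= r * ?N / (?N - \<eta>)" using g' by (simp add: field_simps)
  then show ?thesis using s(3) by linarith
 qed
 define m1 where "m1 = \<eta> * s / (s - r)"
 define m2 where "m2 = (\<eta> * q - b * r) / (q - r)"
 have m1: "0 <= m1" "m1 < ?N"
 proof -
  show "0 <= m1" unfolding m1_def using \<eta>0 rs s(1) by simp
  have "r * ?N < s * (?N - \<eta>)" using s(3) g' by (simp add: field_simps)
  then have "\<eta> * s < ?N * (s - r)" by (simp add: algebra_simps)
  then show "m1 < ?N" unfolding m1_def using rs by (simp add: field_simps)
 qed
 have m2: "?N < m2"
 proof -
  have "?N * (q - r) < \<eta> * q - b * r" using g' by (simp add: algebra_simps)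
  then show ?thesis unfolding m2_def using g' by (simp add: field_simps)
 qed
 define W where "W = (%x :: real ^ 'n. norm x powr (- m1) * indicator (ball 0 1) x + norm x powr (- m2) * indicator (- ball 0 1) x)"
 have Wm: "W \<in> borel_measurable borel" unfolding W_def by measurable
 have W0: "0 <= W x" for x by (simp add: W_def)
 have Wi: "(\<integral>\<^sup>+x. ennreal (W x) \<partial>lborel) < \<infinity>"
 proof -
  have "(\<integral>\<^sup>+x. ennreal (W x) \<partial>lborel) = (\<integral>\<^sup>+x. ennreal (norm x powr (- m1)) * indicator (ball (0::real^'n) 1) x
    + ennreal (norm x powr (- m2)) * indicator (- ball (0::real^'n) 1) x \<partial>lborel)"
   by (intro nn_integral_cong) (auto simp: W_def indicator_def)
  also have "... = (\<integral>\<^sup>+x. ennreal (norm x powr (- m1)) * indicator (ball (0::real^'n) 1) x \<partial>lborel)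
    + (\<integral>\<^sup>+x. ennreal (norm x powr (- m2)) * indicator (- ball (0::real^'n) 1) x \<partial>lborel)"
   by (rule nn_integral_add) auto
  also have "... < \<infinity>"
   using radial_near[where 'a="real^'n", of m1 1] radial_far[where 'a="real^'n", of m2] m1 m2 by simp
  finally show ?thesis .
 qed
 have dom: "EX C>=0. ALL x. ALL t>=0. norm x powr (- \<eta>) * t powr r <=
    e * (norm x powr (- b) * t powr q + t powr s * indicator (ball 0 1) x) + C * W x" if e: "0 < e" for e
 proof -
  obtain C1 where C1: "C1 >= 0" "!!t y. t >= 0 ==> y > 0 ==> y powr (- \<eta>) * t powr r <= e * t powr s + C1 * y powr (- m1)"
   using Young_near[of r s e \<eta>] g' rs e unfolding m1_def by auto
  obtain C2 where C2: "C2 >= 0" "!!t y. t >= 0 ==> y > 0 ==> y powr (- \<eta>) * t powr r <= e * (y powr (- b) * t powr q) + C2 * y powr (- m2)"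
   using Young_far[of r q e \<eta> b] g' e unfolding m2_def by auto
  show ?thesis
  proof (intro exI[of _ "C1 + C2"] conjI allI impI)
   fix x :: "real ^ 'n" and t :: real assume t: "t >= 0"
   show "norm x powr (- \<eta>) * t powr r <= e * (norm x powr (- b) * t powr q + t powr s * indicator (ball 0 1) x) + (C1 + C2) * W x"
   proof (cases "x = 0")
    case True
    then show ?thesis using e C1(1) C2(1) W0[of 0] by simp
   next
    case x: False
    show ?thesis
    proof (cases "x \<in> ball 0 1")
     case True
     have "norm x powr (- \<eta>) * t powr r <= e * t powr s + C1 * norm x powr (- m1)"
      using C1(2)[OF t, of "norm x"] x by simp
     moreover have "0 <= e * (norm x powr (- b) * t powr q)" "0 <= C2 * norm x powr (- m1)" using e C2(1) by auto
     ultimately show ?thesis using True by (simp add: W_def algebra_simps)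
    next
     case False
     have "norm x powr (- \<eta>) * t powr r <= e * (norm x powr (- b) * t powr q) + C2 * norm x powr (- m2)"
      using C2(2)[OF t, of "norm x"] x by simp
     moreover have "0 <= C1 * norm x powr (- m2)" using C1(1) by auto
     ultimately show ?thesis using False by (simp add: W_def algebra_simps)
    qed
   qed
  qed (use C1 C2 in auto)
 qed
 show ?thesis using that[OF s(1,2) Wm W0 Wi dom] by blast
qed

lemma tail_small:
 fixes W :: "'a::euclidean_space => real"
 assumes [measurable]: "W \<in> borel_measurable borel" and W: "(\<integral>\<^sup>+x. ennreal (W x) \<partial>lborel) < \<infinity>" and e: "0 < e"
 obtains \<rho> R where "0 < \<rho>" "\<rho> < R" "(\<integral>\<^sup>+x. ennreal (W x) * indicator (ball 0 \<rho> \<union> - ball 0 R) x \<partial>lborel) < ennreal e"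
proof -
 define A where "A = (%n::nat. ball (0::'a) (1 / real (n + 2)) \<union> - ball 0 (real (n + 2)))"
 have [measurable]: "A n \<in> sets borel" for n unfolding A_def by measurable
 have "(%n. \<integral>\<^sup>+x. ennreal (W x) * indicator (A n) x \<partial>lborel) ----> (\<integral>\<^sup>+(x::'a). 0 \<partial>lborel)"
 proof (rule nn_integral_dominated_convergence[where w="%x. ennreal (W x)"])
  show "AE x in lborel. ennreal (W x) * indicator (A j) x <= ennreal (W x)" for j
   by (auto simp: indicator_def)
  show "AE x in lborel. (%i. ennreal (W x) * indicator (A i) x) ----> 0"
   using AE_nonzero
  proof eventually_elim
   case (elim x)
   obtain n1 :: nat where n1: "norm x < real n1" using reals_Archimedean2 by blast
   obtain n2 :: nat where n2: "1 / norm x < real n2" using reals_Archimedean2 by blast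
   show ?case
   proof (rule tendsto_eventually, unfold eventually_sequentially, intro exI[of _ "max n1 n2"] allI impI)
    fix n assume n: "max n1 n2 <= n"
    then have "1 / norm x < real (n + 2)" using n2 by auto
    then have "1 / real (n + 2) < norm x" using elim by (simp add: field_simps)
    moreover have "norm x < real (n + 2)" using n n1 by auto
    ultimately have "x \<notin> A n" by (auto simp: A_def)
    then show "ennreal (W x) * indicator (A n) x = 0" by simp
   qed
  qed
 qed (use W in auto)
 then have "(%n. \<integral>\<^sup>+x. ennreal (W x) * indicator (A n) x \<partial>lborel) ----> 0" by simp
 then have "\<forall>\<^sub>F n in sequentially. (\<integral>\<^sup>+x. ennreal (W x) * indicator (A n) x \<partial>lborel) < ennreal e"
  using e by (intro order_tendstoD(2)) auto
 then obtain n where n: "(\<integral>\<^sup>+x. ennreal (W x) * indicator (A n) x \<partial>lborel) < ennreal e"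
  unfolding eventually_sequentially by blast
 have "1 / real (n + 2) < real (n + 2)"
 proof -
  have "1 / real (n + 2) <= 1" by simp
  also have "1 < real (n + 2)" by simp
  finally show ?thesis .
 qed
 then show ?thesis using that[of "1 / real (n + 2)" "real (n + 2)"] n by (simp add: A_def)
qed

lemma nn_pint_tf:
 fixes u :: "real ^ 'n::finite => real"
 assumes "u \<in> test_functions" "0 <= \<eta>" "\<eta> < real CARD('n)" "0 < r"
 shows "(\<integral>\<^sup>+x. ennreal (norm x powr (- \<eta>) * abs (u x) powr r) \<partial>lborel) = ennreal (pint (wmeas \<eta>) r u)"
 by (rule nn_pint_wmeas[OF tf_Lspace_wmeas[OF assms]])

lemma embedding_bound:
 assumes g: "good_pair CARD('n::finite) b q \<eta> r" and N: "2 <= CARD('n)"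
 shows "EX C>=0. ALL u:(test_functions :: (real ^ 'n => real) set).
  dirichlet u <= 1 --> pint (wmeas b) q u <= 1 --> pint (wmeas \<eta>) r u <= C"
proof -
 note g' = g[unfolded good_pair_def]
 obtain s W where s: "2 <= s" "(real CARD('n) - 2) * s < 2 * real CARD('n)"
  and W: "W \<in> borel_measurable (borel :: (real ^ 'n) measure)" "!!x. 0 <= W x" "(\<integral>\<^sup>+x. ennreal (W x) \<partial>lborel) < \<infinity>"
  and dom: "!!e. 0 < e ==> EX C>=0. ALL x. ALL t>=0. norm x powr (- \<eta>) * t powr r <=
    e * (norm x powr (- b) * t powr q + t powr s * indicator (ball 0 1) x) + C * W x"
  using good_pair_dominated[OF g N] by metis
 note [measurable] = W(1)
 obtain C where C: "C >= 0" "!!x t. t >= 0 ==> norm x powr (- \<eta>) * t powr r <=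
    1 * (norm x powr (- b) * t powr q + t powr s * indicator (ball 0 1) x) + C * W x"
  using dom[of 1] by auto
 obtain CS where CS: "CS >= 0" "!!u. u \<in> (test_functions :: (real ^ 'n => real) set) ==> dirichlet u <= 1 ==>
   pint (wmeas b) q u <= 1 ==> (\<integral>\<^sup>+x. ennreal (abs (u x) powr s) * indicator (ball 0 1) x \<partial>lborel) <= ennreal CS"
  using local_Sobolev[OF s N, of b q] g' by auto
 obtain I where I: "(\<integral>\<^sup>+x. ennreal (W x) \<partial>lborel) = ennreal I" "I >= 0"
  using W(3) by (cases "(\<integral>\<^sup>+x. ennreal (W x) \<partial>lborel)") auto
 show ?thesis
 proof (intro exI[of _ "1 + CS + C * I"] conjI ballI impI)
  fix u :: "real ^ 'n => real" assume u: "u \<in> test_functions" and d: "dirichlet u <= 1" and Q: "pint (wmeas b) q u <= 1"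
  note [measurable] = tf_borel[OF u]
  have "ennreal (pint (wmeas \<eta>) r u) = (\<integral>\<^sup>+x. ennreal (norm x powr (- \<eta>) * abs (u x) powr r) \<partial>lborel)"
   using g' by (intro nn_pint_tf[symmetric] u) auto
  also have "... <= (\<integral>\<^sup>+x. ennreal (norm x powr (- b) * abs (u x) powr q) + ennreal (abs (u x) powr s) * indicator (ball 0 1) x + ennreal C * ennreal (W x) \<partial>lborel)"
  proof (rule nn_integral_mono)
   fix x
   have "ennreal (norm x powr (- \<eta>) * abs (u x) powr r) <= ennreal ((norm x powr (- b) * abs (u x) powr q + abs (u x) powr s * indicator (ball 0 1) x) + C * W x)"
    using C(2)[of "abs (u x)" x] by (intro ennreal_leI) simp
   also have "... = ennreal (norm x powr (- b) * abs (u x) powr q) + ennreal (abs (u x) powr s) * indicator (ball 0 1) x + ennreal C * ennreal (W x)"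
    using C(1) W(2)[of x] by (auto simp: indicator_def ennreal_mult)
   finally show "ennreal (norm x powr (- \<eta>) * abs (u x) powr r) <= ennreal (norm x powr (- b) * abs (u x) powr q) + ennreal (abs (u x) powr s) * indicator (ball 0 1) x + ennreal C * ennreal (W x)" .
  qed
  also have "... = (\<integral>\<^sup>+x. ennreal (norm x powr (- b) * abs (u x) powr q) \<partial>lborel) + (\<integral>\<^sup>+x. ennreal (abs (u x) powr s) * indicator (ball 0 1) x \<partial>lborel) + ennreal C * (\<integral>\<^sup>+x. ennreal (W x) \<partial>lborel)"
   by (simp add: nn_integral_add nn_integral_cmult)
  also have "... <= ennreal 1 + ennreal CS + ennreal C * ennreal I"
   unfolding I(1) using g' Q CS(2)[OF u d Q]
   by (intro add_mono order_refl) (auto simp: nn_pint_tf[OF u])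
  also have "... = ennreal (1 + CS + C * I)" using CS(1) C(1) I(2)
   by (simp add: ennreal_mult[symmetric] ennreal_plus[symmetric] ennreal_1[symmetric] del: ennreal_plus ennreal_1)
  finally show "pint (wmeas \<eta>) r u <= 1 + CS + C * I"
   using CS(1) C(1) I(2) by (subst (asm) ennreal_le_iff) auto
 qed (use CS(1) C(1) I(2) in auto)
qed

text \<open>
 A bounded sequence that tends to zero in \<open>L\<^sup>1\<close> on balls tends to zero in each good weighted space:
 the contributions of small and of large \<open>|x|\<close> are uniformly small, and in between the exponent \<open>r\<close> lies
 strictly between \<open>1\<close> and \<open>q\<close>.
\<close>

lemma embedding_null:
 fixes w :: "nat => real ^ 'n::finite => real"
 assumes g: "good_pair CARD('n) b q \<eta> r" and N: "2 <= CARD('n)"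
  and w: "!!n. w n \<in> test_functions" and d: "!!n. dirichlet (w n) <= 1" and Q: "!!n. pint (wmeas b) q (w n) <= 1"
  and L1: "!!R. 0 < R ==> (%n. \<integral>\<^sup>+x. ennreal \<bar>w n x\<bar> * indicator (ball 0 R) x \<partial>lborel) ----> 0"
 shows "(%n. pint (wmeas \<eta>) r (w n)) ----> 0"
proof (rule LIMSEQ_I)
 fix \<epsilon> :: real assume \<epsilon>: "0 < \<epsilon>"
 note g' = g[unfolded good_pair_def]
 obtain s W where s: "2 <= s" "(real CARD('n) - 2) * s < 2 * real CARD('n)"
  and W: "W \<in> borel_measurable (borel :: (real ^ 'n) measure)" "!!x. 0 <= W x" "(\<integral>\<^sup>+x. ennreal (W x) \<partial>lborel) < \<infinity>"
  and dom: "!!e. 0 < e ==> EX C>=0. ALL x. ALL t>=0. norm x powr (- \<eta>) * t powr r <=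
    e * (norm x powr (- b) * t powr q + t powr s * indicator (ball 0 1) x) + C * W x"
  using good_pair_dominated[OF g N] by metis
 note [measurable] = W(1)
 obtain CS where CS: "CS >= 0" "!!u. u \<in> (test_functions :: (real ^ 'n => real) set) ==> dirichlet u <= 1 ==>
   pint (wmeas b) q u <= 1 ==> (\<integral>\<^sup>+x. ennreal (abs (u x) powr s) * indicator (ball 0 1) x \<partial>lborel) <= ennreal CS"
  using local_Sobolev[OF s N, of b q] g' by auto
 define e where "e = \<epsilon> / (4 * (2 + CS))"
 have e: "e > 0" using \<epsilon> CS(1) by (simp add: e_def)
 obtain C where C: "C >= 0" "!!x t. t >= 0 ==> norm x powr (- \<eta>) * t powr r <=
    e * (norm x powr (- b) * t powr q + t powr s * indicator (ball 0 1) x) + C * W x"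
  using dom[OF e] by auto
 obtain \<rho> R where \<rho>R: "0 < \<rho>" "\<rho> < R"
  and tail: "(\<integral>\<^sup>+x. ennreal (W x) * indicator (ball 0 \<rho> \<union> - ball 0 R) x \<partial>lborel) < ennreal (\<epsilon> / (4 * (C + 1)))"
  using tail_small[OF W(1,3), of "\<epsilon> / (4 * (C + 1))"] \<epsilon> C(1) by auto
 define e2 where "e2 = e * \<rho> powr \<eta> * R powr (- b)"
 have e2: "e2 > 0" using e \<rho>R by (simp add: e2_def)
 obtain C2 where C2: "C2 >= 0" "!!t. t >= 0 ==> t powr r <= e2 * t powr q + C2 * t"
  using Young_mid[of r q e2] g' e2 by auto
 define C3 where "C3 = \<rho> powr (- \<eta>) * C2"
 have C3: "C3 >= 0" using C2 by (simp add: C3_def)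
 have mid: "norm x powr (- \<eta>) * t powr r <= e * (norm x powr (- b) * t powr q) + C3 * t"
  if x: "\<rho> <= norm x" "norm x < R" and t: "t >= 0" for x :: "real ^ 'n" and t
 proof -
  have x0: "norm x > 0" using x \<rho>R by linarith
  have "norm x powr (- \<eta>) * t powr r <= \<rho> powr (- \<eta>) * (e2 * t powr q + C2 * t)"
   using x \<rho>R g' C2(2)[OF t] by (intro mult_mono powr_mono2') auto
  also have "... = e * (R powr (- b) * t powr q) + C3 * t"
   using \<rho>R by (simp add: e2_def C3_def distrib_left powr_minus)
  also have "R powr (- b) <= norm x powr (- b)"
   using x x0 g' by (intro powr_mono2') auto
  then have "e * (R powr (- b) * t powr q) + C3 * t <= e * (norm x powr (- b) * t powr q) + C3 * t"
   using e by (intro add_right_mono mult_left_mono mult_right_mono) auto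
  finally show ?thesis .
 qed
 let ?A = "ball (0::real^'n) \<rho> \<union> - ball 0 R"
 have main: "ennreal (pint (wmeas \<eta>) r (w n)) <= ennreal (\<epsilon> / 2) + ennreal C3 * (\<integral>\<^sup>+x. ennreal \<bar>w n x\<bar> * indicator (ball 0 R) x \<partial>lborel)" for n
 proof -
  let ?u = "w n"
  note [measurable] = tf_borel[OF w[of n]]
  let ?rhs = "%x. ennreal e * (ennreal (norm x powr (- b) * \<bar>?u x\<bar> powr q) + ennreal (\<bar>?u x\<bar> powr s) * indicator (ball 0 1) x)
    + ennreal C * (ennreal (W x) * indicator ?A x) + ennreal C3 * (ennreal \<bar>?u x\<bar> * indicator (ball 0 R) x)"
  have pt: "ennreal (norm x powr (- \<eta>) * \<bar>?u x\<bar> powr r) <= ?rhs x" for x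
  proof (cases "x \<in> ?A")
   case True
   have "ennreal (norm x powr (- \<eta>) * \<bar>?u x\<bar> powr r) <= ennreal (e * (norm x powr (- b) * \<bar>?u x\<bar> powr q + \<bar>?u x\<bar> powr s * indicator (ball 0 1) x) + C * W x)"
    using C(2)[of "\<bar>?u x\<bar>" x] by (intro ennreal_leI) simp
   also have "... = ennreal e * (ennreal (norm x powr (- b) * \<bar>?u x\<bar> powr q) + ennreal (\<bar>?u x\<bar> powr s) * indicator (ball 0 1) x) + ennreal C * ennreal (W x)"
    using C(1) W(2)[of x] e by (auto simp: indicator_def ennreal_mult)
   also have "... <= ?rhs x" using True by (simp add: add_increasing2)
   finally show ?thesis .
  next
   case False
   then have "\<rho> <= norm x" "norm x < R" by auto
   from mid[OF this, of "\<bar>?u x\<bar>"] have "ennreal (norm x powr (- \<eta>) * \<bar>?u x\<bar> powr r) <= ennreal (e * (norm x powr (- b) * \<bar>?u x\<bar> powr q) + C3 * \<bar>?u x\<bar>)"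
    by (intro ennreal_leI) simp
   also have "... = ennreal e * ennreal (norm x powr (- b) * \<bar>?u x\<bar> powr q) + ennreal C3 * ennreal \<bar>?u x\<bar>"
    using C3 e by (simp add: ennreal_mult)
   also have "... <= ?rhs x" using \<open>norm x < R\<close>
    by (intro add_mono add_increasing2) (auto intro!: mult_left_mono add_increasing2)
   finally show ?thesis .
  qed
  have "ennreal (pint (wmeas \<eta>) r ?u) = (\<integral>\<^sup>+x. ennreal (norm x powr (- \<eta>) * \<bar>?u x\<bar> powr r) \<partial>lborel)"
   using g' by (intro nn_pint_tf[symmetric] w) auto
  also have "... <= (\<integral>\<^sup>+x. ?rhs x \<partial>lborel)" by (intro nn_integral_mono pt)
  also have "... = ennreal e * ((\<integral>\<^sup>+x. ennreal (norm x powr (- b) * \<bar>?u x\<bar> powr q) \<partial>lborel) + (\<integral>\<^sup>+x. ennreal (\<bar>?u x\<bar> powr s) * indicator (ball 0 1) x \<partial>lborel))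
    + ennreal C * (\<integral>\<^sup>+x. ennreal (W x) * indicator ?A x \<partial>lborel) + ennreal C3 * (\<integral>\<^sup>+x. ennreal \<bar>?u x\<bar> * indicator (ball 0 R) x \<partial>lborel)"
   by (simp add: nn_integral_add nn_integral_cmult)
  also have "... <= ennreal e * (ennreal 1 + ennreal CS) + ennreal C * ennreal (\<epsilon> / (4 * (C + 1))) + ennreal C3 * (\<integral>\<^sup>+x. ennreal \<bar>?u x\<bar> * indicator (ball 0 R) x \<partial>lborel)"
   using g' Q[of n] CS(2)[OF w d Q, of n] tail
   by (intro add_mono mult_left_mono order_refl) (auto simp: nn_pint_tf[OF w] ennreal_le_1)
  also have "ennreal e * (ennreal 1 + ennreal CS) + ennreal C * ennreal (\<epsilon> / (4 * (C + 1))) = ennreal (e * (1 + CS) + C * (\<epsilon> / (4 * (C + 1))))"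
   using e CS(1) C(1) \<epsilon>
   by (simp add: ennreal_mult[symmetric] ennreal_plus[symmetric] ennreal_1[symmetric] del: ennreal_plus ennreal_1)
  also have "... <= ennreal (\<epsilon> / 2)"
  proof (rule ennreal_leI)
   have "e * (1 + CS) <= \<epsilon> / 4" using \<epsilon> CS(1) by (simp add: e_def field_simps)
   moreover have "C * (\<epsilon> / (4 * (C + 1))) <= \<epsilon> / 4" using \<epsilon> C(1) by (simp add: field_simps)
   ultimately show "e * (1 + CS) + C * (\<epsilon> / (4 * (C + 1))) <= \<epsilon> / 2" by linarith
  qed
  finally show ?thesis by (simp add: add_right_mono)
 qed
 have "\<forall>\<^sub>F n in sequentially. (\<integral>\<^sup>+x. ennreal \<bar>w n x\<bar> * indicator (ball 0 R) x \<partial>lborel) < ennreal (\<epsilon> / (4 * (C3 + 1)))"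
  using L1[of R] \<rho>R \<epsilon> C3 by (intro order_tendstoD(2)) auto
 then obtain n0 where n0: "!!n. n >= n0 ==> (\<integral>\<^sup>+x. ennreal \<bar>w n x\<bar> * indicator (ball 0 R) x \<partial>lborel) < ennreal (\<epsilon> / (4 * (C3 + 1)))"
  unfolding eventually_sequentially by blast
 have "norm (pint (wmeas \<eta>) r (w n) - 0) < \<epsilon>" if n: "n >= n0" for n
 proof -
  have "ennreal (pint (wmeas \<eta>) r (w n)) <= ennreal (\<epsilon> / 2) + ennreal C3 * ennreal (\<epsilon> / (4 * (C3 + 1)))"
   using n0[OF n] by (intro order_trans[OF main] add_left_mono mult_left_mono) auto
  also have "... = ennreal (\<epsilon> / 2 + C3 * (\<epsilon> / (4 * (C3 + 1))))"
   using \<epsilon> C3 by (simp add: ennreal_mult[symmetric] ennreal_plus[symmetric] del: ennreal_plus)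
  finally have "pint (wmeas \<eta>) r (w n) <= \<epsilon> / 2 + C3 * (\<epsilon> / (4 * (C3 + 1)))"
   using \<epsilon> C3 by (subst (asm) ennreal_le_iff) auto
  moreover have "C3 * (\<epsilon> / (4 * (C3 + 1))) <= \<epsilon> / 4" using \<epsilon> C3 by (simp add: field_simps)
  ultimately have "pint (wmeas \<eta>) r (w n) < \<epsilon>" using \<epsilon> by linarith
  then show ?thesis by simp
 qed
 then show "EX no. ALL n>=no. norm (pint (wmeas \<eta>) r (w n) - 0) < \<epsilon>" by blast
qed

subsection \<open>Detecting null sequences by countably many linear functionals\<close>

definition dense_points :: "(real ^ 'n::finite) set" where
 "dense_points = (SOME D. countable D & (ALL X. open X --> X ~= {} --> (EX d:D. d \<in> X)))"

lemma dense_points: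
 "countable (dense_points :: (real ^ 'n::finite) set)"
 "open X ==> X ~= {} ==> EX d:dense_points. d \<in> (X :: (real ^ 'n) set)"
proof -
 have "EX D::(real ^ 'n) set. countable D & (ALL X. open X --> X ~= {} --> (EX d:D. d \<in> X))"
  by (rule countable_dense_exists)
 from someI_ex[OF this] show "countable (dense_points :: (real ^ 'n::finite) set)"
  "open X ==> X ~= {} ==> EX d:dense_points. d \<in> (X :: (real ^ 'n) set)"
  unfolding dense_points_def by blast+
qed

text \<open>
 The averages over balls of radius \<open>1/(j+1)\<close> around the points of a dense set, in one enumeration.
\<close>

definition probe :: "nat => (real ^ 'n::finite => real) => real" where
 "probe i u = (let (d, j) = from_nat_into (dense_points \<times> (UNIV :: nat set)) i in avg (1 / real (Suc j)) u d)"

lemma probe_surj: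
 assumes "d \<in> (dense_points :: (real ^ 'n::finite) set)"
 shows "EX i. ALL u. probe i u = avg (1 / real (Suc j)) u d"
proof -
 have "countable ((dense_points :: (real ^ 'n) set) \<times> (UNIV :: nat set))"
  using dense_points(1) by auto
 then obtain i where "from_nat_into (dense_points \<times> (UNIV :: nat set)) i = (d, j)"
  using from_nat_into_surj[of "dense_points \<times> UNIV" "(d, j)"] assms by auto
 then show ?thesis by (intro exI[of _ i]) (simp add: probe_def)
qed

lemma probe_ex: "EX d j. ALL u. probe i u = avg (1 / real (Suc j)) u (d :: real ^ 'n::finite)"
 by (cases "from_nat_into ((dense_points :: (real ^ 'n) set) \<times> (UNIV :: nat set)) i") (auto simp: probe_def)

text \<open>
 At a fixed radius the averages are equi-Lipschitz, so it suffices to control them at dense points; by dominated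
 convergence they tend to zero in \<open>L\<^sup>1\<close> of a ball. By \<open>avg_L2\<close> they approximate the functions uniformly along the
 sequence as the radius tends to zero.
\<close>

lemma null_of_probes:
 fixes w :: "nat => real ^ 'n::finite => real"
 assumes b: "0 <= b" "b < real CARD('n)" and q: "1 < q"
  and w: "!!n. w n \<in> test_functions" and d: "!!n. dirichlet (w n) <= 1" and Q: "!!n. pint (wmeas b) q (w n) <= 1"
  and pr: "!!i. (%n. probe i (w n)) ----> 0" and R: "0 < R"
 shows "(%n. \<integral>\<^sup>+x. ennreal \<bar>w n x\<bar> * indicator (ball 0 R) x \<partial>lborel) ----> 0"
proof -
 define V where "V = measure lborel (ball (0 :: real ^ 'n) R)"
 have V: "emeasure lborel (ball (0 :: real ^ 'n) R) = ennreal V" "V >= 0"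
  using emeasure_bounded_finite[OF bounded_ball, of "0::real^'n" R] by (auto simp: V_def emeasure_eq_ennreal_measure)
 have [measurable]: "w n \<in> borel_measurable borel" for n using w by (rule tf_borel)
 have [measurable]: "avg h (w n) \<in> borel_measurable borel" for n h using w by (rule avg_borel)
 have pw: "(%n. avg (1 / real (Suc j)) (w n) x) ----> 0" for j x
 proof (rule LIMSEQ_I)
  fix e :: real assume e: "0 < e"
  define h where "h = 1 / real (Suc j)"
  have h: "h > 0" by (simp add: h_def)
  define K where "K = sqrt (ball_const TYPE('n) * (1 / h ^ CARD('n)))"
  have K: "K >= 0" "K\<^sup>2 = ball_const TYPE('n) * (1 / h ^ CARD('n))"
   using ball_const_pos[where 'n='n] h by (auto simp: K_def)
  have lip: "\<bar>avg h (w n) x - avg h (w n) y\<bar> <= K * norm (x - y)" for n y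
  proof -
   have "(avg h (w n) x - avg h (w n) y)\<^sup>2 <= K\<^sup>2 * ((norm (x - y))\<^sup>2 * dirichlet (w n))"
    unfolding K(2) by (rule avg_Lipschitz[OF w h])
   also have "... <= K\<^sup>2 * ((norm (x - y))\<^sup>2 * 1)" using d by (intro mult_left_mono) auto
   finally have "(avg h (w n) x - avg h (w n) y)\<^sup>2 <= (K * norm (x - y))\<^sup>2" by (simp add: power_mult_distrib)
   then show ?thesis using K(1) by (subst (asm) abs_le_square_iff[symmetric]) auto
  qed
  have "e / (2 * (K + 1)) > 0" using e K(1) by simp
  then obtain y where y: "y \<in> dense_points" "dist x y < e / (2 * (K + 1))"
   using dense_points(2)[of "ball x (e / (2 * (K + 1)))"] by auto
  obtain i where i: "!!u. probe i u = avg h u y" using probe_surj[OF y(1), of j] h_def by blast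
  obtain n0 where n0: "!!n. n >= n0 ==> norm (probe i (w n) - 0) < e / 2"
   using LIMSEQ_D[OF pr[of i], of "e / 2"] e by auto
  have "norm (avg h (w n) x - 0) < e" if "n >= n0" for n
  proof -
   have "K * norm (x - y) <= K * (e / (2 * (K + 1)))" using y(2) K(1) by (intro mult_left_mono) (auto simp: dist_norm)
   also have "... <= e / 2" using e K(1) by (simp add: field_simps)
   finally have "\<bar>avg h (w n) x - avg h (w n) y\<bar> <= e / 2" using lip order_trans by blast
   moreover have "\<bar>avg h (w n) y\<bar> < e / 2" using n0[OF that] i by simp
   ultimately show ?thesis
    using abs_triangle_ineq[of "avg h (w n) x - avg h (w n) y" "avg h (w n) y"] by simp
  qed
  then show "EX no. ALL n>=no. norm (avg (1 / real (Suc j)) (w n) x - 0) < e" unfolding h_def by blast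
 qed
 have avg0: "(%n. \<integral>\<^sup>+x. ennreal \<bar>avg (1 / real (Suc j)) (w n) x\<bar> * indicator (ball 0 R) x \<partial>lborel) ----> 0" for j
 proof -
  define h where "h = 1 / real (Suc j)"
  have h: "0 < h" "h <= 1" by (auto simp: h_def)
  define B where "B = 1 + ball_const TYPE('n) * (1 / h ^ CARD('n)) * ((R + 1) powr b * 1)"
  have "(%n. \<integral>\<^sup>+x. ennreal \<bar>avg h (w n) x\<bar> * indicator (ball 0 R) x \<partial>lborel) ----> (\<integral>\<^sup>+(x::real^'n). 0 \<partial>lborel)"
  proof (rule nn_integral_dominated_convergence[where w="%x. ennreal B * indicator (ball 0 R) x"])
   show "AE x in lborel. ennreal \<bar>avg h (w n) x\<bar> * indicator (ball 0 R) x <= ennreal B * indicator (ball 0 R) x" for n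
   proof (rule AE_I2)
    fix x
    show "ennreal \<bar>avg h (w n) x\<bar> * indicator (ball 0 R) x <= ennreal B * indicator (ball 0 R) x"
    proof (cases "x \<in> ball 0 R")
     case True
     have "\<bar>avg h (w n) x\<bar> <= 1 + ball_const TYPE('n) * (1 / h ^ CARD('n)) * ((R + 1) powr b * pint (wmeas b) q (w n))"
      by (rule avg_bound[OF w b q h]) (use True in auto)
     also have "... <= B" unfolding B_def using Q[of n] h ball_const_pos[where 'n='n] R
      by (intro add_left_mono mult_left_mono) auto
     finally show ?thesis using True by (simp add: ennreal_leI)
    qed simp
   qed
   show "(\<integral>\<^sup>+x. ennreal B * indicator (ball (0::real^'n) R) x \<partial>lborel) < \<infinity>"
    by (subst nn_integral_cmult_indicator) (auto simp: V ennreal_mult_less_top)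
   show "AE x in lborel. (%n. ennreal \<bar>avg h (w n) x\<bar> * indicator (ball 0 R) x) ----> 0"
   proof (rule AE_I2)
    fix x :: "real ^ 'n"
    have "(%n. ennreal (\<bar>avg h (w n) x\<bar> * indicator (ball 0 R) x)) ----> ennreal (abs 0 * indicator (ball 0 R) x)"
     using pw[of j x] unfolding h_def[symmetric] by (intro tendsto_intros)
    then show "(%n. ennreal \<bar>avg h (w n) x\<bar> * indicator (ball 0 R) x) ----> 0"
     by (cases "x \<in> ball 0 R") auto
   qed
  qed auto
  then show ?thesis by (simp add: h_def)
 qed
 show ?thesis
 proof (rule order_tendstoI)
  fix a :: ennreal assume "0 < a"
  obtain e where e: "0 < e" "ennreal e <= a"
  proof (cases a)
   case (real r)
   then show ?thesis using that[of r] \<open>0 < a\<close> by auto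
  next
   case top
   then show ?thesis using that[of 1] by auto
  qed
  obtain j where "(V + 1) / e < real j" using reals_Archimedean2[of "(V + 1) / e"] by blast
  then have j: "(V + 1) / e < real (Suc j)" by simp
  define h where "h = 1 / real (Suc j)"
  have h: "h > 0" "h * (V + 1) < e" using j e by (auto simp: h_def field_simps)
  have bound: "(\<integral>\<^sup>+x. ennreal \<bar>w n x\<bar> * indicator (ball 0 R) x \<partial>lborel)
   <= (\<integral>\<^sup>+x. ennreal \<bar>avg h (w n) x\<bar> * indicator (ball 0 R) x \<partial>lborel) + ennreal (h * (V + 1) / 2)" for n
  proof -
   have pt: "ennreal \<bar>w n x\<bar> * indicator (ball 0 R) x <= ennreal \<bar>avg h (w n) x\<bar> * indicator (ball 0 R) x
    + (ennreal (h / 2) * indicator (ball 0 R) x + ennreal (1 / (2 * h)) * ennreal ((w n x - avg h (w n) x)\<^sup>2))" for x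
   proof (cases "x \<in> ball 0 R")
    case True
    let ?d = "\<bar>w n x - avg h (w n) x\<bar>"
    have "d <= h / 2 + 1 / (2 * h) * d\<^sup>2" for d
    proof -
     have "0 <= (d - h)\<^sup>2" by simp
     also have "(d - h)\<^sup>2 = h * h + d * d - 2 * h * d" by (simp add: power2_eq_square algebra_simps)
     finally show ?thesis using h by (simp add: field_simps power2_eq_square)
    qed
    from this[of ?d] have "?d <= h / 2 + 1 / (2 * h) * ?d\<^sup>2" .
    then have "abs (w n x) <= \<bar>avg h (w n) x\<bar> + (h / 2 + 1 / (2 * h) * (w n x - avg h (w n) x)\<^sup>2)"
     using abs_triangle_ineq2[of "w n x" "avg h (w n) x"] by simp
    then have "ennreal \<bar>w n x\<bar> <= ennreal (\<bar>avg h (w n) x\<bar> + (h / 2 + 1 / (2 * h) * (w n x - avg h (w n) x)\<^sup>2))"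
     by (rule ennreal_leI)
    also have "... = ennreal \<bar>avg h (w n) x\<bar> + (ennreal (h / 2) + ennreal (1 / (2 * h)) * ennreal ((w n x - avg h (w n) x)\<^sup>2))"
     using h by (simp add: ennreal_mult[symmetric])
    finally show ?thesis using True by simp
   qed simp
   have "(\<integral>\<^sup>+x. ennreal \<bar>w n x\<bar> * indicator (ball 0 R) x \<partial>lborel)
    <= (\<integral>\<^sup>+x. ennreal \<bar>avg h (w n) x\<bar> * indicator (ball 0 R) x
    + (ennreal (h / 2) * indicator (ball 0 R) x + ennreal (1 / (2 * h)) * ennreal ((w n x - avg h (w n) x)\<^sup>2)) \<partial>lborel)"
    by (intro nn_integral_mono pt)
   also have "... = (\<integral>\<^sup>+x. ennreal \<bar>avg h (w n) x\<bar> * indicator (ball 0 R) x \<partial>lborel)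
    + (ennreal (h / 2) * emeasure lborel (ball (0::real^'n) R) + ennreal (1 / (2 * h)) * (\<integral>\<^sup>+x. ennreal ((w n x - avg h (w n) x)\<^sup>2) \<partial>lborel))"
    by (simp add: nn_integral_add nn_integral_cmult nn_integral_cmult_indicator)
   also have "... <= (\<integral>\<^sup>+x. ennreal \<bar>avg h (w n) x\<bar> * indicator (ball 0 R) x \<partial>lborel)
    + (ennreal (h / 2) * ennreal V + ennreal (1 / (2 * h)) * ennreal (h\<^sup>2 * 1))"
   proof (intro add_left_mono mult_left_mono add_mono)
    have "(\<integral>\<^sup>+x. ennreal ((w n x - avg h (w n) x)\<^sup>2) \<partial>lborel) <= ennreal (h\<^sup>2 * dirichlet (w n))"
     using h by (intro avg_L2 w) auto
    also have "... <= ennreal (h\<^sup>2 * 1)" using d by (intro ennreal_leI mult_left_mono) auto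
    finally show "(\<integral>\<^sup>+x. ennreal ((w n x - avg h (w n) x)\<^sup>2) \<partial>lborel) <= ennreal (h\<^sup>2 * 1)" .
   qed (auto simp: V)
   also have "ennreal (h / 2) * ennreal V + ennreal (1 / (2 * h)) * ennreal (h\<^sup>2 * 1) = ennreal (h / 2 * V + 1 / (2 * h) * (h\<^sup>2 * 1))"
    using h V(2) by (simp add: ennreal_mult[symmetric] ennreal_plus[symmetric] del: ennreal_plus)
   also have "h / 2 * V + 1 / (2 * h) * (h\<^sup>2 * 1) = h * (V + 1) / 2" using h by (simp add: field_simps power2_eq_square)
   finally show ?thesis .
  qed
  have "\<forall>\<^sub>F n in sequentially. (\<integral>\<^sup>+x. ennreal \<bar>avg h (w n) x\<bar> * indicator (ball 0 R) x \<partial>lborel) < ennreal (e / 2)"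
   using avg0[of j] e(1) unfolding h_def[symmetric] by (intro order_tendstoD(2)) auto
  then show "\<forall>\<^sub>F n in sequentially. (\<integral>\<^sup>+x. ennreal \<bar>w n x\<bar> * indicator (ball 0 R) x \<partial>lborel) < a"
  proof eventually_elim
   case (elim n)
   have "(\<integral>\<^sup>+x. ennreal \<bar>w n x\<bar> * indicator (ball 0 R) x \<partial>lborel) <= ennreal (e / 2) + ennreal (h * (V + 1) / 2)"
    using elim by (intro order_trans[OF bound] add_right_mono) auto
   also have "... = ennreal (e / 2 + h * (V + 1) / 2)" using e h V(2) by simp
   also have "... < ennreal e" using h(2) e(1) by (intro ennreal_lessI) auto
   also have "... <= a" by fact
   finally show ?case .
  qed
 qed simp
qed

section \<open>Completeness and compactness\<close>

lemma Lspace_Cauchy_subseq_AE: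
 fixes u :: "nat => 'a => real"
 assumes r: "1 < r" and u: "!!n. u n \<in> Lspace M r"
  and cau: "!!e. 0 < e ==> EX N. ALL m>=N. ALL n>=N. pint M r (%x. u m x - u n x) < e"
 shows "EX \<sigma> w. strict_mono \<sigma> & w \<in> borel_measurable M & (AE x in M. (%n. u (\<sigma> n) x) ----> w x)"
proof -
 have [measurable]: "u n \<in> borel_measurable M" for n using u by (auto dest: LspaceD)
 have "EX \<sigma>. ALL n. (ALL i>=\<sigma> n. ALL j>=\<sigma> n. pint M r (%x. u i x - u j x) < (1/4) ^ n) & \<sigma> n < \<sigma> (Suc n)"
 proof (rule dependent_nat_choice)
  show "EX N. ALL i>=N. ALL j>=N. pint M r (%x. u i x - u j x) < (1/4) ^ 0" using cau[of 1] by simp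
  fix k n :: nat
  obtain N where N: "ALL i>=N. ALL j>=N. pint M r (%x. u i x - u j x) < (1/4) ^ Suc n"
   using cau[of "(1/4) ^ Suc n"] by auto
  show "EX N. (ALL i>=N. ALL j>=N. pint M r (%x. u i x - u j x) < (1/4) ^ Suc n) & k < N"
   by (rule exI[of _ "max N (Suc k)"]) (use N in auto)
 qed
 then obtain \<sigma> where \<sigma>: "!!n i j. \<sigma> n <= i ==> \<sigma> n <= j ==> pint M r (%x. u i x - u j x) < (1/4) ^ n"
  "!!n. \<sigma> n < \<sigma> (Suc n)" by blast
 have mono: "strict_mono \<sigma>" using \<sigma>(2) by (simp add: strict_mono_Suc_iff)
 let ?d = "%k x. \<bar>u (\<sigma> (Suc k)) x - u (\<sigma> k) x\<bar> powr r"
 have "(\<integral>\<^sup>+x. (\<Sum>k. ennreal (2 ^ k * ?d k x)) \<partial>M) = (\<Sum>k. \<integral>\<^sup>+x. ennreal (2 ^ k * ?d k x) \<partial>M)"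
  by (rule nn_integral_suminf) measurable
 also have "... <= (\<Sum>k. ennreal ((1/2) ^ k))"
 proof (rule suminf_le)
  fix k
  have "(\<integral>\<^sup>+x. ennreal (2 ^ k * ?d k x) \<partial>M) = ennreal (2 ^ k) * (\<integral>\<^sup>+x. ennreal (?d k x) \<partial>M)"
   by (subst nn_integral_cmult[symmetric]) (auto simp: ennreal_mult)
  also have "... = ennreal (2 ^ k) * ennreal (pint M r (%x. u (\<sigma> (Suc k)) x - u (\<sigma> k) x))"
   by (simp add: nn_pint[OF Lspace_diff[OF r u u]])
  also have "... <= ennreal (2 ^ k) * ennreal ((1/4) ^ k)"
   using \<sigma>(1)[of k "\<sigma> (Suc k)" "\<sigma> k"] \<sigma>(2)[of k] by (intro mult_left_mono ennreal_leI) auto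
  also have "... = ennreal ((1/2) ^ k)"
   by (simp add: ennreal_mult[symmetric] power_mult_distrib[symmetric])
  finally show "(\<integral>\<^sup>+x. ennreal (2 ^ k * ?d k x) \<partial>M) <= ennreal ((1/2) ^ k)" .
 qed auto
 finally have le: "(\<integral>\<^sup>+x. (\<Sum>k. ennreal (2 ^ k * ?d k x)) \<partial>M) <= (\<Sum>k. ennreal ((1/2) ^ k))" .
 have "(\<Sum>k. ennreal ((1/2) ^ k)) ~= top"
  by (intro ennreal_suminf_neq_top summable_geometric) auto
 then have fin: "(\<integral>\<^sup>+x. (\<Sum>k. ennreal (2 ^ k * ?d k x)) \<partial>M) ~= \<infinity>"
  using le by (metis infinity_ennreal_def top.extremum_uniqueI)
 have "AE x in M. (\<Sum>k. ennreal (2 ^ k * ?d k x)) ~= \<infinity>"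
  by (rule nn_integral_PInf_AE[OF _ fin]) measurable
 then have ae: "AE x in M. convergent (%n. u (\<sigma> n) x)"
 proof eventually_elim
  case (elim x)
  define S where "S = (\<Sum>k. ennreal (2 ^ k * ?d k x))"
  define B where "B = enn2real S"
  have "S < top" using elim unfolding S_def infinity_ennreal_def less_top .
  then have B: "S = ennreal B" "B >= 0" by (simp_all add: B_def)
  have le: "\<bar>u (\<sigma> (Suc k)) x - u (\<sigma> k) x\<bar> <= B powr (1 / r) * ((1/2) powr (1 / r)) ^ k" for k
  proof -
   have "ennreal (2 ^ k * ?d k x) <= ennreal B"
    unfolding B(1)[symmetric] S_def by (rule suminf_term_le)
   then have "2 ^ k * ?d k x <= B" using B(2) by simp
   then have "?d k x <= B * (1/2) ^ k" by (simp add: field_simps)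
   then have "?d k x powr (1 / r) <= (B * (1/2) ^ k) powr (1 / r)" using r by (intro powr_mono2) auto
   also have "... = B powr (1 / r) * ((1/2) ^ k) powr (1 / r)" using B(2) by (simp add: powr_mult)
   also have "((1/2::real) ^ k) powr (1 / r) = ((1/2) powr (1 / r)) ^ k"
    by (simp add: powr_realpow[symmetric] powr_powr mult.commute)
   finally show ?thesis using r by (simp add: powr_powr)
  qed
  have "(1/2::real) powr (1 / r) < 1" using powr_less_mono2[of "1 / r" "1/2" 1] r by simp
  then have "summable (%k. B powr (1 / r) * ((1/2) powr (1 / r)) ^ k)"
   by (intro summable_mult summable_geometric) simp
  then have "summable (%k. u (\<sigma> (Suc k)) x - u (\<sigma> k) x)"
   by (rule summable_comparison_test'[where N=0]) (use le in simp)
  then have "convergent (%n. \<Sum>k<n. u (\<sigma> (Suc k)) x - u (\<sigma> k) x)"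
   by (simp add: summable_iff_convergent)
  moreover have "(\<Sum>k<n. u (\<sigma> (Suc k)) x - u (\<sigma> k) x) = u (\<sigma> n) x - u (\<sigma> 0) x" for n
   by (rule sum_lessThan_telescope)
  ultimately have "convergent (%n. (u (\<sigma> n) x - u (\<sigma> 0) x) + u (\<sigma> 0) x)"
   by (intro convergent_add convergent_const) simp
  then show ?case by simp
 qed
 show ?thesis
 proof (intro exI[of _ \<sigma>] exI[of _ "%x. lim (%n. u (\<sigma> n) x)"] conjI mono)
  show "(%x. lim (%n. u (\<sigma> n) x)) \<in> borel_measurable M" by measurable
  show "AE x in M. (%n. u (\<sigma> n) x) ----> lim (%n. u (\<sigma> n) x)"
   using ae by eventually_elim (simp add: convergent_LIMSEQ_iff)
 qed
qed

lemma pint_triangle: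
 assumes r: "1 < r" and u: "u \<in> Lspace M r" and v: "v \<in> Lspace M r"
 shows "pint M r (%x. u x - v x) <= 2 powr r * (pint M r u + pint M r v)"
proof -
 have "pint M r (%x. u x - v x) <= (LINT x|M. 2 powr r * (abs (u x) powr r + abs (v x) powr r))"
  unfolding pint_def using LspaceD[OF Lspace_diff[OF r u v]] LspaceD[OF u] LspaceD[OF v] powr_diff_le[OF r]
  by (intro integral_mono) auto
 then show ?thesis using LspaceD[OF u] LspaceD[OF v] by (simp add: pint_def)
qed

lemma Lspace_complete:
 fixes u :: "nat => 'a => real"
 assumes r: "1 < r" and u: "!!n. u n \<in> Lspace M r"
  and cau: "!!e. 0 < e ==> EX N. ALL m>=N. ALL n>=N. pint M r (%x. u m x - u n x) < e"
 shows "EX w:Lspace M r. (%n. pint M r (%x. u n x - w x)) ----> 0"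
proof -
 obtain \<sigma> w where \<sigma>: "strict_mono \<sigma>" and w: "w \<in> borel_measurable M" "AE x in M. (%n. u (\<sigma> n) x) ----> w x"
  using Lspace_Cauchy_subseq_AE[OF r u cau] by blast
 have cau': "EX N. ALL m>=N. ALL n>=N. pint M r (%x. u (\<sigma> m) x - u (\<sigma> n) x) < e" if e: "0 < e" for e
 proof -
  obtain N where "ALL m>=N. ALL n>=N. pint M r (%x. u m x - u n x) < e" using cau[OF e] by blast
  then show ?thesis using seq_suble[OF \<sigma>] by (intro exI[of _ N]) (meson le_trans)
 qed
 note lim = pint_Cauchy_limit[of r "%n. u (\<sigma> n)", OF r u w cau']
 have wL: "w \<in> Lspace M r" using lim(1) .
 have "(%n. pint M r (%x. u n x - w x)) ----> 0"
 proof (rule LIMSEQ_I)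
  fix e :: real assume e: "0 < e"
  define e' where "e' = e / (2 * 2 powr r + 1)"
  have den: "2 * 2 powr r + 1 > (0::real)" by (simp add: add_nonneg_pos)
  have e': "e' > 0" using e den by (simp add: e'_def)
  obtain N1 where N1: "ALL m>=N1. ALL n>=N1. pint M r (%x. u m x - u n x) < e'" using cau[OF e'] by blast
  obtain N2 where N2: "!!n. n >= N2 ==> norm (pint M r (%x. u (\<sigma> n) x - w x) - 0) < e'"
   using LIMSEQ_D[OF lim(2) e'] by blast
  have "norm (pint M r (%x. u n x - w x) - 0) < e" if n: "n >= N1" for n
  proof -
   define k where "k = max N1 N2"
   have k: "\<sigma> k >= N1" "k >= N2" using seq_suble[OF \<sigma>, of k] by (auto simp: k_def)
   have tri: "pint M r (%x. u n x - w x)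
    <= 2 powr r * (pint M r (%x. u n x - u (\<sigma> k) x) + pint M r (%x. w x - u (\<sigma> k) x))"
    using pint_triangle[OF r Lspace_diff[OF r u u] Lspace_diff[OF r wL u], of n "\<sigma> k" "\<sigma> k"] by simp
   have sym: "pint M r (%x. w x - u (\<sigma> k) x) = pint M r (%x. u (\<sigma> k) x - w x)"
    by (simp add: pint_def abs_minus_commute)
   have small: "pint M r (%x. u n x - u (\<sigma> k) x) < e'" "pint M r (%x. u (\<sigma> k) x - w x) < e'"
    using N1 n k N2[OF k(2)] by auto
   have "2 powr r * (pint M r (%x. u n x - u (\<sigma> k) x) + pint M r (%x. u (\<sigma> k) x - w x)) <= 2 powr r * (e' + e')"
    using small by (intro mult_left_mono) auto
   from order_trans[OF tri[unfolded sym] this] have "pint M r (%x. u n x - w x) <= 2 powr r * (e' + e')" .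
   also have "... < e"
   proof -
    have "e' * (2 * 2 powr r + 1) = e" using den by (simp add: e'_def)
    then have "2 powr r * (e' + e') + e' = e" by (simp add: algebra_simps)
    then show ?thesis using e' by linarith
   qed
   finally show ?thesis by simp
  qed
  then show "EX no. ALL n>=no. norm (pint M r (%x. u n x - w x) - 0) < e" by blast
 qed
 then show ?thesis using wL by blast
qed

lemma grad_diff:
 assumes "u \<in> test_functions" "v \<in> test_functions"
 shows "grad (%x. u x - v x) x = grad u x - grad v x"
proof -
 have "partial_deriv i (%x. u x - v x) x = partial_deriv i u x - partial_deriv i v x" for i
  using partial_deriv_add[OF tf_differentiable[OF assms(1)] tf_differentiable[OF tf_cmult[OF assms(2), of "-1"]], of i x]
   partial_deriv_cmult[OF tf_differentiable[OF assms(2)], of i "-1" x] by simp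
 then show ?thesis by (simp add: grad_def vec_eq_iff)
qed

lemma grad_cmult: "u \<in> test_functions ==> grad (%x. c * u x) x = c *\<^sub>R grad u x"
 by (simp add: grad_def vec_eq_iff partial_deriv_cmult tf_differentiable)

lemma dirichlet_cmult: "u \<in> test_functions ==> dirichlet (%x. c * u x) = c\<^sup>2 * dirichlet u"
 by (simp add: dirichlet_def grad_cmult power_mult_distrib)

lemma dirichlet_diff_le:
 assumes u: "u \<in> test_functions" and v: "v \<in> test_functions"
 shows "dirichlet (%x. u x - v x) <= 2 * dirichlet u + 2 * dirichlet v"
proof -
 have "dirichlet (%x. u x - v x) <= (LINT x|lborel. 2 * (norm (grad u x))\<^sup>2 + 2 * (norm (grad v x))\<^sup>2)"
  unfolding dirichlet_def
 proof (rule integral_mono)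
  show "integrable lborel (%x. (norm (grad (%x. u x - v x) x))\<^sup>2)"
   by (rule dirichlet_integrable[OF tf_diff[OF u v]])
  show "integrable lborel (%x. 2 * (norm (grad u x))\<^sup>2 + 2 * (norm (grad v x))\<^sup>2)"
   using dirichlet_integrable[OF u] dirichlet_integrable[OF v] by simp
  fix x
  have "norm (grad u x - grad v x) <= norm (grad u x) + norm (grad v x)" by (rule norm_triangle_ineq4)
  then have "(norm (grad u x - grad v x))\<^sup>2 <= (norm (grad u x) + norm (grad v x))\<^sup>2" by (intro power_mono) auto
  also have "... <= 2 * (norm (grad u x))\<^sup>2 + 2 * (norm (grad v x))\<^sup>2"
   using sum_squares_bound[of "norm (grad u x)" "norm (grad v x)"] by (simp add: power2_sum)
  finally show "(norm (grad (%x. u x - v x) x))\<^sup>2 <= 2 * (norm (grad u x))\<^sup>2 + 2 * (norm (grad v x))\<^sup>2"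
   by (simp add: grad_diff[OF u v])
 qed
 then show ?thesis using dirichlet_integrable[OF u] dirichlet_integrable[OF v] by (simp add: dirichlet_def)
qed

text \<open>
 A diagonal subsequence makes every probe converge. Then the probes of differences of late members tend to zero, and
 \<open>null_of_probes\<close> and \<open>embedding_null\<close> apply to these differences, for all good pairs at once.
\<close>

lemma compact_subsequence:
 fixes u :: "nat => real ^ 'n::finite => real"
 assumes N: "2 <= CARD('n)" and b: "0 <= b" "b < real CARD('n)" and q: "1 < q"
  and u: "!!n. u n \<in> test_functions" and d: "!!n. dirichlet (u n) <= B" and Q: "!!n. pint (wmeas b) q (u n) <= B"
 shows "EX \<sigma>::nat => nat. strict_mono \<sigma> & (ALL \<eta> r. good_pair CARD('n) b q \<eta> r -->
  (ALL e>0. EX N. ALL m>=N. ALL n>=N. pint (wmeas \<eta>) r (%x. u (\<sigma> m) x - u (\<sigma> n) x) < e))"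
proof -
 have B0: "B >= 0" using d[of 0] dirichlet_nonneg order_trans by blast
 have "EX K. ALL n. \<bar>probe i (u n)\<bar> <= K" for i
 proof -
  obtain x j where x: "!!u. probe i u = avg (1 / real (Suc j)) u (x :: real ^ 'n)" using probe_ex by blast
  define h where "h = 1 / real (Suc j)"
  have h: "0 < h" "h <= 1" by (auto simp: h_def)
  have "\<bar>avg h (u n) x\<bar> <= 1 + ball_const TYPE('n) * (1 / h ^ CARD('n)) * ((norm x + 1) powr b * B)" for n
  proof -
   have "\<bar>avg h (u n) x\<bar> <= 1 + ball_const TYPE('n) * (1 / h ^ CARD('n)) * ((norm x + 1) powr b * pint (wmeas b) q (u n))"
    by (rule avg_bound[OF u b q h order_refl])
   also have "... <= 1 + ball_const TYPE('n) * (1 / h ^ CARD('n)) * ((norm x + 1) powr b * B)"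
    using Q[of n] h ball_const_pos[where 'n='n] by (intro add_left_mono mult_left_mono) auto
   finally show ?thesis .
  qed
  then show ?thesis unfolding x h_def[symmetric] by blast
 qed
 then obtain K where K: "!!i n. \<bar>probe i (u n)\<bar> <= K i" by metis
 have "compact (PiE UNIV (%i::nat. {- K i..K i}))"
  using compactin_PiE[of "%_::nat. euclideanreal" UNIV "%i::nat. {- K i..K i}"]
  by (simp add: euclidean_product_topology)
 then have sc: "seq_compact (PiE UNIV (%i::nat. {- K i..K i}))" by (rule compact_imp_seq_compact)
 define f where "f = (%n i. probe i (u n))"
 have "ALL n. f n \<in> PiE UNIV (%i::nat. {- K i..K i})"
 proof
  fix n
  have "f n i \<in> {- K i..K i}" for i
   using K[of i n] unfolding f_def by (simp add: abs_le_iff minus_le_iff)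
  then show "f n \<in> PiE UNIV (%i::nat. {- K i..K i})" by (simp add: PiE_iff)
 qed
 then obtain l \<sigma> where \<sigma>: "strict_mono \<sigma>" and l: "(f \<circ> \<sigma>) ----> l"
  using sc unfolding seq_compact_def by blast
 have pr: "(%n. probe i (u (\<sigma> n))) ----> l i" for i
 proof -
  have "continuous_on UNIV (%f :: nat => real. f i)" by (rule continuous_on_product_coordinates)
  then have "isCont (%f :: nat => real. f i) l"
   using continuous_on_eq_continuous_at[OF open_UNIV] by blast
  from isCont_tendsto_compose[OF this l] show ?thesis by (simp add: o_def f_def)
 qed
 define K0 where "K0 = max 1 (max (4 * B) (2 powr q * (2 * B)))"
 define c where "c = 1 / K0"
 have c: "0 < c" "c <= 1" "c * (4 * B) <= 1" "c * (2 powr q * (2 * B)) <= 1"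
 proof -
  have "K0 >= 1" "K0 >= 4 * B" "K0 >= 2 powr q * (2 * B)" unfolding K0_def by auto
  then show "0 < c" "c <= 1" "c * (4 * B) <= 1" "c * (2 powr q * (2 * B)) <= 1" by (auto simp: c_def)
 qed
 have uL: "u n \<in> Lspace (wmeas b) q" for n using b q by (intro tf_Lspace_wmeas u) auto
 have main: "EX N. ALL m>=N. ALL n>=N. pint (wmeas \<eta>) r (%x. u (\<sigma> m) x - u (\<sigma> n) x) < e"
  if g: "good_pair CARD('n) b q \<eta> r" and e: "0 < e" for \<eta> r e
 proof (rule ccontr)
  assume "~ ?thesis"
  then have "ALL k. EX m n. m >= k & n >= k & e <= pint (wmeas \<eta>) r (%x. u (\<sigma> m) x - u (\<sigma> n) x)"
   by (meson not_le)
  then obtain m n where mn: "!!k. m k >= k" "!!k. n k >= k"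
   "!!k. e <= pint (wmeas \<eta>) r (%x. u (\<sigma> (m k)) x - u (\<sigma> (n k)) x)" by metis
  define w where "w = (%k x. c * (u (\<sigma> (m k)) x - u (\<sigma> (n k)) x))"
  have w: "w k \<in> test_functions" for k unfolding w_def by (intro tf_cmult tf_diff u)
  have "dirichlet (w k) <= 1" for k
  proof -
   have "dirichlet (w k) = c\<^sup>2 * dirichlet (%x. u (\<sigma> (m k)) x - u (\<sigma> (n k)) x)"
    unfolding w_def by (rule dirichlet_cmult[OF tf_diff[OF u u]])
   also have "... <= c\<^sup>2 * (2 * dirichlet (u (\<sigma> (m k))) + 2 * dirichlet (u (\<sigma> (n k))))"
    by (intro mult_left_mono dirichlet_diff_le u) auto
   also have "... <= c\<^sup>2 * (4 * B)" using d[of "\<sigma> (m k)"] d[of "\<sigma> (n k)"] by (intro mult_left_mono) auto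
   also have "... <= c * (4 * B)" using c B0 by (intro mult_right_mono) (auto simp: power2_eq_square mult_left_le)
   also have "... <= 1" by (rule c(3))
   finally show ?thesis .
  qed
  moreover have "pint (wmeas b) q (w k) <= 1" for k
  proof -
   have "pint (wmeas b) q (w k) = abs c powr q * pint (wmeas b) q (%x. u (\<sigma> (m k)) x - u (\<sigma> (n k)) x)"
    unfolding w_def by (rule pint_cmult)
   also have "... <= abs c powr q * (2 powr q * (pint (wmeas b) q (u (\<sigma> (m k))) + pint (wmeas b) q (u (\<sigma> (n k)))))"
    by (intro mult_left_mono pint_triangle q uL) auto
   also have "... <= abs c powr q * (2 powr q * (2 * B))"
    using Q[of "\<sigma> (m k)"] Q[of "\<sigma> (n k)"] by (intro mult_left_mono) auto
   also have "... <= c * (2 powr q * (2 * B))"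
   proof (rule mult_right_mono)
    have "c powr q <= c powr 1" using c q by (intro powr_mono') auto
    then show "abs c powr q <= c" using c by simp
   qed (use B0 in auto)
   also have "... <= 1" by (rule c(4))
   finally show ?thesis .
  qed
  moreover have "(%k. probe i (w k)) ----> 0" for i
  proof -
   obtain x j where x: "!!u. probe i u = avg (1 / real (Suc j)) u (x :: real ^ 'n)" using probe_ex by blast
   have "probe i (w k) = c * (probe i (u (\<sigma> (m k))) - probe i (u (\<sigma> (n k))))" for k
    unfolding x w_def by (simp add: avg_cmult avg_diff[OF u u])
   moreover have "filterlim m at_top sequentially" "filterlim n at_top sequentially"
    using mn(1,2) filterlim_at_top_mono[OF filterlim_ident] by (auto intro!: always_eventually)
   then have "(%k. probe i (u (\<sigma> (m k)))) ----> l i" "(%k. probe i (u (\<sigma> (n k)))) ----> l i"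
    using filterlim_compose[OF pr[of i]] by auto
   then have "(%k. c * (probe i (u (\<sigma> (m k))) - probe i (u (\<sigma> (n k))))) ----> c * (l i - l i)"
    by (intro tendsto_intros)
   ultimately show ?thesis by simp
  qed
  ultimately have "(%k. pint (wmeas \<eta>) r (w k)) ----> 0"
   by (intro embedding_null[OF g N w] null_of_probes[OF b q w]) auto
  moreover have "pint (wmeas \<eta>) r (w k) >= abs c powr r * e" for k
   unfolding w_def pint_cmult using mn(3) by (intro mult_left_mono) auto
  ultimately have "abs c powr r * e <= 0" by (intro LIMSEQ_le_const) auto
  then show False using c e by (simp add: mult_le_0_iff)
 qed
 show ?thesis
 proof (intro exI[of _ \<sigma>] conjI allI impI)
  show "strict_mono \<sigma>" by (rule \<sigma>)
 qed (rule main)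
qed

section \<open>The functional and its scaling\<close>

lemma pint_lborel_two: "pint M 2 f = (LINT x|M. (f x)\<^sup>2)"
 by (simp add: pint_def)

lemma sint_two: "sint M 2 f g = (LINT x|M. f x * g x)"
 by (simp add: sint_def)

lemma tf_L2: "u \<in> test_functions ==> u \<in> Lspace lborel 2"
 using tf_mult_integrable[of u u] by (auto simp: Lspace_def power2_eq_square intro: tf_borel)

lemma dirichlet_eq: "u \<in> test_functions ==> dirichlet u = (\<Sum>i\<in>UNIV. pint lborel 2 (partial_deriv i u))"
proof -
 assume u: "u \<in> test_functions"
 have i: "integrable lborel (%x. (partial_deriv i u x)\<^sup>2)" for i
  using LspaceD(2)[OF tf_L2[OF tf_partial[OF u]]] by simp
 show ?thesis
  unfolding dirichlet_def norm_grad pint_lborel_two by (rule Bochner_Integration.integral_sum) (rule i)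
qed

definition Dform :: "(real ^ 'n::finite => real) => (real ^ 'n => real) => real" where
 "Dform u v = (\<Sum>i\<in>UNIV. sint lborel 2 (partial_deriv i u) (partial_deriv i v))"

lemma Dform_self: "u \<in> test_functions ==> Dform u u = dirichlet u"
 by (simp add: Dform_def dirichlet_eq sint_self)

lemma partial_deriv_sum:
 assumes "finite A" "!!j. j \<in> A ==> e j \<in> test_functions"
 shows "partial_deriv i (%x. \<Sum>j\<in>A. c j * e j x) = (%x. \<Sum>j\<in>A. c j * partial_deriv i (e j) x)"
 using assms
proof (induction A rule: finite_induct)
 case empty
 then show ?case by (simp add: partial_deriv_const)
next
 case (insert k A)
 have t: "(%x. \<Sum>j\<in>A. c j * e j x) \<in> test_functions" using insert.prems by (intro tf_sum tf_cmult) auto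
 show ?case
 proof
  fix x
  have "partial_deriv i (%x. \<Sum>j\<in>insert k A. c j * e j x) x = partial_deriv i (%x. c k * e k x + (\<Sum>j\<in>A. c j * e j x)) x"
   using insert.hyps by simp
  also have "... = partial_deriv i (%x. c k * e k x) x + partial_deriv i (%x. \<Sum>j\<in>A. c j * e j x) x"
   by (rule partial_deriv_add[OF tf_differentiable[OF tf_cmult] tf_differentiable[OF t]]) (use insert.prems in auto)
  also have "partial_deriv i (%x. c k * e k x) x = c k * partial_deriv i (e k) x"
   by (rule partial_deriv_cmult[OF tf_differentiable]) (use insert.prems in auto)
  also have "partial_deriv i (%x. \<Sum>j\<in>A. c j * e j x) = (%x. \<Sum>j\<in>A. c j * partial_deriv i (e j) x)"
   using insert by auto
  finally show "partial_deriv i (%x. \<Sum>j\<in>insert k A. c j * e j x) x = (\<Sum>j\<in>insert k A. c j * partial_deriv i (e j) x)"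
   using insert.hyps by simp
 qed
qed

lemma partial_deriv_diff:
 "u \<in> test_functions ==> v \<in> test_functions ==>
  partial_deriv i (%x. u x - s * v x) = (%x. partial_deriv i u x - s * partial_deriv i v x)"
 using partial_deriv_add[OF tf_differentiable tf_differentiable[OF tf_cmult], of u v i "- s"]
  partial_deriv_cmult[OF tf_differentiable, of v i "- s"] by (auto simp: fun_eq_iff)

lemma integral_lborel_scale:
 fixes f :: "'a::euclidean_space => real"
 assumes [measurable]: "f \<in> borel_measurable borel" and t: "t > 0"
 shows "(LINT x|lborel. f (t *\<^sub>R x)) = t powr (- real DIM('a)) * (LINT x|lborel. f x)"
proof -
 have "(LINT x|lborel. f x) = (LINT x|density (distr lborel borel (%x. 0 + t *\<^sub>R x)) (%_. ennreal (abs t ^ DIM('a))). f x)"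
  using lborel_affine[of t "0 :: 'a"] t by simp
 also have "... = (LINT x|lborel. t ^ DIM('a) * f (t *\<^sub>R x))"
  using t by (simp add: integral_density integral_distr)
 also have "... = t ^ DIM('a) * (LINT x|lborel. f (t *\<^sub>R x))" by simp
 finally show ?thesis using t by (simp add: powr_minus powr_realpow)
qed

lemma sint_wmeas:
 assumes [measurable]: "u \<in> borel_measurable borel" "v \<in> borel_measurable borel"
 shows "sint (wmeas \<eta>) r u v = (LINT x|lborel. norm x powr (- \<eta>) * (spow r (u x) * v x))"
 unfolding sint_def wmeas_def by (subst integral_density) auto

definition dil :: "real => real => (real ^ 'n::finite => real) => real ^ 'n => real" where
 "dil \<delta> t u = (%x. t powr \<delta> * u (t *\<^sub>R x))"

lemma tf_dil: "u \<in> test_functions ==> t > 0 ==> dil \<delta> t u \<in> test_functions"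
 unfolding dil_def by (rule tf_dilation) auto

lemma dil_dil: "s > 0 ==> t > 0 ==> dil \<delta> s (dil \<delta> t u) = dil \<delta> (s * t) u"
 by (auto simp: dil_def fun_eq_iff powr_mult mult.commute)

lemma dil_one: "dil \<delta> 1 u = u"
 by (simp add: dil_def)

lemma sint_dil:
 fixes u v :: "real ^ 'n::finite => real"
 assumes [measurable]: "u \<in> borel_measurable borel" "v \<in> borel_measurable borel" and t: "t > 0"
 shows "sint (wmeas \<eta>) r (dil \<delta> t u) (dil \<delta> t v) = t powr (r * \<delta> + \<eta> - real CARD('n)) * sint (wmeas \<eta>) r u v"
proof -
 let ?h = "%x. norm x powr (- \<eta>) * (spow r (u x) * v x)"
 have [measurable]: "dil \<delta> t u \<in> borel_measurable borel" "dil \<delta> t v \<in> borel_measurable borel"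
  unfolding dil_def by measurable
 have e: "norm x powr (- \<eta>) * (spow r (dil \<delta> t u x) * dil \<delta> t v x) = t powr (r * \<delta> + \<eta>) * ?h (t *\<^sub>R x)" for x
 proof -
  have "spow r (dil \<delta> t u x) * dil \<delta> t v x = ((t powr \<delta>) powr (r - 1) * t powr \<delta>) * (spow r (u (t *\<^sub>R x)) * v (t *\<^sub>R x))"
   using t by (simp add: dil_def spow_scale spow_pos)
  also have "(t powr \<delta>) powr (r - 1) * t powr \<delta> = t powr (r * \<delta>)"
   by (simp add: powr_powr powr_add[symmetric] algebra_simps)
  finally have 1: "spow r (dil \<delta> t u x) * dil \<delta> t v x = t powr (r * \<delta>) * (spow r (u (t *\<^sub>R x)) * v (t *\<^sub>R x))" .
  have "norm (t *\<^sub>R x) powr (- \<eta>) = t powr (- \<eta>) * norm x powr (- \<eta>)"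
   using t by (simp add: powr_mult)
  then have 2: "norm x powr (- \<eta>) = t powr \<eta> * norm (t *\<^sub>R x) powr (- \<eta>)"
   using t by (simp add: powr_minus)
  show ?thesis unfolding 1 by (subst 2) (simp add: powr_add)
 qed
 have "sint (wmeas \<eta>) r (dil \<delta> t u) (dil \<delta> t v) = (LINT x|lborel. t powr (r * \<delta> + \<eta>) * ?h (t *\<^sub>R x))"
  by (subst sint_wmeas) (auto simp: e)
 also have "... = t powr (r * \<delta> + \<eta>) * (t powr (- real CARD('n)) * (LINT x|lborel. ?h x))"
  using integral_lborel_scale[of ?h t] t by simp
 also have "... = t powr (r * \<delta> + \<eta> - real CARD('n)) * sint (wmeas \<eta>) r u v"
  using t by (subst sint_wmeas) (auto simp: powr_diff powr_minus divide_inverse)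
 finally show ?thesis .
qed

lemma partial_deriv_dil:
 assumes "u \<in> test_functions" "t > 0"
 shows "partial_deriv i (dil \<delta> t u) = dil (\<delta> + 1) t (partial_deriv i u)"
proof
 fix x
 have "partial_deriv i (dil \<delta> t u) x = t powr \<delta> * partial_deriv i (%x. u (t *\<^sub>R x)) x"
  unfolding dil_def
  by (rule partial_deriv_cmult) (use assms tf_dilation[of u t 1] in \<open>auto intro: tf_differentiable\<close>)
 also have "... = t powr \<delta> * (t * partial_deriv i u (t *\<^sub>R x))"
  by (simp add: partial_deriv_dilation[OF tf_differentiable[OF assms(1)]])
 finally show "partial_deriv i (dil \<delta> t u) x = dil (\<delta> + 1) t (partial_deriv i u) x"
  using assms(2) by (simp add: dil_def powr_add)
qed

lemma wmeas_zero: "sint (wmeas 0 :: (real ^ 'n::finite) measure) r u v = sint lborel r u v"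
 if [measurable]: "u \<in> borel_measurable borel" "v \<in> borel_measurable borel"
proof -
 have "sint (wmeas 0 :: (real ^ 'n) measure) r u v = (LINT x|lborel. norm x powr (- 0) * (spow r (u x) * v x))"
  by (rule sint_wmeas) auto
 also have "... = (LINT x|lborel. spow r (u x) * v x)"
 proof (rule integral_cong_AE)
  show "AE x in lborel. norm x powr (- 0) * (spow r (u x) * v x) = spow r (u x) * v x"
   using AE_nonzero by eventually_elim simp
 qed auto
 finally show ?thesis by (simp add: sint_def)
qed

lemma Dform_dil:
 fixes u v :: "real ^ 'n::finite => real"
 assumes u: "u \<in> test_functions" and v: "v \<in> test_functions" and t: "t > 0"
 shows "Dform (dil \<delta> t u) (dil \<delta> t v) = t powr (2 * \<delta> + 2 - real CARD('n)) * Dform u v"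
proof -
 have "sint lborel 2 (partial_deriv i (dil \<delta> t u)) (partial_deriv i (dil \<delta> t v))
  = t powr (2 * \<delta> + 2 - real CARD('n)) * sint lborel 2 (partial_deriv i u) (partial_deriv i v)" for i
 proof -
  note [measurable] = tf_borel[OF tf_partial[OF u, of i]] tf_borel[OF tf_partial[OF v, of i]]
   tf_borel[OF tf_partial[OF tf_dil[OF u t, of \<delta>], of i]] tf_borel[OF tf_partial[OF tf_dil[OF v t, of \<delta>], of i]]
  have "sint lborel 2 (partial_deriv i (dil \<delta> t u)) (partial_deriv i (dil \<delta> t v))
   = sint (wmeas 0 :: (real ^ 'n) measure) 2 (partial_deriv i (dil \<delta> t u)) (partial_deriv i (dil \<delta> t v))"
   by (rule wmeas_zero[symmetric]) auto
  also have "... = sint (wmeas 0 :: (real ^ 'n) measure) 2 (dil (\<delta> + 1) t (partial_deriv i u)) (dil (\<delta> + 1) t (partial_deriv i v))"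
   by (simp only: partial_deriv_dil[OF u t] partial_deriv_dil[OF v t])
  also have "... = t powr (2 * (\<delta> + 1) + 0 - real CARD('n)) * sint (wmeas 0 :: (real ^ 'n) measure) 2 (partial_deriv i u) (partial_deriv i v)"
   by (rule sint_dil[OF _ _ t]) auto
  also have "sint (wmeas 0 :: (real ^ 'n) measure) 2 (partial_deriv i u) (partial_deriv i v) = sint lborel 2 (partial_deriv i u) (partial_deriv i v)"
   by (rule wmeas_zero) auto
  finally show ?thesis by (simp add: algebra_simps)
 qed
 then show ?thesis by (simp add: Dform_def sum_distrib_left)
qed

text \<open>
 The locale collects what is needed of the exponents. The dilations \<open>dil \<delta> t\<close> multiply the principal
 part \<open>En\<close> and the eigenvalue term by \<open>t\<^sup>\<ell>\<close> and the subscaled term by a smaller power \<open>t\<^sup>\<ell>\<^sup>'\<close>.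
\<close>

locale scaled_problem =
 fixes ty :: "'n::finite itself" and b q a p \<eta> r \<delta> lam :: real
 assumes N: "2 <= CARD('n)" and p2: "2 < p" and pq: "p < q"
  and ga: "good_pair CARD('n) b q a p" and g\<eta>: "good_pair CARD('n) b q \<eta> r"
  and lev2: "2 * \<delta> + 2 = q * \<delta> + b" and leva: "p * \<delta> + a = q * \<delta> + b"
  and lev\<eta>: "r * \<delta> + \<eta> < q * \<delta> + b" "real CARD('n) < r * \<delta> + \<eta>"
begin

definition ell :: real where "ell = q * \<delta> + b - real CARD('n)"
definition ell' :: real where "ell' = r * \<delta> + \<eta> - real CARD('n)"
definition \<theta> :: real where "\<theta> = ell' / ell"

lemma ell: "0 < ell'" "ell' < ell" "0 < ell" "0 < \<theta>" "\<theta> < 1"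
 using lev\<eta> by (auto simp: ell_def ell'_def \<theta>_def)

lemma exps: "0 <= b" "b < real CARD('n)" "0 <= a" "a < real CARD('n)" "0 <= \<eta>" "\<eta> < real CARD('n)"
 "1 < q" "2 < q" "1 < p" "1 < r"
 using ga g\<eta> p2 pq by (auto simp: good_pair_def)

definition En :: "(real ^ 'n => real) => real" where
 "En u = dirichlet u / 2 + pint (wmeas b) q u / q"

definition Ja :: "(real ^ 'n => real) => real" where "Ja u = pint (wmeas a) p u"
definition Gr :: "(real ^ 'n => real) => real" where "Gr u = pint (wmeas \<eta>) r u"

definition Phi :: "(real ^ 'n => real) => real" where
 "Phi u = En u - lam / p * Ja u - Gr u / r"

text \<open>
 The derivative of \<open>Phi\<close> at \<open>u\<close> is \<open>dPhi 1 u\<close>. The coefficient \<open>\<kappa>\<close> is kept variable because dilations change it.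
\<close>

definition dPhi :: "real => (real ^ 'n => real) => (real ^ 'n => real) => real" where
 "dPhi \<kappa> u v = Dform u v + sint (wmeas b) q u v - lam * sint (wmeas a) p u v - \<kappa> * sint (wmeas \<eta>) r u v"

lemma tf_L:
 assumes "u \<in> test_functions"
 shows "u \<in> Lspace (wmeas b :: (real^'n) measure) q" "u \<in> Lspace (wmeas a :: (real^'n) measure) p"
  "u \<in> Lspace (wmeas \<eta> :: (real^'n) measure) r" "partial_deriv i u \<in> Lspace lborel 2"
 using assms exps tf_L2[OF tf_partial[OF assms]] by (auto intro!: tf_Lspace_wmeas)

lemma En_nonneg [simp]: "0 <= En u" and Ja_nonneg [simp]: "0 <= Ja u" and Gr_nonneg [simp]: "0 <= Gr u"
 using exps by (auto simp: En_def Ja_def Gr_def)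

lemma En_bounds: "dirichlet u <= q * En u" "pint (wmeas b) q u <= q * En u"
proof -
 have "1 * dirichlet u <= q / 2 * dirichlet u" using exps by (intro mult_right_mono) auto
 moreover have "q * En u = q / 2 * dirichlet u + pint (wmeas b) q u" using exps by (simp add: En_def field_simps)
 ultimately show "dirichlet u <= q * En u" "pint (wmeas b) q u <= q * En u"
  using pint_nonneg[of "wmeas b" q u] dirichlet_nonneg[of u] by linarith+
qed

lemma lower_order_bounds:
 "lam / p * Ja u <= abs lam * Ja u" "- (lam / p * Ja u) <= abs lam * Ja u" "Gr u / r <= Gr u"
proof -
 have "abs lam / p <= abs lam" using exps by (simp add: divide_le_eq mult_le_cancel_left1)
 from mult_right_mono[OF this Ja_nonneg[of u]] have "abs lam / p * Ja u <= abs lam * Ja u" .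
 moreover have "\<bar>lam / p * Ja u\<bar> = abs lam / p * Ja u" using exps by (simp add: abs_mult)
 ultimately have "\<bar>lam / p * Ja u\<bar> <= abs lam * Ja u" by simp
 then show "lam / p * Ja u <= abs lam * Ja u" "- (lam / p * Ja u) <= abs lam * Ja u" by (simp_all only: abs_le_iff)
 show "Gr u / r <= Gr u" using exps Gr_nonneg[of u] by (simp add: divide_le_eq mult_le_cancel_left1 del: Gr_nonneg)
qed

lemma pint_dil:
 assumes "u \<in> test_functions" "t > 0"
 shows "pint (wmeas s) k (dil \<delta> t u) = t powr (k * \<delta> + s - real CARD('n)) * pint (wmeas s :: (real^'n) measure) k u"
 using sint_dil[OF tf_borel[OF assms(1)] tf_borel[OF assms(1)] assms(2), of s k \<delta>] by (simp add: sint_self)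

lemma En_dil: "u \<in> test_functions ==> t > 0 ==> En (dil \<delta> t u) = t powr ell * En u"
proof -
 assume u: "u \<in> test_functions" and t: "t > 0"
 have e: "2 * \<delta> + 2 - real CARD('n) = ell" "q * \<delta> + b - real CARD('n) = ell"
  by (simp_all add: ell_def lev2)
 show ?thesis
  using Dform_dil[OF u u t, of \<delta>] pint_dil[OF u t, of b q]
  by (simp add: En_def Dform_self[symmetric] u t tf_dil e distrib_left)
qed

lemma Ja_dil: "u \<in> test_functions ==> t > 0 ==> Ja (dil \<delta> t u) = t powr ell * Ja u"
 using pint_dil[of u t a p] by (simp add: Ja_def ell_def leva)

lemma Gr_dil: "u \<in> test_functions ==> t > 0 ==> Gr (dil \<delta> t u) = t powr ell' * Gr u"
 using pint_dil[of u t \<eta> r] by (simp add: Gr_def ell'_def)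

text \<open>
 Enlarging the energy by a dilation and shrinking the coefficient of the subscaled term are the same.
\<close>

lemma dPhi_dil:
 assumes u: "u \<in> test_functions" and v: "v \<in> test_functions" and t: "t > 0"
 shows "dPhi \<kappa> (dil \<delta> t u) (dil \<delta> t v) = t powr ell * dPhi (\<kappa> * t powr (ell' - ell)) u v"
proof -
 note m = tf_borel[OF u] tf_borel[OF v]
 have e: "t powr ell' = t powr ell * t powr (ell' - ell)" by (simp flip: powr_add)
 have "dPhi \<kappa> (dil \<delta> t u) (dil \<delta> t v) = t powr ell * Dform u v + t powr ell * sint (wmeas b) q u v
  - lam * (t powr ell * sint (wmeas a) p u v) - \<kappa> * (t powr ell' * sint (wmeas \<eta>) r u v)"
  using Dform_dil[OF u v t, of \<delta>] sint_dil[OF m t, of b q \<delta>] sint_dil[OF m t, of a p \<delta>] sint_dil[OF m t, of \<eta> r \<delta>]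
  by (simp add: dPhi_def ell_def ell'_def lev2 leva)
 then show ?thesis unfolding e dPhi_def by (simp add: algebra_simps)
qed

text \<open>
 The embeddings on the unit ball, carried to every energy by dilation.
\<close>

lemma scale_bounds:
 shows "EX C>0. ALL u:test_functions. ALL K>0. En u <= K --> Ja u <= C * K & Gr u <= C * K powr \<theta>"
proof -
 obtain C1 where C1: "C1 >= 0" "!!u. u \<in> (test_functions :: (real ^ 'n => real) set) ==> dirichlet u <= 1 ==>
   pint (wmeas b) q u <= 1 ==> pint (wmeas a) p u <= C1"
  using embedding_bound[OF ga N] by blast
 obtain C2 where C2: "C2 >= 0" "!!u. u \<in> (test_functions :: (real ^ 'n => real) set) ==> dirichlet u <= 1 ==>
   pint (wmeas b) q u <= 1 ==> pint (wmeas \<eta>) r u <= C2"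
  using embedding_bound[OF g\<eta> N] by blast
 define C where "C = (C1 + C2 + 1) * q"
 have q: "q > 2" using exps by simp
 have "C > 0" using C1 C2 q by (simp add: C_def)
 moreover have "Ja u <= C * K & Gr u <= C * K powr \<theta>" if u: "u \<in> test_functions" and K: "K > 0" and le: "En u <= K" for u K
 proof -
  define t where "t = (1 / (q * K)) powr (1 / ell)"
  have t: "t > 0" using q K by (simp add: t_def)
  have tl: "t powr ell = 1 / (q * K)" using ell q K by (simp add: t_def powr_powr)
  have tl': "t powr ell' = (1 / (q * K)) powr \<theta>" by (simp add: t_def powr_powr \<theta>_def)
  let ?v = "dil \<delta> t u"
  have v: "?v \<in> test_functions" by (rule tf_dil[OF u t])
  have "q * En ?v <= 1" using le q K by (simp add: En_dil[OF u t] tl field_simps)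
  then have vv: "dirichlet ?v <= 1" "pint (wmeas b) q ?v <= 1" using En_bounds[of ?v] by linarith+
  have "Ja ?v <= C1" "Gr ?v <= C2" using C1(2)[OF v vv] C2(2)[OF v vv] by (auto simp: Ja_def Gr_def)
  then have "1 / (q * K) * Ja u <= C1" "(1 / (q * K)) powr \<theta> * Gr u <= C2"
   by (simp_all add: Ja_dil[OF u t] Gr_dil[OF u t] tl tl')
  then have 1: "Ja u <= C1 * (q * K)" and 2: "Gr u <= C2 * (q * K) powr \<theta>"
   using q K by (simp_all add: powr_divide field_simps)
  have "C1 * (q * K) <= C * K" using C2 q K unfolding C_def by (simp add: algebra_simps)
  moreover have "C2 * (q * K) powr \<theta> <= C * K powr \<theta>"
  proof -
   have "q powr \<theta> <= q powr 1" using q ell by (intro powr_mono) auto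
   then have "C2 * (q powr \<theta> * K powr \<theta>) <= C2 * (q * K powr \<theta>)"
    using C2 q by (intro mult_left_mono mult_right_mono) auto
   also have "... <= C * K powr \<theta>" using C1 q unfolding C_def by (simp add: algebra_simps)
   finally show ?thesis using q K by (simp add: powr_mult)
  qed
  ultimately show ?thesis using 1 2 by linarith
 qed
 ultimately show ?thesis by blast
qed

lemma En_convex:
 assumes A: "finite A" "!!i. i \<in> A ==> 0 <= c i" "sum c A <= 1" and u: "!!i. i \<in> A ==> u i \<in> test_functions"
 shows "En (%x. \<Sum>i\<in>A. c i * u i x) <= (\<Sum>i\<in>A. c i * En (u i))"
proof -
 have t: "(%x. \<Sum>i\<in>A. c i * u i x) \<in> test_functions" using u by (intro tf_sum tf_cmult)
 have "dirichlet (%x. \<Sum>i\<in>A. c i * u i x) = (\<Sum>k\<in>UNIV. pint lborel 2 (%x. \<Sum>i\<in>A. c i * partial_deriv k (u i) x))"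
  by (simp add: dirichlet_eq[OF t] partial_deriv_sum[OF A(1) u])
 also have "... <= (\<Sum>k\<in>UNIV. \<Sum>i\<in>A. c i * pint lborel 2 (partial_deriv k (u i)))"
  using tf_L(4)[OF u] by (intro sum_mono pint_convex A) auto
 also have "... = (\<Sum>i\<in>A. c i * dirichlet (u i))"
  by (subst sum.swap) (auto simp: dirichlet_eq[OF u] sum_distrib_left)
 finally have 1: "dirichlet (%x. \<Sum>i\<in>A. c i * u i x) <= (\<Sum>i\<in>A. c i * dirichlet (u i))" .
 have 2: "pint (wmeas b) q (%x. \<Sum>i\<in>A. c i * u i x) <= (\<Sum>i\<in>A. c i * pint (wmeas b) q (u i))"
  using tf_L(1)[OF u] exps by (intro pint_convex A) auto
 have "En (%x. \<Sum>i\<in>A. c i * u i x) <= (\<Sum>i\<in>A. c i * dirichlet (u i)) / 2 + (\<Sum>i\<in>A. c i * pint (wmeas b) q (u i)) / q"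
  unfolding En_def using 1 2 exps by (intro add_mono divide_right_mono) auto
 also have "... = (\<Sum>i\<in>A. c i * En (u i))"
  by (simp add: En_def sum_divide_distrib sum.distrib[symmetric] distrib_left)
 finally show ?thesis .
qed

lemma uminus_sym:
 assumes "u \<in> test_functions"
 shows "En (%x. - u x) = En u" "Ja (%x. - u x) = Ja u" "Gr (%x. - u x) = Gr u" "Phi (%x. - u x) = Phi u"
  "dPhi \<kappa> (%x. - u x) v = - dPhi \<kappa> u v"
proof -
 have pd: "partial_deriv i (%x. - u x) = (%x. - partial_deriv i u x)" for i
  using partial_deriv_cmult[OF tf_differentiable[OF assms], of i "-1"] by (auto simp: fun_eq_iff)
 have pm: "pint M k (%x. - f x) = pint M k f" for M :: "(real^'n) measure" and k f by (simp add: pint_def)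
 have "dirichlet (%x. - u x) = dirichlet u"
  using dirichlet_cmult[OF assms, of "-1"] by simp
 then show 1: "En (%x. - u x) = En u" "Ja (%x. - u x) = Ja u" "Gr (%x. - u x) = Gr u"
  by (simp_all add: En_def Ja_def Gr_def pm)
 then show "Phi (%x. - u x) = Phi u" by (simp add: Phi_def)
 show "dPhi \<kappa> (%x. - u x) v = - dPhi \<kappa> u v"
  by (simp add: dPhi_def Dform_def pd sint_uminus_left sum_negf algebra_simps)
qed

lemma dPhi_linear:
 assumes u: "u \<in> test_functions" and A: "finite A" and w: "!!i. i \<in> A ==> w i \<in> test_functions"
 shows "dPhi \<kappa> u (%x. \<Sum>i\<in>A. c i * w i x) = (\<Sum>i\<in>A. c i * dPhi \<kappa> u (w i))"
proof -
 have lin: "sint M k f (%x. \<Sum>i\<in>A. c i * h i x) = (\<Sum>i\<in>A. c i * sint M k f (h i))"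
  if "1 < k" "f \<in> Lspace M k" "!!i. i \<in> A ==> h i \<in> Lspace M k" for M :: "(real^'n) measure" and k f h
 proof -
  have "sint M k f (%x. \<Sum>i\<in>A. c i * h i x) = (LINT x|M. (\<Sum>i\<in>A. c i * (spow k (f x) * h i x)))"
   by (simp add: sint_def sum_distrib_left mult.left_commute)
  also have "... = (\<Sum>i\<in>A. c i * sint M k f (h i))"
   using integrable_spow_mult[OF that(1,2) that(3)] by (simp add: sint_def)
  finally show ?thesis .
 qed
 have D: "Dform u (%x. \<Sum>i\<in>A. c i * w i x) = (\<Sum>i\<in>A. c i * Dform u (w i))"
 proof -
  have pd: "partial_deriv k (%x. \<Sum>i\<in>A. c i * w i x) = (%x. \<Sum>i\<in>A. c i * partial_deriv k (w i) x)" for k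
   by (rule partial_deriv_sum[OF A w])
  have "Dform u (%x. \<Sum>i\<in>A. c i * w i x) = (\<Sum>k\<in>UNIV. \<Sum>i\<in>A. c i * sint lborel 2 (partial_deriv k u) (partial_deriv k (w i)))"
   unfolding Dform_def pd
   using tf_L(4)[OF u] tf_L(4)[OF w] by (intro sum.cong refl lin) auto
  then show ?thesis by (subst (asm) sum.swap) (simp add: Dform_def sum_distrib_left)
 qed
 show ?thesis
  unfolding dPhi_def D
  using lin[OF exps(7) tf_L(1)[OF u] tf_L(1)[OF w]] lin[OF exps(9) tf_L(2)[OF u] tf_L(2)[OF w]]
   lin[OF exps(10) tf_L(3)[OF u] tf_L(3)[OF w]]
  by (simp add: sum.distrib[symmetric] sum_subtractf[symmetric] sum_distrib_left algebra_simps)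
qed

text \<open>
 All remainders are small multiples of \<open>En u\<close>. For the subscaled term, of order \<open>En u\<close> to the power \<open>\<theta> < 1\<close>, this uses
 the lower bound on the energy. So the step \<open>s0\<close> serves functions of arbitrarily large energy.
\<close>

lemma Phi_Taylor:
 assumes \<epsilon>: "0 < \<epsilon>" and K0: "0 < K0"
 shows "EX s0>0. ALL s u w. 0 <= s --> s <= s0 --> u \<in> test_functions --> w \<in> test_functions -->
  K0 <= En u --> En w <= 2 * En u --> Phi (%x. u x - s * w x) <= Phi u - s * dPhi 1 u w + s * (\<epsilon> * En u)"
proof -
 obtain C where C: "C > 0" "!!u K. u \<in> test_functions ==> K > 0 ==> En u <= K ==> Ja u <= C * K & Gr u <= C * K powr \<theta>"
  using scale_bounds by blast
 define M0 where "M0 = 3 + abs lam * (3 * C) + 3 * C * K0 powr (\<theta> - 1)"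
 have M0: "M0 > 0" using C by (simp add: M0_def add_pos_nonneg)
 define e where "e = \<epsilon> / M0"
 have e: "e > 0" using \<epsilon> M0 by (simp add: e_def)
 have two: "(1::real) < 2" by simp
 obtain s1 where s1: "s1 > 0" "!!u w s. u \<in> Lspace (lborel :: (real^'n) measure) 2 ==> w \<in> Lspace lborel 2 ==> 0 <= s ==> s <= s1 ==>
   \<bar>pint lborel 2 (%x. u x - s * w x) - pint lborel 2 u + 2 * s * sint lborel 2 u w\<bar> <= s * (e * (pint lborel 2 u + pint lborel 2 w))"
  using pint_Taylor[OF two e, of "lborel :: (real^'n) measure"] by blast
 obtain s2 where s2: "s2 > 0" "!!u w s. u \<in> Lspace (wmeas b :: (real^'n) measure) q ==> w \<in> Lspace (wmeas b) q ==> 0 <= s ==> s <= s2 ==>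
   \<bar>pint (wmeas b) q (%x. u x - s * w x) - pint (wmeas b) q u + q * s * sint (wmeas b) q u w\<bar> <= s * (e * (pint (wmeas b) q u + pint (wmeas b) q w))"
  using pint_Taylor[OF exps(7) e, of "wmeas b :: (real^'n) measure"] by blast
 obtain s3 where s3: "s3 > 0" "!!u w s. u \<in> Lspace (wmeas a :: (real^'n) measure) p ==> w \<in> Lspace (wmeas a) p ==> 0 <= s ==> s <= s3 ==>
   \<bar>pint (wmeas a) p (%x. u x - s * w x) - pint (wmeas a) p u + p * s * sint (wmeas a) p u w\<bar> <= s * (e * (pint (wmeas a) p u + pint (wmeas a) p w))"
  using pint_Taylor[OF exps(9) e, of "wmeas a :: (real^'n) measure"] by blast
 obtain s4 where s4: "s4 > 0" "!!u w s. u \<in> Lspace (wmeas \<eta> :: (real^'n) measure) r ==> w \<in> Lspace (wmeas \<eta>) r ==> 0 <= s ==> s <= s4 ==>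
   \<bar>pint (wmeas \<eta>) r (%x. u x - s * w x) - pint (wmeas \<eta>) r u + r * s * sint (wmeas \<eta>) r u w\<bar> <= s * (e * (pint (wmeas \<eta>) r u + pint (wmeas \<eta>) r w))"
  using pint_Taylor[OF exps(10) e, of "wmeas \<eta> :: (real^'n) measure"] by blast
 define s0 where "s0 = min (min s1 s2) (min s3 s4)"
 have "s0 > 0" using s1 s2 s3 s4 by (simp add: s0_def)
 moreover have "Phi (%x. u x - s * w x) <= Phi u - s * dPhi 1 u w + s * (\<epsilon> * En u)"
  if s: "0 <= s" "s <= s0" and u: "u \<in> test_functions" and w: "w \<in> test_functions"
   and Ku: "K0 <= En u" and Ew: "En w <= 2 * En u" for s u w
 proof -
  have Eu: "En u > 0" using K0 Ku by linarith
  have ss: "s <= s1" "s <= s2" "s <= s3" "s <= s4" using s by (auto simp: s0_def)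
  define TD where "TD = dirichlet (%x. u x - s * w x) - dirichlet u + 2 * s * Dform u w"
  define Tb where "Tb = pint (wmeas b) q (%x. u x - s * w x) - pint (wmeas b) q u + q * s * sint (wmeas b) q u w"
  define Ta where "Ta = Ja (%x. u x - s * w x) - Ja u + p * s * sint (wmeas a) p u w"
  define Tr where "Tr = Gr (%x. u x - s * w x) - Gr u + r * s * sint (wmeas \<eta>) r u w"
  have uw: "(%x. u x - s * w x) \<in> test_functions" by (intro tf_diff tf_cmult u w)
  have "abs TD <= s * (e * (dirichlet u + dirichlet w))"
  proof -
   have TDe: "TD = (\<Sum>i\<in>UNIV. pint lborel 2 (%x. partial_deriv i u x - s * partial_deriv i w x)
     - pint lborel 2 (partial_deriv i u) + 2 * s * sint lborel 2 (partial_deriv i u) (partial_deriv i w))"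
    by (simp add: TD_def dirichlet_eq[OF uw] dirichlet_eq[OF u] partial_deriv_diff[OF u w] Dform_def
      sum.distrib sum_subtractf sum_distrib_left)
   have "abs TD <= (\<Sum>i\<in>UNIV. \<bar>pint lborel 2 (%x. partial_deriv i u x - s * partial_deriv i w x)
     - pint lborel 2 (partial_deriv i u) + 2 * s * sint lborel 2 (partial_deriv i u) (partial_deriv i w)\<bar>)"
    unfolding TDe by (rule sum_abs)
   also have "... <= (\<Sum>i\<in>UNIV. s * (e * (pint lborel 2 (partial_deriv i u) + pint lborel 2 (partial_deriv i w))))"
    using s ss by (intro sum_mono s1(2) tf_L u w) auto
   also have "... = s * (e * (dirichlet u + dirichlet w))"
    unfolding dirichlet_eq[OF u] dirichlet_eq[OF w] sum_distrib_left[symmetric] sum.distrib ..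
   finally show ?thesis .
  qed
  moreover have "abs Tb <= s * (e * (pint (wmeas b) q u + pint (wmeas b) q w))"
   unfolding Tb_def using s ss by (intro s2(2) tf_L u w) auto
  moreover have "abs Ta <= s * (e * (3 * C * En u))"
  proof -
   have "abs Ta <= s * (e * (Ja u + Ja w))"
    unfolding Ta_def Ja_def using s ss by (intro s3(2) tf_L u w) auto
   also have "Ja u + Ja w <= 3 * C * En u"
    using C(2)[OF u Eu order_refl] C(2)[OF w _ Ew] Eu by auto
   finally show ?thesis using s e by (simp add: mult_left_mono)
  qed
  moreover have "abs Tr <= s * (e * (3 * C * K0 powr (\<theta> - 1) * En u))"
  proof -
   have "abs Tr <= s * (e * (Gr u + Gr w))"
    unfolding Tr_def Gr_def using s ss by (intro s4(2) tf_L u w) auto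
   also have "Gr u + Gr w <= 3 * C * K0 powr (\<theta> - 1) * En u"
   proof -
    have "En u powr \<theta> = En u powr (\<theta> - 1) * En u" using Eu by (simp add: powr_diff)
    also have "... <= K0 powr (\<theta> - 1) * En u" using K0 Ku Eu ell by (intro mult_right_mono powr_mono2') auto
    finally have 1: "En u powr \<theta> <= K0 powr (\<theta> - 1) * En u" .
    have "2 powr \<theta> <= 2 powr 1" using ell by (intro powr_mono) auto
    then have "(2 * En u) powr \<theta> <= 2 * (En u powr \<theta>)" using Eu by (simp add: powr_mult mult_right_mono)
    then have 2: "(2 * En u) powr \<theta> <= 2 * (K0 powr (\<theta> - 1) * En u)" using 1 by linarith
    have "Gr u <= C * (K0 powr (\<theta> - 1) * En u)"
     using C(2)[OF u Eu order_refl] mult_left_mono[OF 1, of C] C(1) by linarith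
    moreover have "Gr w <= C * (2 * (K0 powr (\<theta> - 1) * En u))"
     using C(2)[OF w _ Ew] mult_left_mono[OF 2, of C] C(1) Eu by linarith
    ultimately show ?thesis by (simp add: algebra_simps)
   qed
   finally show ?thesis using s e by (simp add: mult_left_mono)
  qed
  moreover have "Phi (%x. u x - s * w x) = Phi u - s * dPhi 1 u w + (TD / 2 + Tb / q - lam / p * Ta - Tr / r)"
   using exps by (simp add: Phi_def dPhi_def En_def TD_def Tb_def Ta_def Tr_def field_simps)
  moreover have "- (lam / p * Ta) <= abs lam * abs Ta"
  proof -
   have "- (lam / p * Ta) <= \<bar>lam / p * Ta\<bar>" by (rule abs_ge_minus_self)
   also have "... = abs lam * abs Ta / p" using exps by (simp add: abs_mult)
   also have "... <= abs lam * abs Ta"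
    using exps mult_nonneg_nonneg[OF abs_ge_zero[of lam] abs_ge_zero[of Ta]]
    by (simp add: divide_le_eq mult_le_cancel_left1 not_less)
   finally show ?thesis .
  qed
  moreover have "- (Tr / r) <= abs Tr"
  proof -
   have "- (Tr / r) <= abs Tr / r" using exps abs_ge_minus_self[of Tr]
    by (simp add: minus_divide_left divide_right_mono del: divide_minus_left)
   also have "... <= abs Tr" using exps by (simp add: divide_le_eq mult_le_cancel_left1)
   finally show ?thesis .
  qed
  moreover have "TD / 2 + Tb / q <= s * (e * (3 * En u))"
  proof -
   have "TD / 2 + Tb / q <= s * (e * (dirichlet u + dirichlet w)) / 2 + s * (e * (pint (wmeas b) q u + pint (wmeas b) q w)) / q"
    using calculation(1,2) exps by (intro add_mono divide_right_mono) auto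
   also have "... = s * (e * (En u + En w))" by (simp add: En_def algebra_simps add_divide_distrib)
   also have "... <= s * (e * (3 * En u))" using s e Ew by (intro mult_left_mono) auto
   finally show ?thesis .
  qed
  moreover have "abs lam * abs Ta <= abs lam * (s * (e * (3 * C * En u)))"
   using calculation(3) by (intro mult_left_mono) auto
  ultimately have "Phi (%x. u x - s * w x) <= Phi u - s * dPhi 1 u w
   + (s * (e * (3 * En u)) + abs lam * (s * (e * (3 * C * En u))) + s * (e * (3 * C * K0 powr (\<theta> - 1) * En u)))"
   by linarith
  also have "s * (e * (3 * En u)) + abs lam * (s * (e * (3 * C * En u))) + s * (e * (3 * C * K0 powr (\<theta> - 1) * En u)) = s * (e * M0 * En u)"
   by (simp add: M0_def algebra_simps)
  also have "e * M0 = \<epsilon>" using M0 by (simp add: e_def)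
  finally show ?thesis .
 qed
 ultimately show ?thesis by blast
qed

subsection \<open>Finite combinations of test functions\<close>

lemma comb_limits:
 fixes e :: "nat => 'a => real"
 assumes k: "1 < k" and e: "!!j. j < m ==> e j \<in> Lspace M k"
  and c: "!!j. j < m ==> (%n. c n j) ----> c0 j"
 shows "(%n. pint M k (%x. \<Sum>j<m. c n j * e j x)) ----> pint M k (%x. \<Sum>j<m. c0 j * e j x)"
  and "v \<in> Lspace M k ==> (%n. sint M k (%x. \<Sum>j<m. c n j * e j x) v) ----> sint M k (%x. \<Sum>j<m. c0 j * e j x) v"
proof -
 have L: "(%x. \<Sum>j<m. d j * e j x) \<in> Lspace M k" for d :: "nat => real"
  using k e by (intro Lspace_sum Lspace_cmult) auto
 have "(%n. pint M k (%x. (\<Sum>j<m. c n j * e j x) - (\<Sum>j<m. c0 j * e j x))) ----> 0"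
 proof (cases "m = 0")
  case True
  then show ?thesis by (simp add: pint_def)
 next
  case False
  have le: "pint M k (%x. (\<Sum>j<m. c n j * e j x) - (\<Sum>j<m. c0 j * e j x))
    <= (\<Sum>j<m. 1 / real m * (\<bar>real m * (c n j - c0 j)\<bar> powr k * pint M k (e j)))" for n
  proof -
   have "(%x. (\<Sum>j<m. c n j * e j x) - (\<Sum>j<m. c0 j * e j x)) = (%x. \<Sum>j<m. 1 / real m * ((real m * (c n j - c0 j)) * e j x))"
    using False by (simp add: fun_eq_iff sum_subtractf[symmetric] left_diff_distrib)
   moreover have "pint M k (%x. \<Sum>j<m. 1 / real m * ((real m * (c n j - c0 j)) * e j x))
    <= (\<Sum>j<m. 1 / real m * pint M k (%x. (real m * (c n j - c0 j)) * e j x))"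
    by (rule pint_convex) (use k e False in \<open>auto intro: Lspace_cmult\<close>)
   ultimately show ?thesis by (simp add: pint_cmult)
  qed
  have "(%n. \<Sum>j<m. 1 / real m * (\<bar>real m * (c n j - c0 j)\<bar> powr k * pint M k (e j)))
   ----> (\<Sum>j<m. 1 / real m * (\<bar>real m * (c0 j - c0 j)\<bar> powr k * pint M k (e j)))"
   using k c by (intro tendsto_intros) auto
  then have "(%n. \<Sum>j<m. 1 / real m * (\<bar>real m * (c n j - c0 j)\<bar> powr k * pint M k (e j))) ----> 0" by simp
  note lim0 = this
  show ?thesis
  proof (rule tendsto_sandwich)
   show "\<forall>\<^sub>F n in sequentially. (0::real) <= pint M k (%x. (\<Sum>j<m. c n j * e j x) - (\<Sum>j<m. c0 j * e j x))" by simp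
   show "\<forall>\<^sub>F n in sequentially. pint M k (%x. (\<Sum>j<m. c n j * e j x) - (\<Sum>j<m. c0 j * e j x))
    <= (\<Sum>j<m. 1 / real m * (\<bar>real m * (c n j - c0 j)\<bar> powr k * pint M k (e j)))"
    using le by (intro always_eventually) blast
  qed (rule tendsto_const lim0)+
 qed
 note lim = pint_sint_limit[OF k L L this]
 show "(%n. pint M k (%x. \<Sum>j<m. c n j * e j x)) ----> pint M k (%x. \<Sum>j<m. c0 j * e j x)" by (rule lim(1))
 show "(%n. sint M k (%x. \<Sum>j<m. c n j * e j x) v) ----> sint M k (%x. \<Sum>j<m. c0 j * e j x) v"
  if "v \<in> Lspace M k" by (rule lim(2)[OF that])
qed

lemma comb_continuous:
 fixes c :: "'y::metric_space => nat => real"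
 assumes e: "!!j. j < m ==> e j \<in> test_functions" and c: "!!j. j < m ==> continuous_on X (%y. c y j)"
 shows "continuous_on X (%y. En (%x. \<Sum>j<m. c y j * e j x))"
  and "continuous_on X (%y. Phi (%x. \<Sum>j<m. c y j * e j x))"
  and "v \<in> test_functions ==> continuous_on X (%y. dPhi \<kappa> (%x. \<Sum>j<m. c y j * e j x) v)"
proof -
 have cl: "(%n. c (y n) j) ----> c l j" if "l \<in> X" "!!n. y n \<in> X" "y ----> l" "j < m" for y l j
  using c[OF that(4)] that(1-3) unfolding continuous_on_sequentially o_def by blast
 have comb: "(%x. \<Sum>j<m. d j * e j x) \<in> test_functions" for d :: "nat => real"
  using e by (intro tf_sum tf_cmult) auto
 have pd: "partial_deriv i (%x. \<Sum>j<m. d j * e j x) = (%x. \<Sum>j<m. d j * partial_deriv i (e j) x)" for i and d :: "nat => real"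
  using e by (intro partial_deriv_sum) auto
 have P: "(%n. pint (wmeas s) k (%x. \<Sum>j<m. c (y n) j * e j x)) ----> pint (wmeas s) k (%x. \<Sum>j<m. c l j * e j x)"
  if "l \<in> X" "!!n. y n \<in> X" "y ----> l" "0 <= s" "s < real CARD('n)" "1 < k" for y l s k
  using that by (intro comb_limits cl e tf_Lspace_wmeas) auto
 have S: "(%n. sint (wmeas s) k (%x. \<Sum>j<m. c (y n) j * e j x) v) ----> sint (wmeas s) k (%x. \<Sum>j<m. c l j * e j x) v"
  if "l \<in> X" "!!n. y n \<in> X" "y ----> l" "0 <= s" "s < real CARD('n)" "1 < k" "v \<in> test_functions" for y l s k v
  using that by (intro comb_limits cl e tf_Lspace_wmeas) auto
 have D: "(%n. dirichlet (%x. \<Sum>j<m. c (y n) j * e j x)) ----> dirichlet (%x. \<Sum>j<m. c l j * e j x)"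
  if "l \<in> X" "!!n. y n \<in> X" "y ----> l" for y l
  unfolding dirichlet_eq[OF comb] pd using that by (intro tendsto_sum comb_limits cl tf_L e) auto
 have DF: "(%n. Dform (%x. \<Sum>j<m. c (y n) j * e j x) v) ----> Dform (%x. \<Sum>j<m. c l j * e j x) v"
  if "l \<in> X" "!!n. y n \<in> X" "y ----> l" "v \<in> test_functions" for y l v
  unfolding Dform_def pd using that by (intro tendsto_sum comb_limits cl tf_L e) auto
 have E: "(%n. En (%x. \<Sum>j<m. c (y n) j * e j x)) ----> En (%x. \<Sum>j<m. c l j * e j x)"
  if "l \<in> X" "!!n. y n \<in> X" "y ----> l" for y l
  unfolding En_def using that exps by (intro tendsto_intros D P) auto
 show "continuous_on X (%y. En (%x. \<Sum>j<m. c y j * e j x))"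
  unfolding continuous_on_sequentially o_def using E by blast
 show "continuous_on X (%y. Phi (%x. \<Sum>j<m. c y j * e j x))"
  unfolding continuous_on_sequentially o_def
 proof (intro allI ballI impI, elim conjE)
  fix y l assume *: "l \<in> X" "ALL n. y n \<in> X" "y ----> l"
  show "(%n. Phi (%x. \<Sum>j<m. c (y n) j * e j x)) ----> Phi (%x. \<Sum>j<m. c l j * e j x)"
   unfolding Phi_def Ja_def Gr_def using * exps by (intro tendsto_intros E P) auto
 qed
 show "continuous_on X (%y. dPhi \<kappa> (%x. \<Sum>j<m. c y j * e j x) v)" if v: "v \<in> test_functions"
  unfolding continuous_on_sequentially o_def
 proof (intro allI ballI impI, elim conjE)
  fix y l assume *: "l \<in> X" "ALL n. y n \<in> X" "y ----> l"
  show "(%n. dPhi \<kappa> (%x. \<Sum>j<m. c (y n) j * e j x) v) ----> dPhi \<kappa> (%x. \<Sum>j<m. c l j * e j x) v"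
   unfolding dPhi_def using * exps v by (intro tendsto_intros DF S) auto
 qed
qed

end

section \<open>From limits of test functions to weak solutions\<close>

lemma locally_integrable_lborel:
 fixes g :: "real ^ 'n::finite => real"
 assumes [measurable]: "g \<in> borel_measurable borel"
  and i: "!!R. 0 < R ==> integrable lborel (%x. indicator (ball 0 R) x * g x)"
 shows "locally_integrable g"
 unfolding locally_integrable_def set_integrable_def
proof (intro allI impI)
 fix K :: "(real ^ 'n) set" assume K: "compact K"
 then obtain R where R: "R > 0" "K \<subseteq> ball 0 R" using bounded_subset_ballD[OF compact_imp_bounded[OF K], of 0] by auto
 have [measurable]: "K \<in> sets borel" using K by (simp add: borel_compact)
 have "integrable lborel (%x. indicator K x *\<^sub>R g x)"
  by (rule Bochner_Integration.integrable_bound[OF i[OF R(1)]]) (use R in \<open>auto simp: indicator_def intro!: AE_I2\<close>)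
 then show "integrable lebesgue (%x. indicator K x *\<^sub>R g x)" by (subst integrable_completion) auto
qed

lemma integrable_wmeas_iff:
 assumes [measurable]: "f \<in> borel_measurable borel"
 shows "integrable (wmeas s) f \<longleftrightarrow> integrable lborel (%x. norm x powr (- s) * f x :: real)"
 unfolding wmeas_def by (subst integrable_density) auto

lemma integral_wmeas:
 assumes [measurable]: "f \<in> borel_measurable borel"
 shows "integral\<^sup>L (wmeas s) f = (LINT x|lborel. norm x powr (- s) * f x :: real)"
 unfolding wmeas_def by (subst integral_density) auto

lemma ball_integrable_wmeas:
 assumes "0 <= s" "s < real CARD('n::finite)" "0 < R"
 shows "integrable (wmeas s :: (real ^ 'n) measure) (indicator (ball 0 R) :: _ => real)"
proof -
 have "integrable lborel (%x::real ^ 'n. norm x powr (- s) * indicator (ball 0 R) x)"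
 proof (rule integrableI_bounded)
  have "(\<integral>\<^sup>+(x::real ^ 'n). ennreal (norm (norm x powr (- s) * indicator (ball 0 R) x :: real)) \<partial>lborel)
   = (\<integral>\<^sup>+(x::real ^ 'n). ennreal (norm x powr (- s)) * indicator (ball 0 R) x \<partial>lborel)"
   by (intro nn_integral_cong) (auto simp: indicator_def)
  also have "... < \<infinity>" using radial_near[of s R, where 'a="real ^ 'n"] assms by simp
  finally show "(\<integral>\<^sup>+(x::real ^ 'n). ennreal (norm (norm x powr (- s) * indicator (ball 0 R) x :: real)) \<partial>lborel) < \<infinity>" .
 qed auto
 then show ?thesis by (subst integrable_wmeas_iff) auto
qed

lemma locally_integrable_spow:
 fixes w :: "real ^ 'n::finite => real"
 assumes w: "w \<in> Lspace (wmeas s) k" and k: "1 < k" and s: "0 <= s" "s < real CARD('n)"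
 shows "locally_integrable (%x. norm x powr (- s) * spow k (w x))"
proof (rule locally_integrable_lborel)
 have [measurable]: "w \<in> borel_measurable borel" using LspaceD(1)[OF w] by (simp cong: measurable_cong_sets)
 show "(%x. norm x powr (- s) * spow k (w x)) \<in> borel_measurable borel" by measurable
 fix R :: real assume R: "0 < R"
 have "integrable (wmeas s) (%x. indicator (ball 0 R) x * spow k (w x))"
 proof (rule Bochner_Integration.integrable_bound)
  show "integrable (wmeas s) (%x. indicator (ball 0 R) x + abs (w x) powr k)"
   by (intro Bochner_Integration.integrable_add ball_integrable_wmeas s R LspaceD(2)[OF w])
  show "AE x in wmeas s. norm (indicator (ball 0 R) x * spow k (w x)) <= norm (indicator (ball 0 R) x + abs (w x) powr k)"
  proof (rule AE_I2)
   fix x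
   have "abs (w x) powr (k - 1) <= 1 + abs (w x) powr k"
   proof (cases "abs (w x) <= 1")
    case True
    then have "abs (w x) powr (k - 1) <= 1 powr (k - 1)" using k by (intro powr_mono2) auto
    then show ?thesis using powr_ge_zero[of "abs (w x)" k] by (simp del: powr_ge_zero)
   next
    case False
    then have "abs (w x) powr (k - 1) <= abs (w x) powr k" by (intro powr_mono) auto
    then show ?thesis by simp
   qed
   then show "norm (indicator (ball 0 R) x * spow k (w x)) <= norm (indicator (ball 0 R) x + abs (w x) powr k)"
    by (auto simp: indicator_def abs_spow)
  qed
 qed (simp cong: measurable_cong_sets)
 then show "integrable lborel (%x. indicator (ball 0 R) x * (norm x powr (- s) * spow k (w x)))"
  by (subst (asm) integrable_wmeas_iff) (auto simp: mult.left_commute)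
qed

text \<open>On bounded sets the weight is bounded below, so the weighted norm controls the integral against
 a test function up to an arbitrarily small error.\<close>

lemma local_pairing:
 fixes \<phi> :: "real ^ 'n::finite => real"
 assumes b: "0 <= b" and q: "1 < q" and \<phi>: "\<phi> \<in> test_functions" and e: "0 < e"
 shows "EX C>=0. ALL d:Lspace (wmeas b) q. \<bar>LINT x|lborel. d x * \<phi> x\<bar> <= e + C * pint (wmeas b) q d"
  and "ALL d:Lspace (wmeas b) q. integrable lborel (%x. d x * \<phi> x)"
proof -
 obtain R B where RB: "R > 0" "B > 0" "!!x. abs (\<phi> x) <= B" "!!x. norm x >= R ==> \<phi> x = 0"
  using tf_bound[OF \<phi>] by metis
 note [measurable] = tf_borel[OF \<phi>]
 define V where "V = measure lborel (ball (0 :: real ^ 'n) R)"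
 define D where "D = e / (B * (V + 1))"
 have V: "V >= 0" by (simp add: V_def)
 have D: "D > 0" using e RB V by (simp add: D_def)
 define C where "C = B * (D powr (1 - q) * R powr b)"
 have C: "C >= 0" using RB by (simp add: C_def)
 have pt: "\<bar>s * \<phi> x\<bar> <= B * D * indicator (ball 0 R) x + C * (norm x powr (- b) * abs s powr q)" if x: "x ~= 0" for x and s :: real
 proof (cases "norm x < R")
  case False
  then show ?thesis using RB C D by (auto simp: not_less indicator_def)
 next
  case True
  have 1: "abs s <= D + D powr (1 - q) * abs s powr q"
  proof (cases "abs s <= D")
   case True
   then show ?thesis by (simp add: add_increasing2)
  next
   case False
   then have "abs s powr (1 - q) <= D powr (1 - q)" using D q by (intro powr_mono2') auto
   then have "abs s powr (1 - q) * abs s powr q <= D powr (1 - q) * abs s powr q" by (intro mult_right_mono) auto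
   moreover have "abs s powr (1 - q) * abs s powr q = abs s" using False D by (simp add: powr_add[symmetric])
   ultimately show ?thesis using D by linarith
  qed
  have 2: "1 <= R powr b * norm x powr (- b)"
   using True x b powr_mono2[of b "norm x" R] by (simp add: powr_minus field_simps)
  have "D powr (1 - q) * abs s powr q * 1 <= D powr (1 - q) * abs s powr q * (R powr b * norm x powr (- b))"
   by (intro mult_left_mono 2) auto
  then have "abs s <= D + D powr (1 - q) * R powr b * (norm x powr (- b) * abs s powr q)"
   using 1 by (simp add: mult_ac)
  then have "B * abs s <= B * (D + D powr (1 - q) * R powr b * (norm x powr (- b) * abs s powr q))"
   using RB(2) by (intro mult_left_mono) auto
  moreover have "\<bar>s * \<phi> x\<bar> <= B * abs s"
   using mult_right_mono[OF RB(3)[of x], of "abs s"] by (simp add: abs_mult mult.commute)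
  ultimately show ?thesis using True by (simp add: C_def algebra_simps)
 qed
 have main: "integrable lborel (%x. d x * \<phi> x) & \<bar>LINT x|lborel. d x * \<phi> x\<bar> <= e + C * pint (wmeas b) q d"
  if d: "d \<in> Lspace (wmeas b) q" for d
 proof -
  have [measurable]: "d \<in> borel_measurable borel" using LspaceD(1)[OF d] by (simp cong: measurable_cong_sets)
  let ?h = "%x. B * D * indicator (ball 0 R) x + C * (norm x powr (- b) * abs (d x) powr q)"
  have i2: "integrable lborel (%x. norm x powr (- b) * abs (d x) powr q)"
   using LspaceD(2)[OF d] by (subst (asm) integrable_wmeas_iff) auto
  have i1: "integrable lborel (indicator (ball (0 :: real ^ 'n) R) :: _ => real)"
   by (intro integrable_real_indicator) (use emeasure_lborel_ball_finite in auto)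
  have ih: "integrable lborel ?h"
   using i1 i2 by simp
  have ae: "AE x in lborel. norm (d x * \<phi> x) <= ?h x"
   using AE_nonzero by eventually_elim (use pt in simp)
  have i: "integrable lborel (%x. d x * \<phi> x)"
   by (rule Bochner_Integration.integrable_bound[OF ih]) (use ae in \<open>auto elim!: eventually_mono\<close>)
  have "\<bar>LINT x|lborel. d x * \<phi> x\<bar> <= (LINT x|lborel. \<bar>d x * \<phi> x\<bar>)" by (rule integral_abs_bound)
  also have "... <= (LINT x|lborel. ?h x)"
   by (rule integral_mono_AE) (use i ih ae in auto)
  also have "... = B * D * V + C * pint (wmeas b) q d"
   using i1 i2 by (simp add: V_def pint_def integral_wmeas)
  finally have 1: "\<bar>LINT x|lborel. d x * \<phi> x\<bar> <= B * D * V + C * pint (wmeas b) q d" .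
  have "B * D * V = e * (V / (V + 1))" using RB by (simp add: D_def)
  also have "... <= e * 1" using e V by (intro mult_left_mono) auto
  finally show ?thesis using i 1 by simp
 qed
 show "EX C>=0. ALL d:Lspace (wmeas b) q. \<bar>LINT x|lborel. d x * \<phi> x\<bar> <= e + C * pint (wmeas b) q d"
  using main C by blast
 show "ALL d:Lspace (wmeas b) q. integrable lborel (%x. d x * \<phi> x)" using main by blast
qed

lemma pairing_limit:
 fixes \<phi> :: "real ^ 'n::finite => real"
 assumes b: "0 <= b" and q: "1 < q" and \<phi>: "\<phi> \<in> test_functions"
  and u: "!!n. u n \<in> Lspace (wmeas b) q" and w: "w \<in> Lspace (wmeas b) q"
  and lim: "(%n. pint (wmeas b) q (%x. u n x - w x)) ----> 0"
 shows "(%n. LINT x|lborel. u n x * \<phi> x) ----> (LINT x|lborel. w x * \<phi> x)"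
proof (rule LIMSEQ_I)
 fix e :: real assume e: "0 < e"
 then have "0 < e / 2" by simp
 then obtain C where C: "C >= 0" "!!d. d \<in> Lspace (wmeas b) q ==> \<bar>LINT x|lborel. d x * \<phi> x\<bar> <= e / 2 + C * pint (wmeas b) q d"
  using local_pairing(1)[OF b q \<phi>] by blast
 have "(%n. C * pint (wmeas b) q (%x. u n x - w x)) ----> C * 0" using lim by (rule tendsto_mult_left)
 then have "\<forall>\<^sub>F n in sequentially. C * pint (wmeas b) q (%x. u n x - w x) < e / 2"
  by (rule order_tendstoD) (use e in simp)
 then obtain n0 where n0: "!!n. n >= n0 ==> C * pint (wmeas b) q (%x. u n x - w x) < e / 2"
  unfolding eventually_sequentially by blast
 have i: "d \<in> Lspace (wmeas b) q ==> integrable lborel (%x. d x * \<phi> x)" for d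
  using local_pairing(2)[OF b q \<phi> e] by blast
 show "EX no. ALL n>=no. norm ((LINT x|lborel. u n x * \<phi> x) - (LINT x|lborel. w x * \<phi> x)) < e"
 proof (intro exI[of _ n0] allI impI)
  fix n assume n: "n0 <= n"
  have "(LINT x|lborel. u n x * \<phi> x) - (LINT x|lborel. w x * \<phi> x) = (LINT x|lborel. (u n x - w x) * \<phi> x)"
   using i[OF u[of n]] i[OF w] by (simp add: left_diff_distrib)
  then show "norm ((LINT x|lborel. u n x * \<phi> x) - (LINT x|lborel. w x * \<phi> x)) < e"
   using C(2)[OF Lspace_diff[OF q u[of n] w]] n0[OF n] by simp
 qed
qed

lemma L2_locally_integrable:
 fixes g :: "real ^ 'n::finite => real"
 assumes g: "g \<in> Lspace lborel 2"
 shows "locally_integrable g"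
proof (rule locally_integrable_lborel)
 show [measurable]: "g \<in> borel_measurable borel" using LspaceD(1)[OF g] by simp
 fix R :: real
 have i1: "integrable lborel (indicator (ball (0 :: real ^ 'n) R) :: _ => real)"
  by (intro integrable_real_indicator) (use emeasure_lborel_ball_finite in auto)
 show "integrable lborel (%x. indicator (ball 0 R) x * g x)"
 proof (rule Bochner_Integration.integrable_bound)
  show "integrable lborel (%x. indicator (ball 0 R) x + abs (g x) powr 2)"
   using i1 LspaceD(2)[OF g] by (rule Bochner_Integration.integrable_add)
  have "abs (g x) <= 1 + (g x)\<^sup>2" for x
  proof -
   have "0 <= (abs (g x) - 1)\<^sup>2" by simp
   then show ?thesis by (simp add: power2_eq_square algebra_simps)
  qed
  then show "AE x in lborel. norm (indicator (ball 0 R) x * g x) <= norm (indicator (ball 0 R) x + abs (g x) powr 2)"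
   by (intro AE_I2) (auto simp: indicator_def)
 qed measurable
qed

lemma locally_integrable_Lspace:
 fixes w :: "real ^ 'n::finite => real"
 assumes w: "w \<in> Lspace (wmeas b) q" and b: "0 <= b" and q: "1 < q"
 shows "locally_integrable w"
proof (rule locally_integrable_lborel)
 show [measurable]: "w \<in> borel_measurable borel" using LspaceD(1)[OF w] by (simp cong: measurable_cong_sets)
 fix R :: real assume R: "0 < R"
 define c where "c = (\<Prod>i\<in>(UNIV::'n set). flat 0 1 * flat 0 (1::real))"
 have c0: "c > 0" unfolding c_def by (intro prod_pos) (auto intro!: mult_pos_pos flat_0_bounds)
 let ?a = "(\<chi> i. - R - 1) :: real ^ 'n" and ?b = "(\<chi> i. R + 1) :: real ^ 'n"
 let ?\<phi> = "box_bump 1 ?a ?b"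
 have mono: "flat 0 s >= flat 0 1" if "s >= 1" for s
  using that by (simp add: flat_def field_simps)
 have bump: "c <= ?\<phi> x" if x: "x \<in> ball 0 R" for x
  unfolding c_def box_bump_def
 proof (rule prod_mono)
  fix i :: 'n
  have "\<bar>x $ i\<bar> <= R" using component_le_norm_cart[of x i] x by simp
  then show "0 <= flat 0 1 * flat 0 (1::real) &
    flat 0 1 * flat 0 1 <= flat 0 (real 1 * (x $ i - ?a $ i)) * flat 0 (real 1 * (?b $ i - x $ i))"
   using flat_0_bounds(1)[of 1] by (auto intro!: mult_mono mono flat_0_bounds(1))
 qed
 have i: "integrable lborel (%x. w x * ?\<phi> x)"
  by (rule bspec[OF local_pairing(2)[OF b q box_bump_tf zero_less_one] w])
 show "integrable lborel (%x. indicator (ball 0 R) x * w x)"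
 proof (rule Bochner_Integration.integrable_bound)
  show "integrable lborel (%x. 1 / c * (w x * ?\<phi> x))" using i by (rule integrable_mult_right)
  show "AE x in lborel. norm (indicator (ball 0 R) x * w x) <= norm (1 / c * (w x * ?\<phi> x))"
  proof (rule AE_I2)
   fix x
   have "abs (w x) * c <= abs (w x) * ?\<phi> x" if "x \<in> ball 0 R" using bump[OF that] by (intro mult_left_mono) auto
   then show "norm (indicator (ball 0 R) x * w x) <= norm (1 / c * (w x * ?\<phi> x))"
    using c0 box_bump_bounds(1)[of 1 ?a ?b x]
    by (cases "x \<in> ball 0 R") (auto simp: abs_mult field_simps)
  qed
 qed measurable
qed

lemma primitive_power:
 assumes p: "1 < p" and r: "1 < r"
 shows "primitive (%x s. l * power_nonlinearity a p x s + k * power_nonlinearity \<eta> r x s) x s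
  = l / p * (norm x powr (- a) * abs s powr p) + k / r * (norm x powr (- \<eta>) * abs s powr r)"
proof -
 define F where "F s = l * norm x powr (- a) * (abs s powr p / p) + k * norm x powr (- \<eta>) * (abs s powr r / r)" for s
 define f where "f s = l * norm x powr (- a) * spow p s + k * norm x powr (- \<eta>) * spow r s" for s
 have "(LBINT t=ereal 0..ereal s. f t) = F s - F 0"
 proof (rule interval_integral_FTC_finite)
  show "continuous_on {min 0 s..max 0 s} f"
   unfolding f_def using p r by (intro continuous_intros continuous_on_spow)
  show "(F has_vector_derivative f t) (at t within {min 0 s..max 0 s})" for t
   unfolding F_def f_def has_real_derivative_iff_has_vector_derivative[symmetric]
   by (rule has_field_derivative_at_within, intro DERIV_add DERIV_cmult powr_abs_DERIV p r)
 qed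
 moreover have "F 0 = 0" using p r by (simp add: F_def)
 ultimately show ?thesis
  by (simp add: primitive_def power_nonlinearity_def F_def f_def mult_ac)
qed

lemma lebesgue_integral_lborel:
 fixes f :: "real ^ 'n::finite => real"
 assumes "f \<in> borel_measurable borel"
 shows "integrable lebesgue f \<longleftrightarrow> integrable lborel f" "(LINT x|lebesgue. f x) = (LINT x|lborel. f x)"
 using assms by (simp_all add: integrable_completion integral_completion)

lemma is_weak_gradient_components:
 fixes w :: "real ^ 'n::finite => real"
 assumes w: "w \<in> borel_measurable borel" "locally_integrable w" and G: "!!i. G i \<in> Lspace lborel 2"
  and parts: "!!\<phi> i. \<phi> \<in> test_functions ==> (LINT x|lborel. w x * partial_deriv i \<phi> x) = - (LINT x|lborel. G i x * \<phi> x)"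
 shows "is_weak_gradient w (%x. \<chi> i. G i x)"
  and "(%x. (\<chi> i. G i x) :: real ^ 'n) \<in> borel_measurable borel"
proof -
 have [measurable]: "G i \<in> borel_measurable borel" for i using LspaceD(1)[OF G] by simp
 have e: "(\<chi> i. G i x) = (\<Sum>i\<in>UNIV. G i x *\<^sub>R axis i (1::real))" for x :: "real ^ 'n"
  by (simp add: vec_eq_iff axis_def if_distrib cong: if_cong)
 show "(%x. (\<chi> i. G i x) :: real ^ 'n) \<in> borel_measurable borel" unfolding e by measurable
 have "locally_integrable (%x. (\<chi> i. G i x) :: real ^ 'n)"
  unfolding locally_integrable_def set_integrable_def
 proof (intro allI impI)
  fix K :: "(real ^ 'n) set" assume K: "compact K"
  have "integrable lebesgue (%x. indicator K x *\<^sub>R G i x)" for i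
   using L2_locally_integrable[OF G[of i]] K unfolding locally_integrable_def set_integrable_def by blast
  then have "integrable lebesgue (%x. \<Sum>i\<in>UNIV. (indicator K x *\<^sub>R G i x) *\<^sub>R axis i (1::real))"
   by (intro Bochner_Integration.integrable_sum integrable_scaleR_left)
  then show "integrable lebesgue (%x. indicator K x *\<^sub>R ((\<chi> i. G i x) :: real ^ 'n))"
   unfolding e by (simp add: scaleR_sum_right)
 qed
 moreover have "(LINT x|lebesgue. w x * partial_deriv i v x) = - (LINT x|lebesgue. (\<chi> i. G i x) $ i * v x)"
  if v: "v \<in> test_functions" for v i
 proof -
  note [measurable] = w(1) tf_borel[OF v] tf_borel[OF tf_partial[OF v, of i]]
  show ?thesis using parts[OF v, of i] by (simp add: lebesgue_integral_lborel)
 qed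
 ultimately show "is_weak_gradient w (%x. \<chi> i. G i x)"
  unfolding is_weak_gradient_def using w by blast
qed

context scaled_problem
begin

text \<open>
 The gradient chosen by \<open>weak_grad\<close> agrees with the Borel function \<open>G\<close> almost everywhere, so that all integrals can be
 computed with \<open>G\<close> and with Lebesgue--Borel measure.
\<close>

lemma critical_point_weak_solution:
 fixes w :: "real ^ 'n => real" and G :: "'n => real ^ 'n => real"
 fixes \<kappa> :: real
 defines "f \<equiv> %(x :: real ^ 'n) s. lam * power_nonlinearity a p x s + \<kappa> * power_nonlinearity \<eta> r x s"
 assumes w: "w \<in> Lspace (wmeas b) q" "w \<in> Lspace (wmeas a) p" "w \<in> Lspace (wmeas \<eta>) r"
  and G: "!!i. G i \<in> Lspace lborel 2"
  and parts: "!!\<phi> i. \<phi> \<in> test_functions ==> (LINT x|lborel. w x * partial_deriv i \<phi> x) = - (LINT x|lborel. G i x * \<phi> x)"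
  and eq: "!!\<phi>. \<phi> \<in> test_functions ==> (\<Sum>i\<in>UNIV. sint lborel 2 (G i) (partial_deriv i \<phi>)) + sint (wmeas b) q w \<phi>
    = lam * sint (wmeas a) p w \<phi> + \<kappa> * sint (wmeas \<eta>) r w \<phi>"
 shows "weak_solution b q f w"
  and "energy b q f w = (\<Sum>i\<in>UNIV. pint lborel 2 (G i)) / 2 + pint (wmeas b) q w / q
    - lam / p * pint (wmeas a) p w - \<kappa> / r * pint (wmeas \<eta>) r w"
proof -
 have [measurable]: "w \<in> borel_measurable borel" using LspaceD(1)[OF w(1)] by (simp cong: measurable_cong_sets)
 have [measurable]: "G i \<in> borel_measurable borel" for i using LspaceD(1)[OF G] by simp
 define Gv where "Gv x = (\<chi> i. G i x)" for x
 have wb: "w \<in> borel_measurable borel" by measurable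
 have wg: "is_weak_gradient w Gv"
  unfolding Gv_def by (rule is_weak_gradient_components(1)[OF wb locally_integrable_Lspace[OF w(1) exps(1,7)] G parts])
 have Gvm[measurable]: "Gv \<in> borel_measurable borel"
  unfolding Gv_def by (rule is_weak_gradient_components(2)[OF wb locally_integrable_Lspace[OF w(1) exps(1,7)] G parts])
 have Gvl: "Gv \<in> borel_measurable lebesgue" using Gvm by (intro measurable_completion) simp
 have "is_weak_gradient w (weak_grad w)" unfolding weak_grad_def by (rule someI[of "is_weak_gradient w"]) (rule wg)
 then have wgm: "weak_grad w \<in> borel_measurable lebesgue"
  using locally_integrable_measurable by (auto simp: is_weak_gradient_def)
 have ae: "AE x in lebesgue. weak_grad w x = Gv x" by (rule weak_grad_AE[OF wg])
 have nG: "(norm (Gv x))\<^sup>2 = (\<Sum>i\<in>UNIV. (G i x)\<^sup>2)" for x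
  unfolding Gv_def power2_norm_eq_inner inner_vec_def by (simp add: power2_eq_square)
 have iG: "integrable lborel (%x. (G i x)\<^sup>2)" for i using LspaceD(2)[OF G[of i]] by simp
 have "integrable lborel (%x. (norm (Gv x))\<^sup>2)" unfolding nG using iG by simp
 then have iGl: "integrable lebesgue (%x. (norm (Gv x))\<^sup>2)" by (subst lebesgue_integral_lborel) auto
 have iw: "integrable lebesgue (%x. (norm (weak_grad w x))\<^sup>2)"
 proof (rule integrable_cong_AE_imp[OF iGl])
  show "(%x. (norm (weak_grad w x))\<^sup>2) \<in> borel_measurable lebesgue" using wgm by measurable
  show "AE x in lebesgue. (norm (Gv x))\<^sup>2 = (norm (weak_grad w x))\<^sup>2" using ae by eventually_elim simp
 qed
 have I1: "(LINT x|lebesgue. (norm (weak_grad w x))\<^sup>2) = (\<Sum>i\<in>UNIV. pint lborel 2 (G i))"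
 proof -
  have "(LINT x|lebesgue. (norm (weak_grad w x))\<^sup>2) = (LINT x|lebesgue. (norm (Gv x))\<^sup>2)"
  proof (rule integral_cong_AE)
   show "(%x. (norm (weak_grad w x))\<^sup>2) \<in> borel_measurable lebesgue" using wgm by measurable
   show "(%x. (norm (Gv x))\<^sup>2) \<in> borel_measurable lebesgue" using Gvl by measurable
   show "AE x in lebesgue. (norm (weak_grad w x))\<^sup>2 = (norm (Gv x))\<^sup>2" using ae by eventually_elim simp
  qed
  also have "... = (LINT x|lborel. (\<Sum>i\<in>UNIV. (G i x)\<^sup>2))" unfolding nG by (subst lebesgue_integral_lborel) auto
  also have "... = (\<Sum>i\<in>UNIV. pint lborel 2 (G i))" using iG by (simp add: pint_lborel_two)
  finally show ?thesis .
 qed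
 have I2: "(LINT x|lebesgue. weak_grad w x \<bullet> grad v x) = (\<Sum>i\<in>UNIV. sint lborel 2 (G i) (partial_deriv i v))"
  if v: "v \<in> test_functions" for v
 proof -
  have [measurable]: "grad v \<in> borel_measurable borel" by (rule grad_borel[OF v])
  have [measurable]: "partial_deriv i v \<in> borel_measurable borel" for i by (rule tf_borel[OF tf_partial[OF v]])
  have gl: "grad v \<in> borel_measurable lebesgue" by (intro measurable_completion) simp
  have "(LINT x|lebesgue. weak_grad w x \<bullet> grad v x) = (LINT x|lebesgue. Gv x \<bullet> grad v x)"
  proof (rule integral_cong_AE)
   show "(%x. weak_grad w x \<bullet> grad v x) \<in> borel_measurable lebesgue" using wgm gl by measurable
   show "(%x. Gv x \<bullet> grad v x) \<in> borel_measurable lebesgue" using Gvl gl by measurable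
   show "AE x in lebesgue. weak_grad w x \<bullet> grad v x = Gv x \<bullet> grad v x" using ae by eventually_elim simp
  qed
  also have "... = (LINT x|lborel. (\<Sum>i\<in>UNIV. G i x * partial_deriv i v x))"
   by (subst lebesgue_integral_lborel) (auto simp: Gv_def grad_def inner_vec_def)
  also have "... = (\<Sum>i\<in>UNIV. LINT x|lborel. G i x * partial_deriv i v x)"
  proof (rule Bochner_Integration.integral_sum)
   show "integrable lborel (%x. G i x * partial_deriv i v x)" for i
    using integrable_spow_mult[OF _ G tf_L2[OF tf_partial[OF v]], of i i] by simp
  qed
  finally show ?thesis by (simp add: sint_two)
 qed
 have I3: "integrable lebesgue (%x. norm x powr (- s) * spow k (w x) * v x)"
   "(LINT x|lebesgue. norm x powr (- s) * spow k (w x) * v x) = sint (wmeas s) k w v"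
  if v: "v \<in> test_functions" and s: "0 <= s" "s < real CARD('n)" and k: "1 < k" and wk: "w \<in> Lspace (wmeas s) k" for v s k
 proof -
  note [measurable] = tf_borel[OF v]
  have vk: "v \<in> Lspace (wmeas s) k" using v s k by (intro tf_Lspace_wmeas) auto
  show "integrable lebesgue (%x. norm x powr (- s) * spow k (w x) * v x)"
   using integrable_spow_mult[OF k wk vk]
   by (subst lebesgue_integral_lborel) (auto simp: integrable_wmeas_iff mult.assoc)
  show "(LINT x|lebesgue. norm x powr (- s) * spow k (w x) * v x) = sint (wmeas s) k w v"
   by (subst lebesgue_integral_lborel) (auto simp: sint_wmeas mult.assoc)
 qed
 have I4: "integrable lebesgue (%x. abs (w x) powr k * norm x powr (- s))"
   "(LINT x|lebesgue. abs (w x) powr k * norm x powr (- s)) = pint (wmeas s) k w"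
  if wk: "w \<in> Lspace (wmeas s) k" for s k
  using LspaceD(2)[OF wk]
  by (auto simp: lebesgue_integral_lborel integrable_wmeas_iff integral_wmeas pint_def mult.commute)
 have wl: "w \<in> borel_measurable lebesgue" by (intro measurable_completion) simp
 have E: "w \<in> E_space b q"
  using wl I4(1)[OF w(1)] wg iw by (auto simp: E_space_def weighted_Lebesgue_space_def)
 have loc: "locally_integrable (%x. f x (w x))"
  unfolding locally_integrable_def
 proof (intro allI impI)
  fix K :: "(real ^ 'n) set" assume K: "compact K"
  have "set_integrable lebesgue K (%x. norm x powr (- a) * spow p (w x))"
   "set_integrable lebesgue K (%x. norm x powr (- \<eta>) * spow r (w x))"
   using locally_integrable_spow[OF w(2) exps(9,3,4)] locally_integrable_spow[OF w(3) exps(10,5,6)] K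
   unfolding locally_integrable_def by blast+
  then show "set_integrable lebesgue K (%x. f x (w x))"
   unfolding f_def power_nonlinearity_def by (intro set_integral_add set_integrable_mult_right)
 qed
 show "weak_solution b q f w"
  unfolding weak_solution_def
 proof (intro conjI ballI E loc)
  fix v :: "real ^ 'n => real" assume v: "v \<in> test_functions"
  note A = I3[OF v exps(3,4,9) w(2)] and H = I3[OF v exps(5,6,10) w(3)] and Bq = I3[OF v exps(1,2,7) w(1)]
  have "(LINT x|lebesgue. f x (w x) * v x)
   = (LINT x|lebesgue. lam * (norm x powr (- a) * spow p (w x) * v x) + \<kappa> * (norm x powr (- \<eta>) * spow r (w x) * v x))"
   by (simp add: f_def power_nonlinearity_def algebra_simps)
  also have "... = lam * sint (wmeas a) p w v + \<kappa> * sint (wmeas \<eta>) r w v"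
   using A H by simp
  finally show "(LINT x|lebesgue. weak_grad w x \<bullet> grad v x) + (LINT x|lebesgue. norm x powr (- b) * spow q (w x) * v x)
   = (LINT x|lebesgue. f x (w x) * v x)"
   using eq[OF v] I2[OF v] Bq(2) by simp
 qed
 have "(LINT x|lebesgue. primitive f x (w x))
  = (LINT x|lebesgue. lam / p * (abs (w x) powr p * norm x powr (- a)) + \<kappa> / r * (abs (w x) powr r * norm x powr (- \<eta>)))"
  unfolding f_def by (simp add: primitive_power[OF exps(9,10)] mult.commute)
 also have "... = lam / p * pint (wmeas a) p w + \<kappa> / r * pint (wmeas \<eta>) r w"
  using I4[OF w(2)] I4[OF w(3)] by simp
 finally show "energy b q f w = (\<Sum>i\<in>UNIV. pint lborel 2 (G i)) / 2 + pint (wmeas b) q w / q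
    - lam / p * pint (wmeas a) p w - \<kappa> / r * pint (wmeas \<eta>) r w"
  unfolding energy_def I1 I4(2)[OF w(1)] by simp
qed

lemma weak_gradient_null:
 fixes w :: "real ^ 'n => real" and G :: "'n => real ^ 'n => real"
 assumes w: "w \<in> borel_measurable borel" and 0: "AE x in lborel. w x = 0" and G: "G i \<in> Lspace lborel 2"
  and parts: "!!\<phi>. \<phi> \<in> test_functions ==> (LINT x|lborel. w x * partial_deriv i \<phi> x) = - (LINT x|lborel. G i x * \<phi> x)"
 shows "pint lborel 2 (G i) = 0"
proof -
 have [measurable]: "w \<in> borel_measurable borel" "G i \<in> borel_measurable borel" using LspaceD(1)[OF G] w by auto
 have "AE x in lebesgue. G i x = 0"
 proof (rule du_Bois_Reymond[OF L2_locally_integrable[OF G]])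
  fix v :: "real ^ 'n => real" assume v: "v \<in> test_functions"
  note [measurable] = tf_borel[OF v] tf_borel[OF tf_partial[OF v, of i]]
  have "(LINT x|lborel. w x * partial_deriv i v x) = (LINT x::real ^ 'n|lborel. (0 :: real))"
   by (rule integral_cong_AE) (use 0 in auto)
  then show "(LINT x|lebesgue. G i x * v x) = 0" using parts[OF v] by (simp add: lebesgue_integral_lborel)
 qed
 then have "AE x in lborel. G i x = 0" by (simp add: AE_completion_iff)
 then have "pint lborel 2 (G i) = (LINT x::real ^ 'n|lborel. 0)"
  unfolding pint_def by (intro integral_cong_AE) (auto elim!: eventually_mono)
 then show ?thesis by simp
qed

end

section \<open>Palais--Smale sequences\<close>

definition pCauchy :: "'a measure => real => (nat => 'a => real) => bool" where
 "pCauchy M k u \<longleftrightarrow> (ALL e>0. EX N. ALL m>=N. ALL n>=N. pint M k (%x. u m x - u n x) < e)"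

lemma pCauchyD: "pCauchy M k u ==> 0 < e ==> EX N. ALL m>=N. ALL n>=N. pint M k (%x. u m x - u n x) < e"
 by (simp add: pCauchy_def)

lemma pCauchy_subseq:
 fixes \<sigma> :: "nat => nat"
 assumes c: "pCauchy M k u" and \<sigma>: "strict_mono \<sigma>"
 shows "pCauchy M k (%n. u (\<sigma> n))"
 unfolding pCauchy_def
proof (intro allI impI)
 fix e :: real assume "0 < e"
 then obtain N where N: "!!m n. m >= N ==> n >= N ==> pint M k (%x. u m x - u n x) < e"
  using pCauchyD[OF c] by blast
 have "n <= \<sigma> n" for n using \<sigma> by (rule strict_mono_imp_increasing)
 then show "EX N. ALL m>=N. ALL n>=N. pint M k (%x. u (\<sigma> m) x - u (\<sigma> n) x) < e"
  by (intro exI[of _ N] allI impI N) (meson order_trans)+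
qed

lemma pCauchy_sint_small:
 assumes k: "1 < k" and u: "!!n. u n \<in> Lspace M k" and B: "!!n. pint M k (u n) <= B"
  and c: "pCauchy M k u" and e: "0 < e"
 shows "EX N. ALL m>=N. ALL n>=N. \<bar>sint M k (u m) (%x. u m x - u n x)\<bar> < e & \<bar>sint M k (u n) (%x. u m x - u n x)\<bar> < e"
proof -
 have B0: "0 <= B" using B[of 0] pint_nonneg[of M k "u 0"] by linarith
 define d where "d = e / 2 / (B + 1)"
 have d: "d > 0" using e B0 by (simp add: d_def)
 have dB: "d * B < e / 2"
 proof -
  have "d * B < d * (B + 1)" using d by simp
  also have "... = e / 2" using nonzero_mult_div_cancel_right[of "B + 1" "e / 2"] B0 unfolding d_def times_divide_eq_left by linarith
  finally show ?thesis .
 qed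
 have "0 < e / 2 * d powr (k - 1)" using e d by simp
 then obtain N where N: "!!m n. m >= N ==> n >= N ==> pint M k (%x. u m x - u n x) < e / 2 * d powr (k - 1)"
  using pCauchyD[OF c] by blast
 have "\<bar>sint M k (u l) (%x. u m x - u n x)\<bar> < e" if mn: "m >= N" "n >= N" for l m n
 proof -
  have "\<bar>sint M k (u l) (%x. u m x - u n x)\<bar> <= d * pint M k (u l) + d powr (1 - k) * pint M k (%x. u m x - u n x)"
   by (rule sint_Young[OF k u Lspace_diff[OF k u u] d])
  also have "d * pint M k (u l) <= d * B" using d B[of l] by simp
  also have "d powr (1 - k) * pint M k (%x. u m x - u n x) <= d powr (1 - k) * (e / 2 * d powr (k - 1))"
   using N[OF mn] by (intro mult_left_mono) auto
  also have "d powr (1 - k) * (e / 2 * d powr (k - 1)) = e / 2 * (d powr (1 - k) * d powr (k - 1))" by simp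
  also have "d powr (1 - k) * d powr (k - 1) = 1" using d by (subst powr_add[symmetric]) simp
  finally show ?thesis using dB by simp
 qed
 then show ?thesis by blast
qed

context scaled_problem
begin

lemma Dform_diff:
 fixes u v :: "real ^ 'n => real"
 assumes u: "u \<in> test_functions" and v: "v \<in> test_functions"
 shows "Dform u (%x. u x - v x) - Dform v (%x. u x - v x) = dirichlet (%x. u x - v x :: real)"
proof -
 have pd: "partial_deriv i (%x. u x - v x) = (%x. partial_deriv i u x - partial_deriv i v x)" for i
  using partial_deriv_diff[OF u v, of i 1] by simp
 have "sint lborel 2 (partial_deriv i u) (%x. partial_deriv i u x - partial_deriv i v x)
   - sint lborel 2 (partial_deriv i v) (%x. partial_deriv i u x - partial_deriv i v x)
   = pint lborel 2 (%x. partial_deriv i u x - partial_deriv i v x)" for i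
 proof -
  note L = tf_L(4)[OF u, of i] tf_L(4)[OF v, of i]
  have d: "(%x. partial_deriv i u x - partial_deriv i v x) \<in> Lspace lborel 2"
   by (rule Lspace_diff) (use L in auto)
  have "integrable lborel (%x. partial_deriv i u x * (partial_deriv i u x - partial_deriv i v x))"
   "integrable lborel (%x. partial_deriv i v x * (partial_deriv i u x - partial_deriv i v x))"
   using integrable_spow_mult[OF _ L(1) d] integrable_spow_mult[OF _ L(2) d] by simp_all
  then show ?thesis
   unfolding sint_two pint_lborel_two
   by (subst Bochner_Integration.integral_diff[symmetric]) (auto simp: power2_eq_square algebra_simps)
 qed
 then show ?thesis
  unfolding Dform_def pd dirichlet_eq[OF tf_diff[OF u v]] by (simp add: sum_subtractf[symmetric])
qed

lemma dPhi_scale: "u \<in> test_functions ==> w \<in> test_functions ==> dPhi \<kappa> u (%x. c * w x) = c * dPhi \<kappa> u w"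
 using dPhi_linear[of u "{0::nat}" "%_. w" \<kappa> "%_. c"] by simp

text \<open>
 Up to a constant factor, the difference of two functions is an admissible test function for both of their equations.
\<close>

lemma En_half_diff:
 assumes "u \<in> test_functions" "v \<in> test_functions" "En u <= B" "En v <= B" "0 <= s" "s <= 1"
 shows "En (%x. s / 2 * (u x - v x)) <= s * B"
proof -
 define U where "U i = (if i = (0::nat) then u else (%x. - v x))" for i
 have "(%x. - v x) \<in> test_functions" using tf_cmult[OF assms(2), of "-1"] by simp
 then have U: "U i \<in> test_functions" for i using assms by (simp add: U_def)
 have "En (%x. \<Sum>i\<in>{0,1}. s / 2 * U i x) <= (\<Sum>i\<in>{0,1::nat}. s / 2 * En (U i))"
  by (rule En_convex) (use assms U in auto)
 moreover have "(%x. \<Sum>i\<in>{0,1}. s / 2 * U i x) = (%x. s / 2 * (u x - v x))"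
  by (simp add: U_def fun_eq_iff algebra_simps)
 moreover have "(\<Sum>i\<in>{0,1::nat}. s / 2 * En (U i)) = s / 2 * (En u + En v)"
  by (simp add: U_def uminus_sym(1)[OF assms(2)] algebra_simps)
 moreover have "s / 2 * (En u + En v) <= s / 2 * (2 * B)" using assms by (intro mult_left_mono) auto
 ultimately show ?thesis by simp
qed

text \<open>The principal part is strongly monotone: test the difference of two approximate equations with the
 difference of their solutions.\<close>

lemma PS_Cauchy:
 assumes u: "!!n. u n \<in> test_functions" and i0: "0 < i0" "!!n. i0 <= En (u n)" "!!n. En (u n) <= i1"
  and \<kappa>: "!!n. abs (\<kappa> n) <= K" and \<beta>: "\<beta> ----> 0"
  and PS: "!!n \<phi>. \<phi> \<in> test_functions ==> En \<phi> <= En (u n) ==> \<bar>dPhi (\<kappa> n) (u n) \<phi>\<bar> <= \<beta> n"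
  and ca: "pCauchy (wmeas a) p u" and cr: "pCauchy (wmeas \<eta>) r u" and e: "0 < e"
 shows "EX N. ALL m>=N. ALL n>=N. dirichlet (%x. u m x - u n x) < e & pint (wmeas b) q (%x. u m x - u n x) < e"
proof -
 obtain C where C: "C > 0" "!!v E. v \<in> test_functions ==> E > 0 ==> En v <= E ==> Ja v <= C * E & Gr v <= C * E powr \<theta>"
  using scale_bounds by blast
 have i1: "i1 > 0" and i01: "i0 <= i1" using i0(1) i0(2,3)[of 0] by linarith+
 have K: "0 <= K" using \<kappa>[of 0] by linarith
 define s where "s = i0 / i1"
 have s: "0 < s" "s <= 1" "s * i1 = i0" using i0 i1 i01 by (auto simp: s_def)
 define D where "D = 4 / s + 2 * abs lam + 2 * K + 1"
 have D: "D > 0" using s K by (simp add: D_def add_nonneg_pos)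
 define e' where "e' = e / 2 powr (q - 1) / D"
 have e': "e' > 0" using e D by (simp add: e'_def)
 obtain Na where Na: "!!m n. m >= Na ==> n >= Na ==> \<bar>sint (wmeas a) p (u m) (%x. u m x - u n x)\<bar> < e' & \<bar>sint (wmeas a) p (u n) (%x. u m x - u n x)\<bar> < e'"
  using pCauchy_sint_small[OF exps(9) tf_L(2)[OF u] _ ca e', of "C * i1"] C(2)[OF u i1 i0(3)] unfolding Ja_def by blast
 obtain Nr where Nr: "!!m n. m >= Nr ==> n >= Nr ==> \<bar>sint (wmeas \<eta>) r (u m) (%x. u m x - u n x)\<bar> < e' & \<bar>sint (wmeas \<eta>) r (u n) (%x. u m x - u n x)\<bar> < e'"
  using pCauchy_sint_small[OF exps(10) tf_L(3)[OF u] _ cr e', of "C * i1 powr \<theta>"] C(2)[OF u i1 i0(3)] unfolding Gr_def by blast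
 obtain Nb where Nb: "!!n. n >= Nb ==> \<beta> n < e'"
  using order_tendstoD(2)[OF \<beta> e'] unfolding eventually_sequentially by blast
 define N where "N = max (max Na Nr) Nb"
 have "dirichlet (%x. u m x - u n x) < e & pint (wmeas b) q (%x. u m x - u n x) < e" if mn: "m >= N" "n >= N" for m n
 proof -
  have mn': "m >= Na" "n >= Na" "m >= Nr" "n >= Nr" "m >= Nb" "n >= Nb" using mn by (auto simp: N_def)
  define d where "d x = u m x - u n x" for x
  have d: "d \<in> test_functions" unfolding d_def by (rule tf_diff[OF u u])
  have "En (%x. s / 2 * d x) <= s * i1" unfolding d_def
   by (rule En_half_diff[OF u u i0(3) i0(3)]) (use s in auto)
  then have Es: "En (%x. s / 2 * d x) <= En (u l)" for l using i0(2)[of l] s by linarith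
  have sd: "(%x. s / 2 * d x) \<in> test_functions" by (rule tf_cmult[OF d])
  have P: "\<bar>dPhi (\<kappa> l) (u l) d\<bar> <= 2 / s * e'" if "\<beta> l < e'" for l
  proof -
   have "\<bar>s / 2 * dPhi (\<kappa> l) (u l) d\<bar> <= \<beta> l"
    using PS[OF sd Es[of l]] unfolding dPhi_scale[OF u d] .
   then have "s / 2 * \<bar>dPhi (\<kappa> l) (u l) d\<bar> <= e'" using that s by (simp add: abs_mult)
   then show ?thesis using s by (simp add: field_simps)
  qed
  have Pm: "\<bar>dPhi (\<kappa> m) (u m) d\<bar> <= 2 / s * e'" and Pn: "\<bar>dPhi (\<kappa> n) (u n) d\<bar> <= 2 / s * e'"
   using P Nb mn' by blast+
  define Am where "Am = sint (wmeas a) p (u m) d"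
  define An where "An = sint (wmeas a) p (u n) d"
  define Hm where "Hm = sint (wmeas \<eta>) r (u m) d"
  define Hn where "Hn = sint (wmeas \<eta>) r (u n) d"
  have small: "abs Am < e'" "abs An < e'" "abs Hm < e'" "abs Hn < e'"
   using Na[OF mn'(1,2)] Nr[OF mn'(3,4)] unfolding Am_def An_def Hm_def Hn_def d_def[abs_def] by auto
  have lA: "\<bar>lam * (Am - An)\<bar> <= abs lam * (2 * e')"
   unfolding abs_mult by (intro mult_left_mono) (use small in auto)
  have kH: "\<bar>\<kappa> l * H\<bar> <= K * e'" if "abs H < e'" for l H
   unfolding abs_mult by (intro mult_mono \<kappa>) (use that K in auto)
  define S where "S = sint (wmeas b) q (u m) d - sint (wmeas b) q (u n) d"
  have Sp: "pint (wmeas b) q d <= 2 powr (q - 1) * S"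
   unfolding S_def d_def by (rule pint_monotone) (use exps tf_L(1)[OF u] in auto)
  then have S0: "S >= 0"
   using pint_nonneg[of "wmeas b" q d] by (smt (verit) mult_pos_neg powr_gt_zero)
  have "dirichlet d + S = dPhi (\<kappa> m) (u m) d - dPhi (\<kappa> n) (u n) d + lam * (Am - An) + \<kappa> m * Hm - \<kappa> n * Hn"
   using Dform_diff[OF u[of m] u[of n]] unfolding d_def[abs_def, symmetric]
   by (simp add: dPhi_def S_def Am_def An_def Hm_def Hn_def algebra_simps)
  also have "... <= 4 / s * e' + abs lam * (2 * e') + 2 * (K * e')"
   using Pm Pn lA kH[OF small(3), of m] kH[OF small(4), of n] by linarith
  also have "... = (D - 1) * e'" by (simp add: D_def algebra_simps)
  also have "... < D * e'" using e' by (simp add: algebra_simps)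
  also have "... = e / 2 powr (q - 1)" using D by (simp add: e'_def)
  finally have main: "dirichlet d + S < e / 2 powr (q - 1)" .
  have p1: "1 <= 2 powr (q - 1)" using exps by (intro ge_one_powr_ge_zero) auto
  then have "e / 2 powr (q - 1) <= e" using e by (simp add: divide_le_eq mult_le_cancel_left1)
  then have "dirichlet d < e" using main S0 by linarith
  moreover have "2 powr (q - 1) * S < e"
  proof -
   have "S < e / 2 powr (q - 1)" using main dirichlet_nonneg[of d] by linarith
   then show ?thesis by (simp add: less_divide_eq mult.commute)
  qed
  ultimately show ?thesis using Sp unfolding d_def[abs_def] by linarith
 qed
 then show ?thesis by blast
qed

text \<open>
 Compactness of the embeddings makes the lower order terms converge along a subsequence, and \<open>PS_Cauchy\<close> then gives
 convergence of the gradients and of the \<open>q\<close>-term. Every term of the equation and of the energy passes to the limit,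
 and the lower bound on \<open>En\<close> excludes the zero limit.
\<close>

theorem PS_limit:
 assumes u: "!!n. u n \<in> test_functions" and i0: "0 < i0" "!!n. i0 <= En (u n)" "!!n. En (u n) <= i1"
  and \<kappa>: "\<kappa> ----> \<kappa>0" and \<beta>: "\<beta> ----> 0"
  and PS: "!!n \<phi>. \<phi> \<in> test_functions ==> En \<phi> <= En (u n) ==> \<bar>dPhi (\<kappa> n) (u n) \<phi>\<bar> <= \<beta> n"
 defines "f \<equiv> %(x :: real ^ 'n) s. lam * power_nonlinearity a p x s + \<kappa>0 * power_nonlinearity \<eta> r x s"
 shows "EX w (\<sigma> :: nat => nat). strict_mono \<sigma> & weak_solution b q f w & ~ (AE x in lebesgue. w x = 0) &
  (%n. En (u (\<sigma> n)) - lam / p * Ja (u (\<sigma> n)) - \<kappa>0 / r * Gr (u (\<sigma> n))) ----> energy b q f w"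
proof -
 have i1: "i1 > 0" using i0(1) i0(2,3)[of 0] by linarith
 have Eb: "dirichlet (u n) <= q * i1 & pint (wmeas b) q (u n) <= q * i1" for n
  using En_bounds[of "u n"] mult_left_mono[OF i0(3)[of n], of q] exps by linarith
 obtain \<sigma> :: "nat => nat" where \<sigma>: "strict_mono \<sigma>" and c0: "ALL \<eta> r. good_pair CARD('n) b q \<eta> r -->
  (ALL e>0. EX N. ALL m>=N. ALL n>=N. pint (wmeas \<eta>) r (%x. u (\<sigma> m) x - u (\<sigma> n) x) < e)"
  using compact_subsequence[where u=u and B="q * i1", OF N exps(1,2,7) u Eb[THEN conjunct1] Eb[THEN conjunct2]] by blast
 have ca: "pCauchy (wmeas a) p (%n. u (\<sigma> n))" and cr: "pCauchy (wmeas \<eta>) r (%n. u (\<sigma> n))"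
  unfolding pCauchy_def using c0 ga g\<eta> by blast+
 obtain K where K: "!!n. abs (\<kappa> n) <= K"
  using convergent_imp_Bseq[OF convergentI[OF \<kappa>]] by (auto simp: Bseq_def)
 have \<beta>\<sigma>: "(%n. \<beta> (\<sigma> n)) ----> 0" using LIMSEQ_subseq_LIMSEQ[OF \<beta> \<sigma>] by (simp add: o_def)
 have cau: "EX N. ALL m>=N. ALL n>=N. dirichlet (%x. u (\<sigma> m) x - u (\<sigma> n) x) < e & pint (wmeas b) q (%x. u (\<sigma> m) x - u (\<sigma> n) x) < e"
  if e: "0 < e" for e
  by (rule PS_Cauchy[where u="%n. u (\<sigma> n)" and \<beta>="%n. \<beta> (\<sigma> n)" and \<kappa>="%n. \<kappa> (\<sigma> n)", OF u i0(1,2,3) K \<beta>\<sigma> PS ca cr e])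
 have cb: "pCauchy (wmeas b) q (%n. u (\<sigma> n))" unfolding pCauchy_def using cau by blast
 have cd: "pCauchy lborel 2 (%n. partial_deriv i (u (\<sigma> n)))" for i
  unfolding pCauchy_def
 proof (intro allI impI)
  fix e :: real assume "0 < e"
  then obtain N where N: "!!m n. m >= N ==> n >= N ==> dirichlet (%x. u (\<sigma> m) x - u (\<sigma> n) x) < e" using cau by blast
  have "pint lborel 2 (%x. partial_deriv i (u (\<sigma> m)) x - partial_deriv i (u (\<sigma> n)) x) <= dirichlet (%x. u (\<sigma> m) x - u (\<sigma> n) x)" for m n
  proof -
   have pd: "partial_deriv j (%x. u (\<sigma> m) x - u (\<sigma> n) x) = (%x. partial_deriv j (u (\<sigma> m)) x - partial_deriv j (u (\<sigma> n)) x)" for j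
    using partial_deriv_diff[OF u u, of j "\<sigma> m" 1 "\<sigma> n"] by simp
   show ?thesis unfolding dirichlet_eq[OF tf_diff[OF u u]] pd
    by (rule member_le_sum[of i UNIV "%j. pint lborel 2 (%x. partial_deriv j (u (\<sigma> m)) x - partial_deriv j (u (\<sigma> n)) x)"]) auto
  qed
  then show "EX N. ALL m>=N. ALL n>=N. pint lborel 2 (%x. partial_deriv i (u (\<sigma> m)) x - partial_deriv i (u (\<sigma> n)) x) < e"
   using N by (intro exI[of _ N]) (meson le_less_trans)
 qed
 obtain \<tau> :: "nat => nat" and w where \<tau>: "strict_mono \<tau>" and wm: "w \<in> borel_measurable (wmeas b :: (real ^ 'n) measure)"
  and aeb: "AE x in wmeas b. (%n. u (\<sigma> (\<tau> n)) x) ----> w x"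
  using Lspace_Cauchy_subseq_AE[OF exps(7) tf_L(1)[OF u] pCauchyD[OF cb]] by blast
 define v where "v n = u (\<sigma> (\<tau> n))" for n
 have v: "v n \<in> test_functions" for n by (simp add: v_def u)
 have [measurable]: "w \<in> borel_measurable borel" using wm by (simp cong: measurable_cong_sets)
 have ael: "AE x in lborel. (%n. v n x) ----> w x"
 proof -
  have "AE x in lborel. 0 < ennreal (norm (x :: real ^ 'n) powr (- b)) --> (%n. v n x) ----> w x"
   using aeb unfolding wmeas_def v_def by (subst (asm) AE_density) auto
  with AE_nonzero show ?thesis by eventually_elim simp
 qed
 have aew: "AE x in wmeas s. (%n. v n x) ----> w x" for s
  unfolding wmeas_def by (subst AE_density) (use ael in \<open>auto elim!: eventually_mono\<close>)
 have st: "strict_mono (\<sigma> \<circ> \<tau>)" by (rule strict_mono_o[OF \<sigma> \<tau>])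
 have wlim: "w \<in> Lspace (wmeas s) k & (%n. pint (wmeas s) k (%x. v n x - w x)) ----> 0"
  if k: "1 < k" and L: "!!n. v n \<in> Lspace (wmeas s) k" and c: "pCauchy (wmeas s) k (%n. u (\<sigma> n))" for s k
 proof -
  have c': "pCauchy (wmeas s) k v" unfolding v_def by (rule pCauchy_subseq[OF c \<tau>])
  have wm: "w \<in> borel_measurable (wmeas s :: (real ^ 'n) measure)" by (simp cong: measurable_cong_sets)
  show ?thesis using pint_Cauchy_limit[OF k L wm aew pCauchyD[OF c']] by blast
 qed
 have wb: "w \<in> Lspace (wmeas b) q" "(%n. pint (wmeas b) q (%x. v n x - w x)) ----> 0"
  and wa: "w \<in> Lspace (wmeas a) p" "(%n. pint (wmeas a) p (%x. v n x - w x)) ----> 0"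
  and wr: "w \<in> Lspace (wmeas \<eta>) r" "(%n. pint (wmeas \<eta>) r (%x. v n x - w x)) ----> 0"
  using wlim[OF exps(7) tf_L(1)[OF v] cb] wlim[OF exps(9) tf_L(2)[OF v] ca] wlim[OF exps(10) tf_L(3)[OF v] cr] by blast+
 have "ALL i. EX g. g \<in> Lspace lborel 2 & (%n. pint lborel 2 (%x. partial_deriv i (v n) x - g x)) ----> 0"
 proof
  fix i
  have "pCauchy lborel 2 (%n. partial_deriv i (v n))" unfolding v_def by (rule pCauchy_subseq[OF cd \<tau>])
  from Lspace_complete[OF _ tf_L(4)[OF v] pCauchyD[OF this]]
  show "EX g. g \<in> Lspace lborel 2 & (%n. pint lborel 2 (%x. partial_deriv i (v n) x - g x)) ----> 0" by auto
 qed
 from choice[OF this] obtain G where G0: "ALL i. G i \<in> Lspace lborel 2 &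
   (%n. pint lborel 2 (%x. partial_deriv i (v n) x - G i x)) ----> 0" by blast
 have G: "G i \<in> Lspace lborel 2" "(%n. pint lborel 2 (%x. partial_deriv i (v n) x - G i x)) ----> 0" for i
  using G0 by blast+
 have two: "1 < (2::real)" by simp
 note limG = pint_sint_limit[OF two tf_L(4)[OF v] G(1) G(2)]
 note limb = pint_sint_limit[OF exps(7) tf_L(1)[OF v] wb]
 note lima = pint_sint_limit[OF exps(9) tf_L(2)[OF v] wa]
 note limr = pint_sint_limit[OF exps(10) tf_L(3)[OF v] wr]
 have parts: "(LINT x|lborel. w x * partial_deriv i \<phi> x) = - (LINT x|lborel. G i x * \<phi> x)" if \<phi>: "\<phi> \<in> test_functions" for \<phi> i
 proof (rule LIMSEQ_unique)
  show "(%n. LINT x|lborel. v n x * partial_deriv i \<phi> x) ----> (LINT x|lborel. w x * partial_deriv i \<phi> x)"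
   by (rule pairing_limit[OF exps(1,7) tf_partial[OF \<phi>] tf_L(1)[OF v] wb])
  have "(%n. - sint lborel 2 (partial_deriv i (v n)) \<phi>) ----> - sint lborel 2 (G i) \<phi>"
   by (intro tendsto_minus limG(2) tf_L2 \<phi>)
  then show "(%n. LINT x|lborel. v n x * partial_deriv i \<phi> x) ----> - (LINT x|lborel. G i x * \<phi> x)"
   using tf_integral_by_parts[OF v \<phi>, of _ i] by (simp add: sint_two)
 qed
 have \<kappa>v: "(%n. \<kappa> (\<sigma> (\<tau> n))) ----> \<kappa>0" "(%n. \<beta> (\<sigma> (\<tau> n))) ----> 0"
  using LIMSEQ_subseq_LIMSEQ[OF \<kappa> st] LIMSEQ_subseq_LIMSEQ[OF \<beta> st] by (simp_all add: o_def)
 have eq: "(\<Sum>i\<in>UNIV. sint lborel 2 (G i) (partial_deriv i \<phi>)) + sint (wmeas b) q w \<phi>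
    = lam * sint (wmeas a) p w \<phi> + \<kappa>0 * sint (wmeas \<eta>) r w \<phi>" if \<phi>: "\<phi> \<in> test_functions" for \<phi>
 proof -
  have "(%n. dPhi (\<kappa> (\<sigma> (\<tau> n))) (v n) \<phi>) ----> (\<Sum>i\<in>UNIV. sint lborel 2 (G i) (partial_deriv i \<phi>)) + sint (wmeas b) q w \<phi>
    - lam * sint (wmeas a) p w \<phi> - \<kappa>0 * sint (wmeas \<eta>) r w \<phi>"
   unfolding dPhi_def Dform_def
   by (intro tendsto_intros limG(2) limb(2) lima(2) limr(2) \<kappa>v(1) tf_L \<phi>)
  moreover have "(%n. dPhi (\<kappa> (\<sigma> (\<tau> n))) (v n) \<phi>) ----> 0"
  proof -
   define c where "c = min 1 (i0 / (En \<phi> + 1))"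
   have c: "0 < c" "c <= 1" "c * En \<phi> <= i0"
   proof -
    show "0 < c" "c <= 1" using i0(1) by (auto simp: c_def add_nonneg_pos)
    have "c * En \<phi> <= i0 / (En \<phi> + 1) * En \<phi>" by (intro mult_right_mono) (auto simp: c_def)
    also have "... <= i0" using i0(1) En_nonneg[of \<phi>]
     by (simp add: divide_le_eq add_nonneg_pos algebra_simps del: En_nonneg)
    finally show "c * En \<phi> <= i0" .
   qed
   have "En (%x. \<Sum>i\<in>{0::nat}. c * \<phi> x) <= (\<Sum>i\<in>{0::nat}. c * En \<phi>)"
    by (rule En_convex) (use c \<phi> in auto)
   then have Ec: "En (%x. c * \<phi> x) <= En (u n)" for n using c i0(2)[of n] by simp
   have bd: "\<bar>dPhi (\<kappa> (\<sigma> (\<tau> n))) (v n) \<phi>\<bar> <= \<beta> (\<sigma> (\<tau> n)) / c" for n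
    using PS[OF tf_cmult[OF \<phi>] Ec, of "\<sigma> (\<tau> n)"] dPhi_scale[OF v \<phi>, of _ n c] c
    by (simp add: v_def abs_mult field_simps)
   have "(%n. \<beta> (\<sigma> (\<tau> n)) / c) ----> 0 / c" using c by (intro tendsto_divide \<kappa>v tendsto_const) auto
   then have lim0: "(%n. \<beta> (\<sigma> (\<tau> n)) / c) ----> 0" by simp
   show ?thesis
   proof (rule Lim_null_comparison[OF _ lim0])
    show "\<forall>\<^sub>F n in sequentially. norm (dPhi (\<kappa> (\<sigma> (\<tau> n))) (v n) \<phi>) <= \<beta> (\<sigma> (\<tau> n)) / c"
     unfolding real_norm_def using bd by (rule always_eventually[OF allI])
   qed
  qed
  ultimately have "(\<Sum>i\<in>UNIV. sint lborel 2 (G i) (partial_deriv i \<phi>)) + sint (wmeas b) q w \<phi>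
    - lam * sint (wmeas a) p w \<phi> - \<kappa>0 * sint (wmeas \<eta>) r w \<phi> = 0" by (rule LIMSEQ_unique)
  then show ?thesis by simp
 qed
 note sol = critical_point_weak_solution[OF wb(1) wa(1) wr(1) G(1) parts eq]
 have limE: "(%n. En (v n)) ----> (\<Sum>i\<in>UNIV. pint lborel 2 (G i)) / 2 + pint (wmeas b) q w / q"
  unfolding En_def dirichlet_eq[OF v] using exps by (intro tendsto_intros limG(1) limb(1)) auto
 have "(%n. En (v n) - lam / p * Ja (v n) - \<kappa>0 / r * Gr (v n)) ----> energy b q f w"
 proof -
  have en: "energy b q f w = (\<Sum>i\<in>UNIV. pint lborel 2 (G i)) / 2 + pint (wmeas b) q w / q
    - lam / p * pint (wmeas a) p w - \<kappa>0 / r * pint (wmeas \<eta>) r w"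
   unfolding f_def by (rule sol(2))
  show ?thesis
   unfolding en Ja_def Gr_def by (intro tendsto_diff limE tendsto_mult_left lima(1) limr(1))
 qed
 moreover have "~ (AE x in lebesgue. w x = 0)"
 proof
  assume "AE x in lebesgue. w x = 0"
  then have 0: "AE x in lborel. w x = 0" by (simp add: AE_completion_iff)
  have "pint lborel 2 (G i) = 0" for i
   by (rule weak_gradient_null[OF _ 0 G(1) parts]) auto
  moreover have "pint (wmeas b) q w = 0"
  proof -
   have "pint (wmeas b) q w = (LINT x|lborel. norm x powr (- b) * abs (w x) powr q)"
    unfolding pint_def by (rule integral_wmeas) measurable
   also have "... = (LINT x::real ^ 'n|lborel. 0)" by (rule integral_cong_AE) (use 0 in \<open>auto elim!: eventually_mono\<close>)
   finally show ?thesis by simp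
  qed
  ultimately have "(%n. En (v n)) ----> 0" using limE by simp
  then have "i0 <= 0" using i0(2) by (intro LIMSEQ_le_const[of "%n. En (v n)"]) (auto simp: v_def)
  then show False using i0(1) by simp
 qed
 moreover have "weak_solution b q f w" using sol(1) unfolding f_def .
 ultimately show ?thesis
  using st unfolding v_def by (intro exI[of _ w] exI[of _ "\<sigma> \<circ> \<tau>"]) (simp add: o_def)
qed

end

section \<open>Negative levels\<close>

context scaled_problem
begin

text \<open>
 By \<open>scale_bounds\<close> all terms of \<open>Phi\<close> are small where the energy is small.
\<close>

lemma Phi_lower_bound:
 assumes "0 < k"
 shows "EX K0>0. ALL u:test_functions. Phi u <= - k --> K0 <= En u"
proof -
 obtain C where C: "C > 0" "!!u K. u \<in> test_functions ==> K > 0 ==> En u <= K ==> Ja u <= C * K & Gr u <= C * K powr \<theta>"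
  using scale_bounds by blast
 define L where "L = abs lam * C + 1"
 define K0 where "K0 = min (k / (4 * L)) ((k / (4 * C)) powr (1 / \<theta>))"
 have l: "0 < L" using C by (simp add: L_def add_nonneg_pos)
 have K0: "K0 > 0" using assms C l by (simp add: K0_def)
 have 1: "abs lam * (C * K0) <= k / 4"
 proof -
  have "L * K0 <= L * (k / (4 * L))"
   using l by (intro mult_left_mono) (auto simp: K0_def)
  also have "... = k / 4" using l by simp
  finally show ?thesis using K0 by (simp add: L_def algebra_simps)
 qed
 have 2: "C * K0 powr \<theta> <= k / 4"
 proof -
  have "K0 powr \<theta> <= ((k / (4 * C)) powr (1 / \<theta>)) powr \<theta>"
   using K0 ell by (intro powr_mono2) (auto simp: K0_def)
  also have "... = k / (4 * C)" using ell assms C by (simp add: powr_powr)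
  finally show ?thesis using C by (simp add: field_simps)
 qed
 have "K0 <= En u" if u: "u \<in> test_functions" and P: "Phi u <= - k" for u
 proof (rule ccontr)
  assume "~ K0 <= En u"
  then have JG: "Ja u <= C * K0" "Gr u <= C * K0 powr \<theta>" using C(2)[OF u K0] by auto
  then have "Phi u >= - (k / 4) - k / 4"
   using lower_order_bounds(1,3)[of u] mult_left_mono[OF JG(1), of "abs lam"] 1 2 En_nonneg[of u] unfolding Phi_def by linarith
  then show False using P assms by linarith
 qed
 then show ?thesis using K0 by blast
qed

text \<open>
 Dilating \<open>u n\<close> to energy \<open>1\<close> multiplies the coefficient of the subscaled term by a negative power of \<open>En (u n)\<close>, so the
 limit equation is the eigenvalue equation.
\<close>

lemma PS_unbounded:
 assumes u: "!!n. u n \<in> test_functions"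
  and PS: "!!n \<phi>. \<phi> \<in> test_functions ==> En \<phi> <= En (u n) ==> \<bar>dPhi 1 (u n) \<phi>\<bar> <= En (u n) * \<gamma> n"
  and \<gamma>: "\<gamma> ----> 0" and Einf: "filterlim (%n. En (u n)) at_top sequentially" and pos: "!!n. 0 < En (u n)"
 shows "is_eigenvalue TYPE('n) b q a p lam"
proof -
 define t where "t n = En (u n) powr (- 1 / ell)" for n
 have t: "t n > 0" for n using pos[of n] by (simp add: t_def)
 have tl: "t n powr ell = 1 / En (u n)" for n
 proof -
  have e: "- 1 / ell * ell = - 1" using ell by simp
  show ?thesis unfolding t_def powr_powr e using pos[of n] by (simp add: powr_minus_divide)
 qed
 define v where "v n = dil \<delta> (t n) (u n)" for n
 have v: "v n \<in> test_functions" for n unfolding v_def by (rule tf_dil[OF u t])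
 have Ev: "En (v n) = 1" for n unfolding v_def using pos[of n] by (simp add: En_dil[OF u t] tl)
 define \<kappa> where "\<kappa> n = t n powr (ell - ell')" for n
 have \<kappa>: "\<kappa> ----> 0"
 proof -
  have "(%n. En (u n) powr (- ((ell - ell') / ell))) ----> 0"
   by (rule tendsto_neg_powr[OF _ Einf]) (use ell in simp)
  moreover have e: "- 1 / ell * (ell - ell') = - ((ell - ell') / ell)" by simp
  have "\<kappa> = (%n. En (u n) powr (- ((ell - ell') / ell)))"
   unfolding \<kappa>_def t_def powr_powr e ..
  ultimately show ?thesis by (simp only:)
 qed
 have PSv: "\<bar>dPhi (\<kappa> n) (v n) \<psi>\<bar> <= \<gamma> n" if \<psi>: "\<psi> \<in> test_functions" and E: "En \<psi> <= En (v n)" for n \<psi>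
 proof -
  define \<phi> where "\<phi> = dil \<delta> (1 / t n) \<psi>"
  have t': "1 / t n > 0" using t[of n] by simp
  have \<phi>: "\<phi> \<in> test_functions" unfolding \<phi>_def by (rule tf_dil[OF \<psi> t'])
  have e: "\<psi> = dil \<delta> (t n) \<phi>" unfolding \<phi>_def dil_dil[OF t t'] using t[of n] by (simp add: dil_one)
  have "En \<psi> = En \<phi> / En (u n)" unfolding e En_dil[OF \<phi> t] tl by simp
  then have "En \<phi> <= En (u n)" using E pos[of n] unfolding Ev by (simp add: divide_le_eq)
  then have P: "\<bar>dPhi 1 (u n) \<phi>\<bar> <= En (u n) * \<gamma> n" by (rule PS[OF \<phi>])
  have k1: "\<kappa> n * t n powr (ell' - ell) = 1" unfolding \<kappa>_def using t[of n] by (subst powr_add[symmetric]) simp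
  have "dPhi (\<kappa> n) (v n) \<psi> = t n powr ell * dPhi 1 (u n) \<phi>"
   unfolding v_def e dPhi_dil[OF u \<phi> t] k1 ..
  also have "\<bar>...\<bar> = \<bar>dPhi 1 (u n) \<phi>\<bar> / En (u n)" using pos[of n] by (simp add: tl abs_mult)
  also have "... <= \<gamma> n" using P pos[of n] by (simp add: divide_le_eq mult.commute)
  finally show ?thesis .
 qed
 have i: "1 <= En (v n)" "En (v n) <= 1" for n using Ev by simp_all
 obtain w where "weak_solution b q (%(x :: real ^ 'n) s. lam * power_nonlinearity a p x s + 0 * power_nonlinearity \<eta> r x s) w"
   "~ (AE x in lebesgue. w x = 0)"
  using PS_limit[OF v zero_less_one i \<kappa> \<gamma> PSv] by blast
 then show ?thesis unfolding is_eigenvalue_def by auto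
qed

definition nonlin :: "real ^ 'n => real => real" where
 "nonlin x s = lam * power_nonlinearity a p x s + power_nonlinearity \<eta> r x s"

text \<open>
 The Palais--Smale condition at negative levels in contrapositive form: a sequence of functions without a good descent
 direction contains a subsequence that is bounded, with a limit at level \<open>c\<close>, or its energies tend to infinity.
\<close>

lemma pseudo_gradient:
 assumes c: "c < 0" and ne: "~ is_eigenvalue TYPE('n) b q a p lam"
  and no: "!!w. weak_solution b q nonlin w ==> energy b q nonlin w ~= c"
 shows "EX \<epsilon>>0. EX \<beta>>0. ALL u:test_functions. \<bar>Phi u - c\<bar> <= \<epsilon> -->
  (EX \<phi>:test_functions. En \<phi> <= En u & \<beta> * En u <= dPhi 1 u \<phi>)"
proof (rule ccontr)
 assume neg: "~ ?thesis"
 define \<gamma> where "\<gamma> n = 1 / real (Suc n)" for n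
 have \<gamma>0: "\<gamma> n > 0" for n by (simp add: \<gamma>_def)
 have \<gamma>: "\<gamma> ----> 0" unfolding \<gamma>_def using LIMSEQ_inverse_real_of_nat by (simp add: inverse_eq_divide)
 have "ALL n. EX u. u \<in> test_functions & \<bar>Phi u - c\<bar> <= min (\<gamma> n) (- c / 2) &
   (ALL \<phi>:test_functions. En \<phi> <= En u --> dPhi 1 u \<phi> < \<gamma> n * En u)"
 proof
  fix n
  have "min (\<gamma> n) (- c / 2) > 0" using c \<gamma>0[of n] by simp
  moreover have "ALL \<epsilon>>0. ALL \<beta>>0. EX u:test_functions. \<bar>Phi u - c\<bar> <= \<epsilon> &
    (ALL \<phi>:test_functions. En \<phi> <= En u --> dPhi 1 u \<phi> < \<beta> * En u)"
  proof (intro allI impI, rule ccontr)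
   fix \<epsilon> \<beta> :: real assume pos: "0 < \<epsilon>" "0 < \<beta>" and none: "~ (EX u:test_functions. \<bar>Phi u - c\<bar> <= \<epsilon> &
    (ALL \<phi>:test_functions. En \<phi> <= En u --> dPhi 1 u \<phi> < \<beta> * En u))"
   have "EX \<phi>:test_functions. En \<phi> <= En u & \<beta> * En u <= dPhi 1 u \<phi>"
    if u: "u \<in> test_functions" "\<bar>Phi u - c\<bar> <= \<epsilon>" for u
   proof (rule ccontr)
    assume no: "~ (EX \<phi>:test_functions. En \<phi> <= En u & \<beta> * En u <= dPhi 1 u \<phi>)"
    have "dPhi 1 u \<phi> < \<beta> * En u" if "\<phi> \<in> test_functions" "En \<phi> <= En u" for \<phi>
     by (rule ccontr) (use no that in \<open>simp add: not_less\<close>)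
    then show False using none u by blast
   qed
   then show False using neg pos by blast
  qed
  ultimately show "EX u. u \<in> test_functions & \<bar>Phi u - c\<bar> <= min (\<gamma> n) (- c / 2) &
   (ALL \<phi>:test_functions. En \<phi> <= En u --> dPhi 1 u \<phi> < \<gamma> n * En u)"
   using \<gamma>0[of n] by blast
 qed
 from choice[OF this] obtain u where u0: "ALL n. u n \<in> test_functions & \<bar>Phi (u n) - c\<bar> <= min (\<gamma> n) (- c / 2) &
   (ALL \<phi>:test_functions. En \<phi> <= En (u n) --> dPhi 1 (u n) \<phi> < \<gamma> n * En (u n))" by blast
 have u: "u n \<in> test_functions" and lev: "\<bar>Phi (u n) - c\<bar> <= min (\<gamma> n) (- c / 2)" for n using u0 by blast+
 have d: "\<phi> \<in> test_functions ==> En \<phi> <= En (u n) ==> dPhi 1 (u n) \<phi> < \<gamma> n * En (u n)" for n \<phi> using u0 by blast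
 have "- c / 2 > 0" using c by simp
 then obtain K0 where K0: "K0 > 0" "!!u. u \<in> test_functions ==> Phi u <= - (- c / 2) ==> K0 <= En u"
  using Phi_lower_bound by blast
 have Eu: "K0 <= En (u n)" for n
 proof (rule K0(2)[OF u])
  have "\<bar>Phi (u n) - c\<bar> <= - c / 2" using lev[of n] by simp
  then show "Phi (u n) <= - (- c / 2)" by linarith
 qed
 have PS: "\<bar>dPhi 1 (u n) \<phi>\<bar> <= En (u n) * \<gamma> n" if \<phi>: "\<phi> \<in> test_functions" and E: "En \<phi> <= En (u n)" for n \<phi>
 proof -
  have m: "(%x. - 1 * \<phi> x) \<in> test_functions" by (rule tf_cmult[OF \<phi>])
  have "En (%x. - 1 * \<phi> x) = En \<phi>" using uminus_sym(1)[OF \<phi>] by simp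
  then have "dPhi 1 (u n) (%x. - 1 * \<phi> x) < \<gamma> n * En (u n)" using d[OF m, of n] E by simp
  moreover have "dPhi 1 (u n) (%x. - 1 * \<phi> x) = - 1 * dPhi 1 (u n) \<phi>" by (rule dPhi_scale[OF u \<phi>])
  ultimately show ?thesis using d[OF \<phi> E] by (simp add: mult.commute abs_le_iff)
 qed
 show False
 proof (cases "EX B. \<exists>\<^sub>\<infinity>n. En (u n) <= B")
  case False
  have "filterlim (%n. En (u n)) at_top sequentially"
   unfolding filterlim_at_top
  proof
   fix Z
   have "\<forall>\<^sub>F n in cofinite. ~ En (u n) <= Z" using False unfolding frequently_def by simp
   then show "\<forall>\<^sub>F n in sequentially. Z <= En (u n)"
    unfolding cofinite_eq_sequentially by eventually_elim simp
  qed
  then have "is_eigenvalue TYPE('n) b q a p lam"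
   by (intro PS_unbounded[OF u PS \<gamma>]) (use Eu K0(1) in \<open>auto intro: less_le_trans\<close>)
  then show False using ne by simp
 next
  case True
  then obtain B where B: "\<exists>\<^sub>\<infinity>n. En (u n) <= B" by blast
  then have inf: "infinite {n. En (u n) <= B}" by (simp add: frequently_cofinite)
  define \<rho> where "\<rho> = enumerate {n. En (u n) <= B}"
  have \<rho>: "strict_mono \<rho>" unfolding \<rho>_def using inf by (rule strict_mono_enumerate)
  have \<rho>B: "En (u (\<rho> n)) <= B" for n using enumerate_in_set[OF inf, of n] by (simp add: \<rho>_def)
  have \<gamma>\<rho>: "(%n. \<gamma> (\<rho> n)) ----> 0" using LIMSEQ_subseq_LIMSEQ[OF \<gamma> \<rho>] by (simp add: o_def)
  have \<beta>: "(%n. B * \<gamma> (\<rho> n)) ----> 0" using tendsto_mult_left[OF \<gamma>\<rho>, of B] by simp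
  have PS': "\<bar>dPhi 1 (u (\<rho> n)) \<phi>\<bar> <= B * \<gamma> (\<rho> n)" if \<phi>: "\<phi> \<in> test_functions" and E: "En \<phi> <= En (u (\<rho> n))" for n \<phi>
   using PS[OF \<phi> E] mult_right_mono[OF \<rho>B[of n] less_imp_le[OF \<gamma>0[of "\<rho> n"]]] by linarith
  have one: "(%n::nat. 1) ----> (1::real)" by (rule tendsto_const)
  obtain w and \<sigma> :: "nat => nat" where \<sigma>: "strict_mono \<sigma>"
   and w: "weak_solution b q (%(x :: real ^ 'n) s. lam * power_nonlinearity a p x s + 1 * power_nonlinearity \<eta> r x s) w"
   and lim: "(%n. En (u (\<rho> (\<sigma> n))) - lam / p * Ja (u (\<rho> (\<sigma> n))) - 1 / r * Gr (u (\<rho> (\<sigma> n))))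
    ----> energy b q (%(x :: real ^ 'n) s. lam * power_nonlinearity a p x s + 1 * power_nonlinearity \<eta> r x s) w"
   using PS_limit[where u="%n. u (\<rho> n)" and \<beta>="%n. B * \<gamma> (\<rho> n)" and \<kappa>="%n. 1", OF u K0(1) Eu \<rho>B one \<beta> PS'] by blast
  have nl: "(%(x :: real ^ 'n) s. lam * power_nonlinearity a p x s + 1 * power_nonlinearity \<eta> r x s) = nonlin"
   by (simp add: nonlin_def fun_eq_iff)
  have "(%n. Phi (u (\<rho> (\<sigma> n)))) ----> energy b q nonlin w" using lim unfolding nl Phi_def by simp
  moreover have "(%n. Phi (u (\<rho> (\<sigma> n)))) ----> c"
  proof (rule LIM_zero_cancel, rule Lim_null_comparison)
   have "\<bar>Phi (u n) - c\<bar> <= \<gamma> n" for n using lev[of n] by simp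
   then show "\<forall>\<^sub>F n in sequentially. norm (Phi (u (\<rho> (\<sigma> n))) - c) <= \<gamma> (\<rho> (\<sigma> n))"
    unfolding real_norm_def by (rule always_eventually[OF allI])
   show "(%n. \<gamma> (\<rho> (\<sigma> n))) ----> 0" using LIMSEQ_subseq_LIMSEQ[OF \<gamma>\<rho> \<sigma>] by (simp add: o_def)
  qed
  ultimately have "energy b q nonlin w = c" by (rule LIMSEQ_unique)
  then show False using no[of w] w unfolding nl by blast
 qed
qed

subsection \<open>Odd maps of cross-polytopes\<close>

definition odd_coeff :: "nat => ((nat => real) => real) => bool" where
 "odd_coeff k c \<longleftrightarrow> continuous_on (cross_sphere k) c & (ALL y:cross_sphere k. c (pneg y) = - c y)"

text \<open>
 Maps with values in finite combinations of test functions; continuity along the map is then a matter of the real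
 coefficients, and no topology on a function space is needed.
\<close>

definition odd_maps :: "nat => ((nat => real) => real ^ 'n => real) set" where
 "odd_maps k = {g. EX m c e. (ALL j<m. e j \<in> test_functions & odd_coeff k (%y. c y j)) &
  g = (%y x. \<Sum>j<(m::nat). c y j * e j x)}"

lemma cross_sphere_mono: "l <= k ==> cross_sphere l \<subseteq> cross_sphere k"
proof
 fix x assume "l <= k" and x: "x \<in> cross_sphere l"
 then have "(\<Sum>i\<le>k. abs (x i)) = (\<Sum>i\<le>l. abs (x i))"
  by (intro sum.mono_neutral_right) (auto simp: cross_sphere_def not_le)
 then show "x \<in> cross_sphere k" using x \<open>l <= k\<close> by (auto simp: cross_sphere_def)
qed

lemma odd_coeff_mono:
 assumes "odd_coeff k c" "l <= k" shows "odd_coeff l c"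
 using assms(1) cross_sphere_mono[OF assms(2)] unfolding odd_coeff_def by (meson continuous_on_subset subsetD)

lemma odd_maps_mono: "g \<in> odd_maps k ==> l <= k ==> g \<in> odd_maps l"
 unfolding odd_maps_def using odd_coeff_mono by (smt (verit) mem_Collect_eq)

lemma odd_mapsI:
 assumes "!!j. j < (m::nat) ==> e j \<in> test_functions" "!!j. j < m ==> odd_coeff k (%y. c y j)"
 shows "(%y x. \<Sum>j<m. c y j * e j x) \<in> odd_maps k"
 unfolding odd_maps_def using assms by (intro CollectI exI[of _ m] exI[of _ c] exI[of _ e]) simp

lemma odd_mapsE:
 assumes "g \<in> odd_maps k"
 obtains m c e where "!!j. j < (m::nat) ==> e j \<in> test_functions" "!!j. j < m ==> odd_coeff k (%y. c y j)"
  "g = (%y x. \<Sum>j<m. c y j * e j x)"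
 using assms unfolding odd_maps_def by blast

lemma odd_maps_tf: "g \<in> odd_maps k ==> g y \<in> test_functions"
 by (erule odd_mapsE) (auto intro!: tf_sum tf_cmult)

lemma odd_maps_odd: "g \<in> odd_maps k ==> y \<in> cross_sphere k ==> g (pneg y) = (%x. - g y x)"
 by (erule odd_mapsE) (auto simp: odd_coeff_def sum_negf[symmetric] intro!: sum.cong)

lemma odd_maps_continuous:
 assumes "g \<in> odd_maps k"
 shows "continuous_on (cross_sphere k) (%y. En (g y))" "continuous_on (cross_sphere k) (%y. Phi (g y))"
  "v \<in> test_functions ==> continuous_on (cross_sphere k) (%y. dPhi \<kappa> (g y) v)"
proof -
 obtain m c e where e: "!!j. j < (m::nat) ==> e j \<in> test_functions" and c: "!!j. j < m ==> odd_coeff k (%y. c y j)"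
  and g: "g = (%y x. \<Sum>j<m. c y j * e j x)"
  using assms by (elim odd_mapsE) blast
 have cc: "!!j. j < m ==> continuous_on (cross_sphere k) (%y. c y j)" using c by (simp add: odd_coeff_def)
 show "continuous_on (cross_sphere k) (%y. En (g y))" "continuous_on (cross_sphere k) (%y. Phi (g y))"
  unfolding g by (rule comb_continuous[OF e cc]; assumption)+
 show "v \<in> test_functions ==> continuous_on (cross_sphere k) (%y. dPhi \<kappa> (g y) v)"
  unfolding g by (rule comb_continuous(3)[OF e cc])
qed

lemma odd_maps_add:
 assumes g: "g \<in> odd_maps k" and d: "odd_coeff k d" and \<phi>: "\<phi> \<in> test_functions"
 shows "(%y x. g y x + d y * \<phi> x) \<in> odd_maps k"
proof -
 obtain m c e where e: "!!j. j < (m::nat) ==> e j \<in> test_functions" and c: "!!j. j < m ==> odd_coeff k (%y. c y j)"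
  and g: "g = (%y x. \<Sum>j<m. c y j * e j x)"
  using assms by (elim odd_mapsE) blast
 define c' where "c' y j = (if j < m then c y j else d y)" for y j
 define e' where "e' j = (if j < m then e j else \<phi>)" for j
 have "(%y x. g y x + d y * \<phi> x) = (%y x. \<Sum>j<Suc m. c' y j * e' j x)"
  by (simp add: g c'_def e'_def)
 moreover have "(%y x. \<Sum>j<Suc m. c' y j * e' j x) \<in> odd_maps k"
 proof (rule odd_mapsI)
  fix j assume "j < Suc m"
  show "e' j \<in> test_functions" using e \<phi> by (simp add: e'_def)
  show "odd_coeff k (%y. c' y j)" using c d by (cases "j < m") (simp_all add: c'_def)
 qed
 ultimately show ?thesis by (simp only:)
qed

lemma odd_maps_sum:
 assumes "finite I" "g \<in> odd_maps k" "!!i. i \<in> I ==> odd_coeff k (d i)" "!!i. i \<in> I ==> \<phi> i \<in> test_functions"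
 shows "(%y x. g y x + (\<Sum>i\<in>I. d i y * \<phi> i x)) \<in> odd_maps k"
 using assms
proof (induction I rule: finite_induct)
 case empty
 then show ?case by simp
next
 case (insert i I)
 have "(%y x. (g y x + (\<Sum>i\<in>I. d i y * \<phi> i x)) + d i y * \<phi> i x) \<in> odd_maps k"
  by (rule odd_maps_add) (use insert in auto)
 moreover have "(%y x. (g y x + (\<Sum>i\<in>I. d i y * \<phi> i x)) + d i y * \<phi> i x) = (%y x. g y x + (\<Sum>i\<in>insert i I. d i y * \<phi> i x))"
  using insert.hyps by (simp add: fun_eq_iff algebra_simps)
 ultimately show ?case by simp
qed

lemma bump_Gr_pos:
 assumes "!!i. A $ i < B $ i"
 shows "0 < Gr (box_bump 1 A B :: real ^ 'n => real)"
proof -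
 let ?e = "box_bump 1 A B :: real ^ 'n => real"
 note [measurable] = tf_borel[OF box_bump_tf[of 1 A B]]
 have "Gr ?e ~= 0"
 proof
  assume "Gr ?e = 0"
  then have "AE x in wmeas \<eta>. \<bar>?e x\<bar> powr r = 0"
   using integral_nonneg_eq_0_iff_AE[OF LspaceD(2)[OF tf_L(3)[OF box_bump_tf[of 1 A B]]]] by (simp add: Gr_def pint_def)
  then have "AE x in lborel. 0 < ennreal (norm (x :: real ^ 'n) powr (- \<eta>)) --> \<bar>?e x\<bar> powr r = 0"
   unfolding wmeas_def by (subst (asm) AE_density) auto
  with AE_nonzero have "AE x in lborel. x \<notin> box A B"
  proof eventually_elim
   case (elim x)
   then show ?case using box_bump_pos[of x A B 1] by auto
  qed
  then have "box A B \<in> null_sets lborel" by (subst AE_iff_null_sets) auto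
  then have "negligible (box A B)" unfolding negligible_iff_null_sets by (rule null_sets_completionI)
  then show False using open_not_negligible[OF open_box, of A B] assms by (auto simp: interval_ne_empty_cart)
 qed
 then show ?thesis using Gr_nonneg[of ?e] by linarith
qed

text \<open>
 On combinations of bumps with disjoint supports \<open>Gr\<close> is bounded below, as one coefficient is at least \<open>1/(k+1)\<close>.
 For a small dilation factor \<open>t\<close> the power \<open>t\<^sup>\<ell>\<^sup>'\<close> then outweighs the terms of order \<open>t\<^sup>\<ell>\<close>.
\<close>

lemma negative_odd_map: "EX g:odd_maps k. EX s<0. ALL y:cross_sphere k. Phi (g y) <= s"
proof -
 define e :: "nat => real ^ 'n => real" where "e j = box_bump 1 (\<chi> i. real j) (\<chi> i. real j + 1)" for j
 have e: "e j \<in> test_functions" for j by (simp add: e_def box_bump_tf)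
 have disj: "e j x = 0" if "e i x ~= 0" "i ~= j" for i j x
 proof (rule ccontr)
  assume "e j x ~= 0"
  then have x: "x \<in> box (\<chi> l. real j) (\<chi> l. real j + 1)" "x \<in> box (\<chi> l. real i) (\<chi> l. real i + 1)"
   using box_bump_zero that(1) unfolding e_def by blast+
  obtain l :: 'n where True by blast
  have "real j < x $ l" "x $ l < real j + 1" "real i < x $ l" "x $ l < real i + 1"
   using x by (auto simp: mem_box_cart)
  then have "real j < real (Suc i)" "real i < real (Suc j)" by linarith+
  then show False using that(2) unfolding of_nat_less_iff by linarith
 qed
 define h where "h y x = (\<Sum>j<Suc k. y j * e j x)" for y :: "nat => real" and x
 have h: "h y \<in> test_functions" for y unfolding h_def by (intro tf_sum tf_cmult e)
 have coord: "odd_coeff k (%y. y j)" for j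
  by (auto simp: odd_coeff_def pneg_def intro: continuous_on_product_then_coordinatewise)
 have hG: "h \<in> odd_maps k"
  unfolding h_def[abs_def] by (rule odd_mapsI[where c="%y j. y j"]) (rule e, rule coord)
 have bdd: "EX K>0. ALL y:cross_sphere k. En (h y) <= K"
 proof -
  have "compact ((%y. En (h y)) ` cross_sphere k)"
   by (intro compact_continuous_image odd_maps_continuous hG compact_cross_sphere)
  from compact_imp_bounded[OF this] have "EX K. ALL z:(%y. En (h y)) ` cross_sphere k. norm z <= K"
   unfolding bounded_iff .
  then obtain K where K: "ALL z:(%y. En (h y)) ` cross_sphere k. norm z <= K" ..
  show ?thesis
  proof (intro exI[of _ "abs K + 1"] conjI ballI)
   fix y :: "nat => real" assume "y \<in> cross_sphere k"
   then have "norm (En (h y)) <= K" using bspec[OF K imageI] by blast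
   then show "En (h y) <= abs K + 1" unfolding real_norm_def by linarith
  qed (simp add: add_nonneg_pos)
 qed
 then obtain K where K: "K > 0" "!!y. y \<in> cross_sphere k ==> En (h y) <= K" by blast
 obtain C where C: "C > 0" "!!u K. u \<in> test_functions ==> K > 0 ==> En u <= K ==> Ja u <= C * K & Gr u <= C * K powr \<theta>"
  using scale_bounds by blast
 define M where "M = K + abs lam * (C * K)"
 have M: "M > 0" using K C by (simp add: M_def add_pos_nonneg)
 define c where "c = Min ((%j. Gr (e j)) ` {..k}) * (1 / real (Suc k)) powr r"
 have Gmin: "Min ((%j. Gr (e j)) ` {..k}) > 0"
 proof -
  have "0 < Gr (e j)" for j unfolding e_def by (rule bump_Gr_pos) simp
  then show ?thesis by (subst Min_gr_iff) auto
 qed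
 then have c: "c > 0" by (simp add: c_def)
 have low: "c <= Gr (h y)" if y: "y \<in> cross_sphere k" for y
 proof -
  have "EX j<=k. 1 / real (Suc k) <= abs (y j)"
  proof (rule ccontr)
   assume "~ ?thesis"
   then have "(\<Sum>j\<le>k. abs (y j)) < (\<Sum>j\<le>k. 1 / real (Suc k))" by (intro sum_strict_mono) auto
   then show False using y by (simp add: cross_sphere_def)
  qed
  then obtain j where j: "j <= k" "1 / real (Suc k) <= abs (y j)" by blast
  have pt: "\<bar>y j * e j x\<bar> <= abs (h y x)" for x
  proof (cases "e j x = 0")
   case False
   have "h y x = (\<Sum>i\<in>{j}. y i * e i x)"
    unfolding h_def by (rule sum.mono_neutral_right) (use j disj[OF False] in auto)
   then show ?thesis by simp
  qed simp
  have "c <= Gr (e j) * abs (y j) powr r"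
   unfolding c_def using j Gmin exps by (intro mult_mono Min_le powr_mono2) auto
  also have "... = pint (wmeas \<eta>) r (%x. y j * e j x)" by (simp add: pint_cmult Gr_def)
  also have "... <= Gr (h y)"
   unfolding Gr_def pint_def
   by (rule integral_mono) (use exps pt in \<open>auto intro!: LspaceD(2) tf_cmult tf_L e h powr_mono2\<close>)
  finally show ?thesis .
 qed
 define t where "t = (c / (2 * r * M)) powr (1 / (ell - ell'))"
 have t: "t > 0" using c M exps by (simp add: t_def)
 have tt: "t powr ell = t powr ell' * (c / (2 * r * M))"
 proof -
  have "t powr (ell - ell') = c / (2 * r * M)" using ell c M exps by (simp add: t_def powr_powr)
  moreover have "t powr ell = t powr ell' * t powr (ell - ell')" by (subst powr_add[symmetric]) simp
  ultimately show ?thesis by simp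
 qed
 define g where "g y = dil \<delta> t (h y)" for y
 have g: "g \<in> odd_maps k"
 proof -
  have "g = (%y x. \<Sum>j<Suc k. y j * dil \<delta> t (e j) x)"
   by (simp add: g_def dil_def h_def fun_eq_iff sum_distrib_left algebra_simps del: sum.lessThan_Suc)
  moreover have "(%y x. \<Sum>j<Suc k. y j * dil \<delta> t (e j) x) \<in> odd_maps k"
   by (rule odd_mapsI[where c="%y j. y j" and e="%j. dil \<delta> t (e j)"]) (rule tf_dil[OF e t], rule coord)
  ultimately show ?thesis by (simp only:)
 qed
 have "Phi (g y) <= - (t powr ell' * (c / (2 * r)))" if y: "y \<in> cross_sphere k" for y
 proof -
  have "abs lam * Ja (h y) <= abs lam * (C * K)" using C(2)[OF h K(1) K(2)[OF y]] by (intro mult_left_mono) auto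
  then have 1: "En (h y) - lam / p * Ja (h y) <= M"
   using lower_order_bounds(2)[of "h y"] K(2)[OF y] unfolding M_def by linarith
  have "Phi (g y) = t powr ell * (En (h y) - lam / p * Ja (h y)) - t powr ell' * Gr (h y) / r"
   by (simp add: Phi_def g_def En_dil[OF h t] Ja_dil[OF h t] Gr_dil[OF h t] algebra_simps)
  also have "... <= t powr ell * M - t powr ell' * c / r"
   using 1 low[OF y] exps by (intro diff_mono mult_left_mono divide_right_mono) auto
  also have "... = - (t powr ell' * (c / (2 * r)))"
   unfolding tt using M exps by (simp add: field_simps)
  finally show ?thesis .
 qed
 moreover have "- (t powr ell' * (c / (2 * r))) < 0" using t c exps by simp
 ultimately show ?thesis using g by blast
qed

end

section \<open>Levels tend to zero\<close>

text \<open>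
 Makes the probes of the rescaled map continuous, where the dilation factor depends on the point.
\<close>

lemma avg_dil_continuous:
 fixes u :: "real ^ 'n::finite => real"
 assumes u: "u \<in> test_functions"
 shows "continuous_on {0<..} (%s. avg h (dil \<delta> s u) d)"
proof -
 obtain R B where B: "!!x. abs (u x) <= B" using tf_bound[OF u] by metis
 note [measurable] = tf_borel[OF u]
 have "continuous_on {0<..} (%s::real. LINT z|unif unit_ball. u (s *\<^sub>R (d + h *\<^sub>R z)))"
  unfolding continuous_on_sequentially o_def
 proof (intro allI ballI impI, elim conjE)
  fix s :: "nat => real" and l :: real assume lim: "s ----> l"
  show "(%n. LINT z|unif unit_ball. u (s n *\<^sub>R (d + h *\<^sub>R z))) ----> (LINT z|unif unit_ball. u (l *\<^sub>R (d + h *\<^sub>R z)))"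
  proof (rule integral_dominated_convergence[where w="%_. B"])
   show "integrable (unif unit_ball) (%_::real ^ 'n. B)" by (rule unif_ball_integrable_const)
   have "(%n. u (s n *\<^sub>R (d + h *\<^sub>R z))) ----> u (l *\<^sub>R (d + h *\<^sub>R z))" for z
    by (rule isCont_tendsto_compose[where g=u])
     (use tf_continuous[OF u, of UNIV] in \<open>auto simp: continuous_on_eq_continuous_at intro!: tendsto_intros lim\<close>)
   then show "AE z in unif unit_ball. (%n. u (s n *\<^sub>R (d + h *\<^sub>R z))) ----> u (l *\<^sub>R (d + h *\<^sub>R z))" by simp
  qed (use B in auto)
 qed
 then have "continuous_on {0<..} (%s::real. s powr \<delta> * (LINT z|unif unit_ball. u (s *\<^sub>R (d + h *\<^sub>R z))))"
  by (intro continuous_intros) auto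
 moreover have "avg h (dil \<delta> s u) d = s powr \<delta> * (LINT z|unif unit_ball. u (s *\<^sub>R (d + h *\<^sub>R z)))" for s
  by (simp add: avg_def dil_def)
 ultimately show ?thesis by simp
qed

lemma avg_comb:
 fixes u :: "nat => real ^ 'n::finite => real"
 assumes "!!j. j < m ==> u j \<in> test_functions"
 shows "avg h (%x. \<Sum>j<m. c j * u j x) d = (\<Sum>j<m. c j * avg h (u j) d)"
 unfolding avg_def by (simp add: avg_integrable[OF assms])

context scaled_problem
begin

lemma En_zero:
 assumes u: "u \<in> test_functions" and E: "En u <= 0"
 shows "Ja u = 0" "Gr u = 0"
proof -
 obtain C where C: "C > 0" "!!u K. u \<in> test_functions ==> K > 0 ==> En u <= K ==> Ja u <= C * K & Gr u <= C * K powr \<theta>"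
  using scale_bounds by blast
 show "Ja u = 0"
 proof (rule ccontr)
  assume "Ja u ~= 0"
  then have J: "Ja u > 0" using Ja_nonneg[of u] by linarith
  have "Ja u <= C * (Ja u / (2 * C))" by (rule conjunct1[OF C(2)[OF u]]) (use J C E in \<open>auto intro: order_trans[OF E]\<close>)
  then show False using J C by simp
 qed
 show "Gr u = 0"
 proof (rule ccontr)
  assume "Gr u ~= 0"
  then have J: "Gr u > 0" using Gr_nonneg[of u] by linarith
  define K where "K = (Gr u / (2 * C)) powr (1 / \<theta>)"
  have K: "K > 0" using J C by (simp add: K_def)
  have "Gr u <= C * K powr \<theta>" by (rule conjunct2[OF C(2)[OF u K]]) (use E K in linarith)
  also have "K powr \<theta> = Gr u / (2 * C)" using ell J C by (simp add: K_def powr_powr)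
  finally show False using J C by simp
 qed
qed

text \<open>
 After rescaling to constant energy, the map composed with the first \<open>k\<close> averages is odd and continuous, so by
 the Borsuk--Ulam theorem all these averages vanish at some point. Functions of bounded energy on which more and
 more averages vanish tend to zero in the compactly embedded spaces.
\<close>

lemma index_lemma:
 assumes e: "0 < e"
 shows "EX m. ALL k>=m. ALL g:odd_maps k. EX y:cross_sphere k. Ja (g y) <= e * En (g y) & Gr (g y) <= e * En (g y) powr \<theta>"
proof (rule ccontr)
 assume neg: "~ ?thesis"
 have "ALL m. EX w. w \<in> test_functions & En w = 1 / q & ~ (Ja w <= e / q & Gr w <= e / q powr \<theta>) & (ALL i<m. probe i w = 0)"
 proof
  fix m
  obtain k g where k: "m <= k" and g: "g \<in> odd_maps k"
   and bad: "!!y. y \<in> cross_sphere k ==> ~ (Ja (g y) <= e * En (g y) & Gr (g y) <= e * En (g y) powr \<theta>)"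
   using neg by blast
  obtain l c u where u: "!!j. j < (l::nat) ==> u j \<in> test_functions" and c: "!!j. j < l ==> odd_coeff k (%y. c y j)"
   and geq: "g = (%y x. \<Sum>j<l. c y j * u j x)"
   using g by (elim odd_mapsE) blast
  have gt: "g y \<in> test_functions" for y by (rule odd_maps_tf[OF g])
  have pos: "0 < En (g y)" if y: "y \<in> cross_sphere k" for y
  proof (rule ccontr)
   assume "~ 0 < En (g y)"
   then have E: "En (g y) <= 0" by simp
   show False using bad[OF y] En_zero[OF gt E] e by simp
  qed
  define t where "t y = (q * En (g y)) powr (- 1 / ell)" for y
  have t: "t y > 0" if y: "y \<in> cross_sphere k" for y using pos[OF y] exps by (simp add: t_def)
  have tl: "t y powr ell = 1 / (q * En (g y))" "t y powr ell' = 1 / (q powr \<theta> * En (g y) powr \<theta>)" if y: "y \<in> cross_sphere k" for y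
  proof -
   have 1: "- 1 / ell * ell = - 1" using ell by simp
   have 2: "- 1 / ell * ell' = - \<theta>" by (simp add: \<theta>_def)
   show "t y powr ell = 1 / (q * En (g y))"
    unfolding t_def powr_powr 1 using pos[OF y] exps by (simp add: powr_minus_divide)
   show "t y powr ell' = 1 / (q powr \<theta> * En (g y) powr \<theta>)"
    unfolding t_def powr_powr 2 using pos[OF y] exps by (simp add: powr_minus_divide powr_mult)
  qed
  define v where "v y = dil \<delta> (t y) (g y)" for y
  have odd: "v (pneg y) = (%x. - 1 * v y x)" if y: "y \<in> cross_sphere k" for y
   by (simp add: v_def t_def dil_def odd_maps_odd[OF g y] uminus_sym(1)[OF gt])
  have cont_t: "continuous_on (cross_sphere k) t"
  proof -
   have "ALL y:cross_sphere k. q * En (g y) ~= 0" using pos exps by force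
   then show ?thesis
    unfolding t_def by (intro continuous_on_powr continuous_on_mult continuous_on_const odd_maps_continuous(1)[OF g])
  qed
  have "EX y:cross_sphere k. ALL i<k. probe i (v y) = 0"
  proof (rule Borsuk_Ulam_cross_sphere)
   fix i
   obtain d j where pr: "!!u. probe i u = avg (1 / real (Suc j)) u (d :: real ^ 'n)" using probe_ex by blast
   have veq: "v y = (%x. \<Sum>j<l. c y j * dil \<delta> (t y) (u j) x)" for y
    by (simp add: v_def geq dil_def fun_eq_iff sum_distrib_left mult.left_commute)
   have "continuous_on (cross_sphere k) (%y. \<Sum>j'<l. c y j' * avg (1 / real (Suc j)) (dil \<delta> (t y) (u j')) d)"
   proof (intro continuous_on_sum continuous_on_mult)
    fix i assume i: "i \<in> {..<l}"
    show "continuous_on (cross_sphere k) (%y. c y i)" using c i by (simp add: odd_coeff_def)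
    show "continuous_on (cross_sphere k) (%y. avg (1 / real (Suc j)) (dil \<delta> (t y) (u i)) d)"
     by (rule continuous_on_compose2[OF avg_dil_continuous cont_t]) (use i u t in auto)
   qed
   moreover have "probe i (v y) = (\<Sum>j'<l. c y j' * avg (1 / real (Suc j)) (dil \<delta> (t y) (u j')) d)" if y: "y \<in> cross_sphere k" for y
    unfolding pr veq by (rule avg_comb) (use u t[OF y] tf_dil in blast)
   ultimately show "continuous_on (cross_sphere k) (%y. probe i (v y))" by (simp cong: continuous_on_cong)
   show "probe i (v (pneg y)) = - probe i (v y)" if "y \<in> cross_sphere k" for y
    unfolding odd[OF that] pr avg_cmult by simp
  qed
  then obtain y where y: "y \<in> cross_sphere k" and 0: "!!i. i < k ==> probe i (v y) = 0" by blast
  show "EX w. w \<in> test_functions & En w = 1 / q & ~ (Ja w <= e / q & Gr w <= e / q powr \<theta>) & (ALL i<m. probe i w = 0)"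
  proof (intro exI[of _ "v y"] conjI)
   show "v y \<in> test_functions" unfolding v_def by (rule tf_dil[OF gt t[OF y]])
   show "En (v y) = 1 / q" unfolding v_def En_dil[OF gt t[OF y]] tl[OF y] using pos[OF y] by simp
   have q: "q > 0" "q powr \<theta> > 0" "En (g y) powr \<theta> > 0" using exps pos[OF y] by auto
   have "Ja (v y) <= e / q \<longleftrightarrow> Ja (g y) <= e * En (g y)"
    unfolding v_def Ja_dil[OF gt t[OF y]] tl[OF y] using pos[OF y] q by (simp add: field_simps)
   moreover have "Gr (v y) <= e / q powr \<theta> \<longleftrightarrow> Gr (g y) <= e * En (g y) powr \<theta>"
    unfolding v_def Gr_dil[OF gt t[OF y]] tl[OF y] using q by (simp add: field_simps)
   ultimately show "~ (Ja (v y) <= e / q & Gr (v y) <= e / q powr \<theta>)" using bad[OF y] by blast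
   show "ALL i<m. probe i (v y) = 0" using 0 k by auto
  qed
 qed
 from choice[OF this] obtain w where w0: "ALL m. w m \<in> test_functions & En (w m) = 1 / q &
   ~ (Ja (w m) <= e / q & Gr (w m) <= e / q powr \<theta>) & (ALL i<m. probe i (w m) = 0)" by blast
 have w: "w m \<in> test_functions" and E: "En (w m) = 1 / q" and big: "~ (Ja (w m) <= e / q & Gr (w m) <= e / q powr \<theta>)"
  and pr0: "i < m ==> probe i (w m) = 0" for m i using w0 by blast+
 have d: "dirichlet (w m) <= 1" and Q: "pint (wmeas b) q (w m) <= 1" for m
  using En_bounds[of "w m"] exps by (simp_all add: E)
 have pr: "(%m. probe i (w m)) ----> 0" for i
 proof (rule tendsto_eventually)
  show "\<forall>\<^sub>F m in sequentially. probe i (w m) = 0"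
   using eventually_gt_at_top[of i] by eventually_elim (rule pr0)
 qed
 note L1 = null_of_probes[OF exps(1,2,7) w d Q pr]
 have "(%m. Ja (w m)) ----> 0" "(%m. Gr (w m)) ----> 0"
  unfolding Ja_def Gr_def by (rule embedding_null[OF ga N w d Q L1] embedding_null[OF g\<eta> N w d Q L1]; assumption)+
 then have "\<forall>\<^sub>F m in sequentially. Ja (w m) < e / q" "\<forall>\<^sub>F m in sequentially. Gr (w m) < e / q powr \<theta>"
  using e exps by (intro order_tendstoD(2)[where y="0::real"]; simp)+
 then have "\<forall>\<^sub>F m in sequentially. False"
 proof eventually_elim
  case (elim m)
  then show ?case using big[of m] by linarith
 qed
 then show False by simp
qed

text \<open>
 At the point provided by \<open>index_lemma\<close> the energy absorbs the eigenvalue term, and all of the subscaled term except for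
 a small constant.
\<close>

lemma levels_vanish:
 assumes e: "0 < e"
 shows "EX m. ALL k>=m. ALL g:odd_maps k. EX y:cross_sphere k. - e <= Phi (g y)"
proof -
 define e0 where "e0 = min e (1 / (abs lam + 1))"
 have e0: "0 < e0" "e0 <= e" "e0 * (abs lam + 1) <= 1"
 proof -
  show "0 < e0" "e0 <= e" using e by (auto simp: e0_def)
  have "e0 * (abs lam + 1) <= 1 / (abs lam + 1) * (abs lam + 1)" by (intro mult_right_mono) (auto simp: e0_def)
  moreover have "abs lam + 1 ~= 0" using abs_ge_zero[of lam] by linarith
  ultimately show "e0 * (abs lam + 1) <= 1" by simp
 qed
 obtain m where m: "ALL k>=m. ALL g:odd_maps k. EX y:cross_sphere k. Ja (g y) <= e0 * En (g y) & Gr (g y) <= e0 * En (g y) powr \<theta>"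
  using index_lemma[OF e0(1)] by blast
 have P: "- e <= Phi u" if J: "Ja u <= e0 * En u" and G: "Gr u <= e0 * En u powr \<theta>" for u
 proof -
  have 1: "En u - abs lam * (e0 * En u) - e0 * En u powr \<theta> <= Phi u"
   using lower_order_bounds(1,3)[of u] mult_left_mono[OF J, of "abs lam"] G unfolding Phi_def by linarith
  have 2: "e0 * (abs lam + 1) * En u <= 1 * En u" by (intro mult_right_mono e0) auto
  show ?thesis
  proof (cases "En u <= 1")
   case True
   have "En u powr \<theta> <= 1 powr \<theta>" using True ell by (intro powr_mono2) auto
   then have "e0 * En u powr \<theta> <= e0" using e0(1) by (simp add: mult_left_le)
   moreover have "0 <= e0 * En u" using e0(1) by simp
   ultimately show ?thesis using 1 2 e0(2) by (simp add: algebra_simps del: En_nonneg)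
  next
   case False
   then have "En u powr \<theta> <= En u powr 1" using ell by (intro powr_mono) auto
   then have "e0 * En u powr \<theta> <= e0 * En u" using e0(1) False by (intro mult_left_mono) auto
   then show ?thesis using 1 2 e by (simp add: algebra_simps)
  qed
 qed
 show ?thesis using m P by blast
qed

end

section \<open>Deformation and minimax\<close>

context scaled_problem
begin

text \<open>
 One step along an odd pseudo-gradient field pushes all maps whose maximum is close to \<open>c\<close> below \<open>c\<close>. The step
 length \<open>s0\<close> comes from the uniform Taylor estimate and does not depend on the map, so no flow is needed.
\<close>

lemma deformation:
 assumes c: "c < 0" and ne: "~ is_eigenvalue TYPE('n) b q a p lam"
  and no: "!!w. weak_solution b q nonlin w ==> energy b q nonlin w ~= c"
 shows "EX \<sigma>>0. ALL k. ALL g:odd_maps k. (ALL y:cross_sphere k. Phi (g y) <= c + \<sigma>) -->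
  (EX g':odd_maps k. ALL y:cross_sphere k. Phi (g' y) <= c - \<sigma>)"
proof -
 obtain \<epsilon> \<beta> where \<epsilon>: "\<epsilon> > 0" and \<beta>: "\<beta> > 0" and pg: "ALL u:test_functions. \<bar>Phi u - c\<bar> <= \<epsilon> -->
  (EX \<phi>:test_functions. En \<phi> <= En u & \<beta> * En u <= dPhi 1 u \<phi>)"
  using pseudo_gradient[OF c ne no] by blast
 have "- c / 2 > 0" using c by simp
 then obtain K0 where K0: "K0 > 0" and K0b: "ALL u:test_functions. Phi u <= - (- c / 2) --> K0 <= En u"
  using Phi_lower_bound by blast
 have "\<beta> / 4 > 0" using \<beta> by simp
 then obtain s0 where s0: "s0 > 0" and Tay: "ALL s u w. 0 <= s --> s <= s0 --> u \<in> test_functions --> w \<in> test_functions -->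
  K0 <= En u --> En w <= 2 * En u --> Phi (%x. u x - s * w x) <= Phi u - s * dPhi 1 u w + s * (\<beta> / 4 * En u)"
  using Phi_Taylor[OF _ K0] by blast
 define \<sigma> where "\<sigma> = min \<epsilon> (min (- c / 2) (s0 * (\<beta> / 4 * K0) / 2))"
 have \<sigma>: "\<sigma> > 0" "\<sigma> <= \<epsilon>" "\<sigma> <= - c / 2" "2 * \<sigma> <= s0 * (\<beta> / 4 * K0)"
  using \<epsilon> c s0 \<beta> K0 by (auto simp: \<sigma>_def)
 have "EX g':odd_maps k. ALL y:cross_sphere k. Phi (g' y) <= c - \<sigma>"
  if g: "g \<in> odd_maps k" and top: "ALL y:cross_sphere k. Phi (g y) <= c + \<sigma>" for k g
 proof -
  let ?X = "cross_sphere k"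
  define A where "A = ?X \<inter> (%y. Phi (g y)) -` {c - \<sigma>..}"
  have gt: "g y \<in> test_functions" for y by (rule odd_maps_tf[OF g])
  have E: "K0 <= En (g y)" if "y \<in> ?X" for y
  proof -
   have "Phi (g y) <= c + \<sigma>" using top that by blast
   then have "Phi (g y) <= - (- c / 2)" using \<sigma>(3) by linarith
   then show ?thesis using K0b gt by blast
  qed
  have Epos: "0 < En (g y)" if "y \<in> ?X" for y using E[OF that] K0 by linarith
  have "closed A" unfolding A_def
   by (rule continuous_closed_preimage[OF odd_maps_continuous(2)[OF g] compact_imp_closed[OF compact_cross_sphere]]) simp
  then have cA: "compact A"
   using compact_Int_closed[OF compact_cross_sphere[of k], of A] by (simp add: A_def Int_left_absorb)
  show ?thesis
  proof (cases "A = {}")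
   case True
   then have "ALL y:?X. Phi (g y) <= c - \<sigma>" by (auto simp: A_def)
   then show ?thesis using g by blast
  next
   case False
   have "ALL y:A. EX \<phi>. \<phi> \<in> test_functions & En \<phi> <= En (g y) & \<beta> * En (g y) <= dPhi 1 (g y) \<phi>"
   proof
    fix y assume "y \<in> A"
    then have "Phi (g y) <= c + \<sigma>" "c - \<sigma> <= Phi (g y)" using top by (auto simp: A_def)
    then have "\<bar>Phi (g y) - c\<bar> <= \<epsilon>" using \<sigma>(2) by linarith
    then show "EX \<phi>. \<phi> \<in> test_functions & En \<phi> <= En (g y) & \<beta> * En (g y) <= dPhi 1 (g y) \<phi>"
     using pg gt[of y] by blast
   qed
   from bchoice[OF this] obtain \<phi> where \<phi>0: "ALL y:A. \<phi> y \<in> test_functions & En (\<phi> y) <= En (g y) & \<beta> * En (g y) <= dPhi 1 (g y) (\<phi> y)" by blast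
   \<comment> \<open>positive exactly where \<open>\<phi> i\<close> is a descent direction of controlled energy, also at nearby points\<close>
   define \<psi> where "\<psi> i z = max 0 (min (dPhi 1 (g z) (\<phi> i) - \<beta> / 2 * En (g z)) (2 * En (g z) - En (\<phi> i)))" for i z
   have \<psi>0: "0 <= \<psi> i z" for i z by (simp add: \<psi>_def)
   have \<psi>c: "continuous_on ?X (\<psi> i)" if "i \<in> A" for i
    unfolding \<psi>_def using \<phi>0 that
    by (intro continuous_intros odd_maps_continuous(1,3)[OF g]) auto
   have \<psi>A: "0 < \<psi> y y" if "y \<in> A" for y
   proof -
    have "y \<in> ?X" using that by (simp add: A_def)
    from Epos[OF this] have "0 < En (g y)" "0 < \<beta> * En (g y)" using \<beta> by auto
    then show ?thesis using \<phi>0 that by (force simp: \<psi>_def)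
   qed
   have "ALL i:A. EX U. open U & U \<inter> ?X = \<psi> i -` {0<..} \<inter> ?X"
   proof
    fix i assume "i \<in> A"
    from \<psi>c[OF this, unfolded continuous_on_open_invariant, rule_format, of "{0<..}"]
    show "EX U. open U & U \<inter> ?X = \<psi> i -` {0<..} \<inter> ?X" by simp
   qed
   from bchoice[OF this] obtain U where U: "ALL i:A. open (U i) & U i \<inter> ?X = \<psi> i -` {0<..} \<inter> ?X" by blast
   have cov: "A \<subseteq> (\<Union>i\<in>A. U i)"
   proof
    fix y assume y: "y \<in> A"
    then have "y \<in> \<psi> y -` {0<..} \<inter> ?X" using \<psi>A[OF y] by (simp add: A_def)
    then have "y \<in> U y" using U y by blast
    then show "y \<in> (\<Union>i\<in>A. U i)" using y by blast
   qed
   obtain I where I: "I \<subseteq> A" "finite I" "A \<subseteq> (\<Union>i\<in>I. U i)"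
    using compactE_image[OF cA _ cov] U by blast
   have It: "\<phi> i \<in> test_functions" if "i \<in> I" for i using \<phi>0 I(1) that by blast
   define S where "S z = (\<Sum>i\<in>I. \<psi> i z + \<psi> i (pneg z))" for z
   have S0: "0 <= S z" for z unfolding S_def by (intro sum_nonneg add_nonneg_nonneg \<psi>0)
   have pc: "continuous_on ?X pneg"
   proof (rule continuous_on_coordinatewise_then_product)
    fix i
    show "continuous_on ?X (%x. pneg x i)"
     unfolding pneg_def by (rule continuous_on_minus, rule continuous_on_product_then_coordinatewise, rule continuous_on_id)
   qed
   have \<psi>pc: "continuous_on ?X (%z. \<psi> i (pneg z))" if "i \<in> I" for i
    by (rule continuous_on_compose2[OF \<psi>c pc]) (use I(1) that in auto)
   have Sc: "continuous_on ?X S"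
    unfolding S_def by (intro continuous_on_sum continuous_on_add \<psi>c \<psi>pc) (use I(1) in auto)
   have Seven: "S (pneg z) = S z" for z by (simp add: S_def add.commute)
   have SA: "0 < S z" if z: "z \<in> A" for z
   proof -
    obtain i where i: "i \<in> I" "z \<in> U i" using I(3) z by blast
    moreover have "z \<in> ?X" using z by (simp add: A_def)
    ultimately have "0 < \<psi> i z" using U I(1) by blast
    also have "\<psi> i z <= \<psi> i z + \<psi> i (pneg z)" using \<psi>0[of i "pneg z"] by simp
    also have "... <= S z" unfolding S_def
     by (rule member_le_sum[OF i(1)]) (use I(2) in \<open>auto intro!: add_nonneg_nonneg \<psi>0\<close>)
    finally show ?thesis .
   qed
   have "continuous_on A S" using Sc by (rule continuous_on_subset) (simp add: A_def)
   from continuous_attains_inf[OF cA False this] obtain z0 where z0: "z0 \<in> A" "ALL z:A. S z0 <= S z" by blast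
   \<comment> \<open>bounded away from zero, so that the quotients are continuous also off \<open>A\<close>; on \<open>A\<close> it equals \<open>S\<close>\<close>
   define D where "D z = max (S z) (S z0)" for z
   have D: "0 < D z" "S z <= D z" for z using SA[OF z0(1)] by (auto simp: D_def)
   have DA: "D z = S z" if "z \<in> A" for z using z0(2) that by (simp add: D_def max_absorb1)
   \<comment> \<open>antisymmetrised, since the reflected point needs the opposite direction\<close>
   define d where "d i z = - s0 * ((\<psi> i z - \<psi> i (pneg z)) / D z)" for i z
   have dodd: "odd_coeff k (d i)" if i: "i \<in> I" for i
    unfolding odd_coeff_def
   proof (intro conjI ballI)
    have "continuous_on ?X D" unfolding D_def by (intro continuous_intros Sc)
    then show "continuous_on ?X (d i)"
     unfolding d_def using D(1) I(1) i
     by (intro continuous_on_mult continuous_on_divide continuous_on_diff continuous_on_const \<psi>c \<psi>pc) (auto simp: less_imp_neq[symmetric])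
    fix y show "d i (pneg y) = - d i y"
     by (simp add: d_def D_def Seven minus_divide_left[symmetric] diff_divide_distrib algebra_simps)
   qed
   define g' where "g' = (%y x. g y x + (\<Sum>i\<in>I. d i y * \<phi> i x))"
   have g': "g' \<in> odd_maps k" unfolding g'_def by (rule odd_maps_sum[OF I(2) g dodd It])
   have "Phi (g' z) <= c - \<sigma>" if z: "z \<in> ?X" for z
   proof (cases "S z = 0")
    case True
    have "\<psi> i z + \<psi> i (pneg z) = 0" if "i \<in> I" for i
     using True I(2) that unfolding S_def
     by (subst (asm) sum_nonneg_eq_0_iff) (auto intro!: add_nonneg_nonneg \<psi>0)
    then have "d i z = 0" if "i \<in> I" for i
     using \<psi>0[of i z] \<psi>0[of i "pneg z"] that by (force simp: d_def add_nonneg_eq_0_iff)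
    then have "g' z = g z" by (simp add: g'_def fun_eq_iff)
    moreover have "z \<notin> A" using SA[of z] True by auto
    ultimately show ?thesis using z by (simp add: A_def)
   next
    case False
    then have S: "0 < S z" using S0[of z] by simp
    define \<alpha> where "\<alpha> i = (\<psi> i z - \<psi> i (pneg z)) / S z" for i
    define w where "w x = (\<Sum>i\<in>I. \<alpha> i * \<phi> i x)" for x
    define s where "s = s0 * (S z / D z)"
    have w: "w \<in> test_functions" unfolding w_def by (intro tf_sum tf_cmult It)
    have "0 <= S z / D z" "S z / D z <= 1" using S D(1,2)[of z] by simp_all
    then have s: "0 <= s" "s <= s0"
     using s0 by (simp_all add: s_def mult_left_le del: times_divide_eq_right)
    have g'z: "g' z = (%x. g z x - s * w x)"
    proof
     fix x
     have "d i z = - s * \<alpha> i" for i using S D(1)[of z] by (simp add: d_def s_def \<alpha>_def)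
     then show "g' z x = g z x - s * w x"
      by (simp add: g'_def w_def sum_distrib_left sum_negf mult.assoc)
    qed
    have Em: "En (g (pneg z)) = En (g z)" using odd_maps_odd[OF g z] uminus_sym(1)[OF gt] by simp
    have dm: "dPhi 1 (g (pneg z)) v = - dPhi 1 (g z) v" for v
     using odd_maps_odd[OF g z] uminus_sym(5)[OF gt] by simp
      have desc: "\<psi> i z * (\<beta> / 2 * En (g z)) <= \<psi> i z * dPhi 1 (g z) (\<phi> i)"
     "\<psi> i (pneg z) * (\<beta> / 2 * En (g z)) <= - (\<psi> i (pneg z) * dPhi 1 (g z) (\<phi> i))" for i
    proof -
     have "\<psi> i y * (\<beta> / 2 * En (g y)) <= \<psi> i y * dPhi 1 (g y) (\<phi> i)" for y
     proof (cases "\<psi> i y = 0")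
      case False
      then have "\<beta> / 2 * En (g y) <= dPhi 1 (g y) (\<phi> i)" by (auto simp: \<psi>_def max_def min_def split: if_splits)
      then show ?thesis using \<psi>0 by (rule mult_left_mono)
     qed simp
     from this[of z] this[of "pneg z"]
     show "\<psi> i z * (\<beta> / 2 * En (g z)) <= \<psi> i z * dPhi 1 (g z) (\<phi> i)"
      "\<psi> i (pneg z) * (\<beta> / 2 * En (g z)) <= - (\<psi> i (pneg z) * dPhi 1 (g z) (\<phi> i))" by (simp_all add: Em dm)
    qed
    have sumS: "(\<Sum>i\<in>I. (\<psi> i z + \<psi> i (pneg z)) / S z) = 1"
     unfolding sum_divide_distrib[symmetric] S_def[symmetric] using S by simp
    have \<alpha>le: "abs (\<alpha> i) <= (\<psi> i z + \<psi> i (pneg z)) / S z" for i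
     using S \<psi>0[of i z] \<psi>0[of i "pneg z"] by (auto simp: \<alpha>_def intro!: divide_right_mono)
    have \<alpha>1: "(\<Sum>i\<in>I. abs (\<alpha> i)) <= 1" unfolding sumS[symmetric] by (rule sum_mono) (rule \<alpha>le)
    have "En w <= 2 * En (g z)"
    proof -
     have t: "(%x. sgn (\<alpha> i) * \<phi> i x) \<in> test_functions" if "i \<in> I" for i by (intro tf_cmult It that)
     have "w = (%x. \<Sum>i\<in>I. abs (\<alpha> i) * (sgn (\<alpha> i) * \<phi> i x))"
      by (simp add: w_def fun_eq_iff mult.assoc[symmetric] abs_mult_sgn)
     then have "En w <= (\<Sum>i\<in>I. abs (\<alpha> i) * En (%x. sgn (\<alpha> i) * \<phi> i x))"
      using En_convex[OF I(2) _ \<alpha>1 t] by simp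
     also have "... <= (\<Sum>i\<in>I. abs (\<alpha> i) * (2 * En (g z)))"
     proof (rule sum_mono)
      fix i assume i: "i \<in> I"
      show "abs (\<alpha> i) * En (%x. sgn (\<alpha> i) * \<phi> i x) <= abs (\<alpha> i) * (2 * En (g z))"
      proof (cases "\<alpha> i = 0")
       case False
       then have "\<psi> i z ~= 0 | \<psi> i (pneg z) ~= 0" by (auto simp: \<alpha>_def)
       then have "En (\<phi> i) <= 2 * En (g z)"
        by (auto simp: \<psi>_def Em max_def min_def split: if_splits)
       moreover have "En (%x. sgn (\<alpha> i) * \<phi> i x) = En (\<phi> i)"
        using uminus_sym(1)[OF It[OF i]] False by (cases "\<alpha> i > 0") auto
       ultimately show ?thesis by (simp add: mult_left_mono)
      qed simp
     qed
     also have "... = (\<Sum>i\<in>I. abs (\<alpha> i)) * (2 * En (g z))" by (simp add: sum_distrib_right)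
     also have "... <= 1 * (2 * En (g z))" by (intro mult_right_mono \<alpha>1) auto
     finally show ?thesis by simp
    qed
    then have T: "Phi (g' z) <= Phi (g z) - s * dPhi 1 (g z) w + s * (\<beta> / 4 * En (g z))"
     unfolding g'z using Tay s gt[of z] w E[OF z] by blast
    have "\<beta> / 2 * En (g z) <= dPhi 1 (g z) w"
    proof -
     have "\<beta> / 2 * En (g z) = (\<Sum>i\<in>I. (\<psi> i z + \<psi> i (pneg z)) / S z * (\<beta> / 2 * En (g z)))"
      unfolding sum_distrib_right[symmetric] sumS by simp
     also have "... <= (\<Sum>i\<in>I. \<alpha> i * dPhi 1 (g z) (\<phi> i))"
     proof (rule sum_mono)
      fix i
      have "(\<psi> i z + \<psi> i (pneg z)) * (\<beta> / 2 * En (g z)) <= (\<psi> i z - \<psi> i (pneg z)) * dPhi 1 (g z) (\<phi> i)"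
       unfolding distrib_right left_diff_distrib using desc[of i] by linarith
      then have "(\<psi> i z + \<psi> i (pneg z)) * (\<beta> / 2 * En (g z)) / S z <= (\<psi> i z - \<psi> i (pneg z)) * dPhi 1 (g z) (\<phi> i) / S z"
       using S by (intro divide_right_mono) auto
      then show "(\<psi> i z + \<psi> i (pneg z)) / S z * (\<beta> / 2 * En (g z)) <= \<alpha> i * dPhi 1 (g z) (\<phi> i)"
       by (simp add: \<alpha>_def)
     qed
     also have "... = dPhi 1 (g z) w" unfolding w_def by (rule dPhi_linear[OF gt I(2) It, symmetric])
     finally show ?thesis .
    qed
    then have "s * (\<beta> / 2 * En (g z)) <= s * dPhi 1 (g z) w" using s(1) by (rule mult_left_mono)
    moreover have "s * (\<beta> / 2 * En (g z)) = 2 * (s * (\<beta> / 4 * En (g z)))" by simp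
    ultimately have T2: "Phi (g' z) <= Phi (g z) - s * (\<beta> / 4 * En (g z))" using T by linarith
    show ?thesis
    proof (cases "z \<in> A")
     case True
     then have "s = s0" using DA S by (simp add: s_def)
     moreover have "s0 * (\<beta> / 4 * K0) <= s0 * (\<beta> / 4 * En (g z))"
      using s0 \<beta> E[OF z] by (intro mult_left_mono) auto
     moreover have "Phi (g z) <= c + \<sigma>" using top z by blast
     ultimately show ?thesis using T2 \<sigma>(4) by simp
    next
     case False
     then have "Phi (g z) < c - \<sigma>" using z by (simp add: A_def)
     moreover have "0 <= s * (\<beta> / 4 * En (g z))" using s(1) \<beta> by simp
     ultimately show ?thesis using T2 by linarith
    qed
   qed
   then show ?thesis using g' by blast
  qed
 qed
 then show ?thesis using \<sigma>(1) by blast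
qed

text \<open>
 The infimum of this set is the minimax level.
\<close>

definition levels :: "nat => real set" where
 "levels k = {s. EX g:odd_maps k. ALL y:cross_sphere k. Phi (g y) <= s}"

text \<open>
 For small \<open>k\<close> the minimax level may be infinite; the sequence starts at an index from which on the levels are bounded
 below.
\<close>

theorem solutions_at_negative_levels:
 assumes ne: "~ is_eigenvalue TYPE('n) b q a p lam"
 shows "EX u :: nat => real ^ 'n => real.
  (ALL k. weak_solution b q nonlin (u k) & energy b q nonlin (u k) < 0) &
  incseq (%k. energy b q nonlin (u k)) & (%k. energy b q nonlin (u k)) ----> 0"
proof -
 have low: "EX m. ALL k>=m. ALL s:levels k. - e <= s" if e: "0 < e" for e
 proof -
  obtain m where m: "ALL k>=m. ALL g:odd_maps k. EX y:cross_sphere k. - e <= Phi (g y)" using levels_vanish[OF e] by blast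
  have "- e <= s" if k: "m <= k" and s: "s \<in> levels k" for k s
  proof -
   obtain g where g: "g \<in> odd_maps k" "ALL y:cross_sphere k. Phi (g y) <= s" using s by (auto simp: levels_def)
   then obtain y where "y \<in> cross_sphere k" "- e <= Phi (g y)" using m k by blast
   then show ?thesis using g(2) by (blast intro: order_trans)
  qed
  then show ?thesis by blast
 qed
 obtain k0 where k0: "ALL k>=k0. ALL s:levels k. - 1 <= s" using low[OF zero_less_one] by blast
 have bdd: "bdd_below (levels k)" if "k >= k0" for k using k0 that by (intro bdd_belowI[of _ "- 1"]) auto
 have neg: "EX s:levels k. s < 0" for k using negative_odd_map[of k] unfolding levels_def by blast
 then have nonempty: "levels k ~= {}" for k by blast
 define c where "c k = Inf (levels k)" for k
 have c0: "c k < 0" if "k >= k0" for k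
 proof -
  obtain s where "s \<in> levels k" "s < 0" using neg by blast
  then show ?thesis unfolding c_def using cInf_lower[OF _ bdd[OF that]] by (blast intro: le_less_trans)
 qed
 have anti: "levels l \<subseteq> levels k" if "k <= l" for k l
  unfolding levels_def using odd_maps_mono[OF _ that] cross_sphere_mono[OF that] by blast
 have inc: "c k <= c l" if "k0 <= k" "k <= l" for k l
  unfolding c_def by (rule cInf_superset_mono[OF nonempty bdd[OF that(1)] anti[OF that(2)]])
 have sol: "EX w. weak_solution b q nonlin w & energy b q nonlin w = c k" if k: "k >= k0" for k
 proof (rule ccontr)
  assume no: "~ (EX w. weak_solution b q nonlin w & energy b q nonlin w = c k)"
  have "EX \<sigma>>0. ALL l. ALL g:odd_maps l. (ALL y:cross_sphere l. Phi (g y) <= c k + \<sigma>) -->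
   (EX g':odd_maps l. ALL y:cross_sphere l. Phi (g' y) <= c k - \<sigma>)"
   by (rule deformation[OF c0[OF k] ne]) (use no in blast)
  then obtain \<sigma> where \<sigma>: "\<sigma> > 0" and def: "ALL l. ALL g:odd_maps l. (ALL y:cross_sphere l. Phi (g y) <= c k + \<sigma>) -->
   (EX g':odd_maps l. ALL y:cross_sphere l. Phi (g' y) <= c k - \<sigma>)" by blast
  have "Inf (levels k) < c k + \<sigma>" using \<sigma> by (simp add: c_def)
  from cInf_lessD[OF nonempty this] obtain s where s: "s \<in> levels k" "s < c k + \<sigma>" by blast
  then obtain g where g: "g \<in> odd_maps k" "ALL y:cross_sphere k. Phi (g y) <= s" by (auto simp: levels_def)
  have "ALL y:cross_sphere k. Phi (g y) <= c k + \<sigma>" using g(2) s(2) by force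
  then have "c k - \<sigma> \<in> levels k" using def g(1) unfolding levels_def by blast
  then have "c k <= c k - \<sigma>" unfolding c_def by (intro cInf_lower bdd k)
  then show False using \<sigma> by simp
 qed
 have "ALL k. EX w. weak_solution b q nonlin w & energy b q nonlin w = c (k0 + k)" using sol by simp
 from choice[OF this] obtain u where u: "ALL k. weak_solution b q nonlin (u k) & energy b q nonlin (u k) = c (k0 + k)" by blast
 have en: "energy b q nonlin (u k) = c (k0 + k)" for k using u by blast
 have "(%k. c (k0 + k)) ----> 0"
 proof (rule LIMSEQ_I)
  fix e :: real assume "0 < e"
  then have "0 < e / 2" by simp
  then obtain m where m: "ALL k>=m. ALL s:levels k. - (e / 2) <= s" using low by blast
  have "norm (c (k0 + k) - 0) < e" if "k >= m" for k
  proof -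
   have "ALL s:levels (k0 + k). - (e / 2) <= s" using m trans_le_add2[OF that] by blast
   then have "- (e / 2) <= c (k0 + k)" unfolding c_def by (intro cInf_greatest nonempty) auto
   moreover have "c (k0 + k) < 0" by (rule c0) simp
   ultimately show ?thesis using \<open>0 < e\<close> by simp
  qed
  then show "EX no. ALL k>=no. norm (c (k0 + k) - 0) < e" by blast
 qed
 moreover have "incseq (%k. c (k0 + k))" by (intro incseq_SucI inc) auto
 ultimately have "(ALL k. weak_solution b q nonlin (u k) & energy b q nonlin (u k) < 0) &
  incseq (%k. energy b q nonlin (u k)) & (%k. energy b q nonlin (u k)) ----> 0"
  unfolding en using u c0 by simp
 then show ?thesis by blast
qed

end

section \<open>Exponents\<close>

text \<open>
 The condition \<open>q < 2\<^sup>*\<^sub>b\<close> means \<open>N - 2 < 2 \<delta>\<close>, and then \<open>\<ell>\<close> is positive. In the plane of the pairs \<open>(\<eta>, r)\<close> it also puts the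
 lower boundary for \<open>\<eta> \<le> b\<close> and the upper boundary for \<open>\<eta> \<le> 2\<close> on or above the line of scaled pairs, so that
 subscaled pairs satisfy \<open>b < \<eta>\<close> and lie strictly inside the admissible region.
\<close>

lemma scaled_problemI:
 fixes N :: nat and b p q \<delta> a \<eta> r lam :: real
 assumes N: "N = CARD('n::finite)" "2 <= N"
  and b: "0 <= b" "b < 2" and p: "2 < p" and pq: "p < q" and crit: "ereal q < critical_exponent N b"
  and \<delta>: "\<delta> = (2 - b) / (q - 2)" and a: "a = 2 - \<delta> * (p - 2)" and sub: "subscaled N b q \<delta> \<eta> r"
 shows "scaled_problem TYPE('n) b q a p \<eta> r \<delta>"
proof -
 define n where "n = real N"
 have n: "2 <= n" using N by (simp add: n_def)
 have d0: "\<delta> > 0" and dq: "\<delta> * (q - 2) = 2 - b" using b p pq by (auto simp: \<delta>)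
 have lev: "2 * \<delta> + 2 = q * \<delta> + b" using dq by (simp add: algebra_simps)
 have nd: "n - 2 < 2 * \<delta>"
 proof (cases "N = 2")
  case True
  then show ?thesis using d0 by (simp add: n_def)
 next
  case False
  then have n3: "0 < n - 2" using N by (simp add: n_def)
  have "q < 2 * (n - b) / (n - 2)" using crit False by (simp add: critical_exponent_def n_def)
  then have "q * (n - 2) < 2 * (n - b)" using n3 by (simp add: pos_less_divide_eq)
  then have "(n - 2) * (q - 2) < 2 * (2 - b)" by (simp add: algebra_simps)
  also have "... = 2 * \<delta> * (q - 2)" using dq by simp
  finally show ?thesis using p pq by simp
 qed
 have nb: "0 < n - b" "n - b < q * \<delta>" using b n nd lev by linarith+
 have ab: "a = b + \<delta> * (q - p)" using a dq by (simp add: algebra_simps)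
 have ga: "good_pair CARD('n) b q a p"
  unfolding good_pair_def N(1)[symmetric] n_def[symmetric]
 proof (intro conjI)
  show "b < a" using ab d0 pq by simp
  have "0 < \<delta> * (p - 2)" using d0 p by simp
  then show "a < n" using a n by linarith
  have "(q - p) * (n - b) < (q - p) * (q * \<delta>)" using nb pq by simp
  then show "q * (n - a) < p * (n - b)" unfolding ab by (simp add: algebra_simps)
  have "(p - 2) * (n - 2) < (p - 2) * (2 * \<delta>)" using nd p by simp
  then show "p * (n - 2) < 2 * (n - a)" unfolding a by (simp add: algebra_simps)
 qed (use b p pq in auto)
 have adm: "admissible N b q \<eta> r" and lt: "r * \<delta> + \<eta> < q * \<delta> + b"
  using sub by (auto simp: subscaled_def scaling_level_def)
 have \<eta>0: "0 <= \<eta>" and r1: "1 < r" and two: "N = 2 ==> b <= \<eta> & \<eta> < 2" using adm by (auto simp: admissible_def)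
 have ne: "\<eta> ~= b" if "q <= r"
 proof
  assume "\<eta> = b"
  then have "r * \<delta> < q * \<delta>" using lt by simp
  then show False using that d0 by simp
 qed
 \<comment> \<open>the lower exponent for \<open>\<eta> < b\<close> lies strictly above the line of scaled pairs\<close>
 have below: False if le: "lower_exponent N b q \<eta> <= r" and \<eta>b: "\<eta> < b"
 proof -
  have "N ~= 2" using two \<eta>b by auto
  then have n3: "0 < n - 2" using N by (simp add: n_def)
  have b0: "0 < b" using \<eta>0 \<eta>b by linarith
  have "(\<eta> * q * (n - 2) + 2 * n * (b - \<eta>)) / (b * (n - 2)) <= r"
   using le \<eta>b by (simp add: lower_exponent_def n_def)
  then have "\<eta> * q * (n - 2) + 2 * n * (b - \<eta>) <= r * (b * (n - 2))"
   using n3 b0 by (simp add: pos_divide_le_eq)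
  then have "\<delta> * (\<eta> * q * (n - 2) + 2 * n * (b - \<eta>)) <= \<delta> * (r * (b * (n - 2)))"
   using d0 by (intro mult_left_mono) auto
  also have "... = (b * (n - 2)) * (r * \<delta>)" by simp
  also have "... < (b * (n - 2)) * (q * \<delta> + b - \<eta>)"
   using lt b0 n3 by (intro mult_strict_left_mono) auto
  finally have "(b - \<eta>) * (2 * n * \<delta>) < (b - \<eta>) * ((n - 2) * (q * \<delta> + b))" by (simp add: algebra_simps)
  then have "2 * n * \<delta> < (n - 2) * (2 * \<delta> + 2)" using \<eta>b lev by simp
  then show False using nd by (simp add: algebra_simps)
 qed
 have main: "lower_exponent N b q \<eta> < r & ereal r < critical_exponent N \<eta> & b < \<eta>"
 proof -
  consider "lower_exponent N b q \<eta> < r & ereal r < critical_exponent N \<eta>"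
   | "r = lower_exponent N b q \<eta> & \<eta> <= b" | "ereal r = critical_exponent N \<eta> & \<eta> <= 2 & 3 <= N"
   using adm unfolding admissible_def by blast
  then show ?thesis
  proof cases
   case 1
   have "~ \<eta> < b" using below 1 by auto
   moreover have "\<eta> ~= b"
   proof
    assume "\<eta> = b"
    then have "q < r" using 1 nb by (simp add: lower_exponent_def n_def)
    then show False using ne \<open>\<eta> = b\<close> by simp
   qed
   ultimately show ?thesis using 1 by simp
  next
   case 2
   have "~ \<eta> < b" using below 2 by auto
   then have "\<eta> = b" using 2 by simp
   then have "q = r" using 2 nb by (simp add: lower_exponent_def n_def)
   then show ?thesis using ne \<open>\<eta> = b\<close> by simp
  next
   case 3
   then have n3: "0 < n - 2" by (simp add: n_def)
   have "r = 2 * (n - \<eta>) / (n - 2)" using 3 by (auto simp: critical_exponent_def n_def split: if_splits)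
   then have "r * (n - 2) = 2 * (n - \<eta>)" using n3 by simp
   then have "(r - 2) * (n - 2) = 2 * (2 - \<eta>)" by (simp add: algebra_simps)
   moreover have "\<delta> * (r - 2) < 2 - \<eta>" using lt lev by (simp add: algebra_simps)
   then have "(\<delta> * (r - 2)) * (n - 2) < (2 - \<eta>) * (n - 2)" using n3 by simp
   ultimately have "\<delta> * (2 * (2 - \<eta>)) < (2 - \<eta>) * (n - 2)" by (simp add: mult.assoc)
   then have "(2 - \<eta>) * (2 * \<delta>) < (2 - \<eta>) * (n - 2)" by (simp add: mult_ac)
   moreover have "(2 - \<eta>) * (n - 2) <= (2 - \<eta>) * (2 * \<delta>)" using nd 3 by (intro mult_left_mono) auto
   ultimately show ?thesis by linarith
  qed
 qed
 then have b\<eta>: "b < \<eta>" by blast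
 have lower: "q * (n - \<eta>) < r * (n - b)"
  using main b\<eta> nb by (simp add: lower_exponent_def n_def pos_divide_less_eq)
 have upper: "r * (n - 2) < 2 * (n - \<eta>) & \<eta> < n"
 proof (cases "N = 2")
  case True
  then show ?thesis using two by (simp add: n_def)
 next
  case False
  then have n3: "0 < n - 2" using N by (simp add: n_def)
  have "r < 2 * (n - \<eta>) / (n - 2)" using main False by (simp add: critical_exponent_def n_def)
  then have "r * (n - 2) < 2 * (n - \<eta>)" using n3 by (simp add: pos_less_divide_eq)
  moreover have "0 < r * (n - 2)" using r1 n3 by simp
  ultimately have "0 < 2 * (n - \<eta>)" by (rule less_trans[rotated])
  then show ?thesis using \<open>r * (n - 2) < 2 * (n - \<eta>)\<close> by simp
 qed
 have rq: "r < q"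
 proof -
  have "r * \<delta> < q * \<delta>" using lt b\<eta> by linarith
  then show ?thesis using d0 by simp
 qed
 have pos: "n < r * \<delta> + \<eta>"
 proof -
  have "(n - b) * (n - \<eta>) < (q * \<delta>) * (n - \<eta>)" using nb upper by simp
  also have "... = \<delta> * (q * (n - \<eta>))" by simp
  also have "... < \<delta> * (r * (n - b))" using lower d0 by simp
  also have "... = (n - b) * (r * \<delta>)" by simp
  finally have "n - \<eta> < r * \<delta>" using nb by simp
  then show ?thesis by linarith
 qed
 show ?thesis
 proof
  show "2 <= CARD('n)" using N by simp
  show "good_pair CARD('n) b q \<eta> r"
   unfolding good_pair_def N(1)[symmetric] n_def[symmetric] using b b\<eta> upper r1 rq lower by blast
  show "p * \<delta> + a = q * \<delta> + b" using a lev by (simp add: algebra_simps)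
  show "real CARD('n) < r * \<delta> + \<eta>" using pos by (simp add: n_def N)
 qed (use p pq ga lev lt in auto)
qed

theorem theorem1p8:
  fixes N :: nat and b p q \<delta> a \<eta> r lam :: real
    and f :: "real ^ 'n::finite \<Rightarrow> real \<Rightarrow> real"
  assumes "N = CARD('n)" and "2 \<le> N"
    and "0 \<le> b" and "b < 2" and "2 < p" and "p < q" and "ereal q < critical_exponent N b"
    and "\<delta> = (2 - b) / (q - 2)"
    and "a = 2 - \<delta> * (p - 2)"
    and "subscaled N b q \<delta> \<eta> r"
    and "\<not> is_eigenvalue TYPE('n) b q a p lam"
    and "f = (\<lambda>x s. lam * power_nonlinearity a p x s + power_nonlinearity \<eta> r x s)"
  shows "\<exists>u :: nat \<Rightarrow> real ^ 'n \<Rightarrow> real.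
           (\<forall>k. weak_solution b q f (u k) \<and> energy b q f (u k) < 0) \<and>
           incseq (\<lambda>k. energy b q f (u k)) \<and>
           (\<lambda>k. energy b q f (u k)) \<longlonglongrightarrow> 0"
proof -
  interpret scaled_problem "TYPE('n)" b q a p \<eta> r \<delta> lam
    using assms(1-10) by (rule scaled_problemI)
  have "f = nonlin" by (simp add: assms(12) nonlin_def fun_eq_iff)
  then show ?thesis using solutions_at_negative_levels[OF assms(11)] by simp
qed

end
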